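(* Let $k$ be a commutative artinian ring, let $n\ge 1$, and let $(\mathscr{C},\mathbb{E},\mathfrak{s})$ be an $\mathrm{Ext}$-finite, Krull-Schmidt and $k$-linear $n$-exangulated category. Then the following statements are equivalent. (1) $\mathscr{C}$ has Auslander-Reiten $n$-exangles. (2) $\mathscr{C}$ has an Auslander-Reiten-Serre duality.
   Context: **$n$-exangulated categories.** Let $\mathscr{C}$ be an additive category and $\mathbb{E}\colon\mathscr{C}^{\mathrm{op}}\times\mathscr{C}\to\mathrm{Ab}$ an additive bifunctor. Elements $\delta\in\mathbb{E}(C,A)$ are called extensions. For $a\in\mathscr{C}(A,A')$, $c\in\mathscr{C}(C',C)$ put $a_*\delta=\mathbb{E}(C,a)(\delta)$ and $c^*\delta=\mathbb{E}(c,A)(\delta)$. A morphism of extensions from $\delta\in\mathbb{E}(C,A)$ to $\rho\in\mathbb{E}(D,B)$ is a pair $(a,c)$, $a\in\mathscr{C}(A,B)$, $c\in\mathscr{C}(C,D)$, with $a_*\delta=c^*\rho$. Let $\mathbf{C}^{n+2}_{\mathscr{C}}$ be the category of complexes $X_\bullet\colon X_0\xrightarrow{d_0^X}X_1\to\cdots\to X_n\xrightarrow{d_n^X}X_{n+1}$ in $\mathscr{C}$. For $\delta\in\mathbb{E}(C,A)$ define $\delta_\sharp\colon\mathscr{C}(-,C)\to\mathbb{E}(-,A)$, $f\mapsto f^*\delta$, and $\delta^\sharp\colon\mathscr{C}(A,-)\to\mathbb{E}(C,-)$, $g\mapsto g_*\delta$. A pair $\langle X_\bullet,\delta\rangle$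 with $\delta\in\mathbb{E}(X_{n+1},X_0)$, $(d_0^X)_*\delta=0$, $(d_n^X)^*\delta=0$ is an $n$-exangle if the sequences of functors $\mathscr{C}(-,X_0)\to\cdots\to\mathscr{C}(-,X_{n+1})\xrightarrow{\delta_\sharp}\mathbb{E}(-,X_0)$ and $\mathscr{C}(X_{n+1},-)\to\cdots\to\mathscr{C}(X_0,-)\xrightarrow{\delta^\sharp}\mathbb{E}(X_{n+1},-)$ are exact. For fixed $A,C$, consider complexes with $X_0=A$, $X_{n+1}=C$ and morphisms $f_\bullet$ with $f_0=\mathrm{id}_A$, $f_{n+1}=\mathrm{id}_C$; two such are homotopic if they differ by a chain homotopy $(\varphi_i\colon X_i\to Y_{i-1})_{1\le i\le n+1}$, and $[X_\bullet]$ denotes the resulting homotopy equivalence class. An exact realization $\mathfrak{s}$ of $\mathbb{E}$ assigns to each $\delta\in\mathbb{E}(C,A)$ such a class $\mathfrak{s}(\delta)=[X_\bullet]$ with $X_0=A$, $X_{n+1}=C$, such that: (R0) for $\mathfrak{s}(\delta)=[X_\bullet]$, $\mathfrak{s}(\rho)=[Y_\bullet]$, every morphism of extensions $(a,c)\colon\delta\to\rho$ has a lift $f_\bullet=(a,f_1,\dots,f_n,c)\colon X_\bullet\to Y_\bullet$; (R1) $\langle X_\bullet,\delta\rangle$ is an $n$-exangle whenever $\mathfrak{s}(\delta)=[X_\bullet]$; (R2) $0\in\mathbb{E}(0,A)$ is realized by $A\xrightarrow{\mathrm{id}}A\to0\to\cdots\to0$ and $0\in\mathbb{E}(A,0)$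 is realized by $0\to\cdots\to0\to A\xrightarrow{\mathrm{id}}A$. If $\mathfrak{s}(\delta)=[X_\bullet]$, then $\langle X_\bullet,\delta\rangle$ is called a distinguished $n$-exangle, written $X_0\xrightarrow{d_0}X_1\to\cdots\to X_n\xrightarrow{d_n}X_{n+1}\overset{\delta}{\dashrightarrow}$; then $d_0$ is called an inflation and $d_n$ a deflation. The triple $(\mathscr{C},\mathbb{E},\mathfrak{s})$ is an $n$-exangulated category if: (EA1) inflations are closed under composition and deflations are closed under composition; (EA2) for $\rho\in\mathbb{E}(D,A)$, $c\in\mathscr{C}(C,D)$ and distinguished $\langle X_\bullet,c^*\rho\rangle$, $\langle Y_\bullet,\rho\rangle$, the pair $(\mathrm{id}_A,c)$ has a lift $f_\bullet\colon X_\bullet\to Y_\bullet$ whose mapping cone $X_1\to X_2\oplus Y_1\to\cdots\to X_{n+1}\oplus Y_n\to Y_{n+1}$, with differentials $\begin{bmatrix}-d_1^X\\ f_1\end{bmatrix}$, $\begin{bmatrix}-d_{i+1}^X&0\\ f_{i+1}&d_i^Y\end{bmatrix}$ ($1\le i\le n-1$), $\begin{bmatrix}f_{n+1}&d_n^Y\end{bmatrix}$, together with $(d_0^X)_*\rho$ is a distinguished $n$-exangle; (EA2$^{\mathrm{op}}$) the dual of (EA2). **Linearity and finiteness.** $\mathscr{C}$ is $k$-linear if all $\mathscr{C}(A,B)$ and $\mathbb{E}(A,B)$ are $k$-modules and the compositions $\mathscr{C}(A,B)\times\mathscr{C}(B,C)\to\mathscr{C}(A,C)$ and $\mathscr{C}(A,B)\times\mathbb{E}(B,C)\times\mathscr{C}(C,D)\to\mathbb{E}(A,D)$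 are $k$-linear in each variable; $\mathrm{Ext}$-finite if each $\mathbb{E}(A,B)$ is a finitely generated $k$-module; Krull-Schmidt if each object is a finite direct sum of objects with local endomorphism rings. $\mathrm{rad}_{\mathscr{C}}$ is the Jacobson radical of $\mathscr{C}$. $D=\mathrm{Hom}_k(-,J)$, where $J$ is the minimal injective cogenerator of $k$. **Stable categories.** $f\colon X\to Y$ is $n$-projectively trivial if $\mathbb{E}(f,Z)\colon\mathbb{E}(Y,Z)\to\mathbb{E}(X,Z)$ is zero for all $Z$; $g\colon X\to Y$ is $n$-injectively trivial if $\mathbb{E}(Z,g)\colon\mathbb{E}(Z,X)\to\mathbb{E}(Z,Y)$ is zero for all $Z$. An object is projective (resp. injective) if its identity is $n$-projectively (resp. $n$-injectively) trivial. Let $\mathcal{P}(A,B)$ (resp. $\mathcal{I}(A,B)$) be the set of $n$-projectively (resp. $n$-injectively) trivial morphisms $A\to B$. The categories $\underline{\mathscr{C}}$, $\overline{\mathscr{C}}$ have the objects of $\mathscr{C}$ and morphisms $\underline{\mathscr{C}}(A,B)=\mathscr{C}(A,B)/\mathcal{P}(A,B)$, $\overline{\mathscr{C}}(A,B)=\mathscr{C}(A,B)/\mathcal{I}(A,B)$. **Auslander-Reiten $n$-exangles.** A morphism $\alpha\colon A\to B$ is left almost split if it is not a split monomorphism and every morphism $A\to A'$ that is not a split monomorphism factors through $\alpha$; right almost split is dual. A distinguished $n$-exangle $A_0\xrightarrow{\alpha_0}A_1\to\cdots\to A_n\xrightarrow{\alpha_n}A_{n+1}\overset{\delta}{\dashrightarrow}$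 is an Auslander-Reiten $n$-exangle (starting at $A_0$ and ending at $A_{n+1}$) if $\alpha_0$ is left almost split, $\alpha_n$ is right almost split and, when $n\ge2$, $\alpha_1,\dots,\alpha_{n-1}$ are in $\mathrm{rad}_{\mathscr{C}}$. $\mathscr{C}$ has Auslander-Reiten $n$-exangles if for every indecomposable non-projective object $A$ there is an Auslander-Reiten $n$-exangle ending at $A$, and for every indecomposable non-injective object $B$ there is one starting at $B$. **Auslander-Reiten-Serre duality.** $\mathscr{C}$ has Auslander-Reiten-Serre duality if there is a $k$-linear equivalence $\tau_n\colon\underline{\mathscr{C}}\to\overline{\mathscr{C}}$ with a $k$-linear isomorphism $\Phi_{X,Y}\colon D\mathbb{E}(X,Y)\to\overline{\mathscr{C}}(Y,\tau_nX)$, natural in $X,Y\in\mathscr{C}$. *)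

theory Defs
  imports "HOL-Algebra.Module" "HOL-Algebra.QuotRing"
begin

section \<open>Modules over a commutative ring\<close>

locale artinian_cring = cring +
  assumes descending_chain_condition:
    "\<lbrakk> \<forall>i::nat. ideal (I i) R; \<forall>i. I (Suc i) \<subseteq> I i \<rbrakk> \<Longrightarrow> \<exists>m. \<forall>i\<ge>m. I i = I m"

text \<open>The fields \<open>mult\<close> and \<open>one\<close> of a module record play no role here and are left unspecified
  in the modules constructed below.\<close>

definition linear_map ::
    "('k, 'r) ring_scheme \<Rightarrow> ('k, 'a, 'x) module_scheme \<Rightarrow> ('k, 'b, 'y) module_scheme
      \<Rightarrow> ('a \<Rightarrow> 'b) \<Rightarrow> bool" where
  "linear_map R M N f \<longleftrightarrow>
     f \<in> carrier M \<rightarrow> carrier N \<and>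
     (\<forall>x\<in>carrier M. \<forall>y\<in>carrier M. f (x \<oplus>\<^bsub>M\<^esub> y) = f x \<oplus>\<^bsub>N\<^esub> f y) \<and>
     (\<forall>r\<in>carrier R. \<forall>x\<in>carrier M. f (r \<odot>\<^bsub>M\<^esub> x) = r \<odot>\<^bsub>N\<^esub> f x)"

definition Hom_module ::
    "('k, 'r) ring_scheme \<Rightarrow> ('k, 'a, 'x) module_scheme \<Rightarrow> ('k, 'b, 'y) module_scheme
      \<Rightarrow> ('k, 'a \<Rightarrow> 'b) module" where
  "Hom_module R M N =
     \<lparr> carrier = {f \<in> extensional (carrier M). linear_map R M N f},
       mult = undefined, one = undefined,
       zero = (\<lambda>x\<in>carrier M. \<zero>\<^bsub>N\<^esub>),
       add = (\<lambda>f g. \<lambda>x\<in>carrier M. f x \<oplus>\<^bsub>N\<^esub> g x),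
       smult = (\<lambda>r f. \<lambda>x\<in>carrier M. r \<odot>\<^bsub>N\<^esub> f x) \<rparr>"

definition quotient_module :: "('k, 'a, 'x) module_scheme \<Rightarrow> 'a set \<Rightarrow> ('k, 'a set) module" where
  "quotient_module M N =
     \<lparr> carrier = a_rcosets\<^bsub>M\<^esub> N,
       mult = undefined, one = undefined,
       zero = N,
       add = (\<lambda>X Y. X <+>\<^bsub>M\<^esub> Y),
       smult = (\<lambda>r X. \<Union>x\<in>X. N +>\<^bsub>M\<^esub> (r \<odot>\<^bsub>M\<^esub> x)) \<rparr>"

definition finitely_generated_module ::
    "('k, 'r) ring_scheme \<Rightarrow> ('k, 'a, 'x) module_scheme \<Rightarrow> bool" where
  "finitely_generated_module R M \<longleftrightarrow>
     (\<exists>S. finite S \<and> S \<subseteq> carrier M \<and> (\<forall>N. submodule N R M \<and> S \<subseteq> N \<longrightarrow> N = carrier M))"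

text \<open>Injectivity and the cogenerator property quantify over all \<open>R\<close>-modules, hence over all
  types.  Here the test modules are those whose underlying set is a subset of the type \<open>'k set\<close>.
  No strength is lost: up to isomorphism these include \<open>R\<close>, its ideals (as singletons) and all
  cyclic modules \<open>R/I\<close> (as sets of cosets), so that injectivity against all modules follows from
  Baer's criterion, and an injective module that cogenerates the cyclic modules cogenerates all
  modules.\<close>

definition injective_module :: "('k, 'r) ring_scheme \<Rightarrow> ('k, 'j, 'x) module_scheme \<Rightarrow> bool" where
  "injective_module R J \<longleftrightarrow> module R J \<and>
     (\<forall>(M :: ('k, 'k set) module) (N :: ('k, 'k set) module) i g.
        module R M \<and> module R N \<and> linear_map R M N i \<and> inj_on i (carrier M) \<and> linear_map R M J g \<longrightarrow>
        (\<exists>h. linear_map R N J h \<and> (\<forall>x\<in>carrier M. h (i x) = g x)))"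

definition cogenerator :: "('k, 'r) ring_scheme \<Rightarrow> ('k, 'j, 'x) module_scheme \<Rightarrow> bool" where
  "cogenerator R J \<longleftrightarrow> module R J \<and>
     (\<forall>(M :: ('k, 'k set) module) (N :: ('k, 'k set) module) f g.
        module R M \<and> module R N \<and> linear_map R M N f \<and> linear_map R M N g \<and>
        (\<exists>x\<in>carrier M. f x \<noteq> g x) \<longrightarrow>
        (\<exists>h. linear_map R N J h \<and> (\<exists>x\<in>carrier M. h (f x) \<noteq> h (g x))))"

text \<open>Minimal with respect to inclusion.  Over a commutative artinian ring this determines the
  module up to isomorphism: it is the injective envelope of \<open>R/rad R\<close>.\<close>

definition minimal_injective_cogenerator ::
    "('k, 'r) ring_scheme \<Rightarrow> ('k, 'j, 'x) module_scheme \<Rightarrow> bool" where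
  "minimal_injective_cogenerator R J \<longleftrightarrow>
     injective_module R J \<and> cogenerator R J \<and>
     (\<forall>N. submodule N R J \<and> injective_module R (J\<lparr>carrier := N\<rparr>) \<and> cogenerator R (J\<lparr>carrier := N\<rparr>)
          \<longrightarrow> N = carrier J)"

section \<open>Additive and linear categories\<close>

text \<open>The groups \<open>Hom C A B\<close> are stored as module records so that one type serves for additive
  and for \<open>k\<close>-linear categories; the scalar multiplication is used only in the latter.  The sets of
  morphisms are required to be pairwise disjoint, so that composition need not be indexed by objects.\<close>

record ('o, 'm, 'k) cat =
  Obj :: "'o set"
  Hom :: "'o \<Rightarrow> 'o \<Rightarrow> ('k, 'm) module"
  Comp :: "'m \<Rightarrow> 'm \<Rightarrow> 'm"  (infixl \<open>\<cdot>\<index>\<close> 75)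
  Id :: "'o \<Rightarrow> 'm"

abbreviation arr :: "('o, 'm, 'k, 'z) cat_scheme \<Rightarrow> 'o \<Rightarrow> 'o \<Rightarrow> 'm set" where
  "arr C A B \<equiv> carrier (Hom C A B)"

abbreviation zero_arr :: "('o, 'm, 'k, 'z) cat_scheme \<Rightarrow> 'o \<Rightarrow> 'o \<Rightarrow> 'm" where
  "zero_arr C A B \<equiv> \<zero>\<^bsub>Hom C A B\<^esub>"

locale category =
  fixes C :: "('o, 'm, 'k, 'z) cat_scheme" (structure)
  assumes Hom_disjoint:
      "\<lbrakk> A \<in> Obj C; B \<in> Obj C; A' \<in> Obj C; B' \<in> Obj C; f \<in> arr C A B; f \<in> arr C A' B' \<rbrakk>
       \<Longrightarrow> A = A' \<and> B = B'"
    and Id_closed: "A \<in> Obj C \<Longrightarrow> Id C A \<in> arr C A A"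
    and Comp_closed:
      "\<lbrakk> A \<in> Obj C; B \<in> Obj C; D \<in> Obj C; f \<in> arr C A B; g \<in> arr C B D \<rbrakk> \<Longrightarrow> g \<cdot> f \<in> arr C A D"
    and Comp_assoc:
      "\<lbrakk> A \<in> Obj C; B \<in> Obj C; D \<in> Obj C; E \<in> Obj C;
         f \<in> arr C A B; g \<in> arr C B D; h \<in> arr C D E \<rbrakk> \<Longrightarrow> (h \<cdot> g) \<cdot> f = h \<cdot> (g \<cdot> f)"
    and Id_left: "\<lbrakk> A \<in> Obj C; B \<in> Obj C; f \<in> arr C A B \<rbrakk> \<Longrightarrow> Id C B \<cdot> f = f"
    and Id_right: "\<lbrakk> A \<in> Obj C; B \<in> Obj C; f \<in> arr C A B \<rbrakk> \<Longrightarrow> f \<cdot> Id C A = f"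

locale preadditive_category = category +
  assumes Hom_group: "\<lbrakk> A \<in> Obj C; B \<in> Obj C \<rbrakk> \<Longrightarrow> abelian_group (Hom C A B)"
    and Comp_add_right:
      "\<lbrakk> A \<in> Obj C; B \<in> Obj C; D \<in> Obj C; f \<in> arr C A B; f' \<in> arr C A B; g \<in> arr C B D \<rbrakk>
       \<Longrightarrow> g \<cdot> (f \<oplus>\<^bsub>Hom C A B\<^esub> f') = g \<cdot> f \<oplus>\<^bsub>Hom C A D\<^esub> g \<cdot> f'"
    and Comp_add_left:
      "\<lbrakk> A \<in> Obj C; B \<in> Obj C; D \<in> Obj C; f \<in> arr C A B; g \<in> arr C B D; g' \<in> arr C B D \<rbrakk>
       \<Longrightarrow> (g \<oplus>\<^bsub>Hom C B D\<^esub> g') \<cdot> f = g \<cdot> f \<oplus>\<^bsub>Hom C A D\<^esub> g' \<cdot> f"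

definition zero_object :: "('o, 'm, 'k, 'z) cat_scheme \<Rightarrow> 'o \<Rightarrow> bool" where
  "zero_object C Z \<longleftrightarrow> Z \<in> Obj C \<and> (\<forall>A\<in>Obj C. (\<exists>!f. f \<in> arr C A Z) \<and> (\<exists>!f. f \<in> arr C Z A))"

definition is_biproduct ::
    "('o, 'm, 'k, 'z) cat_scheme \<Rightarrow> 'o \<Rightarrow> 'o \<Rightarrow> 'o \<Rightarrow> 'm \<Rightarrow> 'm \<Rightarrow> 'm \<Rightarrow> 'm \<Rightarrow> bool" where
  "is_biproduct C A B S \<iota>\<^sub>A \<iota>\<^sub>B \<pi>\<^sub>A \<pi>\<^sub>B \<longleftrightarrow>
     A \<in> Obj C \<and> B \<in> Obj C \<and> S \<in> Obj C \<and>
     \<iota>\<^sub>A \<in> arr C A S \<and> \<iota>\<^sub>B \<in> arr C B S \<and> \<pi>\<^sub>A \<in> arr C S A \<and> \<pi>\<^sub>B \<in> arr C S B \<and>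
     \<pi>\<^sub>A \<cdot>\<^bsub>C\<^esub> \<iota>\<^sub>A = Id C A \<and> \<pi>\<^sub>B \<cdot>\<^bsub>C\<^esub> \<iota>\<^sub>B = Id C B \<and>
     \<pi>\<^sub>B \<cdot>\<^bsub>C\<^esub> \<iota>\<^sub>A = zero_arr C A B \<and> \<pi>\<^sub>A \<cdot>\<^bsub>C\<^esub> \<iota>\<^sub>B = zero_arr C B A \<and>
     \<iota>\<^sub>A \<cdot>\<^bsub>C\<^esub> \<pi>\<^sub>A \<oplus>\<^bsub>Hom C S S\<^esub> \<iota>\<^sub>B \<cdot>\<^bsub>C\<^esub> \<pi>\<^sub>B = Id C S"

definition is_direct_sum ::
    "('o, 'm, 'k, 'z) cat_scheme \<Rightarrow> 'o \<Rightarrow> nat \<Rightarrow> (nat \<Rightarrow> 'o) \<Rightarrow> bool" where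
  "is_direct_sum C A m B \<longleftrightarrow>
     A \<in> Obj C \<and> (\<forall>i<m. B i \<in> Obj C) \<and>
     (\<exists>\<iota> \<pi>. (\<forall>i<m. \<iota> i \<in> arr C (B i) A \<and> \<pi> i \<in> arr C A (B i)) \<and>
        (\<forall>i<m. \<forall>j<m. \<pi> j \<cdot>\<^bsub>C\<^esub> \<iota> i = (if i = j then Id C (B i) else zero_arr C (B i) (B j))) \<and>
        (\<Oplus>\<^bsub>Hom C A A\<^esub>i\<in>{..<m}. \<iota> i \<cdot>\<^bsub>C\<^esub> \<pi> i) = Id C A)"

locale additive_category = preadditive_category +
  assumes zero_object_exists: "\<exists>Z. zero_object C Z"
    and biproduct_exists:
      "\<lbrakk> A \<in> Obj C; B \<in> Obj C \<rbrakk> \<Longrightarrow> \<exists>S \<iota>\<^sub>A \<iota>\<^sub>B \<pi>\<^sub>A \<pi>\<^sub>B. is_biproduct C A B S \<iota>\<^sub>A \<iota>\<^sub>B \<pi>\<^sub>A \<pi>\<^sub>B"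

definition End_ring :: "('o, 'm, 'k, 'z) cat_scheme \<Rightarrow> 'o \<Rightarrow> 'm ring" where
  "End_ring C A =
     \<lparr> carrier = arr C A A, mult = Comp C, one = Id C A,
       zero = zero_arr C A A, add = add (Hom C A A) \<rparr>"

definition local_ring :: "('a, 'r) ring_scheme \<Rightarrow> bool" where
  "local_ring R \<longleftrightarrow> ring R \<and> ideal (carrier R - Units R) R"

definition Krull_Schmidt :: "('o, 'm, 'k, 'z) cat_scheme \<Rightarrow> bool" where
  "Krull_Schmidt C \<longleftrightarrow>
     (\<forall>A\<in>Obj C. \<exists>m B. is_direct_sum C A m B \<and> (\<forall>i<m. local_ring (End_ring C (B i))))"

definition indecomposable :: "('o, 'm, 'k, 'z) cat_scheme \<Rightarrow> 'o \<Rightarrow> bool" where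
  "indecomposable C A \<longleftrightarrow>
     A \<in> Obj C \<and> \<not> zero_object C A \<and>
     (\<forall>X Y \<iota>\<^sub>X \<iota>\<^sub>Y \<pi>\<^sub>X \<pi>\<^sub>Y. is_biproduct C X Y A \<iota>\<^sub>X \<iota>\<^sub>Y \<pi>\<^sub>X \<pi>\<^sub>Y \<longrightarrow> zero_object C X \<or> zero_object C Y)"

definition rad :: "('o, 'm, 'k, 'z) cat_scheme \<Rightarrow> 'o \<Rightarrow> 'o \<Rightarrow> 'm set" where
  "rad C A B =
     {f \<in> arr C A B. \<forall>g\<in>arr C B A. Id C A \<ominus>\<^bsub>Hom C A A\<^esub> g \<cdot>\<^bsub>C\<^esub> f \<in> Units (End_ring C A)}"

definition iso_arr :: "('o, 'm, 'k, 'z) cat_scheme \<Rightarrow> 'o \<Rightarrow> 'o \<Rightarrow> 'm \<Rightarrow> bool" where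
  "iso_arr C A B f \<longleftrightarrow>
     f \<in> arr C A B \<and> (\<exists>g\<in>arr C B A. g \<cdot>\<^bsub>C\<^esub> f = Id C A \<and> f \<cdot>\<^bsub>C\<^esub> g = Id C B)"

definition split_mono :: "('o, 'm, 'k, 'z) cat_scheme \<Rightarrow> 'o \<Rightarrow> 'o \<Rightarrow> 'm \<Rightarrow> bool" where
  "split_mono C A B f \<longleftrightarrow> f \<in> arr C A B \<and> (\<exists>g\<in>arr C B A. g \<cdot>\<^bsub>C\<^esub> f = Id C A)"

definition split_epi :: "('o, 'm, 'k, 'z) cat_scheme \<Rightarrow> 'o \<Rightarrow> 'o \<Rightarrow> 'm \<Rightarrow> bool" where
  "split_epi C A B f \<longleftrightarrow> f \<in> arr C A B \<and> (\<exists>g\<in>arr C B A. f \<cdot>\<^bsub>C\<^esub> g = Id C B)"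

text \<open>Biadditivity of composition is part of \<open>preadditive_category\<close>; only homogeneity is added.\<close>

definition linear_category :: "('k, 'r) ring_scheme \<Rightarrow> ('o, 'm, 'k, 'z) cat_scheme \<Rightarrow> bool" where
  "linear_category R C \<longleftrightarrow> preadditive_category C \<and>
     (\<forall>A\<in>Obj C. \<forall>B\<in>Obj C. module R (Hom C A B)) \<and>
     (\<forall>A\<in>Obj C. \<forall>B\<in>Obj C. \<forall>D\<in>Obj C. \<forall>r\<in>carrier R. \<forall>f\<in>arr C A B. \<forall>g\<in>arr C B D.
        g \<cdot>\<^bsub>C\<^esub> (r \<odot>\<^bsub>Hom C A B\<^esub> f) = r \<odot>\<^bsub>Hom C A D\<^esub> (g \<cdot>\<^bsub>C\<^esub> f) \<and>
        (r \<odot>\<^bsub>Hom C B D\<^esub> g) \<cdot>\<^bsub>C\<^esub> f = r \<odot>\<^bsub>Hom C A D\<^esub> (g \<cdot>\<^bsub>C\<^esub> f))"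

subsection \<open>Functors and equivalences\<close>

definition is_functor ::
    "('o, 'm, 'k, 'z) cat_scheme \<Rightarrow> ('p, 'l, 'k, 'y) cat_scheme \<Rightarrow> ('o \<Rightarrow> 'p) \<Rightarrow> ('m \<Rightarrow> 'l) \<Rightarrow> bool" where
  "is_functor C D Fo Fm \<longleftrightarrow>
     (\<forall>A\<in>Obj C. Fo A \<in> Obj D \<and> Fm (Id C A) = Id D (Fo A)) \<and>
     (\<forall>A\<in>Obj C. \<forall>B\<in>Obj C. Fm \<in> arr C A B \<rightarrow> arr D (Fo A) (Fo B)) \<and>
     (\<forall>A\<in>Obj C. \<forall>B\<in>Obj C. \<forall>E\<in>Obj C. \<forall>f\<in>arr C A B. \<forall>g\<in>arr C B E.
        Fm (g \<cdot>\<^bsub>C\<^esub> f) = Fm g \<cdot>\<^bsub>D\<^esub> Fm f)"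

definition naturally_isomorphic ::
    "('o, 'm, 'k, 'z) cat_scheme \<Rightarrow> ('p, 'l, 'k, 'y) cat_scheme
      \<Rightarrow> ('o \<Rightarrow> 'p) \<Rightarrow> ('m \<Rightarrow> 'l) \<Rightarrow> ('o \<Rightarrow> 'p) \<Rightarrow> ('m \<Rightarrow> 'l) \<Rightarrow> bool" where
  "naturally_isomorphic C D Fo Fm Go Gm \<longleftrightarrow>
     (\<exists>\<eta>. (\<forall>A\<in>Obj C. iso_arr D (Fo A) (Go A) (\<eta> A)) \<and>
        (\<forall>A\<in>Obj C. \<forall>B\<in>Obj C. \<forall>f\<in>arr C A B. \<eta> B \<cdot>\<^bsub>D\<^esub> Fm f = Gm f \<cdot>\<^bsub>D\<^esub> \<eta> A))"

definition is_equivalence ::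
    "('o, 'm, 'k, 'z) cat_scheme \<Rightarrow> ('p, 'l, 'k, 'y) cat_scheme \<Rightarrow> ('o \<Rightarrow> 'p) \<Rightarrow> ('m \<Rightarrow> 'l) \<Rightarrow> bool" where
  "is_equivalence C D Fo Fm \<longleftrightarrow> is_functor C D Fo Fm \<and>
     (\<exists>Go Gm. is_functor D C Go Gm \<and>
        naturally_isomorphic C C (Go \<circ> Fo) (Gm \<circ> Fm) id id \<and>
        naturally_isomorphic D D (Fo \<circ> Go) (Fm \<circ> Gm) id id)"

definition is_linear_equivalence ::
    "('k, 'r) ring_scheme \<Rightarrow> ('o, 'm, 'k, 'z) cat_scheme \<Rightarrow> ('p, 'l, 'k, 'y) cat_scheme
      \<Rightarrow> ('o \<Rightarrow> 'p) \<Rightarrow> ('m \<Rightarrow> 'l) \<Rightarrow> bool" where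
  "is_linear_equivalence R C D Fo Fm \<longleftrightarrow> is_equivalence C D Fo Fm \<and>
     (\<forall>A\<in>Obj C. \<forall>B\<in>Obj C. linear_map R (Hom C A B) (Hom D (Fo A) (Fo B)) Fm)"

text \<open>The quotient by a two-sided ideal \<open>I\<close>.  As the sets \<open>arr C A B\<close> are disjoint, the union in
  \<open>Comp\<close> is a single coset.\<close>

definition quotient_category ::
    "('o, 'm, 'k, 'z) cat_scheme \<Rightarrow> ('o \<Rightarrow> 'o \<Rightarrow> 'm set) \<Rightarrow> ('o, 'm set, 'k) cat" where
  "quotient_category C I =
     \<lparr> Obj = Obj C,
       Hom = (\<lambda>A B. quotient_module (Hom C A B) (I A B)),
       Comp = (\<lambda>G F. \<Union>{I A D +>\<^bsub>Hom C A D\<^esub> (g \<cdot>\<^bsub>C\<^esub> f) | A B D f g.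
                 A \<in> Obj C \<and> B \<in> Obj C \<and> D \<in> Obj C \<and> f \<in> F \<inter> arr C A B \<and> g \<in> G \<inter> arr C B D}),
       Id = (\<lambda>A. I A A +>\<^bsub>Hom C A A\<^esub> Id C A) \<rparr>"

section \<open>Extensions and realizations\<close>

text \<open>A complex \<open>X\<^sub>0 \<rightarrow> X\<^sub>1 \<rightarrow> \<dots> \<rightarrow> X\<^sub>n\<^sub>+\<^sub>1\<close> is the list of its objects together with the list of its
  differentials.\<close>

record ('o, 'm) cplx =
  obs :: "'o list"
  diffs :: "'m list"

abbreviation ob :: "('o, 'm) cplx \<Rightarrow> nat \<Rightarrow> 'o" where "ob X i \<equiv> obs X ! i"

abbreviation df :: "('o, 'm) cplx \<Rightarrow> nat \<Rightarrow> 'm" where "df X i \<equiv> diffs X ! i"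

text \<open>\<open>Ext C D A\<close> is \<open>\<bbbE>(D, A)\<close>, \<open>Push C a \<delta>\<close> is \<open>a\<^sub>*\<delta>\<close>, \<open>Pull C c \<delta>\<close> is \<open>c\<^sup>*\<delta>\<close>, and \<open>Real C D A \<delta>\<close> is
  the homotopy equivalence class assigned to \<open>\<delta> \<in> \<bbbE>(D, A)\<close>.\<close>

record ('o, 'm, 'k, 'e) ecat = "('o, 'm, 'k) cat" +
  Ext :: "'o \<Rightarrow> 'o \<Rightarrow> ('k, 'e) module"
  Push :: "'m \<Rightarrow> 'e \<Rightarrow> 'e"
  Pull :: "'m \<Rightarrow> 'e \<Rightarrow> 'e"
  Real :: "'o \<Rightarrow> 'o \<Rightarrow> 'e \<Rightarrow> ('o, 'm) cplx set"

abbreviation ext :: "('o, 'm, 'k, 'e) ecat \<Rightarrow> 'o \<Rightarrow> 'o \<Rightarrow> 'e set" where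
  "ext C D A \<equiv> carrier (Ext C D A)"

definition opposite :: "('o, 'm, 'k, 'e) ecat \<Rightarrow> ('o, 'm, 'k, 'e) ecat" where
  "opposite C =
     \<lparr> Obj = Obj C,
       Hom = (\<lambda>A B. Hom C B A),
       Comp = (\<lambda>g f. f \<cdot>\<^bsub>C\<^esub> g),
       Id = Id C,
       Ext = (\<lambda>D A. Ext C A D),
       Push = Pull C,
       Pull = Push C,
       Real = (\<lambda>D A \<delta>. (\<lambda>X. \<lparr> obs = rev (obs X), diffs = rev (diffs X) \<rparr>) ` Real C A D \<delta>) \<rparr>"

locale additive_bifunctor = additive_category C
  for C :: "('o, 'm, 'k, 'e) ecat" (structure) +
  assumes Ext_group: "\<lbrakk> A \<in> Obj C; D \<in> Obj C \<rbrakk> \<Longrightarrow> abelian_group (Ext C D A)"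
    and Push_closed:
      "\<lbrakk> A \<in> Obj C; B \<in> Obj C; D \<in> Obj C; a \<in> arr C A B; \<delta> \<in> ext C D A \<rbrakk> \<Longrightarrow> Push C a \<delta> \<in> ext C D B"
    and Pull_closed:
      "\<lbrakk> A \<in> Obj C; D \<in> Obj C; D' \<in> Obj C; c \<in> arr C D' D; \<delta> \<in> ext C D A \<rbrakk>
       \<Longrightarrow> Pull C c \<delta> \<in> ext C D' A"
    and Push_Id: "\<lbrakk> A \<in> Obj C; D \<in> Obj C; \<delta> \<in> ext C D A \<rbrakk> \<Longrightarrow> Push C (Id C A) \<delta> = \<delta>"
    and Pull_Id: "\<lbrakk> A \<in> Obj C; D \<in> Obj C; \<delta> \<in> ext C D A \<rbrakk> \<Longrightarrow> Pull C (Id C D) \<delta> = \<delta>"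
    and Push_Comp:
      "\<lbrakk> A \<in> Obj C; A' \<in> Obj C; A'' \<in> Obj C; D \<in> Obj C;
         a \<in> arr C A A'; b \<in> arr C A' A''; \<delta> \<in> ext C D A \<rbrakk>
       \<Longrightarrow> Push C (b \<cdot> a) \<delta> = Push C b (Push C a \<delta>)"
    and Pull_Comp:
      "\<lbrakk> A \<in> Obj C; D \<in> Obj C; D' \<in> Obj C; D'' \<in> Obj C;
         c \<in> arr C D' D; d \<in> arr C D'' D'; \<delta> \<in> ext C D A \<rbrakk>
       \<Longrightarrow> Pull C (c \<cdot> d) \<delta> = Pull C d (Pull C c \<delta>)"
    and Push_Pull:
      "\<lbrakk> A \<in> Obj C; B \<in> Obj C; D \<in> Obj C; D' \<in> Obj C;
         a \<in> arr C A B; c \<in> arr C D' D; \<delta> \<in> ext C D A \<rbrakk>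
       \<Longrightarrow> Push C a (Pull C c \<delta>) = Pull C c (Push C a \<delta>)"
    and Push_add:
      "\<lbrakk> A \<in> Obj C; B \<in> Obj C; D \<in> Obj C; a \<in> arr C A B; \<delta> \<in> ext C D A; \<epsilon> \<in> ext C D A \<rbrakk>
       \<Longrightarrow> Push C a (\<delta> \<oplus>\<^bsub>Ext C D A\<^esub> \<epsilon>) = Push C a \<delta> \<oplus>\<^bsub>Ext C D B\<^esub> Push C a \<epsilon>"
    and Pull_add:
      "\<lbrakk> A \<in> Obj C; D \<in> Obj C; D' \<in> Obj C; c \<in> arr C D' D; \<delta> \<in> ext C D A; \<epsilon> \<in> ext C D A \<rbrakk>
       \<Longrightarrow> Pull C c (\<delta> \<oplus>\<^bsub>Ext C D A\<^esub> \<epsilon>) = Pull C c \<delta> \<oplus>\<^bsub>Ext C D' A\<^esub> Pull C c \<epsilon>"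
    and add_Push:
      "\<lbrakk> A \<in> Obj C; B \<in> Obj C; D \<in> Obj C; a \<in> arr C A B; a' \<in> arr C A B; \<delta> \<in> ext C D A \<rbrakk>
       \<Longrightarrow> Push C (a \<oplus>\<^bsub>Hom C A B\<^esub> a') \<delta> = Push C a \<delta> \<oplus>\<^bsub>Ext C D B\<^esub> Push C a' \<delta>"
    and add_Pull:
      "\<lbrakk> A \<in> Obj C; D \<in> Obj C; D' \<in> Obj C; c \<in> arr C D' D; c' \<in> arr C D' D; \<delta> \<in> ext C D A \<rbrakk>
       \<Longrightarrow> Pull C (c \<oplus>\<^bsub>Hom C D' D\<^esub> c') \<delta> = Pull C c \<delta> \<oplus>\<^bsub>Ext C D' A\<^esub> Pull C c' \<delta>"

subsection \<open>Complexes and homotopy\<close>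

definition is_complex :: "('o, 'm, 'k, 'z) cat_scheme \<Rightarrow> nat \<Rightarrow> ('o, 'm) cplx \<Rightarrow> bool" where
  "is_complex C n X \<longleftrightarrow>
     length (obs X) = n + 2 \<and> length (diffs X) = n + 1 \<and>
     (\<forall>i\<le>n+1. ob X i \<in> Obj C) \<and>
     (\<forall>i\<le>n. df X i \<in> arr C (ob X i) (ob X (i+1))) \<and>
     (\<forall>i<n. df X (i+1) \<cdot>\<^bsub>C\<^esub> df X i = zero_arr C (ob X i) (ob X (i+2)))"

definition chain_map ::
    "('o, 'm, 'k, 'z) cat_scheme \<Rightarrow> nat \<Rightarrow> ('o, 'm) cplx \<Rightarrow> ('o, 'm) cplx \<Rightarrow> (nat \<Rightarrow> 'm) \<Rightarrow> bool" where
  "chain_map C n X Y f \<longleftrightarrow>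
     (\<forall>i\<le>n+1. f i \<in> arr C (ob X i) (ob Y i)) \<and>
     (\<forall>i\<le>n. f (i+1) \<cdot>\<^bsub>C\<^esub> df X i = df Y i \<cdot>\<^bsub>C\<^esub> f i)"

definition homotopic ::
    "('o, 'm, 'k, 'z) cat_scheme \<Rightarrow> nat \<Rightarrow> ('o, 'm) cplx \<Rightarrow> ('o, 'm) cplx
      \<Rightarrow> (nat \<Rightarrow> 'm) \<Rightarrow> (nat \<Rightarrow> 'm) \<Rightarrow> bool" where
  "homotopic C n X Y f g \<longleftrightarrow>
     (\<exists>\<phi>. (\<forall>i\<in>{1..n+1}. \<phi> i \<in> arr C (ob X i) (ob Y (i-1))) \<and>
        f 0 \<ominus>\<^bsub>Hom C (ob X 0) (ob Y 0)\<^esub> g 0 = \<phi> 1 \<cdot>\<^bsub>C\<^esub> df X 0 \<and>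
        (\<forall>i\<in>{1..n}. f i \<ominus>\<^bsub>Hom C (ob X i) (ob Y i)\<^esub> g i =
           df Y (i-1) \<cdot>\<^bsub>C\<^esub> \<phi> i \<oplus>\<^bsub>Hom C (ob X i) (ob Y i)\<^esub> \<phi> (i+1) \<cdot>\<^bsub>C\<^esub> df X i) \<and>
        f (n+1) \<ominus>\<^bsub>Hom C (ob X (n+1)) (ob Y (n+1))\<^esub> g (n+1) = df Y n \<cdot>\<^bsub>C\<^esub> \<phi> (n+1))"

text \<open>Morphisms between complexes with the same end terms that are the identity at both ends.\<close>

definition end_fixing_map ::
    "('o, 'm, 'k, 'z) cat_scheme \<Rightarrow> nat \<Rightarrow> ('o, 'm) cplx \<Rightarrow> ('o, 'm) cplx \<Rightarrow> (nat \<Rightarrow> 'm) \<Rightarrow> bool" where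
  "end_fixing_map C n X Y f \<longleftrightarrow>
     chain_map C n X Y f \<and> f 0 = Id C (ob X 0) \<and> f (n+1) = Id C (ob X (n+1))"

definition homotopy_class ::
    "('o, 'm, 'k, 'z) cat_scheme \<Rightarrow> nat \<Rightarrow> ('o, 'm) cplx \<Rightarrow> ('o, 'm) cplx set" where
  "homotopy_class C n X =
     {Y. is_complex C n Y \<and> ob Y 0 = ob X 0 \<and> ob Y (n+1) = ob X (n+1) \<and>
         (\<exists>f g. end_fixing_map C n X Y f \<and> end_fixing_map C n Y X g \<and>
            homotopic C n X X (\<lambda>i. g i \<cdot>\<^bsub>C\<^esub> f i) (\<lambda>i. Id C (ob X i)) \<and>
            homotopic C n Y Y (\<lambda>i. f i \<cdot>\<^bsub>C\<^esub> g i) (\<lambda>i. Id C (ob Y i)))}"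

definition is_exangle :: "('o, 'm, 'k, 'e) ecat \<Rightarrow> nat \<Rightarrow> ('o, 'm) cplx \<Rightarrow> 'e \<Rightarrow> bool" where
  "is_exangle C n X \<delta> \<longleftrightarrow>
     is_complex C n X \<and> \<delta> \<in> ext C (ob X (n+1)) (ob X 0) \<and>
     Push C (df X 0) \<delta> = \<zero>\<^bsub>Ext C (ob X (n+1)) (ob X 1)\<^esub> \<and>
     Pull C (df X n) \<delta> = \<zero>\<^bsub>Ext C (ob X n) (ob X 0)\<^esub> \<and>
     (\<forall>W\<in>Obj C.
        (\<forall>i<n. (\<lambda>g. df X i \<cdot>\<^bsub>C\<^esub> g) ` arr C W (ob X i) =
           {f \<in> arr C W (ob X (i+1)). df X (i+1) \<cdot>\<^bsub>C\<^esub> f = zero_arr C W (ob X (i+2))}) \<and>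
        (\<lambda>g. df X n \<cdot>\<^bsub>C\<^esub> g) ` arr C W (ob X n) =
           {f \<in> arr C W (ob X (n+1)). Pull C f \<delta> = \<zero>\<^bsub>Ext C W (ob X 0)\<^esub>}) \<and>
     (\<forall>W\<in>Obj C.
        (\<forall>i<n. (\<lambda>g. g \<cdot>\<^bsub>C\<^esub> df X (i+1)) ` arr C (ob X (i+2)) W =
           {f \<in> arr C (ob X (i+1)) W. f \<cdot>\<^bsub>C\<^esub> df X i = zero_arr C (ob X i) W}) \<and>
        (\<lambda>g. g \<cdot>\<^bsub>C\<^esub> df X 0) ` arr C (ob X 1) W =
           {f \<in> arr C (ob X 0) W. Push C f \<delta> = \<zero>\<^bsub>Ext C (ob X (n+1)) W\<^esub>})"

definition distinguished :: "('o, 'm, 'k, 'e) ecat \<Rightarrow> nat \<Rightarrow> ('o, 'm) cplx \<Rightarrow> 'e \<Rightarrow> bool" where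
  "distinguished C n X \<delta> \<longleftrightarrow>
     is_complex C n X \<and> \<delta> \<in> ext C (ob X (n+1)) (ob X 0) \<and> X \<in> Real C (ob X (n+1)) (ob X 0) \<delta>"

definition inflation :: "('o, 'm, 'k, 'e) ecat \<Rightarrow> nat \<Rightarrow> 'o \<Rightarrow> 'o \<Rightarrow> 'm \<Rightarrow> bool" where
  "inflation C n A B f \<longleftrightarrow>
     (\<exists>X \<delta>. distinguished C n X \<delta> \<and> ob X 0 = A \<and> ob X 1 = B \<and> df X 0 = f)"

definition deflation :: "('o, 'm, 'k, 'e) ecat \<Rightarrow> nat \<Rightarrow> 'o \<Rightarrow> 'o \<Rightarrow> 'm \<Rightarrow> bool" where
  "deflation C n A B f \<longleftrightarrow>
     (\<exists>X \<delta>. distinguished C n X \<delta> \<and> ob X n = A \<and> ob X (n+1) = B \<and> df X n = f)"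

locale exact_realization = additive_bifunctor +
  fixes n :: nat
  assumes Real_class:
      "\<lbrakk> A \<in> Obj C; D \<in> Obj C; \<delta> \<in> ext C D A \<rbrakk>
       \<Longrightarrow> \<exists>X. is_complex C n X \<and> ob X 0 = A \<and> ob X (n+1) = D \<and> Real C D A \<delta> = homotopy_class C n X"
    and R0:
      "\<lbrakk> distinguished C n X \<delta>; distinguished C n Y \<rho>;
         a \<in> arr C (ob X 0) (ob Y 0); c \<in> arr C (ob X (n+1)) (ob Y (n+1));
         Push C a \<delta> = Pull C c \<rho> \<rbrakk>
       \<Longrightarrow> \<exists>f. chain_map C n X Y f \<and> f 0 = a \<and> f (n+1) = c"
    and R1: "distinguished C n X \<delta> \<Longrightarrow> is_exangle C n X \<delta>"
    and R2:
      "\<lbrakk> A \<in> Obj C; zero_object C Z; is_complex C n X;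
         ob X 0 = A; ob X 1 = A; \<forall>i\<in>{2..n+1}. ob X i = Z; df X 0 = Id C A \<rbrakk>
       \<Longrightarrow> distinguished C n X \<zero>\<^bsub>Ext C Z A\<^esub>"
    and R2_op:
      "\<lbrakk> A \<in> Obj C; zero_object C Z; is_complex C n X;
         \<forall>i<n. ob X i = Z; ob X n = A; ob X (n+1) = A; df X n = Id C A \<rbrakk>
       \<Longrightarrow> distinguished C n X \<zero>\<^bsub>Ext C A Z\<^esub>"

subsection \<open>n-exangulated categories\<close>

text \<open>\<open>M\<close> is the mapping cone of \<open>f : X \<rightarrow> Y\<close> (with \<open>f\<^sub>0\<close> an identity), formed with some choice of
  the direct sums \<open>M\<^sub>i = X\<^sub>i\<^sub>+\<^sub>1 \<oplus> Y\<^sub>i\<close>; \<open>\<iota>, \<pi>\<close> belong to the summands \<open>X\<^sub>i\<^sub>+\<^sub>1\<close>, and \<open>\<iota>', \<pi>'\<close> to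
  the summands \<open>Y\<^sub>i\<close>.\<close>

definition is_mapping_cone ::
    "('o, 'm, 'k, 'z) cat_scheme \<Rightarrow> nat \<Rightarrow> ('o, 'm) cplx \<Rightarrow> ('o, 'm) cplx \<Rightarrow> (nat \<Rightarrow> 'm)
      \<Rightarrow> ('o, 'm) cplx \<Rightarrow> bool" where
  "is_mapping_cone C n X Y f M \<longleftrightarrow>
     length (obs M) = n + 2 \<and> length (diffs M) = n + 1 \<and>
     ob M 0 = ob X 1 \<and> ob M (n+1) = ob Y (n+1) \<and>
     (\<exists>\<iota> \<iota>' \<pi> \<pi>'.
        (\<forall>i\<in>{1..n}. is_biproduct C (ob X (i+1)) (ob Y i) (ob M i) (\<iota> i) (\<iota>' i) (\<pi> i) (\<pi>' i)) \<and>
        df M 0 = \<iota> 1 \<cdot>\<^bsub>C\<^esub> (\<ominus>\<^bsub>Hom C (ob X 1) (ob X 2)\<^esub> df X 1)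
                 \<oplus>\<^bsub>Hom C (ob M 0) (ob M 1)\<^esub> \<iota>' 1 \<cdot>\<^bsub>C\<^esub> f 1 \<and>
        (\<forall>i\<in>{1..<n}. df M i =
                 \<iota> (i+1) \<cdot>\<^bsub>C\<^esub> (\<ominus>\<^bsub>Hom C (ob X (i+1)) (ob X (i+2))\<^esub> df X (i+1)) \<cdot>\<^bsub>C\<^esub> \<pi> i
                 \<oplus>\<^bsub>Hom C (ob M i) (ob M (i+1))\<^esub> \<iota>' (i+1) \<cdot>\<^bsub>C\<^esub> f (i+1) \<cdot>\<^bsub>C\<^esub> \<pi> i
                 \<oplus>\<^bsub>Hom C (ob M i) (ob M (i+1))\<^esub> \<iota>' (i+1) \<cdot>\<^bsub>C\<^esub> df Y i \<cdot>\<^bsub>C\<^esub> \<pi>' i) \<and>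
        df M n = f (n+1) \<cdot>\<^bsub>C\<^esub> \<pi> n \<oplus>\<^bsub>Hom C (ob M n) (ob M (n+1))\<^esub> df Y n \<cdot>\<^bsub>C\<^esub> \<pi>' n)"

definition EA2 :: "('o, 'm, 'k, 'e) ecat \<Rightarrow> nat \<Rightarrow> bool" where
  "EA2 C n \<longleftrightarrow>
     (\<forall>A\<in>Obj C. \<forall>D\<in>Obj C. \<forall>D'\<in>Obj C. \<forall>\<rho>\<in>ext C D A. \<forall>c\<in>arr C D' D. \<forall>X Y.
        distinguished C n X (Pull C c \<rho>) \<and> ob X 0 = A \<and> ob X (n+1) = D' \<and>
        distinguished C n Y \<rho> \<and> ob Y 0 = A \<and> ob Y (n+1) = D \<longrightarrow>
        (\<exists>f. chain_map C n X Y f \<and> f 0 = Id C A \<and> f (n+1) = c \<and>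
           (\<forall>M. is_mapping_cone C n X Y f M \<longrightarrow> distinguished C n M (Push C (df X 0) \<rho>))))"

locale n_exangulated_category = exact_realization +
  assumes EA1:
      "\<lbrakk> inflation C n A B f; inflation C n B D g \<rbrakk> \<Longrightarrow> inflation C n A D (g \<cdot> f)"
      "\<lbrakk> deflation C n A B f; deflation C n B D g \<rbrakk> \<Longrightarrow> deflation C n A D (g \<cdot> f)"
    and EA2: "EA2 C n"
    and EA2_op: "EA2 (opposite C) n"

text \<open>Additivity in each variable is part of \<open>additive_bifunctor\<close>; only homogeneity is added.\<close>

definition linear_ecat :: "('k, 'r) ring_scheme \<Rightarrow> ('o, 'm, 'k, 'e) ecat \<Rightarrow> bool" where
  "linear_ecat R C \<longleftrightarrow> linear_category R C \<and>
     (\<forall>A\<in>Obj C. \<forall>B\<in>Obj C. module R (Ext C A B)) \<and>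
     (\<forall>A\<in>Obj C. \<forall>B\<in>Obj C. \<forall>D\<in>Obj C. \<forall>E\<in>Obj C.
      \<forall>r\<in>carrier R. \<forall>f\<in>arr C A B. \<forall>\<delta>\<in>ext C B D. \<forall>g\<in>arr C D E.
        Push C g (Pull C (r \<odot>\<^bsub>Hom C A B\<^esub> f) \<delta>) = r \<odot>\<^bsub>Ext C A E\<^esub> Push C g (Pull C f \<delta>) \<and>
        Push C g (Pull C f (r \<odot>\<^bsub>Ext C B D\<^esub> \<delta>)) = r \<odot>\<^bsub>Ext C A E\<^esub> Push C g (Pull C f \<delta>) \<and>
        Push C (r \<odot>\<^bsub>Hom C D E\<^esub> g) (Pull C f \<delta>) = r \<odot>\<^bsub>Ext C A E\<^esub> Push C g (Pull C f \<delta>))"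

definition Ext_finite :: "('k, 'r) ring_scheme \<Rightarrow> ('o, 'm, 'k, 'e) ecat \<Rightarrow> bool" where
  "Ext_finite R C \<longleftrightarrow> (\<forall>A\<in>Obj C. \<forall>B\<in>Obj C. finitely_generated_module R (Ext C A B))"

section \<open>Stable categories\<close>

definition proj_trivial :: "('o, 'm, 'k, 'e) ecat \<Rightarrow> 'o \<Rightarrow> 'o \<Rightarrow> 'm set" where
  "proj_trivial C A B =
     {f \<in> arr C A B. \<forall>Z\<in>Obj C. \<forall>\<delta>\<in>ext C B Z. Pull C f \<delta> = \<zero>\<^bsub>Ext C A Z\<^esub>}"

definition inj_trivial :: "('o, 'm, 'k, 'e) ecat \<Rightarrow> 'o \<Rightarrow> 'o \<Rightarrow> 'm set" where
  "inj_trivial C A B =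
     {g \<in> arr C A B. \<forall>Z\<in>Obj C. \<forall>\<delta>\<in>ext C Z A. Push C g \<delta> = \<zero>\<^bsub>Ext C Z B\<^esub>}"

definition projective :: "('o, 'm, 'k, 'e) ecat \<Rightarrow> 'o \<Rightarrow> bool" where
  "projective C A \<longleftrightarrow> A \<in> Obj C \<and> Id C A \<in> proj_trivial C A A"

definition injective :: "('o, 'm, 'k, 'e) ecat \<Rightarrow> 'o \<Rightarrow> bool" where
  "injective C A \<longleftrightarrow> A \<in> Obj C \<and> Id C A \<in> inj_trivial C A A"

definition proj_stable :: "('o, 'm, 'k, 'e) ecat \<Rightarrow> ('o, 'm set, 'k) cat" where
  "proj_stable C = quotient_category C (proj_trivial C)"

definition inj_stable :: "('o, 'm, 'k, 'e) ecat \<Rightarrow> ('o, 'm set, 'k) cat" where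
  "inj_stable C = quotient_category C (inj_trivial C)"

section \<open>Auslander-Reiten exangles and Auslander-Reiten-Serre duality\<close>

definition left_almost_split :: "('o, 'm, 'k, 'z) cat_scheme \<Rightarrow> 'o \<Rightarrow> 'o \<Rightarrow> 'm \<Rightarrow> bool" where
  "left_almost_split C A B \<alpha> \<longleftrightarrow>
     \<alpha> \<in> arr C A B \<and> \<not> split_mono C A B \<alpha> \<and>
     (\<forall>A'\<in>Obj C. \<forall>f\<in>arr C A A'. \<not> split_mono C A A' f \<longrightarrow> (\<exists>g\<in>arr C B A'. f = g \<cdot>\<^bsub>C\<^esub> \<alpha>))"

definition right_almost_split :: "('o, 'm, 'k, 'z) cat_scheme \<Rightarrow> 'o \<Rightarrow> 'o \<Rightarrow> 'm \<Rightarrow> bool" where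
  "right_almost_split C A B \<alpha> \<longleftrightarrow>
     \<alpha> \<in> arr C A B \<and> \<not> split_epi C A B \<alpha> \<and>
     (\<forall>B'\<in>Obj C. \<forall>f\<in>arr C B' B. \<not> split_epi C B' B f \<longrightarrow> (\<exists>g\<in>arr C B' A. f = \<alpha> \<cdot>\<^bsub>C\<^esub> g))"

definition AR_exangle :: "('o, 'm, 'k, 'e) ecat \<Rightarrow> nat \<Rightarrow> ('o, 'm) cplx \<Rightarrow> 'e \<Rightarrow> bool" where
  "AR_exangle C n X \<delta> \<longleftrightarrow>
     distinguished C n X \<delta> \<and>
     left_almost_split C (ob X 0) (ob X 1) (df X 0) \<and>
     right_almost_split C (ob X n) (ob X (n+1)) (df X n) \<and>
     (n \<ge> 2 \<longrightarrow> (\<forall>i\<in>{1..n-1}. df X i \<in> rad C (ob X i) (ob X (i+1))))"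

definition has_AR_exangles :: "('o, 'm, 'k, 'e) ecat \<Rightarrow> nat \<Rightarrow> bool" where
  "has_AR_exangles C n \<longleftrightarrow>
     (\<forall>A. indecomposable C A \<and> \<not> projective C A \<longrightarrow> (\<exists>X \<delta>. AR_exangle C n X \<delta> \<and> ob X (n+1) = A)) \<and>
     (\<forall>B. indecomposable C B \<and> \<not> injective C B \<longrightarrow> (\<exists>X \<delta>. AR_exangle C n X \<delta> \<and> ob X 0 = B))"

text \<open>The functor \<open>\<tau>\<close> is given by \<open>\<tau>o\<close> on objects and \<open>\<tau>m\<close> on morphisms.  The last two conditions are
  naturality of \<open>\<Phi> X Y : D \<bbbE>(X, Y) \<rightarrow> (inj_stable C)(Y, \<tau> X)\<close> with respect to \<open>x : X \<rightarrow> X'\<close> and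
  \<open>y : Y' \<rightarrow> Y\<close> in \<open>C\<close>, where \<open>D = Hom\<^sub>R(-, J)\<close>.\<close>

definition has_AR_Serre_duality ::
    "('k, 'r) ring_scheme \<Rightarrow> ('k, 'j, 'x) module_scheme \<Rightarrow> ('o, 'm, 'k, 'e) ecat \<Rightarrow> bool" where
  "has_AR_Serre_duality R J C \<longleftrightarrow>
     (\<exists>\<tau>o \<tau>m. is_linear_equivalence R (proj_stable C) (inj_stable C) \<tau>o \<tau>m \<and>
      (\<exists>\<Phi> :: 'o \<Rightarrow> 'o \<Rightarrow> ('e \<Rightarrow> 'j) \<Rightarrow> 'm set.
        (\<forall>X\<in>Obj C. \<forall>Y\<in>Obj C.
           linear_map R (Hom_module R (Ext C X Y) J) (Hom (inj_stable C) Y (\<tau>o X)) (\<Phi> X Y) \<and>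
           bij_betw (\<Phi> X Y) (carrier (Hom_module R (Ext C X Y) J)) (arr (inj_stable C) Y (\<tau>o X))) \<and>
        (\<forall>X\<in>Obj C. \<forall>X'\<in>Obj C. \<forall>Y\<in>Obj C. \<forall>x\<in>arr C X X'.
         \<forall>\<phi>\<in>carrier (Hom_module R (Ext C X Y) J).
           \<Phi> X' Y (\<lambda>\<delta>\<in>ext C X' Y. \<phi> (Pull C x \<delta>)) =
             \<tau>m (proj_trivial C X X' +>\<^bsub>Hom C X X'\<^esub> x) \<cdot>\<^bsub>inj_stable C\<^esub> \<Phi> X Y \<phi>) \<and>
        (\<forall>X\<in>Obj C. \<forall>Y\<in>Obj C. \<forall>Y'\<in>Obj C. \<forall>y\<in>arr C Y' Y.
         \<forall>\<phi>\<in>carrier (Hom_module R (Ext C X Y) J).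
           \<Phi> X Y' (\<lambda>\<delta>\<in>ext C X Y'. \<phi> (Push C y \<delta>)) =
             \<Phi> X Y \<phi> \<cdot>\<^bsub>inj_stable C\<^esub> (inj_trivial C Y' Y +>\<^bsub>Hom C Y' Y\<^esub> y))))"

end

theory Submission
 imports Defs
begin

text \<open>The two statements are linked by \<^emph>\<open>Serre pairs\<close>.  A Serre pair consists of objects \<open>U\<close>, \<open>A\<close> and a linear
functional \<open>\<eta>\<close> on \<open>\<bbbE>(U, A)\<close> such that the functionals on \<open>\<bbbE>(U, X)\<close> are exactly the maps
\<open>\<xi> \<mapsto> \<eta> (f\<^sub>* \<xi>)\<close> with \<open>f : X \<rightarrow> A\<close>, where \<open>f\<close> is unique modulo \<open>n\<close>-injectively trivial morphisms, and dually
the functionals on \<open>\<bbbE>(X, A)\<close> are the maps \<open>\<xi> \<mapsto> \<eta> (c\<^sup>* \<xi>)\<close> with \<open>c : U \<rightarrow> X\<close> unique modulo \<open>n\<close>-projectively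
trivial morphisms.  In other words \<open>\<eta>\<close> represents \<open>D \<bbbE>(U, -)\<close> by \<open>A\<close> and \<open>D \<bbbE>(-, A)\<close> by \<open>U\<close>.

\<^bold>\<open>Duality and Serre pairs.\<close>  Auslander-Reiten-Serre duality holds iff every object is the left member of a
Serre pair and every object is the right member of one (\<open>serre_imp_duality\<close>, \<open>duality_imp_serre\<close>).  Given the
pairs \<open>(U, \<tau> U)\<close>, a morphism \<open>x : X \<rightarrow> X'\<close> is sent by \<open>\<tau>\<close> to the \<open>f : \<tau> X \<rightarrow> \<tau> X'\<close> that induces the same functional
on \<open>\<bbbE>(X', \<tau> X)\<close>; the two universal properties make \<open>\<tau>\<close> full and faithful on the stable categories, and the
pairs with a prescribed right member make it dense.  Conversely the functional that corresponds to the
identity of \<open>\<tau> X\<close> turns \<open>(X, \<tau> X)\<close> into a Serre pair.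

\<^bold>\<open>Serre pairs and almost split extensions.\<close>  Let \<open>U\<close> and \<open>A\<close> have local endomorphism rings.  If \<open>(U, A, \<eta>)\<close> is
a Serre pair and \<open>U\<close> is not projective, then some \<open>\<delta> \<noteq> 0\<close> satisfies \<open>\<eta> (c\<^sup>* \<delta>) = 0\<close> for all non-automorphisms
\<open>c\<close> of \<open>U\<close>, and such a \<open>\<delta>\<close> is almost split: it is killed by every morphism out of \<open>A\<close> that is not a split
monomorphism and by every morphism into \<open>U\<close> that is not a split epimorphism (\<open>serre_almost_split\<close>).
Conversely an almost split \<open>\<delta>\<close> lies in every nonzero subfunctor of \<open>\<bbbE>(U, -)\<close> and of \<open>\<bbbE>(-, A)\<close>.  For \<open>\<eta>\<close> with
\<open>\<eta> \<delta> \<noteq> 0\<close> the functionals \<open>\<xi> \<mapsto> \<eta> (f\<^sub>* \<xi>)\<close> therefore separate the points of \<open>\<bbbE>(U, X)\<close>, so they are all functionals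
(\<open>socle_serre\<close>).  Both directions rest on one fact about modules, \<open>separating_functionals_exhaust\<close>: over an
artinian ring, a submodule of \<open>D M\<close> that separates the points of a finitely generated module \<open>M\<close> is all
of \<open>D M\<close>.  This is where minimality of \<open>J\<close> enters: each simple module occurs only once in the socle of \<open>J\<close>
(\<open>minimal_injective_cogenerator_socle\<close>), and therefore every homomorphism from a submodule of \<open>J\<close> to \<open>J\<close> is
multiplication by a scalar.  The Krull-Schmidt property reduces Serre pairs of arbitrary objects to
those of indecomposable objects, by matrices of morphisms.

\<^bold>\<open>Almost split extensions and Auslander-Reiten exangles.\<close>  By exactness of a distinguished exangle
\<open>\<langle>X, \<delta>\<rangle>\<close>, its first and last differentials are almost split iff \<open>\<delta>\<close> is (\<open>almost_split_iff\<close>).  That an almost split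
\<open>\<delta>\<close> lies in every nonzero subfunctor follows from exactness one step further (\<open>push_exact\<close>): an extension
that is killed by the inflation of \<open>\<langle>X, \<nu>\<rangle>\<close> is a pullback of \<open>\<nu>\<close>.  This is read off from the mapping cone in
(EA2), applied to the inclusion of a direct summand.  Finally the middle differentials can be made
radical within the homotopy class of \<open>X\<close>: a component of a differential that is an isomorphism between
indecomposable summands can be cancelled, and each cancellation lowers the number of summands
(\<open>radical_representative\<close>).

Arguments are given on one side only and transported to the other by the opposite category.\<close>

section \<open>Linear maps\<close>

lemma linear_mapD:
 assumes "linear_map R M N f"
 shows "x \<in> carrier M \<Longrightarrow> f x \<in> carrier N"
  and "x \<in> carrier M \<Longrightarrow> y \<in> carrier M \<Longrightarrow> f (x \<oplus>\<^bsub>M\<^esub> y) = f x \<oplus>\<^bsub>N\<^esub> f y"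
  and "r \<in> carrier R \<Longrightarrow> x \<in> carrier M \<Longrightarrow> f (r \<odot>\<^bsub>M\<^esub> x) = r \<odot>\<^bsub>N\<^esub> f x"
 using assms unfolding linear_map_def by auto

lemma linear_mapI:
 assumes "\<And>x. x \<in> carrier M \<Longrightarrow> f x \<in> carrier N"
  and "\<And>x y. x \<in> carrier M \<Longrightarrow> y \<in> carrier M \<Longrightarrow> f (x \<oplus>\<^bsub>M\<^esub> y) = f x \<oplus>\<^bsub>N\<^esub> f y"
  and "\<And>r x. r \<in> carrier R \<Longrightarrow> x \<in> carrier M \<Longrightarrow> f (r \<odot>\<^bsub>M\<^esub> x) = r \<odot>\<^bsub>N\<^esub> f x"
 shows "linear_map R M N f"
 using assms unfolding linear_map_def by auto

lemma linear_map_comp: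
 assumes "linear_map R M N f" and "linear_map R N L g"
 shows "linear_map R M L (\<lambda>x. g (f x))"
 by (rule linear_mapI) (simp_all add: linear_mapD[OF assms(1)] linear_mapD[OF assms(2)])

lemma linear_map_zero:
 assumes "module R M" and "module R N" and f: "linear_map R M N f"
 shows "f \<zero>\<^bsub>M\<^esub> = \<zero>\<^bsub>N\<^esub>"
proof -
 interpret M: module R M by fact
 interpret N: module R N by fact
 have "f \<zero>\<^bsub>M\<^esub> = f (\<zero>\<^bsub>R\<^esub> \<odot>\<^bsub>M\<^esub> \<zero>\<^bsub>M\<^esub>)" by simp
 also have "\<dots> = \<zero>\<^bsub>R\<^esub> \<odot>\<^bsub>N\<^esub> f \<zero>\<^bsub>M\<^esub>" by (rule linear_mapD(3)[OF f]) auto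
 also have "\<dots> = \<zero>\<^bsub>N\<^esub>" using linear_mapD(1)[OF f M.M.zero_closed] by simp
 finally show ?thesis .
qed

lemma linear_map_minus:
 assumes "module R M" and "module R N" and f: "linear_map R M N f"
  and x: "x \<in> carrier M" and y: "y \<in> carrier M"
 shows "f (x \<ominus>\<^bsub>M\<^esub> y) = f x \<ominus>\<^bsub>N\<^esub> f y"
proof -
 interpret M: module R M by fact
 interpret N: module R N by fact
 have fx: "f x \<in> carrier N" and fy: "f y \<in> carrier N" using linear_mapD(1)[OF f] x y by auto
 have "f (x \<ominus>\<^bsub>M\<^esub> y) \<oplus>\<^bsub>N\<^esub> f y = f ((x \<ominus>\<^bsub>M\<^esub> y) \<oplus>\<^bsub>M\<^esub> y)"
  using linear_mapD(2)[OF f, of "x \<ominus>\<^bsub>M\<^esub> y" y] x y by simp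
 also have "(x \<ominus>\<^bsub>M\<^esub> y) \<oplus>\<^bsub>M\<^esub> y = x"
  using x y by (simp add: M.M.minus_eq M.M.a_assoc M.M.l_neg)
 finally have "f (x \<ominus>\<^bsub>M\<^esub> y) \<oplus>\<^bsub>N\<^esub> f y = f x" .
 then show ?thesis
  using fx fy linear_mapD(1)[OF f M.M.minus_closed[OF x y]]
  by (metis N.M.add.inv_solve_right N.M.minus_eq)
qed

lemma (in cring) ideal_criterion:
 assumes sub: "I \<subseteq> carrier R" and zero: "\<zero> \<in> I"
  and add: "\<And>a b. a \<in> I \<Longrightarrow> b \<in> I \<Longrightarrow> a \<oplus> b \<in> I"
  and mult: "\<And>a r. a \<in> I \<Longrightarrow> r \<in> carrier R \<Longrightarrow> r \<otimes> a \<in> I"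
 shows "ideal I R"
proof (rule idealI)
 show "ring R" by (rule ring_axioms)
 show "subgroup I (add_monoid R)"
 proof (rule add.subgroupI)
  show "I \<subseteq> carrier R" "I \<noteq> {}" using sub zero by auto
  show "\<ominus> a \<in> I" if "a \<in> I" for a
  proof -
   have "\<ominus> a = (\<ominus> \<one>) \<otimes> a" using that sub by (simp add: l_minus subsetD)
   then show ?thesis using mult[OF that, of "\<ominus> \<one>"] by simp
  qed
  show "a \<oplus> b \<in> I" if "a \<in> I" "b \<in> I" for a b using add that by auto
 qed
 show "x \<otimes> a \<in> I" if "a \<in> I" "x \<in> carrier R" for a x using mult that by auto
 show "a \<otimes> x \<in> I" if "a \<in> I" "x \<in> carrier R" for a x using mult that sub m_comm by (metis subsetD)
qed

lemma (in module) submodule_criterion: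
 assumes sub: "N \<subseteq> carrier M" and zero: "\<zero>\<^bsub>M\<^esub> \<in> N"
  and add: "\<And>a b. a \<in> N \<Longrightarrow> b \<in> N \<Longrightarrow> a \<oplus>\<^bsub>M\<^esub> b \<in> N"
  and smult: "\<And>r a. r \<in> carrier R \<Longrightarrow> a \<in> N \<Longrightarrow> r \<odot>\<^bsub>M\<^esub> a \<in> N"
 shows "submodule N R M"
proof (rule submoduleI[OF sub zero])
 show "\<ominus>\<^bsub>M\<^esub> a \<in> N" if "a \<in> N" for a
 proof -
  have "\<ominus>\<^bsub>M\<^esub> a = (\<ominus> \<one>) \<odot>\<^bsub>M\<^esub> a" using that sub by (subst smult_l_minus) auto
  then show ?thesis using smult[of "\<ominus> \<one>" a] that by simp
 qed
qed (use add smult in auto)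

lemma (in module) submoduleD:
 assumes "submodule N R M"
 shows "x \<in> N \<Longrightarrow> x \<in> carrier M" and "\<zero>\<^bsub>M\<^esub> \<in> N"
  and "x \<in> N \<Longrightarrow> y \<in> N \<Longrightarrow> x \<oplus>\<^bsub>M\<^esub> y \<in> N"
  and "r \<in> carrier R \<Longrightarrow> x \<in> N \<Longrightarrow> r \<odot>\<^bsub>M\<^esub> x \<in> N"
  and "x \<in> N \<Longrightarrow> y \<in> N \<Longrightarrow> x \<ominus>\<^bsub>M\<^esub> y \<in> N"
proof -
 note E = submoduleE[OF assms]
 show "x \<in> N \<Longrightarrow> x \<in> carrier M" using E(1) by auto
 show "\<zero>\<^bsub>M\<^esub> \<in> N" using assms by (simp add: submodule_def subgroup.one_closed[of N "add_monoid M", simplified])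
 show "x \<in> N \<Longrightarrow> y \<in> N \<Longrightarrow> x \<oplus>\<^bsub>M\<^esub> y \<in> N" using E(5) .
 show "r \<in> carrier R \<Longrightarrow> x \<in> N \<Longrightarrow> r \<odot>\<^bsub>M\<^esub> x \<in> N" using E(4) .
 show "x \<in> N \<Longrightarrow> y \<in> N \<Longrightarrow> x \<ominus>\<^bsub>M\<^esub> y \<in> N" using E(3,5) by (simp add: M.minus_eq)
qed

text \<open>For the zero submodule this is the annihilator of \<open>x\<close>.\<close>

lemma (in module) colon_ideal:
 assumes N: "submodule N R M" and x: "x \<in> carrier M"
 shows "ideal {a \<in> carrier R. a \<odot>\<^bsub>M\<^esub> x \<in> N} R"
 using submoduleD[OF N] x
 by (intro R.ideal_criterion) (auto simp: smult_l_distr smult_assoc1)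

lemma (in module) coset_eq_iff:
 assumes N: "submodule N R M" and x: "x \<in> carrier M" and y: "y \<in> carrier M"
 shows "N +>\<^bsub>M\<^esub> x = N +>\<^bsub>M\<^esub> y \<longleftrightarrow> x \<ominus>\<^bsub>M\<^esub> y \<in> N"
proof -
 have sg: "subgroup N (add_monoid M)" using N by (simp add: submodule_def)
 have NM: "N \<subseteq> carrier M" using submoduleD(1)[OF N] by auto
 show ?thesis
 proof
  assume "N +>\<^bsub>M\<^esub> x = N +>\<^bsub>M\<^esub> y"
  moreover have "x \<in> N +>\<^bsub>M\<^esub> x"
   using M.a_rcosI[OF submoduleD(2)[OF N] NM x] x by simp
  ultimately obtain n where n: "n \<in> N" "x = n \<oplus>\<^bsub>M\<^esub> y" by (auto simp: a_r_coset_def')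
  then have "x \<ominus>\<^bsub>M\<^esub> y = n" using y NM by (simp add: M.minus_eq M.a_assoc M.r_neg subsetD)
  then show "x \<ominus>\<^bsub>M\<^esub> y \<in> N" using n by simp
 next
  assume d: "x \<ominus>\<^bsub>M\<^esub> y \<in> N"
  have "x = (x \<ominus>\<^bsub>M\<^esub> y) \<oplus>\<^bsub>M\<^esub> y" using x y by (simp add: M.minus_eq M.a_assoc M.l_neg)
  then have "x \<in> N +>\<^bsub>M\<^esub> y" using M.a_rcosI[OF d NM y] by simp
  then show "N +>\<^bsub>M\<^esub> x = N +>\<^bsub>M\<^esub> y" using M.a_repr_independence[OF _ y sg] by simp
 qed
qed

lemma (in module) quotient_carrier:
 "carrier (quotient_module M N) = {N +>\<^bsub>M\<^esub> x | x. x \<in> carrier M}"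
 by (auto simp: quotient_module_def A_RCOSETS_def')

text \<open>Scalar multiplication of cosets is a union over representatives, which is evaluated by this description.\<close>

lemma (in module) mem_coset:
 assumes N: "submodule N R M" and x: "x \<in> carrier M"
 shows "x' \<in> N +>\<^bsub>M\<^esub> x \<longleftrightarrow> x' \<in> carrier M \<and> x' \<ominus>\<^bsub>M\<^esub> x \<in> N"
proof
 assume "x' \<in> N +>\<^bsub>M\<^esub> x"
 then obtain n where "n \<in> N" "x' = n \<oplus>\<^bsub>M\<^esub> x" by (auto simp: a_r_coset_def')
 then show "x' \<in> carrier M \<and> x' \<ominus>\<^bsub>M\<^esub> x \<in> N"
  using x submoduleD(1)[OF N] by (auto simp: M.minus_eq M.a_assoc M.r_neg)
next
 assume "x' \<in> carrier M \<and> x' \<ominus>\<^bsub>M\<^esub> x \<in> N"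
 then show "x' \<in> N +>\<^bsub>M\<^esub> x"
  using x by (auto simp: a_r_coset_def' M.minus_eq M.a_assoc M.l_neg intro!: bexI[of _ "x' \<ominus>\<^bsub>M\<^esub> x"])
qed

lemma (in module) quotient_add:
 assumes N: "submodule N R M" and x: "x \<in> carrier M" and y: "y \<in> carrier M"
 shows "(N +>\<^bsub>M\<^esub> x) \<oplus>\<^bsub>quotient_module M N\<^esub> (N +>\<^bsub>M\<^esub> y) = N +>\<^bsub>M\<^esub> (x \<oplus>\<^bsub>M\<^esub> y)"
proof -
 have "abelian_subgroup N M"
  using N M.a_comm_group
  by (intro abelian_subgroupI3) (simp_all add: submodule_def additive_subgroup_def M.abelian_group_axioms)
 then show ?thesis using x y by (simp add: quotient_module_def abelian_subgroup.a_rcos_sum)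
qed

lemma (in module) quotient_smult:
 assumes N: "submodule N R M" and x: "x \<in> carrier M" and r: "r \<in> carrier R"
 shows "r \<odot>\<^bsub>quotient_module M N\<^esub> (N +>\<^bsub>M\<^esub> x) = N +>\<^bsub>M\<^esub> (r \<odot>\<^bsub>M\<^esub> x)"
proof -
 have "N +>\<^bsub>M\<^esub> (r \<odot>\<^bsub>M\<^esub> x') = N +>\<^bsub>M\<^esub> (r \<odot>\<^bsub>M\<^esub> x)" if "x' \<in> N +>\<^bsub>M\<^esub> x" for x'
 proof -
  have x': "x' \<in> carrier M" "x' \<ominus>\<^bsub>M\<^esub> x \<in> N" using that mem_coset[OF N x] by auto
  have "r \<odot>\<^bsub>M\<^esub> (x' \<ominus>\<^bsub>M\<^esub> x) \<in> N" by (rule submoduleD(4)[OF N r x'(2)])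
  moreover have "r \<odot>\<^bsub>M\<^esub> (x' \<ominus>\<^bsub>M\<^esub> x) = r \<odot>\<^bsub>M\<^esub> x' \<ominus>\<^bsub>M\<^esub> r \<odot>\<^bsub>M\<^esub> x"
   using x x' r by (simp add: M.minus_eq smult_r_distr smult_r_minus)
  ultimately show ?thesis using coset_eq_iff[OF N] x x' r by simp
 qed
 moreover have "x \<in> N +>\<^bsub>M\<^esub> x" using mem_coset[OF N x] x submoduleD(2)[OF N] by (simp add: M.minus_eq M.r_neg)
 ultimately have "(\<Union>x'\<in>N +>\<^bsub>M\<^esub> x. N +>\<^bsub>M\<^esub> (r \<odot>\<^bsub>M\<^esub> x')) = N +>\<^bsub>M\<^esub> (r \<odot>\<^bsub>M\<^esub> x)"
  by blast
 then show ?thesis by (simp add: quotient_module_def)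
qed

lemma (in module) quotient_zero: "\<zero>\<^bsub>quotient_module M N\<^esub> = N"
 by (simp add: quotient_module_def)

lemma (in module) coset_zero:
 assumes N: "submodule N R M"
 shows "N +>\<^bsub>M\<^esub> \<zero>\<^bsub>M\<^esub> = N"
 using M.a_coset_add_zero submoduleD(1)[OF N] by blast

lemma (in module) quotient_module:
 assumes N: "submodule N R M"
 shows "module R (quotient_module M N)"
proof -
 let ?Q = "quotient_module M N"
 note [simp] = quotient_carrier quotient_add[OF N] quotient_smult[OF N]
 have z: "\<zero>\<^bsub>?Q\<^esub> = N +>\<^bsub>M\<^esub> \<zero>\<^bsub>M\<^esub>" using coset_zero[OF N] quotient_zero by simp
 have rep: "\<exists>a. a \<in> carrier M \<and> x = N +>\<^bsub>M\<^esub> a" if "x \<in> carrier ?Q" for x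
  using that by auto
 have mem: "N +>\<^bsub>M\<^esub> a \<in> carrier ?Q" if "a \<in> carrier M" for a
  using that by auto
 note [simp del] = quotient_carrier
 have ag: "abelian_group ?Q"
 proof (rule abelian_groupI)
  fix x assume "x \<in> carrier ?Q"
  then obtain a where a: "a \<in> carrier M" "x = N +>\<^bsub>M\<^esub> a" using rep by blast
  show "\<zero>\<^bsub>?Q\<^esub> \<oplus>\<^bsub>?Q\<^esub> x = x" using a by (simp add: z)
  have "(N +>\<^bsub>M\<^esub> (\<ominus>\<^bsub>M\<^esub> a)) \<oplus>\<^bsub>?Q\<^esub> x = \<zero>\<^bsub>?Q\<^esub>" using a by (simp add: z M.l_neg)
  then show "\<exists>y\<in>carrier ?Q. y \<oplus>\<^bsub>?Q\<^esub> x = \<zero>\<^bsub>?Q\<^esub>" using a mem[of "\<ominus>\<^bsub>M\<^esub> a"] by (intro bexI) auto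
  fix y assume "y \<in> carrier ?Q"
  then obtain b where b: "b \<in> carrier M" "y = N +>\<^bsub>M\<^esub> b" using rep by blast
  show "x \<oplus>\<^bsub>?Q\<^esub> y \<in> carrier ?Q" using a b by (simp add: mem)
  show "x \<oplus>\<^bsub>?Q\<^esub> y = y \<oplus>\<^bsub>?Q\<^esub> x" using a b by (simp add: M.a_comm)
  fix w assume "w \<in> carrier ?Q"
  then obtain c where c: "c \<in> carrier M" "w = N +>\<^bsub>M\<^esub> c" using rep by blast
  show "x \<oplus>\<^bsub>?Q\<^esub> y \<oplus>\<^bsub>?Q\<^esub> w = x \<oplus>\<^bsub>?Q\<^esub> (y \<oplus>\<^bsub>?Q\<^esub> w)" using a b c by (simp add: M.a_assoc)
 next
  show "\<zero>\<^bsub>?Q\<^esub> \<in> carrier ?Q" by (simp add: z mem)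
 qed
 show ?thesis
 proof (rule moduleI[OF R.cring_axioms ag])
  fix r s x assume r: "r \<in> carrier R" and "x \<in> carrier ?Q"
  then obtain a where a: "a \<in> carrier M" "x = N +>\<^bsub>M\<^esub> a" using rep by blast
  show "r \<odot>\<^bsub>?Q\<^esub> x \<in> carrier ?Q" using a r by (simp add: mem)
  { assume s: "s \<in> carrier R"
   show "(r \<oplus> s) \<odot>\<^bsub>?Q\<^esub> x = r \<odot>\<^bsub>?Q\<^esub> x \<oplus>\<^bsub>?Q\<^esub> s \<odot>\<^bsub>?Q\<^esub> x" using a r s by (simp add: smult_l_distr)
   show "(r \<otimes> s) \<odot>\<^bsub>?Q\<^esub> x = r \<odot>\<^bsub>?Q\<^esub> (s \<odot>\<^bsub>?Q\<^esub> x)" using a r s by (simp add: smult_assoc1) }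
  fix y assume "y \<in> carrier ?Q"
  then obtain b where b: "b \<in> carrier M" "y = N +>\<^bsub>M\<^esub> b" using rep by blast
  show "r \<odot>\<^bsub>?Q\<^esub> (x \<oplus>\<^bsub>?Q\<^esub> y) = r \<odot>\<^bsub>?Q\<^esub> x \<oplus>\<^bsub>?Q\<^esub> r \<odot>\<^bsub>?Q\<^esub> y" using a b r by (simp add: smult_r_distr)
 next
  fix x assume "x \<in> carrier ?Q"
  then obtain a where a: "a \<in> carrier M" "x = N +>\<^bsub>M\<^esub> a" using rep by blast
  then show "\<one> \<odot>\<^bsub>?Q\<^esub> x = x" by simp
 qed
qed

definition regular_module :: "('k, 'r) ring_scheme \<Rightarrow> ('k, 'k) module" where
 "regular_module R = \<lparr> carrier = carrier R, mult = mult R, one = one R, zero = zero R,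
   add = add R, smult = mult R \<rparr>"

lemma regular_module_simps [simp]:
 "carrier (regular_module R) = carrier R" "zero (regular_module R) = zero R"
 "add (regular_module R) = add R" "smult (regular_module R) = mult R"
 by (simp_all add: regular_module_def)

lemma (in cring) regular_module: "module R (regular_module R)"
proof (rule moduleI[OF cring_axioms])
 show "abelian_group (regular_module R)"
 proof (rule abelian_groupI)
  show "\<exists>y\<in>carrier (regular_module R). y \<oplus>\<^bsub>regular_module R\<^esub> x = \<zero>\<^bsub>regular_module R\<^esub>"
   if "x \<in> carrier (regular_module R)" for x
   using that by (auto intro!: bexI[of _ "\<ominus> x"] simp: l_neg)
 qed (auto intro: a_assoc a_comm)
qed (auto intro: l_distr r_distr m_assoc)

lemma (in cring) ideal_submodule:
 assumes "ideal I R"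
 shows "submodule I R (regular_module R)"
proof -
 have sg: "additive_subgroup I R" using assms by (simp add: ideal_def)
 show ?thesis
 proof (rule module.submodule_criterion[OF regular_module])
  show "I \<subseteq> carrier (regular_module R)"
   using additive_subgroup.a_subset[OF sg] by simp
  show "\<zero>\<^bsub>regular_module R\<^esub> \<in> I"
   using additive_subgroup.zero_closed[OF sg] by simp
  show "a \<oplus>\<^bsub>regular_module R\<^esub> b \<in> I" if "a \<in> I" "b \<in> I" for a b
   using additive_subgroup.a_closed[OF sg that] by simp
  show "r \<odot>\<^bsub>regular_module R\<^esub> a \<in> I" if "r \<in> carrier R" "a \<in> I" for r a
   using ideal.I_l_closed[OF assms that(2,1)] by simp
 qed
qed

section \<open>Modules over an artinian ring\<close>

text \<open>The minimum condition, which is the form in which the descending chain condition is used.\<close>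

lemma (in artinian_cring) minimal_ideal:
 assumes ne: "I0 \<in> \<I>" and id: "\<And>I. I \<in> \<I> \<Longrightarrow> ideal I R"
 shows "\<exists>I\<in>\<I>. \<forall>I'\<in>\<I>. I' \<subseteq> I \<longrightarrow> I' = I"
proof (rule ccontr)
 assume neg: "\<not> ?thesis"
 then have step: "\<exists>I'. I' \<in> \<I> \<and> I' \<subset> I" if "I \<in> \<I>" for I
  using that by blast
 have "\<exists>f. \<forall>n. f n \<in> \<I> \<and> f (Suc n) \<subset> f n"
 proof (rule dependent_nat_choice)
  show "\<exists>I. I \<in> \<I>" using ne by blast
  show "\<exists>I'. I' \<in> \<I> \<and> I' \<subset> I" if "I \<in> \<I>" for I and n :: nat
   by (rule step[OF that])
 qed
 then obtain f :: "nat \<Rightarrow> 'a set" where f: "\<forall>n. f n \<in> \<I>" "\<forall>n. f (Suc n) \<subset> f n" by blast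
 have "\<forall>n. ideal (f n) R" using f(1) id by blast
 moreover have "\<forall>n. f (Suc n) \<subseteq> f n" using f(2) by blast
 ultimately obtain m where "\<forall>i\<ge>m. f i = f m" using descending_chain_condition by blast
 then have "f (Suc m) = f m" by (meson le_SucI order_refl)
 with f(2) show False by blast
qed

lemma (in module) smult_comm:
 assumes "a \<in> carrier R" "b \<in> carrier R" "x \<in> carrier M"
 shows "a \<odot>\<^bsub>M\<^esub> (b \<odot>\<^bsub>M\<^esub> x) = b \<odot>\<^bsub>M\<^esub> (a \<odot>\<^bsub>M\<^esub> x)"
 using assms by (metis R.m_comm smult_assoc1)

lemma (in module) smult_diff:
 assumes "a \<in> carrier R" "b \<in> carrier R" "x \<in> carrier M"
 shows "(a \<ominus> b) \<odot>\<^bsub>M\<^esub> x = a \<odot>\<^bsub>M\<^esub> x \<ominus>\<^bsub>M\<^esub> b \<odot>\<^bsub>M\<^esub> x"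
 using assms by (simp add: R.minus_eq M.minus_eq smult_l_distr smult_l_minus)

lemma (in module) smult_minus_right:
 assumes "a \<in> carrier R" "x \<in> carrier M" "y \<in> carrier M"
 shows "a \<odot>\<^bsub>M\<^esub> (x \<ominus>\<^bsub>M\<^esub> y) = a \<odot>\<^bsub>M\<^esub> x \<ominus>\<^bsub>M\<^esub> a \<odot>\<^bsub>M\<^esub> y"
 using assms by (simp add: M.minus_eq smult_r_distr smult_r_minus)

lemma (in module) minus_zero_iff:
 assumes "x \<in> carrier M" "y \<in> carrier M"
 shows "x \<ominus>\<^bsub>M\<^esub> y = \<zero>\<^bsub>M\<^esub> \<longleftrightarrow> x = y"
 using assms by (metis M.add.inv_solve_right' M.l_zero M.minus_eq M.zero_closed)

lemma (in module) minus_add_cancel: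
 assumes "x \<in> carrier M" "y \<in> carrier M"
 shows "(x \<ominus>\<^bsub>M\<^esub> y) \<oplus>\<^bsub>M\<^esub> y = x"
 using assms by (simp add: M.minus_eq M.a_assoc M.l_neg)

lemma (in module) zero_submodule: "submodule {\<zero>\<^bsub>M\<^esub>} R M"
 by (rule submodule_criterion) auto

definition adjoin :: "('k, 'r) ring_scheme \<Rightarrow> ('k, 'a, 'x) module_scheme \<Rightarrow> 'a set \<Rightarrow> 'a \<Rightarrow> 'a set" where
 "adjoin R M N x = {n \<oplus>\<^bsub>M\<^esub> c \<odot>\<^bsub>M\<^esub> x | n c. n \<in> N \<and> c \<in> carrier R}"

text \<open>Enlarging a submodule by one element is the step in all maximality arguments below.\<close>

lemma (in module) adjoin:
 assumes N: "submodule N R M" and x: "x \<in> carrier M"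
 shows "submodule (adjoin R M N x) R M" and "N \<subseteq> adjoin R M N x" and "x \<in> adjoin R M N x"
proof -
 note ND = submoduleD[OF N]
 have I: "n \<oplus>\<^bsub>M\<^esub> c \<odot>\<^bsub>M\<^esub> x \<in> adjoin R M N x" if "n \<in> N" "c \<in> carrier R" for n c
  using that by (auto simp: adjoin_def)
 show sub: "N \<subseteq> adjoin R M N x"
 proof
  fix n assume n: "n \<in> N"
  show "n \<in> adjoin R M N x" using I[OF n R.zero_closed] x ND(1)[OF n] by simp
 qed
 show "x \<in> adjoin R M N x" using I[OF ND(2) R.one_closed] x by simp
 show "submodule (adjoin R M N x) R M"
 proof (rule submodule_criterion)
  show "adjoin R M N x \<subseteq> carrier M" using ND(1) x by (auto simp: adjoin_def)
  show "\<zero>\<^bsub>M\<^esub> \<in> adjoin R M N x" using sub ND(2) by blast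
  fix u assume "u \<in> adjoin R M N x"
  then obtain n c where u: "n \<in> N" "c \<in> carrier R" "u = n \<oplus>\<^bsub>M\<^esub> c \<odot>\<^bsub>M\<^esub> x" by (auto simp: adjoin_def)
  show "r \<odot>\<^bsub>M\<^esub> u \<in> adjoin R M N x" if r: "r \<in> carrier R" for r
   using I[OF ND(4)[OF r u(1)], of "r \<otimes> c"] r u x ND(1)[OF u(1)] by (simp add: smult_assoc1 smult_r_distr)
  fix v assume "v \<in> adjoin R M N x"
  then obtain n' c' where v: "n' \<in> N" "c' \<in> carrier R" "v = n' \<oplus>\<^bsub>M\<^esub> c' \<odot>\<^bsub>M\<^esub> x" by (auto simp: adjoin_def)
  have "u \<oplus>\<^bsub>M\<^esub> v = (n \<oplus>\<^bsub>M\<^esub> n') \<oplus>\<^bsub>M\<^esub> (c \<oplus> c') \<odot>\<^bsub>M\<^esub> x"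
   using u v x ND(1) by (simp add: smult_l_distr M.a_ac)
  then show "u \<oplus>\<^bsub>M\<^esub> v \<in> adjoin R M N x" using I[OF ND(3)[OF u(1) v(1)], of "c \<oplus> c'"] u v by simp
 qed
qed

text \<open>Zorn's lemma for submodules that avoid a set \<open>S\<close>.  Maximality is stated in the form in which it is
applied: adjoining any further element hits \<open>S\<close>.\<close>

lemma (in module) maximal_submodule:
 assumes N0: "submodule N0 R M" and S: "N0 \<inter> S = {}"
 shows "\<exists>N. submodule N R M \<and> N0 \<subseteq> N \<and> N \<inter> S = {} \<and>
  (\<forall>x\<in>carrier M. x \<notin> N \<longrightarrow> (\<exists>n\<in>N. \<exists>c\<in>carrier R. n \<oplus>\<^bsub>M\<^esub> c \<odot>\<^bsub>M\<^esub> x \<in> S))"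
proof -
 let ?A = "{N. submodule N R M \<and> N0 \<subseteq> N \<and> N \<inter> S = {}}"
 have "\<exists>N\<in>?A. \<forall>X\<in>?A. N \<subseteq> X \<longrightarrow> X = N"
 proof (rule subset_Zorn_nonempty)
  show "?A \<noteq> {}" using N0 S by blast
  fix \<C> assume ne: "\<C> \<noteq> {}" and ch: "subset.chain ?A \<C>"
  have "\<C> \<subseteq> ?A" using ch unfolding subset_chain_def by (rule conjunct1)
  then have "submodule H R M \<and> N0 \<subseteq> H \<and> H \<inter> S = {}" if "H \<in> \<C>" for H
   using that by (rule subsetD[THEN CollectD])
  then have p: "submodule H R M" "N0 \<subseteq> H" "H \<inter> S = {}" if "H \<in> \<C>" for H
   using that by simp_all
  have lin: "\<forall>H\<in>\<C>. \<forall>H'\<in>\<C>. H \<subseteq> H' \<or> H' \<subseteq> H"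
   using ch unfolding subset_chain_def by (rule conjunct2)
  have dir: "\<exists>H\<in>\<C>. u \<in> H \<and> v \<in> H" if "u \<in> \<Union>\<C>" "v \<in> \<Union>\<C>" for u v
   using lin that by blast
  have "submodule (\<Union>\<C>) R M"
  proof (rule submodule_criterion)
   show "\<Union>\<C> \<subseteq> carrier M" using submoduleD(1)[OF p(1)] by blast
   show "\<zero>\<^bsub>M\<^esub> \<in> \<Union>\<C>" using submoduleD(2)[OF p(1)] ne by blast
   show "u \<oplus>\<^bsub>M\<^esub> v \<in> \<Union>\<C>" if uv: "u \<in> \<Union>\<C>" "v \<in> \<Union>\<C>" for u v
   proof -
    obtain H where "H \<in> \<C>" "u \<in> H" "v \<in> H" using dir[OF uv] by blast
    then show ?thesis using submoduleD(3)[OF p(1)] by blast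
   qed
   show "r \<odot>\<^bsub>M\<^esub> u \<in> \<Union>\<C>" if "r \<in> carrier R" "u \<in> \<Union>\<C>" for r u
    using that submoduleD(4)[OF p(1)] by blast
  qed
  moreover have "N0 \<subseteq> \<Union>\<C>" using ne p(2) by blast
  moreover have "\<Union>\<C> \<inter> S = {}" by (simp add: Int_Union2 p(3))
  ultimately show "\<Union>\<C> \<in> ?A" by (intro CollectI conjI)
 qed
 then obtain N where N: "N \<in> ?A" "\<forall>X\<in>?A. N \<subseteq> X \<longrightarrow> X = N" by (rule bexE)
 have "\<exists>n\<in>N. \<exists>c\<in>carrier R. n \<oplus>\<^bsub>M\<^esub> c \<odot>\<^bsub>M\<^esub> x \<in> S" if x: "x \<in> carrier M" "x \<notin> N" for x
 proof (rule ccontr)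
  assume no: "\<not> ?thesis"
  have sN: "submodule N R M" using N(1) by simp
  note a = adjoin[OF sN x(1)]
  have "adjoin R M N x \<in> ?A" using a N(1) no by (auto simp: adjoin_def)
  then have "adjoin R M N x = N" using N(2) a(2) by blast
  then show False using a(3) x(2) by simp
 qed
 then show ?thesis using N(1) by blast
qed

text \<open>Every cyclic submodule of \<open>M/N\<close> contains a simple one: choose \<open>a\<close> with \<open>a x \<notin> N\<close> and the principal
ideal of \<open>a\<close> minimal.  Simplicity of the class of \<open>a x\<close> is expressed by elements.\<close>

lemma simple_over_submodule:
 fixes M (structure)
 assumes "artinian_cring R" and "module R M" and N: "submodule N R M"
  and x: "x \<in> carrier M" and xN: "x \<notin> N"
 shows "\<exists>a\<in>carrier R. a \<odot> x \<notin> N \<and>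
  (\<forall>b\<in>carrier R. b \<odot> (a \<odot> x) \<notin> N \<longrightarrow>
    (\<exists>c\<in>carrier R. c \<odot> (b \<odot> (a \<odot> x)) = a \<odot> x))"
proof -
 interpret artinian_cring R by fact
 interpret M: module R M by fact
 let ?F = "{PIdl\<^bsub>R\<^esub> a | a. a \<in> carrier R \<and> a \<odot> x \<notin> N}"
 have "PIdl\<^bsub>R\<^esub> \<one>\<^bsub>R\<^esub> \<in> ?F" using x xN by auto
 moreover have "ideal I R" if "I \<in> ?F" for I using that cgenideal_ideal by blast
 ultimately have "\<exists>I\<in>?F. \<forall>I'\<in>?F. I' \<subseteq> I \<longrightarrow> I' = I"
  by (rule minimal_ideal)
 then obtain I where I: "I \<in> ?F" "\<forall>I'\<in>?F. I' \<subseteq> I \<longrightarrow> I' = I" by (rule bexE)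
 then obtain a where a: "a \<in> carrier R" "a \<odot> x \<notin> N" "I = PIdl\<^bsub>R\<^esub> a" by auto
 have "\<exists>c\<in>carrier R. c \<odot> (b \<odot> (a \<odot> x)) = a \<odot> x"
  if b: "b \<in> carrier R" "b \<odot> (a \<odot> x) \<notin> N" for b
 proof -
  have "b \<otimes>\<^bsub>R\<^esub> a \<in> carrier R \<and> (b \<otimes>\<^bsub>R\<^esub> a) \<odot> x \<notin> N"
   using a b x by (simp add: M.smult_assoc1)
  then have "PIdl\<^bsub>R\<^esub> (b \<otimes>\<^bsub>R\<^esub> a) \<in> ?F" by blast
  moreover have "PIdl\<^bsub>R\<^esub> (b \<otimes>\<^bsub>R\<^esub> a) \<subseteq> I"
   unfolding a(3) using cgenideal_minimal[OF cgenideal_ideal[OF a(1)], of "b \<otimes>\<^bsub>R\<^esub> a"]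
    ideal.I_l_closed[OF cgenideal_ideal[OF a(1)] cgenideal_self[OF a(1)] b(1)] by simp
  ultimately have "PIdl\<^bsub>R\<^esub> (b \<otimes>\<^bsub>R\<^esub> a) = PIdl\<^bsub>R\<^esub> a" using I(2) a(3) by simp
  then have "a \<in> PIdl\<^bsub>R\<^esub> (b \<otimes>\<^bsub>R\<^esub> a)" using cgenideal_self[OF a(1)] by simp
  then obtain c where "c \<in> carrier R" "a = c \<otimes>\<^bsub>R\<^esub> (b \<otimes>\<^bsub>R\<^esub> a)" unfolding cgenideal_def by auto
  then have "c \<odot> (b \<odot> (a \<odot> x)) = a \<odot> x"
   using a(1) b(1) x by (metis M.smult_assoc1 m_closed)
  then show ?thesis using \<open>c \<in> carrier R\<close> by (rule bexI)
 qed
 then show ?thesis using a(1,2) by (intro bexI[of _ a]) simp_all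
qed

text \<open>The element generates a simple submodule.\<close>

definition simple_element :: "('k, 'r) ring_scheme \<Rightarrow> ('k, 'a, 'x) module_scheme \<Rightarrow> 'a \<Rightarrow> bool" where
 "simple_element R M t \<longleftrightarrow> t \<in> carrier M \<and> t \<noteq> \<zero>\<^bsub>M\<^esub> \<and>
   (\<forall>b\<in>carrier R. b \<odot>\<^bsub>M\<^esub> t \<noteq> \<zero>\<^bsub>M\<^esub> \<longrightarrow> (\<exists>c\<in>carrier R. c \<odot>\<^bsub>M\<^esub> (b \<odot>\<^bsub>M\<^esub> t) = t))"

text \<open>Each simple module occurs at most once in the socle: the elements killed by the annihilator of a
simple element form a simple module.\<close>

definition multiplicity_free_socle :: "('k, 'r) ring_scheme \<Rightarrow> ('k, 'a, 'x) module_scheme \<Rightarrow> bool" where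
 "multiplicity_free_socle R M \<longleftrightarrow>
   (\<forall>y y'. simple_element R M y \<and> y' \<in> carrier M \<and>
    (\<forall>b\<in>carrier R. b \<odot>\<^bsub>M\<^esub> y = \<zero>\<^bsub>M\<^esub> \<longrightarrow> b \<odot>\<^bsub>M\<^esub> y' = \<zero>\<^bsub>M\<^esub>) \<longrightarrow>
    (\<exists>r\<in>carrier R. y' = r \<odot>\<^bsub>M\<^esub> y))"

lemma simple_multiple_exists:
 fixes M (structure)
 assumes "artinian_cring R" and "module R M" and x: "x \<in> carrier M" and x0: "x \<noteq> \<zero>"
 shows "\<exists>a\<in>carrier R. simple_element R M (a \<odot> x)"
proof -
 interpret M: module R M by fact
 obtain a where "a \<in> carrier R" "a \<odot> x \<noteq> \<zero>"
  "\<forall>b\<in>carrier R. b \<odot> (a \<odot> x) \<noteq> \<zero> \<longrightarrow>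
    (\<exists>c\<in>carrier R. c \<odot> (b \<odot> (a \<odot> x)) = a \<odot> x)"
  using simple_over_submodule[OF assms(1,2) M.zero_submodule x] x0 unfolding singleton_iff by blast
 then show ?thesis using x by (intro bexI[of _ a]) (simp_all add: simple_element_def)
qed

text \<open>The bicommutant argument for a module with multiplicity-free socle.  Call \<open>L \<subseteq> N\<close> good if \<open>h\<close> is a
scalar on \<open>L\<close> and \<open>L\<close> is the annihilator in \<open>N\<close> of its annihilator in \<open>R\<close>.  Take \<open>L\<close> good with minimal
annihilator.  If \<open>L \<noteq> N\<close>, choose \<open>t \<in> N\<close> that is simple modulo \<open>L\<close> and \<open>s\<close> in the annihilator of \<open>L\<close> with
\<open>s t \<noteq> 0\<close>.  Then \<open>s t\<close> is a simple element, every element killed by \<open>{b. b t \<in> L}\<close> is a multiple of it,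
and correcting the scalar by a multiple of \<open>s\<close> makes it agree with \<open>h\<close> on \<open>L + R t\<close>, which is again good
and has a smaller annihilator.\<close>

lemma linear_on_submodule_is_scalar:
 fixes J (structure)
 assumes R: "artinian_cring R" and J: "module R J" and mfs: "multiplicity_free_socle R J"
  and N: "submodule N R J"
  and hc: "\<And>y. y \<in> N \<Longrightarrow> h y \<in> carrier J"
  and hadd: "\<And>x y. x \<in> N \<Longrightarrow> y \<in> N \<Longrightarrow> h (x \<oplus> y) = h x \<oplus> h y"
  and hsm: "\<And>r y. r \<in> carrier R \<Longrightarrow> y \<in> N \<Longrightarrow> h (r \<odot> y) = r \<odot> h y"
 shows "\<exists>r\<in>carrier R. \<forall>y\<in>N. h y = r \<odot> y"
proof -
 interpret artinian_cring R by fact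
 interpret J: module R J by fact
 note ND = J.submoduleD[OF N]
 define ann where "ann L = {r \<in> carrier R. \<forall>y\<in>L. r \<odot> y = \<zero>}" for L
 define sep where "sep L \<longleftrightarrow> (\<forall>x\<in>N - L. \<exists>r\<in>ann L. r \<odot> x \<noteq> \<zero>)" for L
 define good where "good L \<longleftrightarrow> submodule L R J \<and> L \<subseteq> N \<and> sep L \<and>
   (\<exists>r\<in>carrier R. \<forall>y\<in>L. h y = r \<odot> y)" for L
 have annR: "r \<in> carrier R" if "r \<in> ann L" for r L using that by (simp add: ann_def)
 have ann0: "r \<odot> y = \<zero>" if "r \<in> ann L" "y \<in> L" for r y L using that by (simp add: ann_def)
 have h0: "h \<zero> = \<zero>"
  using hsm[OF zero_closed ND(2)] hc[OF ND(2)] by simp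
 have good0: "good {\<zero>}"
 proof -
  have "\<exists>r\<in>ann {\<zero>}. r \<odot> x \<noteq> \<zero>" if "x \<in> N" "x \<noteq> \<zero>" for x
   using that ND(1) by (intro bexI[of _ "\<one>\<^bsub>R\<^esub>"]) (auto simp: ann_def)
  then show ?thesis
   unfolding good_def sep_def using J.zero_submodule ND(2) h0
   by (auto intro!: bexI[of _ "\<zero>\<^bsub>R\<^esub>"])
 qed
 have annid: "ideal (ann L) R" if "submodule L R J" for L
  using J.submoduleD(1)[OF that]
  by (intro ideal_criterion) (auto simp: ann_def J.smult_l_distr J.smult_assoc1)
 have "\<exists>A\<in>ann ` {L. good L}. \<forall>A'\<in>ann ` {L. good L}. A' \<subseteq> A \<longrightarrow> A' = A"
  by (rule minimal_ideal[of "ann {\<zero>}"]) (use good0 annid in \<open>auto simp: good_def\<close>)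
 then obtain L where gL: "good L" and min: "\<And>L'. good L' \<Longrightarrow> ann L' \<subseteq> ann L \<Longrightarrow> ann L' = ann L"
  by auto
 have L: "submodule L R J" "L \<subseteq> N" "sep L" using gL by (auto simp: good_def)
 note LD = J.submoduleD[OF L(1)]
 from gL obtain r where r: "r \<in> carrier R" "\<And>y. y \<in> L \<Longrightarrow> h y = r \<odot> y" by (auto simp: good_def)
 have "N \<subseteq> L"
 proof (rule ccontr)
  assume "\<not> N \<subseteq> L"
  then obtain x where x: "x \<in> N" "x \<notin> L" by blast
  obtain a where a: "a \<in> carrier R" "a \<odot> x \<notin> L"
   and simp_a: "\<forall>b\<in>carrier R. b \<odot> (a \<odot> x) \<notin> L \<longrightarrow>
    (\<exists>c\<in>carrier R. c \<odot> (b \<odot> (a \<odot> x)) = a \<odot> x)"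
   using simple_over_submodule[OF R J L(1) ND(1)[OF x(1)] x(2)] by (elim bexE conjE)
  define t where "t = a \<odot> x"
  have t: "t \<in> N" "t \<in> carrier J" "t \<notin> L" using a x ND by (auto simp: t_def)
  have tsim: "\<exists>c\<in>carrier R. c \<odot> (b \<odot> t) = t" if "b \<in> carrier R" "b \<odot> t \<notin> L" for b
   using simp_a that by (simp add: t_def)
  obtain s where s: "s \<in> ann L" "s \<odot> t \<noteq> \<zero>" using L(3) t by (auto simp: sep_def)
  have sR: "s \<in> carrier R" using s annR by auto
  have st: "s \<odot> t \<in> carrier J" using sR t by simp
  (* s t is a simple element with annihilator {b. b t \<in> L} *)
  have stann: "b \<odot> t \<in> L" if b: "b \<in> carrier R" "b \<odot> (s \<odot> t) = \<zero>" for b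
  proof (rule ccontr)
   assume "b \<odot> t \<notin> L"
   then obtain c where c: "c \<in> carrier R" "c \<odot> (b \<odot> t) = t" using tsim[OF b(1)] by blast
   have "s \<odot> t = c \<odot> (b \<odot> (s \<odot> t))"
    using c b(1) sR t(2) by (metis J.smult_closed J.smult_comm)
   then show False using b s(2) c by simp
  qed
  have key: "\<exists>d\<in>carrier R. y' = d \<odot> (s \<odot> t)"
   if y': "y' \<in> carrier J" and kill: "\<And>b. b \<in> carrier R \<Longrightarrow> b \<odot> t \<in> L \<Longrightarrow> b \<odot> y' = \<zero>" for y'
  proof -
   have "simple_element R J (s \<odot> t)"
    unfolding simple_element_def
   proof (intro conjI ballI impI)
    fix b assume b: "b \<in> carrier R" "b \<odot> (s \<odot> t) \<noteq> \<zero>"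
    have "b \<odot> t \<notin> L"
     using b ann0[OF s(1)] J.smult_comm[OF b(1) sR t(2)] by metis
    then obtain c where c: "c \<in> carrier R" "c \<odot> (b \<odot> t) = t" using tsim[OF b(1)] by blast
    then show "\<exists>c\<in>carrier R. c \<odot> (b \<odot> (s \<odot> t)) = s \<odot> t"
     using b(1) sR t(2) by (metis J.smult_closed J.smult_comm)
   qed (use s st in auto)
   then show ?thesis
    using mfs y' kill stann unfolding multiplicity_free_socle_def by blast
  qed
  \<comment> \<open>the larger submodule that contradicts minimality of the annihilator\<close>
  define L' where "L' = adjoin R J L t"
  have L'I: "l \<oplus> b \<odot> t \<in> L'" if "l \<in> L" "b \<in> carrier R" for l b
   using that by (auto simp: L'_def adjoin_def)
  note L'm = J.adjoin[OF L(1) t(2), folded L'_def]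
  note LL' = subsetD[OF L'm(2)] and tL' = L'm(3) and subL' = L'm(1)
  have L'N: "L' \<subseteq> N" using L(2) t(1) ND by (auto simp: L'_def adjoin_def)
  have annL': "u \<in> ann L'" if u: "u \<in> ann L" "u \<odot> t = \<zero>" for u
  proof -
   have "u \<odot> (l \<oplus> b \<odot> t) = \<zero>" if "l \<in> L" "b \<in> carrier R" for l b
    using that u annR[OF u(1)] ann0[OF u(1)] LD(1) t(2) J.smult_comm[of u b t]
    by (simp add: J.smult_r_distr)
   then show ?thesis using annR[OF u(1)] by (auto simp: ann_def L'_def adjoin_def)
  qed
  have hL': "\<exists>r\<in>carrier R. \<forall>y\<in>L'. h y = r \<odot> y"
  proof -
   have ht: "h t \<in> carrier J" using hc t by auto
   obtain d where d: "d \<in> carrier R" "h t \<ominus> r \<odot> t = d \<odot> (s \<odot> t)"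
   proof (rule bexE[OF key])
    show "h t \<ominus> r \<odot> t \<in> carrier J" using ht r t by simp
    fix b assume b: "b \<in> carrier R" "b \<odot> t \<in> L"
    have "b \<odot> (h t \<ominus> r \<odot> t) = h (b \<odot> t) \<ominus> r \<odot> (b \<odot> t)"
     using b r t ht hsm[OF b(1) t(1)] by (simp add: J.smult_minus_right J.smult_comm)
    also have "\<dots> = \<zero>" using r(2)[OF b(2)] hc[of "b \<odot> t"] b L(2) J.minus_zero_iff
     by (metis subsetD)
    finally show "b \<odot> (h t \<ominus> r \<odot> t) = \<zero>" .
   qed (erule (1) that)
   let ?q = "r \<oplus>\<^bsub>R\<^esub> d \<otimes>\<^bsub>R\<^esub> s"
   have ht': "h t = ?q \<odot> t"
   proof -
    have "h t = (h t \<ominus> r \<odot> t) \<oplus> r \<odot> t" using J.minus_add_cancel ht r t by simp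
    also have "\<dots> = d \<odot> (s \<odot> t) \<oplus> r \<odot> t" using d by simp
    also have "\<dots> = ?q \<odot> t"
     using d sR r t by (simp add: J.smult_l_distr J.smult_assoc1 J.M.a_comm)
    finally show ?thesis .
   qed
   have "h (l \<oplus> b \<odot> t) = ?q \<odot> (l \<oplus> b \<odot> t)" if l: "l \<in> L" and b: "b \<in> carrier R" for l b
   proof -
    have lN: "l \<in> N" "l \<in> carrier J" using l L(2) LD(1) by auto
    have "h (l \<oplus> b \<odot> t) = r \<odot> l \<oplus> b \<odot> (?q \<odot> t)"
     using hadd[OF lN(1) ND(4)[OF b t(1)]] r(2)[OF l] hsm[OF b t(1)] ht' by simp
    also have "b \<odot> (?q \<odot> t) = ?q \<odot> (b \<odot> t)"
     using b d sR r t by (intro J.smult_comm) auto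
    also have "r \<odot> l = ?q \<odot> l"
     using d sR r lN ann0[OF s(1) l] by (simp add: J.smult_l_distr J.smult_assoc1)
    finally show ?thesis using lN b d sR r t by (simp add: J.smult_r_distr)
   qed
   then show ?thesis using r d sR by (intro bexI[of _ ?q]) (auto simp: L'_def adjoin_def)
  qed
  have sepL': "sep L'"
   unfolding sep_def
  proof (rule ballI, rule ccontr)
   fix x assume x: "x \<in> N - L'" and "\<not> (\<exists>r\<in>ann L'. r \<odot> x \<noteq> \<zero>)"
   then have all: "u \<odot> x = \<zero>" if "u \<in> ann L" "u \<odot> t = \<zero>" for u
    using annL'[OF that] by blast
   have xJ: "x \<in> carrier J" using x ND by auto
   have mult_ann: "q \<otimes>\<^bsub>R\<^esub> u \<in> ann L" if "q \<in> carrier R" "u \<in> ann L" for q u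
    using that annid[OF L(1)] by (simp add: ideal.I_l_closed)
   obtain d where d: "d \<in> carrier R" "s \<odot> x = d \<odot> (s \<odot> t)"
   proof (rule bexE[OF key])
    show "s \<odot> x \<in> carrier J" using sR xJ by simp
    fix b assume b: "b \<in> carrier R" "b \<odot> t \<in> L"
    have "(b \<otimes>\<^bsub>R\<^esub> s) \<odot> t = \<zero>"
     using ann0[OF s(1) b(2)] b(1) sR t(2) by (simp add: J.smult_assoc1 J.smult_comm)
    then show "b \<odot> (s \<odot> x) = \<zero>"
     using all[OF mult_ann[OF b(1) s(1)]] b(1) sR xJ by (simp add: J.smult_assoc1)
   qed (erule (1) that)
   define x0 where "x0 = x \<ominus> d \<odot> t"
   have x0: "x0 \<in> N" "x0 \<in> carrier J" using x d t ND by (auto simp: x0_def)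
   have "x0 \<notin> L"
   proof
    assume "x0 \<in> L"
    then have "x0 \<oplus> d \<odot> t \<in> L'" using L'I d by blast
    then show False using x xJ d t J.minus_add_cancel by (simp add: x0_def)
   qed
   then obtain u where u: "u \<in> ann L" "u \<odot> x0 \<noteq> \<zero>" using L(3) x0 by (auto simp: sep_def)
   have uR: "u \<in> carrier R" using u annR by auto
   obtain e where e: "e \<in> carrier R" "u \<odot> t = e \<odot> (s \<odot> t)"
   proof (rule bexE[OF key])
    show "u \<odot> t \<in> carrier J" using uR t by simp
    show "b \<odot> (u \<odot> t) = \<zero>" if b: "b \<in> carrier R" "b \<odot> t \<in> L" for b
     using ann0[OF u(1) b(2)] b(1) uR t(2) by (simp add: J.smult_comm)
   qed (erule (1) that)
   let ?v = "u \<ominus>\<^bsub>R\<^esub> e \<otimes>\<^bsub>R\<^esub> s"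
   have vL: "?v \<in> ann L"
    using ann0[OF u(1)] ann0[OF s(1)] uR e(1) sR LD(1)
    by (auto simp: ann_def J.smult_diff J.smult_assoc1 J.minus_zero_iff)
   have "?v \<odot> t = \<zero>"
    using uR e sR t by (simp add: J.smult_diff J.smult_assoc1 J.minus_zero_iff)
   then have "?v \<odot> x = \<zero>" by (rule all[OF vL])
   then have "u \<odot> x = e \<odot> (s \<odot> x)"
    using uR e sR xJ by (simp add: J.smult_diff J.smult_assoc1 J.minus_zero_iff)
   also have "\<dots> = d \<odot> (u \<odot> t)" using d e sR t by (simp add: J.smult_comm)
   also have "\<dots> = u \<odot> (d \<odot> t)" using d uR t by (simp add: J.smult_comm)
   finally have "u \<odot> x0 = \<zero>"
    using uR xJ d t by (simp add: x0_def J.smult_minus_right J.minus_zero_iff)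
   then show False using u by simp
  qed
  have "good L'" using subL' L'N sepL' hL' by (simp add: good_def)
  moreover have "ann L' \<subseteq> ann L" using LL' by (auto simp: ann_def)
  ultimately have "ann L' = ann L" by (rule min)
  then have "s \<in> ann L'" using s(1) by simp
  then show False using ann0[OF _ tL'] s(2) by simp
 qed
 then have "\<forall>y\<in>N. h y = r \<odot> y" by (intro ballI r(2)) (rule subsetD)
 then show ?thesis by (rule bexI[OF _ r(1)])
qed

section \<open>Injective modules and cogenerators\<close>

lemma (in module) singleton_coset: "x \<in> carrier M \<Longrightarrow> {\<zero>\<^bsub>M\<^esub>} +>\<^bsub>M\<^esub> x = {x}"
 by (simp add: a_r_coset_def')

text \<open>The quotient by zero is a copy of \<open>M\<close> on singletons.  It moves modules on the type of ring elements into
the type over which the test modules of injectivity range.\<close>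

lemma (in module) singleton_quotient:
 defines "S \<equiv> quotient_module M {\<zero>\<^bsub>M\<^esub>}"
 shows "carrier S = {{x} | x. x \<in> carrier M}"
  and "x \<in> carrier M \<Longrightarrow> y \<in> carrier M \<Longrightarrow> {x} \<oplus>\<^bsub>S\<^esub> {y} = {x \<oplus>\<^bsub>M\<^esub> y}"
  and "r \<in> carrier R \<Longrightarrow> x \<in> carrier M \<Longrightarrow> r \<odot>\<^bsub>S\<^esub> {x} = {r \<odot>\<^bsub>M\<^esub> x}"
  and "module R S"
proof -
 note z = zero_submodule
 show "carrier S = {{x} | x. x \<in> carrier M}"
  unfolding S_def quotient_carrier using singleton_coset by (metis (no_types, lifting))
 show "{x} \<oplus>\<^bsub>S\<^esub> {y} = {x \<oplus>\<^bsub>M\<^esub> y}" if "x \<in> carrier M" "y \<in> carrier M"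
  using quotient_add[OF z that] that by (simp add: singleton_coset S_def)
 show "r \<odot>\<^bsub>S\<^esub> {x} = {r \<odot>\<^bsub>M\<^esub> x}" if "r \<in> carrier R" "x \<in> carrier M"
  using quotient_smult[OF z that(2,1)] that by (simp add: singleton_coset S_def)
 show "module R S" unfolding S_def by (rule quotient_module[OF z])
qed

text \<open>The test condition of Baer's criterion, transported along singletons.\<close>

lemma injective_module_ideal_extension:
 fixes R (structure)
 assumes "cring R" and inj: "injective_module R J" and I: "ideal I R"
  and gc: "\<And>a. a \<in> I \<Longrightarrow> g a \<in> carrier J"
  and gadd: "\<And>a b. a \<in> I \<Longrightarrow> b \<in> I \<Longrightarrow> g (a \<oplus> b) = g a \<oplus>\<^bsub>J\<^esub> g b"
  and gsm: "\<And>r a. r \<in> carrier R \<Longrightarrow> a \<in> I \<Longrightarrow> g (r \<otimes> a) = r \<odot>\<^bsub>J\<^esub> g a"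
 shows "\<exists>z\<in>carrier J. \<forall>a\<in>I. g a = a \<odot>\<^bsub>J\<^esub> z"
proof -
 interpret cring R by fact
 let ?K = "regular_module R"
 let ?KI = "(regular_module R)\<lparr>carrier := I\<rparr>"
 interpret K: module R ?K by (rule regular_module)
 interpret KI: module R ?KI
  by (rule submodule.submodule_is_module[OF ideal_submodule[OF I] regular_module])
 let ?S = "quotient_module ?K {\<zero>\<^bsub>?K\<^esub>}"
 let ?SI = "quotient_module ?KI {\<zero>\<^bsub>?KI\<^esub>}"
 note S = K.singleton_quotient and SI = KI.singleton_quotient
 have IR: "a \<in> carrier R" if "a \<in> I" for a using ideal.Icarr[OF I that] .
 have Ia: "a \<oplus> b \<in> I" if "a \<in> I" "b \<in> I" for a b
  using additive_subgroup.a_closed[OF ideal.axioms(1)[OF I] that] .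
 have Il: "r \<otimes> a \<in> I" if "r \<in> carrier R" "a \<in> I" for r a
  using ideal.I_l_closed[OF I that(2,1)] .
 have mem: "X \<in> carrier ?SI \<longleftrightarrow> (\<exists>a\<in>I. X = {a})" for X
  unfolding SI(1) by auto
 have i: "linear_map R ?SI ?S (\<lambda>X. X)"
 proof (rule linear_mapI)
  show "X \<in> carrier ?S" if "X \<in> carrier ?SI" for X
   using that IR unfolding mem S(1) by auto
  show "X \<oplus>\<^bsub>?SI\<^esub> Y = X \<oplus>\<^bsub>?S\<^esub> Y" if XY: "X \<in> carrier ?SI" "Y \<in> carrier ?SI" for X Y
  proof -
   obtain a b where "a \<in> I" "X = {a}" "b \<in> I" "Y = {b}" using XY unfolding mem by blast
   then show ?thesis using S(2)[of a b] SI(2)[of a b] IR by simp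
  qed
  show "r \<odot>\<^bsub>?SI\<^esub> X = r \<odot>\<^bsub>?S\<^esub> X" if rX: "r \<in> carrier R" "X \<in> carrier ?SI" for r X
  proof -
   obtain a where "a \<in> I" "X = {a}" using rX unfolding mem by blast
   then show ?thesis using S(3)[of r a] SI(3)[of r a] IR rX(1) by simp
  qed
 qed
 have g: "linear_map R ?SI J (\<lambda>X. g (the_elem X))"
 proof (rule linear_mapI)
  show "g (the_elem X) \<in> carrier J" if "X \<in> carrier ?SI" for X
   using that gc unfolding mem by auto
  show "g (the_elem (X \<oplus>\<^bsub>?SI\<^esub> Y)) = g (the_elem X) \<oplus>\<^bsub>J\<^esub> g (the_elem Y)"
   if XY: "X \<in> carrier ?SI" "Y \<in> carrier ?SI" for X Y
  proof -
   obtain a b where "a \<in> I" "X = {a}" "b \<in> I" "Y = {b}" using XY unfolding mem by blast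
   then show ?thesis using SI(2)[of a b] gadd[of a b] by simp
  qed
  show "g (the_elem (r \<odot>\<^bsub>?SI\<^esub> X)) = r \<odot>\<^bsub>J\<^esub> g (the_elem X)"
   if rX: "r \<in> carrier R" "X \<in> carrier ?SI" for r X
  proof -
   obtain a where "a \<in> I" "X = {a}" using rX unfolding mem by blast
   then show ?thesis using SI(3)[of r a] gsm[of r a] rX(1) by simp
  qed
 qed
 have "\<exists>h. linear_map R ?S J h \<and> (\<forall>X\<in>carrier ?SI. h X = g (the_elem X))"
  using inj unfolding injective_module_def
  using S(4) SI(4) i g inj_on_id2 by blast
 then obtain h where h: "linear_map R ?S J h" "\<And>X. X \<in> carrier ?SI \<Longrightarrow> h X = g (the_elem X)"
  by blast
 have one: "{\<one>} \<in> carrier ?S" unfolding S(1) by auto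
 have "g a = a \<odot>\<^bsub>J\<^esub> h {\<one>}" if a: "a \<in> I" for a
 proof -
  have "g a = h {a}" using h(2)[of "{a}"] a unfolding mem by simp
  also have "{a} = a \<odot>\<^bsub>?S\<^esub> {\<one>}" using S(3)[of a \<one>] IR[OF a] by simp
  also have "h \<dots> = a \<odot>\<^bsub>J\<^esub> h {\<one>}" by (rule linear_mapD(3)[OF h(1) IR[OF a] one])
  finally show ?thesis .
 qed
 then show ?thesis using linear_mapD(1)[OF h(1) one] by blast
qed

text \<open>Products serve as a home for graphs of partially defined linear maps, so that the
extension of linear maps becomes a maximality argument for submodules.\<close>

definition prod_module :: "('k, 'a, 'x) module_scheme \<Rightarrow> ('k, 'b, 'y) module_scheme \<Rightarrow> ('k, 'a \<times> 'b) module" where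
 "prod_module M N = \<lparr> carrier = carrier M \<times> carrier N, mult = undefined, one = undefined, zero = (\<zero>\<^bsub>M\<^esub>, \<zero>\<^bsub>N\<^esub>),
   add = (\<lambda>p q. (fst p \<oplus>\<^bsub>M\<^esub> fst q, snd p \<oplus>\<^bsub>N\<^esub> snd q)), smult = (\<lambda>r p. (r \<odot>\<^bsub>M\<^esub> fst p, r \<odot>\<^bsub>N\<^esub> snd p)) \<rparr>"

lemma prod_module_simps [simp]:
 "carrier (prod_module M N) = carrier M \<times> carrier N" "zero (prod_module M N) = (\<zero>\<^bsub>M\<^esub>, \<zero>\<^bsub>N\<^esub>)"
 "add (prod_module M N) p q = (fst p \<oplus>\<^bsub>M\<^esub> fst q, snd p \<oplus>\<^bsub>N\<^esub> snd q)"
 "smult (prod_module M N) r p = (r \<odot>\<^bsub>M\<^esub> fst p, r \<odot>\<^bsub>N\<^esub> snd p)"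
 by (simp_all add: prod_module_def)

lemma prod_module:
 assumes "module R M" and "module R N"
 shows "module R (prod_module M N)"
proof -
 interpret M: module R M by fact
 interpret N: module R N by fact
 show ?thesis
 proof (rule moduleI[OF M.R.cring_axioms])
  show "abelian_group (prod_module M N)"
  proof (rule abelian_groupI)
   fix p assume "p \<in> carrier (prod_module M N)"
   then show "\<exists>q\<in>carrier (prod_module M N). q \<oplus>\<^bsub>prod_module M N\<^esub> p = \<zero>\<^bsub>prod_module M N\<^esub>"
    by (intro bexI[of _ "(\<ominus>\<^bsub>M\<^esub> fst p, \<ominus>\<^bsub>N\<^esub> snd p)"]) (auto simp: M.M.l_neg N.M.l_neg)
  qed (auto simp: M.M.a_ac N.M.a_ac)
 qed (auto simp: M.smult_l_distr N.smult_l_distr M.smult_r_distr N.smult_r_distr M.smult_assoc1 N.smult_assoc1)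
qed

text \<open>Baer's criterion for test modules of arbitrary type: a linear map that is given on a submodule by
its graph \<open>G\<close> extends to \<open>M\<close>.  Let \<open>H \<supseteq> G\<close> be maximal among the graphs.  For \<open>x\<close> outside the domain, the map
\<open>a \<mapsto> H(a x)\<close> on the ideal \<open>{a. a x \<in> dom H}\<close> is multiplication by some \<open>z\<close>, so \<open>(x, z)\<close> can be adjoined to \<open>H\<close>.\<close>

lemma linear_extension:
 fixes M (structure)
 assumes M: "module R M" and inj: "injective_module R J" and G: "submodule G R (prod_module M J)"
  and G0: "\<And>w. (\<zero>, w) \<in> G \<Longrightarrow> w = \<zero>\<^bsub>J\<^esub>"
 shows "\<exists>h. linear_map R M J h \<and> (\<forall>v w. (v, w) \<in> G \<longrightarrow> h v = w)"
proof -
 interpret M: module R M by fact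
 have J: "module R J" using inj by (simp add: injective_module_def)
 interpret J: module R J by fact
 interpret P: module R "prod_module M J" by (rule prod_module[OF M J])
 let ?S = "{p. fst p = \<zero> \<and> snd p \<noteq> \<zero>\<^bsub>J\<^esub>}"
 have "G \<inter> ?S = {}" using G0 by auto
 from P.maximal_submodule[OF G this] obtain H where H: "submodule H R (prod_module M J)" and GH: "G \<subseteq> H" and HS: "H \<inter> ?S = {}"
  and max: "\<forall>p\<in>carrier M \<times> carrier J. p \<notin> H \<longrightarrow> (\<exists>q\<in>H. \<exists>c\<in>carrier R. q \<oplus>\<^bsub>prod_module M J\<^esub> c \<odot>\<^bsub>prod_module M J\<^esub> p \<in> ?S)"
  unfolding prod_module_simps(1) by (elim exE conjE)
 note HD = P.submoduleD[OF H]
 have D: "v \<in> carrier M" "w \<in> carrier J" if "(v, w) \<in> H" for v w using HD(1)[OF that] by simp_all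
 have Da: "(v \<oplus> v', w \<oplus>\<^bsub>J\<^esub> w') \<in> H" if "(v, w) \<in> H" "(v', w') \<in> H" for v w v' w' using HD(3)[OF that] by simp
 have Ds: "(r \<odot> v, r \<odot>\<^bsub>J\<^esub> w) \<in> H" if "r \<in> carrier R" "(v, w) \<in> H" for r v w using HD(4)[OF that] by simp
 have D0: "w = \<zero>\<^bsub>J\<^esub>" if "(\<zero>, w) \<in> H" for w using that HS by auto
 have fn: "w = w'" if "(v, w) \<in> H" "(v, w') \<in> H" for v w w'
 proof -
  have "(\<zero>, w \<ominus>\<^bsub>J\<^esub> w') \<in> H" using Da[OF that(1) Ds[OF _ that(2), of "\<ominus>\<^bsub>R\<^esub> \<one>\<^bsub>R\<^esub>"]] D[OF that(1)] D[OF that(2)]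
   by (simp add: M.smult_l_minus J.smult_l_minus M.M.r_neg J.M.minus_eq)
  then show ?thesis using D0 J.minus_zero_iff D(2) that by blast
 qed
 have total: "\<exists>w. (x, w) \<in> H" if x: "x \<in> carrier M" for x
 proof (rule ccontr)
  assume nx: "\<nexists>w. (x, w) \<in> H"
  define I where "I = {a \<in> carrier R. \<exists>w. (a \<odot> x, w) \<in> H}"
  define g where "g a = (THE w. (a \<odot> x, w) \<in> H)" for a
  have ga: "g a = w" if "(a \<odot> x, w) \<in> H" for a w
   unfolding g_def using that fn by (intro the_equality) auto
  have gH: "(a \<odot> x, g a) \<in> H" if "a \<in> I" for a using that ga by (auto simp: I_def)
  have IR: "a \<in> carrier R" if "a \<in> I" for a using that by (simp add: I_def)
  have sumH: "((a \<oplus>\<^bsub>R\<^esub> b) \<odot> x, g a \<oplus>\<^bsub>J\<^esub> g b) \<in> H" if "a \<in> I" "b \<in> I" for a b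
   using Da[OF gH[OF that(1)] gH[OF that(2)]] IR that x by (simp add: M.smult_l_distr)
  have smH: "((r \<otimes>\<^bsub>R\<^esub> a) \<odot> x, r \<odot>\<^bsub>J\<^esub> g a) \<in> H" if "r \<in> carrier R" "a \<in> I" for r a
   using Ds[OF that(1) gH[OF that(2)]] IR that x by (simp add: M.smult_assoc1)
  have Iid: "ideal I R"
  proof (rule M.R.ideal_criterion)
   show "\<zero>\<^bsub>R\<^esub> \<in> I" using HD(2) x by (auto simp: I_def)
   show "a \<oplus>\<^bsub>R\<^esub> b \<in> I" if "a \<in> I" "b \<in> I" for a b using sumH[OF that] IR that unfolding I_def by blast
   show "r \<otimes>\<^bsub>R\<^esub> a \<in> I" if "a \<in> I" "r \<in> carrier R" for r a using smH[OF that(2,1)] IR that unfolding I_def by blast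
  qed (use IR in auto)
  have "\<exists>z\<in>carrier J. \<forall>a\<in>I. g a = a \<odot>\<^bsub>J\<^esub> z"
   by (rule injective_module_ideal_extension[OF M.R.cring_axioms inj Iid])
    (use gH D(2) ga[OF sumH] ga[OF smH] in blast)+
  then obtain z where z: "z \<in> carrier J" "\<And>a. a \<in> I \<Longrightarrow> g a = a \<odot>\<^bsub>J\<^esub> z" by blast
  have "\<exists>q\<in>H. \<exists>c\<in>carrier R. q \<oplus>\<^bsub>prod_module M J\<^esub> c \<odot>\<^bsub>prod_module M J\<^esub> (x, z) \<in> ?S"
   using bspec[OF max, of "(x, z)"] x z(1) nx by blast
  then obtain v w c where c: "(v, w) \<in> H" "c \<in> carrier R" "v \<oplus> c \<odot> x = \<zero>" "w \<oplus>\<^bsub>J\<^esub> c \<odot>\<^bsub>J\<^esub> z \<noteq> \<zero>\<^bsub>J\<^esub>"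
   by auto
  have "c \<odot> x = (\<ominus>\<^bsub>R\<^esub> \<one>\<^bsub>R\<^esub>) \<odot> v"
   using c D[OF c(1)] x by (simp add: M.smult_l_minus) (metis M.M.minus_equality M.M.a_comm M.smult_closed)
  then have cI: "c \<in> I" using Ds[OF _ c(1), of "\<ominus>\<^bsub>R\<^esub> \<one>\<^bsub>R\<^esub>"] c(2) unfolding I_def by auto
  show False using Da[OF c(1) gH[OF cI]] c(3,4) z(2)[OF cI] D0 by simp
 qed
 define h where "h v = (THE w. (v, w) \<in> H)" for v
 have hw: "h v = w" if "(v, w) \<in> H" for v w unfolding h_def using that fn by (intro the_equality) auto
 have hH: "(v, h v) \<in> H" if "v \<in> carrier M" for v using total[OF that] hw by auto
 have "linear_map R M J h"
  by (rule linear_mapI) (use D(2)[OF hH] hw[OF Da[OF hH hH]] hw[OF Ds[OF _ hH]] in blast)+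
 then show ?thesis using hw GH by blast
qed

text \<open>Prescribing a functional on \<open>N + R x\<close> by \<open>N \<mapsto> 0\<close> and \<open>x \<mapsto> z\<close> is consistent under the stated condition.\<close>

lemma functional_extension:
 fixes M (structure)
 assumes M: "module R M" and inj: "injective_module R J" and N: "submodule N R M"
  and x: "x \<in> carrier M" and z: "z \<in> carrier J"
  and ann: "\<And>a. a \<in> carrier R \<Longrightarrow> a \<odot> x \<in> N \<Longrightarrow> a \<odot>\<^bsub>J\<^esub> z = \<zero>\<^bsub>J\<^esub>"
 shows "\<exists>h. linear_map R M J h \<and> (\<forall>n\<in>N. h n = \<zero>\<^bsub>J\<^esub>) \<and> h x = z"
proof -
 interpret M: module R M by fact
 have J: "module R J" using inj by (simp add: injective_module_def)
 interpret J: module R J by fact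
 interpret P: module R "prod_module M J" by (rule prod_module[OF M J])
 note ND = M.submoduleD[OF N]
 have N0: "submodule (N \<times> {\<zero>\<^bsub>J\<^esub>}) R (prod_module M J)"
  by (rule P.submodule_criterion) (use ND in auto)
 have xz: "(x, z) \<in> carrier (prod_module M J)" using x z by simp
 note G = P.adjoin[OF N0 xz]
 have "w = \<zero>\<^bsub>J\<^esub>" if w: "(\<zero>, w) \<in> adjoin R (prod_module M J) (N \<times> {\<zero>\<^bsub>J\<^esub>}) (x, z)" for w
 proof -
  obtain n c where c: "n \<in> N" "c \<in> carrier R" "n \<oplus> c \<odot> x = \<zero>" "w = c \<odot>\<^bsub>J\<^esub> z"
   using w z by (auto simp: adjoin_def)
  have "c \<odot> x = (\<ominus>\<^bsub>R\<^esub> \<one>\<^bsub>R\<^esub>) \<odot> n"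
   using c ND(1)[OF c(1)] x by (simp add: M.smult_l_minus) (metis M.M.minus_equality M.M.a_comm M.smult_closed)
  then have "c \<odot> x \<in> N" using ND(4)[OF _ c(1), of "\<ominus>\<^bsub>R\<^esub> \<one>\<^bsub>R\<^esub>"] by simp
  then show ?thesis using ann[OF c(2)] c(4) by simp
 qed
 from linear_extension[OF M inj G(1) this]
 show ?thesis using G(2,3) by blast
qed

text \<open>The cogenerator property is applied to the cyclic module \<open>R/ann(x)\<close>; its functional is then extended
from \<open>R x\<close> to \<open>M\<close>.\<close>

lemma nonzero_functional:
 fixes J (structure)
 assumes M: "module R M" and inj: "injective_module R J" and cog: "cogenerator R J"
  and x: "x \<in> carrier M" and x0: "x \<noteq> \<zero>\<^bsub>M\<^esub>"
 shows "\<exists>\<phi>. linear_map R M J \<phi> \<and> \<phi> x \<noteq> \<zero>"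
proof -
 interpret M: module R M by fact
 have J: "module R J" using inj by (simp add: injective_module_def)
 interpret J: module R J by fact
 let ?K = "regular_module R"
 interpret K: module R ?K by (rule M.R.regular_module)
 define I where "I = {a \<in> carrier R. a \<odot>\<^bsub>M\<^esub> x \<in> {\<zero>\<^bsub>M\<^esub>}}"
 have I: "submodule I R ?K"
  unfolding I_def by (rule M.R.ideal_submodule[OF M.colon_ideal[OF M.zero_submodule x]])
 let ?Q = "quotient_module ?K I"
 have Q: "module R ?Q" by (rule K.quotient_module[OF I])
 interpret Q: module R ?Q by (rule Q)
 let ?u = "I +>\<^bsub>?K\<^esub> \<one>\<^bsub>R\<^esub>"
 have u: "?u \<in> carrier ?Q" unfolding K.quotient_carrier by auto
 have "?u \<noteq> \<zero>\<^bsub>?Q\<^esub>"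
 proof
  assume "?u = \<zero>\<^bsub>?Q\<^esub>"
  then have "\<one>\<^bsub>R\<^esub> \<in> I"
   using K.M.a_coset_join1[of I "\<one>\<^bsub>R\<^esub>"] I by (simp add: K.quotient_zero submodule_def)
  then show False using x x0 by (simp add: I_def)
 qed
 moreover have "linear_map R ?Q ?Q (\<lambda>X. X)" by (rule linear_mapI) auto
 moreover have "linear_map R ?Q ?Q (\<lambda>X. \<zero>\<^bsub>?Q\<^esub>)" by (rule linear_mapI) auto
 ultimately have "\<exists>h. linear_map R ?Q J h \<and> (\<exists>X\<in>carrier ?Q. h X \<noteq> h \<zero>\<^bsub>?Q\<^esub>)"
  using cog Q u unfolding cogenerator_def by meson
 then obtain h X where h: "linear_map R ?Q J h" and X: "X \<in> carrier ?Q" "h X \<noteq> h \<zero>\<^bsub>?Q\<^esub>" by blast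
 define z where "z = h ?u"
 have zJ: "z \<in> carrier J" unfolding z_def by (rule linear_mapD(1)[OF h u])
 have az: "h (I +>\<^bsub>?K\<^esub> a) = a \<odot> z" if a: "a \<in> carrier R" for a
 proof -
  have "I +>\<^bsub>?K\<^esub> a = a \<odot>\<^bsub>?Q\<^esub> ?u"
   using K.quotient_smult[OF I, of "\<one>\<^bsub>R\<^esub>" a] a by simp
  then show ?thesis using linear_mapD(3)[OF h a u] by (simp add: z_def)
 qed
 have h0: "h \<zero>\<^bsub>?Q\<^esub> = \<zero>" by (rule linear_map_zero[OF Q J h])
 have z0: "z \<noteq> \<zero>"
 proof
  assume "z = \<zero>"
  obtain a where "a \<in> carrier R" "X = I +>\<^bsub>?K\<^esub> a" using X(1) unfolding K.quotient_carrier by auto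
  then show False using az X(2) h0 \<open>z = \<zero>\<close> by simp
 qed
 have kill: "a \<odot> z = \<zero>" if a: "a \<in> carrier R" "a \<odot>\<^bsub>M\<^esub> x = \<zero>\<^bsub>M\<^esub>" for a
 proof -
  have "a \<in> I" using a by (simp add: I_def)
  then have "I +>\<^bsub>?K\<^esub> a = \<zero>\<^bsub>?Q\<^esub>"
   using K.M.a_coset_join2[of a I] I a(1) by (simp add: K.quotient_zero submodule_def)
  then show ?thesis using az[OF a(1)] h0 by simp
 qed
 obtain \<phi> where "linear_map R M J \<phi>" "\<phi> x = z"
  using functional_extension[OF M inj M.zero_submodule x zJ] kill by auto
 then show ?thesis using z0 by blast
qed

lemma linear_map_restrict_codomain:
 assumes "N \<subseteq> carrier J"
 shows "linear_map R M (J\<lparr>carrier := N\<rparr>) g \<longleftrightarrow> linear_map R M J g \<and> (\<forall>x\<in>carrier M. g x \<in> N)"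
 using assms by (auto simp: linear_map_def Pi_iff)

lemma injective_module_retract:
 fixes R (structure)
 assumes inj: "injective_module R J" and N: "submodule N R J"
  and p: "linear_map R J J p" and pN: "\<And>x. x \<in> carrier J \<Longrightarrow> p x \<in> N" and pid: "\<And>x. x \<in> N \<Longrightarrow> p x = x"
 shows "injective_module R (J\<lparr>carrier := N\<rparr>)"
proof -
 have J: "module R J" using inj by (simp add: injective_module_def)
 interpret J: module R J by fact
 have NJ: "N \<subseteq> carrier J" using J.submoduleD(1)[OF N] by blast
 note cod = linear_map_restrict_codomain[OF NJ]
 show ?thesis
  unfolding injective_module_def
 proof (intro conjI allI impI)
  show "module R (J\<lparr>carrier := N\<rparr>)" by (rule submodule.submodule_is_module[OF N J])
  fix A B :: "('a, 'a set) module" and i g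
  assume h: "module R A \<and> module R B \<and> linear_map R A B i \<and> inj_on i (carrier A) \<and> linear_map R A (J\<lparr>carrier := N\<rparr>) g"
  then have g: "linear_map R A J g" "\<And>x. x \<in> carrier A \<Longrightarrow> g x \<in> N" by (auto simp: cod)
  have "\<exists>h. linear_map R B J h \<and> (\<forall>x\<in>carrier A. h (i x) = g x)"
   using inj h g(1) unfolding injective_module_def by blast
  then obtain h where h': "linear_map R B J h" "\<And>x. x \<in> carrier A \<Longrightarrow> h (i x) = g x" by blast
  have "linear_map R B (J\<lparr>carrier := N\<rparr>) (\<lambda>x. p (h x))"
   unfolding cod using linear_map_comp[OF h'(1) p] pN linear_mapD(1)[OF h'(1)] by blast
  moreover have "p (h (i x)) = g x" if "x \<in> carrier A" for x using h'(2)[OF that] pid g(2)[OF that] by simp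
  ultimately show "\<exists>h. linear_map R B (J\<lparr>carrier := N\<rparr>) h \<and> (\<forall>x\<in>carrier A. h (i x) = g x)" by blast
 qed
qed

text \<open>Otherwise there are two independent copies \<open>R y\<close>, \<open>R y'\<close> of a simple module in the socle, and a proper
submodule \<open>N\<close> of \<open>J\<close> is again an injective cogenerator.  Let \<open>N\<close> be maximal with \<open>y \<in> N\<close> and \<open>y' \<notin> N\<close>.  A proper
essential extension of \<open>N\<close> in \<open>J\<close> would contain \<open>y'\<close>, hence a nonzero multiple of \<open>y'\<close> would lie in \<open>N\<close>; so
there is none, and \<open>N\<close> is a direct summand of \<open>J\<close>.  A simple element that is lost under the projection to \<open>N\<close>
is of the type of \<open>y'\<close>, so it can be sent to \<open>y \<in> N\<close> instead.\<close>

lemma minimal_injective_cogenerator_socle: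
 fixes J (structure)
 assumes R: "artinian_cring R" and mic: "minimal_injective_cogenerator R J"
 shows "multiplicity_free_socle R J"
proof (rule ccontr)
 interpret artinian_cring R by fact
 have inj: "injective_module R J" and cog: "cogenerator R J"
  using mic by (simp_all add: minimal_injective_cogenerator_def)
 have J: "module R J" using inj by (simp add: injective_module_def)
 interpret J: module R J by fact
 assume "\<not> multiplicity_free_socle R J"
 then obtain y y' where ys: "simple_element R J y" and y': "y' \<in> carrier J"
  and annyy: "\<forall>b\<in>carrier R. b \<odot> y = \<zero> \<longrightarrow> b \<odot> y' = \<zero>"
  and ny: "\<not> (\<exists>r\<in>carrier R. y' = r \<odot> y)"
  unfolding multiplicity_free_socle_def by blast
 have y: "y \<in> carrier J" "y \<noteq> \<zero>" using ys by (auto simp: simple_element_def)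
 have ysim: "\<exists>c\<in>carrier R. c \<odot> (b \<odot> y) = y" if "b \<in> carrier R" "b \<odot> y \<noteq> \<zero>" for b
  using ys that by (auto simp: simple_element_def)
 have y'0: "y' \<noteq> \<zero>"
 proof
  assume "y' = \<zero>"
  then have "y' = \<zero>\<^bsub>R\<^esub> \<odot> y" using y by simp
  then show False using ny zero_closed by blast
 qed
 (* y and y' are both killed exactly by the same maximal ideal *)
 have y'sim: "\<exists>c\<in>carrier R. c \<odot> (b \<odot> y) = y \<and> c \<odot> (b \<odot> y') = y'"
  if b: "b \<in> carrier R" "b \<odot> y \<noteq> \<zero>" for b
 proof -
  obtain c where c: "c \<in> carrier R" "c \<odot> (b \<odot> y) = y" using ysim[OF b] by blast
  have "(\<one>\<^bsub>R\<^esub> \<ominus>\<^bsub>R\<^esub> c \<otimes>\<^bsub>R\<^esub> b) \<odot> y = \<zero>"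
   using b(1) c y by (simp add: J.smult_diff J.smult_assoc1 J.minus_zero_iff)
  then have "(\<one>\<^bsub>R\<^esub> \<ominus>\<^bsub>R\<^esub> c \<otimes>\<^bsub>R\<^esub> b) \<odot> y' = \<zero>" using annyy b(1) c(1) by simp
  then have "c \<odot> (b \<odot> y') = y'"
   using b(1) c(1) y' by (simp add: J.smult_diff J.smult_assoc1 J.minus_zero_iff)
  then show ?thesis using c by blast
 qed
 have anneq: "b \<odot> y = \<zero> \<longleftrightarrow> b \<odot> y' = \<zero>" if b: "b \<in> carrier R" for b
 proof
  assume "b \<odot> y' = \<zero>"
  then show "b \<odot> y = \<zero>" using y'sim[OF b] y'0 by fastforce
 qed (use annyy b in blast)
 (* N: a submodule containing y that is maximal without y' *)
 have Ry: "submodule (adjoin R J {\<zero>} y) R J" and yRy: "y \<in> adjoin R J {\<zero>} y"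
  by (rule J.adjoin[OF J.zero_submodule y(1)])+
 have "adjoin R J {\<zero>} y \<inter> {y'} = {}" using ny y(1) by (auto simp: adjoin_def)
 from J.maximal_submodule[OF Ry this] obtain N where N: "submodule N R J" and yN: "y \<in> N" and y'N: "y' \<notin> N"
  and reach: "\<And>x. x \<in> carrier J \<Longrightarrow> x \<notin> N \<Longrightarrow> \<exists>n\<in>N. \<exists>c\<in>carrier R. y' = n \<oplus> c \<odot> x"
  using yRy by fastforce
 note ND = J.submoduleD[OF N]
 have notN: "b \<odot> y' \<notin> N" if b: "b \<in> carrier R" "b \<odot> y \<noteq> \<zero>" for b
  using y'sim[OF b] ND(4) y'N by metis
 (* K: a complement of N; the projection to N extends to q, and q maps into N because N has no
   proper essential extension *)
 have "{\<zero>} \<inter> (N - {\<zero>}) = {}" by blast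
 from J.maximal_submodule[OF J.zero_submodule this] obtain K where K: "submodule K R J" and KN: "K \<inter> (N - {\<zero>}) = {}"
  and max: "\<forall>x\<in>carrier J. x \<notin> K \<longrightarrow> (\<exists>k\<in>K. \<exists>c\<in>carrier R. k \<oplus> c \<odot> x \<in> N - {\<zero>})"
  by (elim exE conjE)
 note meet = mp[OF bspec[OF max]]
 note KD = J.submoduleD[OF K]
 interpret P: module R "prod_module J J" by (rule prod_module[OF J J])
 let ?G = "{(n \<oplus> k, n) | n k. n \<in> N \<and> k \<in> K}"
 have GI: "(n \<oplus> k, n) \<in> ?G" if "n \<in> N" "k \<in> K" for n k using that by blast
 have G: "submodule ?G R (prod_module J J)"
 proof (rule P.submodule_criterion)
  show "?G \<subseteq> carrier (prod_module J J)" using ND(1) KD(1) by auto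
  show "\<zero>\<^bsub>prod_module J J\<^esub> \<in> ?G" using GI[OF ND(2) KD(2)] by simp
  fix u assume "u \<in> ?G"
  then obtain n k where u: "n \<in> N" "k \<in> K" "u = (n \<oplus> k, n)" by blast
  note c = ND(1)[OF u(1)] KD(1)[OF u(2)]
  show "r \<odot>\<^bsub>prod_module J J\<^esub> u \<in> ?G" if r: "r \<in> carrier R" for r
   using GI[OF ND(4)[OF r u(1)] KD(4)[OF r u(2)]] u c r by (simp add: J.smult_r_distr)
  fix v assume "v \<in> ?G"
  then obtain n' k' where v: "n' \<in> N" "k' \<in> K" "v = (n' \<oplus> k', n')" by blast
  have "(n \<oplus> k) \<oplus> (n' \<oplus> k') = (n \<oplus> n') \<oplus> (k \<oplus> k')"
   using c ND(1)[OF v(1)] KD(1)[OF v(2)] by (simp add: J.M.a_ac)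
  then show "u \<oplus>\<^bsub>prod_module J J\<^esub> v \<in> ?G" using GI[OF ND(3)[OF u(1) v(1)] KD(3)[OF u(2) v(2)]] u v by simp
 qed
 have "w = \<zero>" if w: "(\<zero>, w) \<in> ?G" for w
 proof -
  obtain k where k: "w \<in> N" "k \<in> K" "\<zero> = w \<oplus> k" using w by blast
  have "w = \<zero> \<ominus> k" using k(3) ND(1)[OF k(1)] KD(1)[OF k(2)] by (simp add: J.M.minus_eq J.M.a_assoc J.M.r_neg)
  then have "w \<in> K" using KD(5)[OF KD(2) k(2)] by simp
  then show ?thesis using k(1) KN by blast
 qed
 from linear_extension[OF J inj G this]
 obtain q where q: "linear_map R J J q" and qG: "\<And>v w. (v, w) \<in> ?G \<Longrightarrow> q v = w" by blast
 note qD = linear_mapD[OF q]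
 have qid: "q n = n" if n: "n \<in> N" for n using qG[OF GI[OF n KD(2)]] ND(1)[OF n] by simp
 have qK: "q k = \<zero>" if k: "k \<in> K" for k using qG[OF GI[OF ND(2) k]] KD(1)[OF k] by simp
 have qN: "q x \<in> N" if x: "x \<in> carrier J" for x
 proof (rule ccontr)
  assume "q x \<notin> N"
  then obtain n c where nc: "n \<in> N" "c \<in> carrier R" "y' = n \<oplus> c \<odot> q x" using reach[OF qD(1)[OF x]] by blast
  let ?z = "n \<oplus> c \<odot> x"
  have z: "?z \<in> carrier J" using ND(1)[OF nc(1)] nc(2) x by simp
  have qz: "q ?z = y'" using nc qD(2)[OF ND(1)[OF nc(1)] J.smult_closed[OF nc(2) x]] qD(3)[OF nc(2) x] qid by simp
  have "?z \<notin> K" using qK[of ?z] qz y'0 by auto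
  from meet[OF z this] obtain k r where k: "k \<in> K" "r \<in> carrier R" "k \<oplus> r \<odot> ?z \<in> N" "k \<oplus> r \<odot> ?z \<noteq> \<zero>"
   by blast
  have "k \<oplus> r \<odot> ?z = q (k \<oplus> r \<odot> ?z)" using qid[OF k(3)] by simp
  also have "\<dots> = r \<odot> y'"
   unfolding qD(2)[OF KD(1)[OF k(1)] J.smult_closed[OF k(2) z]] qK[OF k(1)] qD(3)[OF k(2) z] qz using k(2) y' by simp
  finally have "r \<odot> y' \<in> N" "r \<odot> y' \<noteq> \<zero>" using k(3,4) by simp_all
  then show False using notN[OF k(2)] anneq[OF k(2)] by blast
 qed
 have Ninj: "injective_module R (J\<lparr>carrier := N\<rparr>)"
  by (rule injective_module_retract[OF inj N q qN qid])
 have NJ: "N \<subseteq> carrier J" using ND(1) by blast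
 (* N still contains a copy of every simple module, y replacing y' *)
 have Nfun: "\<exists>h. linear_map R B (J\<lparr>carrier := N\<rparr>) h \<and> h z \<noteq> \<zero>"
  if B: "module R B" and z: "z \<in> carrier B" "z \<noteq> \<zero>\<^bsub>B\<^esub>" for B :: "('a, 'a set) module" and z
 proof -
  interpret B: module R B by fact
  obtain a where a: "a \<in> carrier R" and ts: "simple_element R B (a \<odot>\<^bsub>B\<^esub> z)"
   using simple_multiple_exists[OF R B z] by blast
  define t where "t = a \<odot>\<^bsub>B\<^esub> z"
  have t: "t \<in> carrier B" "t \<noteq> \<zero>\<^bsub>B\<^esub>" using ts by (auto simp: simple_element_def t_def)
  obtain h where h: "linear_map R B J h" "h t \<noteq> \<zero>" using nonzero_functional[OF B inj cog t] by blast
  have ht: "h t \<in> carrier J" using linear_mapD(1)[OF h(1) t(1)] .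
  have "\<exists>h'. linear_map R B J h' \<and> (\<forall>x\<in>carrier B. h' x \<in> N) \<and> h' t \<noteq> \<zero>"
  proof (cases "q (h t) = \<zero>")
   case False
   then show ?thesis using linear_map_comp[OF h(1) q] qN linear_mapD(1)[OF h(1)] by blast
  next
   case True
   have "h t \<notin> N" using qid[of "h t"] True h(2) by auto
   then obtain n c where nc: "n \<in> N" "c \<in> carrier R" "y' = n \<oplus> c \<odot> h t" using reach[OF ht] by blast
   have kill: "b \<odot> y = \<zero>" if b: "b \<in> carrier R" "b \<odot>\<^bsub>B\<^esub> t \<in> {\<zero>\<^bsub>B\<^esub>}" for b
   proof -
    have "b \<odot> h t = \<zero>" using b linear_mapD(3)[OF h(1) b(1) t(1)] linear_map_zero[OF B J h(1)] by simp
    then have "b \<odot> y' = b \<odot> n"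
     using nc b(1) ht ND(1)[OF nc(1)] J.smult_comm[OF b(1) nc(2) ht] by (simp add: J.smult_r_distr)
    then have "b \<odot> y' \<in> N" using ND(4)[OF b(1) nc(1)] by simp
    then show ?thesis using notN[OF b(1)] by blast
   qed
   from functional_extension[OF B inj B.zero_submodule t(1) y(1) kill]
   obtain h' where h': "linear_map R B J h'" "h' t = y" by blast
   show ?thesis using linear_map_comp[OF h'(1) q] qN linear_mapD(1)[OF h'(1)] qid[OF yN] h'(2) y(2)
    by (intro exI[of _ "\<lambda>x. q (h' x)"]) simp
  qed
  then obtain h' where h': "linear_map R B J h'" "\<forall>x\<in>carrier B. h' x \<in> N" "h' t \<noteq> \<zero>" by blast
  have "h' z \<noteq> \<zero>"
   using h'(3) linear_mapD(3)[OF h'(1) a z(1)] a by (auto simp: t_def)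
  moreover have "linear_map R B (J\<lparr>carrier := N\<rparr>) h'"
   unfolding linear_map_restrict_codomain[OF NJ] by (intro conjI h'(1,2))
  ultimately show ?thesis by (intro exI[of _ h'] conjI)
 qed
 have "cogenerator R (J\<lparr>carrier := N\<rparr>)"
  unfolding cogenerator_def
 proof (intro conjI allI impI)
  show "module R (J\<lparr>carrier := N\<rparr>)" using Ninj unfolding injective_module_def by (rule conjunct1)
  fix A B :: "('a, 'a set) module" and f g
  assume a: "module R A \<and> module R B \<and> linear_map R A B f \<and> linear_map R A B g \<and> (\<exists>x\<in>carrier A. f x \<noteq> g x)"
  then obtain x where x: "x \<in> carrier A" "f x \<noteq> g x" by blast
  have B: "module R B" and f: "linear_map R A B f" and g: "linear_map R A B g" using a by blast+
  interpret B: module R B by fact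
  have fx: "f x \<in> carrier B" and gx: "g x \<in> carrier B"
   using linear_mapD(1)[OF f x(1)] linear_mapD(1)[OF g x(1)] by auto
  have "f x \<ominus>\<^bsub>B\<^esub> g x \<noteq> \<zero>\<^bsub>B\<^esub>" using B.minus_zero_iff[OF fx gx] x(2) by blast
  from Nfun[OF B _ this] fx gx
  obtain h where h: "linear_map R B (J\<lparr>carrier := N\<rparr>) h" "h (f x \<ominus>\<^bsub>B\<^esub> g x) \<noteq> \<zero>" by auto
  have hJ: "linear_map R B J h" using h(1) linear_map_restrict_codomain[OF NJ] by blast
  have "h (f x) \<noteq> h (g x)"
   using h(2) linear_map_minus[OF B J hJ fx gx] J.minus_zero_iff linear_mapD(1)[OF hJ] fx gx by auto
  then show "\<exists>h. linear_map R B (J\<lparr>carrier := N\<rparr>) h \<and> (\<exists>x\<in>carrier A. h (f x) \<noteq> h (g x))"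
   using h(1) x(1) by blast
 qed
 then have "N = carrier J"
  using mic N Ninj unfolding minimal_injective_cogenerator_def by blast
 then show False using y'N y' by simp
qed

section \<open>Finitely generated modules over an artinian ring\<close>

fun list_span :: "('k, 'r) ring_scheme \<Rightarrow> ('k, 'a, 'x) module_scheme \<Rightarrow> 'a list \<Rightarrow> 'a set" where
 "list_span R M [] = {\<zero>\<^bsub>M\<^esub>}"
| "list_span R M (x # xs) = adjoin R M (list_span R M xs) x"

lemma (in module) list_span_submodule:
 "set xs \<subseteq> carrier M \<Longrightarrow> submodule (list_span R M xs) R M \<and> set xs \<subseteq> list_span R M xs"
proof (induction xs)
 case Nil
 then show ?case using zero_submodule by simp
next
 case (Cons x xs)
 then show ?case using adjoin[of "list_span R M xs" x] by auto
qed

text \<open>Finitely generated modules over an artinian ring are artinian.  The induction adds generators one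
at a time: first minimise the ideal of coefficients of the new generator \<open>x\<close>, then, among the submodules that
attain this ideal, the intersection with the span of the remaining generators.\<close>

lemma minimal_submodule_exists:
 fixes M (structure)
 assumes R: "artinian_cring R" and M: "module R M" and fg: "finitely_generated_module R M"
  and ne: "N0 \<in> \<N>" and subm: "\<And>N. N \<in> \<N> \<Longrightarrow> submodule N R M"
 shows "\<exists>N\<in>\<N>. \<forall>N'\<in>\<N>. N' \<subseteq> N \<longrightarrow> N' = N"
proof -
 interpret artinian_cring R by fact
 interpret M: module R M by fact
 obtain S where S: "finite S" "S \<subseteq> carrier M" "\<forall>N. submodule N R M \<and> S \<subseteq> N \<longrightarrow> N = carrier M"
  using fg unfolding finitely_generated_module_def by (elim exE conjE)
 obtain xs where xs: "set xs = S" using finite_list[OF S(1)] by blast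
 have span: "list_span R M xs = carrier M"
  using S(3)[rule_format, OF M.list_span_submodule[of xs, unfolded xs, OF S(2)]] .
 have chain: "\<exists>N\<in>\<N>. \<forall>N'\<in>\<N>. N' \<subseteq> N \<longrightarrow> N' \<inter> list_span R M zs = N \<inter> list_span R M zs"
  if "set zs \<subseteq> carrier M" "N0 \<in> \<N>" "\<And>N. N \<in> \<N> \<Longrightarrow> submodule N R M" for zs \<N> N0
  using that
 proof (induction zs arbitrary: \<N> N0)
  case Nil
  have eq: "N \<inter> list_span R M [] = {\<zero>}" if "N \<in> \<N>" for N
   using M.submoduleD(2)[OF Nil(3)[OF that]] by auto
  show ?case by (intro bexI[OF _ Nil(2)] ballI impI) (simp only: eq Nil(2))
 next
  case (Cons x zs)
  have x: "x \<in> carrier M" and zs: "set zs \<subseteq> carrier M" using Cons.prems(1) by auto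
  note SD = M.submoduleD[OF conjunct1[OF M.list_span_submodule[OF zs]]]
  \<comment> \<open>coefficients of the new generator \<open>x\<close> in elements of \<open>N\<close>\<close>
  define I where "I N = {a \<in> carrier R. \<exists>g\<in>list_span R M zs. a \<odot> x \<oplus> g \<in> N}" for N
  have Iid: "ideal (I N) R" if N: "N \<in> \<N>" for N
  proof -
   note ND = M.submoduleD[OF Cons.prems(3)[OF N]]
   show ?thesis
   proof (rule ideal_criterion)
    show "I N \<subseteq> carrier R" by (auto simp: I_def)
    show "\<zero>\<^bsub>R\<^esub> \<in> I N" using x SD(2) ND(2) by (auto simp: I_def intro!: bexI[of _ "\<zero>"])
    fix a assume "a \<in> I N"
    then obtain g where a: "a \<in> carrier R" "g \<in> list_span R M zs" "a \<odot> x \<oplus> g \<in> N" by (auto simp: I_def)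
    show "r \<otimes>\<^bsub>R\<^esub> a \<in> I N" if r: "r \<in> carrier R" for r
     using ND(4)[OF r a(3)] SD(4)[OF r a(2)] r a x SD(1)[OF a(2)]
     by (auto simp: I_def M.smult_r_distr M.smult_assoc1)
    fix b assume "b \<in> I N"
    then obtain h where b: "b \<in> carrier R" "h \<in> list_span R M zs" "b \<odot> x \<oplus> h \<in> N" by (auto simp: I_def)
    have "(a \<oplus>\<^bsub>R\<^esub> b) \<odot> x \<oplus> (g \<oplus> h) = (a \<odot> x \<oplus> g) \<oplus> (b \<odot> x \<oplus> h)"
     using a(1) b(1) x SD(1)[OF a(2)] SD(1)[OF b(2)] by (simp add: M.smult_l_distr M.M.a_ac)
    then show "a \<oplus>\<^bsub>R\<^esub> b \<in> I N"
     using ND(3)[OF a(3) b(3)] SD(3)[OF a(2) b(2)] a(1) b(1)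
     unfolding I_def by (intro CollectI conjI bexI[of _ "g \<oplus> h"]) simp_all
   qed
  qed
  have "\<exists>A\<in>I ` \<N>. \<forall>A'\<in>I ` \<N>. A' \<subseteq> A \<longrightarrow> A' = A"
   by (rule minimal_ideal[of "I N0"]) (use Iid Cons.prems(2) in auto)
  then obtain N1 where N1: "N1 \<in> \<N>" "\<And>N. N \<in> \<N> \<Longrightarrow> I N \<subseteq> I N1 \<Longrightarrow> I N = I N1"
   unfolding bex_simps ball_simps by blast
  have "\<exists>N\<in>{N \<in> \<N>. I N = I N1}. \<forall>N'\<in>{N \<in> \<N>. I N = I N1}. N' \<subseteq> N \<longrightarrow> N' \<inter> list_span R M zs = N \<inter> list_span R M zs"
  proof (rule Cons.IH[OF zs, of N1])
   show "N1 \<in> {N \<in> \<N>. I N = I N1}" using N1(1) by simp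
   show "submodule N R M" if "N \<in> {N \<in> \<N>. I N = I N1}" for N
    using Cons.prems(3)[of N] that by simp
  qed
  then obtain N where N0: "N \<in> {N \<in> \<N>. I N = I N1}"
   "\<forall>N'\<in>{N \<in> \<N>. I N = I N1}. N' \<subseteq> N \<longrightarrow> N' \<inter> list_span R M zs = N \<inter> list_span R M zs" by (rule bexE)
  then have N: "N \<in> \<N>" "I N = I N1" by simp_all
  have Nmin: "N' \<inter> list_span R M zs = N \<inter> list_span R M zs" if "N' \<in> \<N>" "I N' = I N1" "N' \<subseteq> N" for N'
   using N0(2)[rule_format, of N'] that by (simp only: mem_Collect_eq simp_thms)
  note ND = M.submoduleD[OF Cons.prems(3)[OF N(1)]]
  have least: "N' \<inter> list_span R M (x # zs) = N \<inter> list_span R M (x # zs)" if N': "N' \<in> \<N>" "N' \<subseteq> N" for N'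
  proof -
   note N'D = M.submoduleD[OF Cons.prems(3)[OF N'(1)]]
   have "I N' \<subseteq> I N" using N'(2) by (auto simp: I_def)
   then have IN': "I N' = I N1" using N1(2)[OF N'(1)] N(2) by simp
   have eq: "N' \<inter> list_span R M zs = N \<inter> list_span R M zs" by (rule Nmin[OF N'(1) IN' N'(2)])
   have "u \<in> N'" if u: "u \<in> N" "u \<in> list_span R M (x # zs)" for u
   proof -
    obtain a g where a: "a \<in> carrier R" "g \<in> list_span R M zs" "u = g \<oplus> a \<odot> x"
     using u(2) by (auto simp: adjoin_def)
    then have a': "u = a \<odot> x \<oplus> g" using x SD(1) M.M.a_comm by simp
    then have "a \<in> I N" using u(1) a(1,2) by (auto simp: I_def)
    then have "a \<in> I N'" using IN' N(2) by simp
    then obtain g' where g': "g' \<in> list_span R M zs" "a \<odot> x \<oplus> g' \<in> N'" by (auto simp: I_def)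
    have c: "g \<in> carrier M" "g' \<in> carrier M" "a \<odot> x \<in> carrier M" using SD(1) a g' x by auto
    have "u \<ominus> (a \<odot> x \<oplus> g') \<in> N" using ND(5)[OF u(1)] g'(2) N'(2) by blast
    moreover have d: "u \<ominus> (a \<odot> x \<oplus> g') = g \<ominus> g'"
    proof -
     have "u \<ominus> (a \<odot> x \<oplus> g') = (a \<odot> x \<oplus> \<ominus> (a \<odot> x)) \<oplus> (g \<oplus> \<ominus> g')"
      using c a' by (simp add: M.M.minus_eq M.M.minus_add M.M.a_ac)
     then show ?thesis using c by (simp add: M.M.r_neg M.M.minus_eq)
    qed
    ultimately have "g \<ominus> g' \<in> N'" using eq SD(5)[OF a(2) g'(1)] by auto
    then have "(u \<ominus> (a \<odot> x \<oplus> g')) \<oplus> (a \<odot> x \<oplus> g') \<in> N'" using N'D(3)[OF _ g'(2)] d by simp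
    then show ?thesis using M.minus_add_cancel[OF ND(1)[OF u(1)]] c by simp
   qed
   then show ?thesis using N'(2) by auto
  qed
  show ?case by (intro bexI[OF _ N(1)] ballI impI least)
 qed
 have "\<exists>N\<in>\<N>. \<forall>N'\<in>\<N>. N' \<subseteq> N \<longrightarrow> N' \<inter> list_span R M xs = N \<inter> list_span R M xs"
  by (rule chain[of xs N0 \<N>]) (use S(2) xs ne subm in simp_all)
 then obtain N where N: "N \<in> \<N>"
  "\<forall>N'\<in>\<N>. N' \<subseteq> N \<longrightarrow> N' \<inter> list_span R M xs = N \<inter> list_span R M xs" by (rule bexE)
 have least: "N' = N" if "N' \<in> \<N>" "N' \<subseteq> N" for N'
 proof -
  have c: "N' \<subseteq> carrier M" "N \<subseteq> carrier M"
   using M.submoduleD(1)[OF subm[OF that(1)]] M.submoduleD(1)[OF subm[OF N(1)]] by blast+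
  show ?thesis using N(2)[rule_format, OF that] unfolding span Int_absorb2[OF c(1)] Int_absorb2[OF c(2)] .
 qed
 show ?thesis by (intro bexI[OF _ N(1)] ballI impI least)
qed

text \<open>Here \<open>s\<close> parametrises by \<open>T\<close> a submodule of the dual of \<open>M\<close> that separates points.  Let \<open>K\<close> be minimal
such that all functionals that vanish on \<open>K\<close> belong to the family.  If \<open>K \<noteq> 0\<close>, some \<open>s t\<close> is nonzero on \<open>K\<close>,
and a functional that vanishes on the kernel of \<open>s t\<close> in \<open>K\<close> factors on \<open>K\<close> through the image of \<open>s t\<close>, so it is
a scalar multiple of \<open>s t\<close> there.  Thus the kernel of \<open>s t\<close> in \<open>K\<close> has the same property, contradicting
minimality.\<close>

lemma separating_functionals_exhaust:
 fixes J (structure)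
 assumes R: "artinian_cring R" and M: "module R M" and fg: "finitely_generated_module R M"
  and J: "module R J" and mfs: "multiplicity_free_socle R J"
  and t0: "t0 \<in> T" and lin: "\<And>t. t \<in> T \<Longrightarrow> linear_map R M J (s t)"
  and sadd: "\<And>t u. t \<in> T \<Longrightarrow> u \<in> T \<Longrightarrow> \<exists>v\<in>T. \<forall>x\<in>carrier M. s v x = s t x \<oplus> s u x"
  and ssm: "\<And>r t. r \<in> carrier R \<Longrightarrow> t \<in> T \<Longrightarrow> \<exists>v\<in>T. \<forall>x\<in>carrier M. s v x = r \<odot> s t x"
  and sep: "\<And>x. x \<in> carrier M \<Longrightarrow> x \<noteq> \<zero>\<^bsub>M\<^esub> \<Longrightarrow> \<exists>t\<in>T. s t x \<noteq> \<zero>"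
  and \<phi>: "linear_map R M J \<phi>"
 shows "\<exists>t\<in>T. \<forall>x\<in>carrier M. \<phi> x = s t x"
proof -
 interpret artinian_cring R by fact
 interpret M: module R M by fact
 interpret J: module R J by fact
 define good where "good K \<longleftrightarrow> submodule K R M \<and>
   (\<forall>\<psi>. linear_map R M J \<psi> \<and> (\<forall>x\<in>K. \<psi> x = \<zero>) \<longrightarrow> (\<exists>t\<in>T. \<forall>x\<in>carrier M. \<psi> x = s t x))" for K
 have "good (carrier M)"
 proof -
  obtain v where v: "v \<in> T" "\<forall>x\<in>carrier M. s v x = \<zero>\<^bsub>R\<^esub> \<odot> s t0 x" using ssm[OF zero_closed t0] by (rule bexE)
  have "\<exists>t\<in>T. \<forall>x\<in>carrier M. \<psi> x = s t x" if "\<forall>x\<in>carrier M. \<psi> x = \<zero>" for \<psi>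
   using v that linear_mapD(1)[OF lin[OF t0]] by (intro bexI[of _ v]) auto
  then show ?thesis using M.carrier_is_submodule unfolding good_def by blast
 qed
 then have "\<exists>K\<in>{K. good K}. \<forall>K'\<in>{K. good K}. K' \<subseteq> K \<longrightarrow> K' = K"
  by (intro minimal_submodule_exists[OF R M fg, of "carrier M"]) (auto simp: good_def)
 then obtain K where K: "good K" and min: "\<And>K'. good K' \<Longrightarrow> K' \<subseteq> K \<Longrightarrow> K' = K" by auto
 have Ks: "submodule K R M" using K by (simp add: good_def)
 note KD = M.submoduleD[OF Ks]
 have "K \<subseteq> {\<zero>\<^bsub>M\<^esub>}"
 proof (rule ccontr)
  assume "\<not> K \<subseteq> {\<zero>\<^bsub>M\<^esub>}"
  then obtain x where x: "x \<in> K" "x \<noteq> \<zero>\<^bsub>M\<^esub>" by blast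
  obtain t where t: "t \<in> T" "s t x \<noteq> \<zero>" using sep[OF KD(1)[OF x(1)] x(2)] by blast
  note sl = lin[OF t(1)]
  note sD = linear_mapD[OF sl]
  let ?K' = "{y \<in> K. s t y = \<zero>}"
  have K'sub: "submodule ?K' R M"
   by (rule M.submodule_criterion) (use KD sD linear_map_zero[OF M J sl] in auto)
  have "good ?K'"
   unfolding good_def
  proof (intro conjI allI impI K'sub, elim conjE)
   fix \<psi> assume \<psi>: "linear_map R M J \<psi>" and kill: "\<forall>y\<in>?K'. \<psi> y = \<zero>"
   note \<psi>D = linear_mapD[OF \<psi>]
   let ?N = "s t ` K"
   define h where "h w = \<psi> (SOME y. y \<in> K \<and> s t y = w)" for w
   have hs: "h (s t y) = \<psi> y" if y: "y \<in> K" for y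
   proof -
    let ?y = "SOME y'. y' \<in> K \<and> s t y' = s t y"
    have y': "?y \<in> K \<and> s t ?y = s t y" by (rule someI[of _ y]) (simp add: y)
    then have m: "?y \<ominus>\<^bsub>M\<^esub> y \<in> K" using KD(5) y by blast
    have c: "?y \<in> carrier M" "y \<in> carrier M" using y y' KD(1) by auto
    have "s t (?y \<ominus>\<^bsub>M\<^esub> y) = \<zero>"
     using linear_map_minus[OF M J sl c] y' J.minus_zero_iff sD(1)[OF c(2)] by simp
    then have "\<psi> (?y \<ominus>\<^bsub>M\<^esub> y) = \<zero>" using kill m by simp
    then show ?thesis
     using linear_map_minus[OF M J \<psi> c] J.minus_zero_iff \<psi>D(1) c by (simp add: h_def)
   qed
   have N: "submodule ?N R J"
   proof (rule J.submodule_criterion)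
    show "?N \<subseteq> carrier J" using sD(1) KD(1) by auto
    show "\<zero> \<in> ?N" using linear_map_zero[OF M J sl] KD(2) by force
    show "u \<oplus> v \<in> ?N" if uv: "u \<in> ?N" "v \<in> ?N" for u v
    proof -
     obtain a b where "a \<in> K" "b \<in> K" "u = s t a" "v = s t b" using uv by auto
     then show ?thesis using sD(2)[OF KD(1) KD(1)] KD(3) by (metis imageI)
    qed
    show "r \<odot> u \<in> ?N" if ru: "r \<in> carrier R" "u \<in> ?N" for r u
    proof -
     obtain a where "a \<in> K" "u = s t a" using ru by auto
     then show ?thesis using sD(3)[OF ru(1) KD(1)] KD(4)[OF ru(1)] by (metis imageI)
    qed
   qed
   have "\<exists>r\<in>carrier R. \<forall>w\<in>?N. h w = r \<odot> w"
   proof (rule linear_on_submodule_is_scalar[OF R J mfs N])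
    show "h w \<in> carrier J" if w: "w \<in> ?N" for w using w hs \<psi>D(1) KD(1) by auto
    show "h (u \<oplus> v) = h u \<oplus> h v" if uv: "u \<in> ?N" "v \<in> ?N" for u v
    proof -
     obtain a b where ab: "a \<in> K" "b \<in> K" "u = s t a" "v = s t b" using uv by auto
     then have "h (u \<oplus> v) = h (s t (a \<oplus>\<^bsub>M\<^esub> b))" using sD(2)[OF KD(1) KD(1)] by simp
     then show ?thesis using hs KD(3) ab \<psi>D(2)[OF KD(1) KD(1)] by simp
    qed
    show "h (r \<odot> u) = r \<odot> h u" if ru: "r \<in> carrier R" "u \<in> ?N" for r u
    proof -
     obtain a where a: "a \<in> K" "u = s t a" using ru by auto
     then have "h (r \<odot> u) = h (s t (r \<odot>\<^bsub>M\<^esub> a))" using sD(3)[OF ru(1) KD(1)] by simp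
     then show ?thesis using hs KD(4)[OF ru(1)] a \<psi>D(3)[OF ru(1) KD(1)] by simp
    qed
   qed
   then obtain r where r: "r \<in> carrier R" "\<And>y. y \<in> K \<Longrightarrow> \<psi> y = r \<odot> s t y" using hs by auto
   let ?\<chi> = "\<lambda>y. \<psi> y \<ominus> r \<odot> s t y"
   have "linear_map R M J ?\<chi>"
    by (rule linear_mapI)
     (use \<psi>D sD r(1) in \<open>simp_all add: J.smult_r_distr J.M.minus_eq J.M.minus_add J.M.a_ac J.smult_r_minus J.smult_comm\<close>)
   moreover have "\<forall>y\<in>K. ?\<chi> y = \<zero>" using r \<psi>D(1) sD(1) KD(1) J.minus_zero_iff by simp
   ultimately obtain t1 where t1: "t1 \<in> T" "\<forall>y\<in>carrier M. ?\<chi> y = s t1 y"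
    using K unfolding good_def by blast
   obtain t2 where t2: "t2 \<in> T" "\<forall>y\<in>carrier M. s t2 y = r \<odot> s t y" using ssm[OF r(1) t(1)] by (rule bexE)
   obtain t3 where t3: "t3 \<in> T" "\<forall>y\<in>carrier M. s t3 y = s t1 y \<oplus> s t2 y" using sadd[OF t1(1) t2(1)] by (rule bexE)
   have "\<psi> y = s t3 y" if y: "y \<in> carrier M" for y
    using t1(2) t2(2) t3(2) y J.minus_add_cancel[OF \<psi>D(1)[OF y], of "r \<odot> s t y"] r(1) sD(1)[OF y] by fastforce
   then show "\<exists>t\<in>T. \<forall>x\<in>carrier M. \<psi> x = s t x" using t3(1) by blast
  qed
  then have "?K' = K" by (rule min) blast
  then show False using x t by blast
 qed
 then have kill: "\<forall>x\<in>K. \<phi> x = \<zero>" using linear_map_zero[OF M J \<phi>] by auto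
 have "\<forall>\<psi>. linear_map R M J \<psi> \<and> (\<forall>x\<in>K. \<psi> x = \<zero>) \<longrightarrow> (\<exists>t\<in>T. \<forall>x\<in>carrier M. \<psi> x = s t x)"
  using K unfolding good_def by (rule conjunct2)
 from mp[OF spec[OF this, of \<phi>] conjI[OF \<phi> kill]] show ?thesis .
qed

section \<open>Calculus in an additive category with a bifunctor\<close>

text \<open>Membership in \<open>mor\<close> and \<open>xt\<close> records that the ends are objects, so that one fact supplies all
typing conditions of a morphism or of an extension.\<close>

definition mor :: "('o, 'm, 'k, 'z) cat_scheme \<Rightarrow> 'o \<Rightarrow> 'o \<Rightarrow> 'm set" where
 "mor C A B = {f \<in> arr C A B. A \<in> Obj C \<and> B \<in> Obj C}"

definition xt :: "('o, 'm, 'k, 'e) ecat \<Rightarrow> 'o \<Rightarrow> 'o \<Rightarrow> 'e set" where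
 "xt C D A = {\<delta> \<in> ext C D A. D \<in> Obj C \<and> A \<in> Obj C}"

lemma morI: "f \<in> arr C A B \<Longrightarrow> A \<in> Obj C \<Longrightarrow> B \<in> Obj C \<Longrightarrow> f \<in> mor C A B"
 by (simp add: mor_def)

lemma morD: "f \<in> mor C A B \<Longrightarrow> f \<in> arr C A B" "f \<in> mor C A B \<Longrightarrow> A \<in> Obj C" "f \<in> mor C A B \<Longrightarrow> B \<in> Obj C"
 by (simp_all add: mor_def)

lemma xtI: "f \<in> ext C A B \<Longrightarrow> A \<in> Obj C \<Longrightarrow> B \<in> Obj C \<Longrightarrow> f \<in> xt C A B"
 by (simp add: xt_def)

lemma xtD: "f \<in> xt C A B \<Longrightarrow> f \<in> ext C A B" "f \<in> xt C A B \<Longrightarrow> A \<in> Obj C" "f \<in> xt C A B \<Longrightarrow> B \<in> Obj C"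
 by (simp_all add: xt_def)

lemma additive_zero:
 assumes "abelian_group G" "abelian_group H" "f \<zero>\<^bsub>G\<^esub> \<in> carrier H"
  and "f (\<zero>\<^bsub>G\<^esub> \<oplus>\<^bsub>G\<^esub> \<zero>\<^bsub>G\<^esub>) = f \<zero>\<^bsub>G\<^esub> \<oplus>\<^bsub>H\<^esub> f \<zero>\<^bsub>G\<^esub>"
 shows "f \<zero>\<^bsub>G\<^esub> = \<zero>\<^bsub>H\<^esub>"
proof -
 interpret G: abelian_group G by fact
 interpret H: abelian_group H by fact
 show ?thesis using assms(3,4) by (metis G.r_zero G.zero_closed H.add.l_cancel_one')
qed

lemma (in abelian_group) diff_add_cancel:
 "x \<in> carrier G \<Longrightarrow> y \<in> carrier G \<Longrightarrow> (x \<ominus> y) \<oplus> y = x"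
 by (simp add: minus_eq a_assoc l_neg)

lemma (in abelian_group) eq_diff_iff:
 "x \<in> carrier G \<Longrightarrow> y \<in> carrier G \<Longrightarrow> z \<in> carrier G \<Longrightarrow> z = x \<ominus> y \<longleftrightarrow> z \<oplus> y = x"
 by (metis add.inv_solve_right minus_eq)

lemma (in abelian_group) diff_zero_iff:
 "x \<in> carrier G \<Longrightarrow> y \<in> carrier G \<Longrightarrow> x \<ominus> y = \<zero> \<longleftrightarrow> x = y"
 using eq_diff_iff[of x y \<zero>] by (metis l_zero zero_closed)

lemma additive_minus:
 assumes "abelian_group G" "abelian_group H" "\<And>x. x \<in> carrier G \<Longrightarrow> f x \<in> carrier H"
  and "\<And>x y. x \<in> carrier G \<Longrightarrow> y \<in> carrier G \<Longrightarrow> f (x \<oplus>\<^bsub>G\<^esub> y) = f x \<oplus>\<^bsub>H\<^esub> f y"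
  and x: "x \<in> carrier G" and y: "y \<in> carrier G"
 shows "f (x \<ominus>\<^bsub>G\<^esub> y) = f x \<ominus>\<^bsub>H\<^esub> f y"
proof -
 interpret G: abelian_group G by fact
 interpret H: abelian_group H by fact
 have d: "x \<ominus>\<^bsub>G\<^esub> y \<in> carrier G" using x y by simp
 have "f (x \<ominus>\<^bsub>G\<^esub> y) \<oplus>\<^bsub>H\<^esub> f y = f x"
  using assms(4)[OF d y] G.diff_add_cancel[OF x y] by simp
 then show ?thesis
  using H.eq_diff_iff[OF assms(3)[OF x] assms(3)[OF y] assms(3)[OF d]] by simp
qed

context category
begin

lemma mor_comp: "f \<in> mor C A B \<Longrightarrow> g \<in> mor C B D \<Longrightarrow> g \<cdot> f \<in> mor C A D"
 using Comp_closed by (auto simp: mor_def)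

lemma mor_Id: "A \<in> Obj C \<Longrightarrow> Id C A \<in> mor C A A"
 using Id_closed by (auto simp: mor_def)

lemma comp_assoc: "f \<in> mor C A B \<Longrightarrow> g \<in> mor C B D \<Longrightarrow> h \<in> mor C D E \<Longrightarrow> (h \<cdot> g) \<cdot> f = h \<cdot> (g \<cdot> f)"
 using Comp_assoc by (auto simp: mor_def)

lemma id_left: "f \<in> mor C A B \<Longrightarrow> Id C B \<cdot> f = f"
 using Id_left by (auto simp: mor_def)

lemma id_right: "f \<in> mor C A B \<Longrightarrow> f \<cdot> Id C A = f"
 using Id_right by (auto simp: mor_def)

end

context preadditive_category
begin

lemma mor_zero: "A \<in> Obj C \<Longrightarrow> B \<in> Obj C \<Longrightarrow> zero_arr C A B \<in> mor C A B"
 using Hom_group[of A B] by (simp add: mor_def abelian_group_def abelian_monoid.zero_closed)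

lemma mor_add: "f \<in> mor C A B \<Longrightarrow> g \<in> mor C A B \<Longrightarrow> f \<oplus>\<^bsub>Hom C A B\<^esub> g \<in> mor C A B"
 using Hom_group[of A B] by (simp add: mor_def abelian_group_def abelian_monoid.a_closed)

lemma mor_diff: "f \<in> mor C A B \<Longrightarrow> g \<in> mor C A B \<Longrightarrow> f \<ominus>\<^bsub>Hom C A B\<^esub> g \<in> mor C A B"
 using abelian_group.minus_closed[OF Hom_group[of A B]] by (simp add: mor_def)

lemma mor_group: "f \<in> mor C A B \<Longrightarrow> abelian_group (Hom C A B)"
 using Hom_group by (auto simp: mor_def)

lemma comp_add_right:
 "f \<in> mor C A B \<Longrightarrow> f' \<in> mor C A B \<Longrightarrow> g \<in> mor C B D \<Longrightarrow>
  g \<cdot> (f \<oplus>\<^bsub>Hom C A B\<^esub> f') = g \<cdot> f \<oplus>\<^bsub>Hom C A D\<^esub> g \<cdot> f'"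
 using Comp_add_right by (auto simp: mor_def)

lemma comp_add_left:
 "f \<in> mor C A B \<Longrightarrow> g \<in> mor C B D \<Longrightarrow> g' \<in> mor C B D \<Longrightarrow>
  (g \<oplus>\<^bsub>Hom C B D\<^esub> g') \<cdot> f = g \<cdot> f \<oplus>\<^bsub>Hom C A D\<^esub> g' \<cdot> f"
 using Comp_add_left by (auto simp: mor_def)

lemma comp_zero_right:
 assumes A: "A \<in> Obj C" and g: "g \<in> mor C B D"
 shows "g \<cdot> zero_arr C A B = zero_arr C A D"
proof (rule additive_zero[where f = "\<lambda>f. g \<cdot> f"])
 note z = mor_zero[OF A morD(2)[OF g]]
 show "abelian_group (Hom C A B)" "abelian_group (Hom C A D)" using Hom_group A morD(2,3)[OF g] by auto
 show "g \<cdot> zero_arr C A B \<in> arr C A D" using morD(1)[OF mor_comp[OF z g]] .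
 show "g \<cdot> (zero_arr C A B \<oplus>\<^bsub>Hom C A B\<^esub> zero_arr C A B) = g \<cdot> zero_arr C A B \<oplus>\<^bsub>Hom C A D\<^esub> g \<cdot> zero_arr C A B"
  by (rule comp_add_right[OF z z g])
qed

lemma comp_zero_left:
 assumes f: "f \<in> mor C A B" and D: "D \<in> Obj C"
 shows "zero_arr C B D \<cdot> f = zero_arr C A D"
proof (rule additive_zero[where f = "\<lambda>g. g \<cdot> f"])
 note z = mor_zero[OF morD(3)[OF f] D]
 show "abelian_group (Hom C B D)" "abelian_group (Hom C A D)" using Hom_group D morD(2,3)[OF f] by auto
 show "zero_arr C B D \<cdot> f \<in> arr C A D" using morD(1)[OF mor_comp[OF f z]] .
 show "(zero_arr C B D \<oplus>\<^bsub>Hom C B D\<^esub> zero_arr C B D) \<cdot> f = zero_arr C B D \<cdot> f \<oplus>\<^bsub>Hom C A D\<^esub> zero_arr C B D \<cdot> f"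
  by (rule comp_add_left[OF f z z])
qed

lemma comp_diff_right:
 assumes f: "f \<in> mor C A B" and f': "f' \<in> mor C A B" and g: "g \<in> mor C B D"
 shows "g \<cdot> (f \<ominus>\<^bsub>Hom C A B\<^esub> f') = g \<cdot> f \<ominus>\<^bsub>Hom C A D\<^esub> g \<cdot> f'"
proof (rule additive_minus[where f = "\<lambda>f. g \<cdot> f"])
 note o = morD(2,3)[OF f] morD(3)[OF g]
 show "abelian_group (Hom C A B)" "abelian_group (Hom C A D)" using Hom_group o by auto
 show "g \<cdot> x \<in> arr C A D" if "x \<in> arr C A B" for x
  using morD(1)[OF mor_comp[OF morI[OF that o(1,2)] g]] .
 show "g \<cdot> (x \<oplus>\<^bsub>Hom C A B\<^esub> y) = g \<cdot> x \<oplus>\<^bsub>Hom C A D\<^esub> g \<cdot> y" if "x \<in> arr C A B" "y \<in> arr C A B" for x y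
  using comp_add_right[OF morI[OF that(1) o(1,2)] morI[OF that(2) o(1,2)] g] .
qed (fact morD(1)[OF f] morD(1)[OF f'])+

lemma comp_diff_left:
 assumes f: "f \<in> mor C A B" and g: "g \<in> mor C B D" and g': "g' \<in> mor C B D"
 shows "(g \<ominus>\<^bsub>Hom C B D\<^esub> g') \<cdot> f = g \<cdot> f \<ominus>\<^bsub>Hom C A D\<^esub> g' \<cdot> f"
proof (rule additive_minus[where f = "\<lambda>g. g \<cdot> f"])
 note o = morD(2,3)[OF f] morD(3)[OF g]
 show "abelian_group (Hom C B D)" "abelian_group (Hom C A D)" using Hom_group o by auto
 show "x \<cdot> f \<in> arr C A D" if "x \<in> arr C B D" for x
  using morD(1)[OF mor_comp[OF f morI[OF that o(2,3)]]] .
 show "(x \<oplus>\<^bsub>Hom C B D\<^esub> y) \<cdot> f = x \<cdot> f \<oplus>\<^bsub>Hom C A D\<^esub> y \<cdot> f" if "x \<in> arr C B D" "y \<in> arr C B D" for x y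
  using comp_add_left[OF f morI[OF that(1) o(2,3)] morI[OF that(2) o(2,3)]] .
qed (fact morD(1)[OF g] morD(1)[OF g'])+

lemma diff_zero_arr:
 assumes f: "f \<in> mor C A B" and g: "g \<in> mor C A B"
 shows "f \<ominus>\<^bsub>Hom C A B\<^esub> g = zero_arr C A B \<longleftrightarrow> f = g"
 by (rule abelian_group.diff_zero_iff[OF mor_group[OF f] morD(1)[OF f] morD(1)[OF g]])

end

context additive_bifunctor
begin

lemma xt_Push: "a \<in> mor C A B \<Longrightarrow> \<delta> \<in> xt C D A \<Longrightarrow> Push C a \<delta> \<in> xt C D B"
 using Push_closed by (auto simp: mor_def xt_def)

lemma xt_Pull: "c \<in> mor C D' D \<Longrightarrow> \<delta> \<in> xt C D A \<Longrightarrow> Pull C c \<delta> \<in> xt C D' A"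
 using Pull_closed by (auto simp: mor_def xt_def)

lemma xt_group: "\<delta> \<in> xt C D A \<Longrightarrow> abelian_group (Ext C D A)"
 using Ext_group by (auto simp: xt_def)

lemma xt_zero: "D \<in> Obj C \<Longrightarrow> A \<in> Obj C \<Longrightarrow> \<zero>\<^bsub>Ext C D A\<^esub> \<in> xt C D A"
 using Ext_group[of A D] by (simp add: xt_def abelian_group_def abelian_monoid.zero_closed)

lemma xt_add: "\<delta> \<in> xt C D A \<Longrightarrow> \<xi> \<in> xt C D A \<Longrightarrow> \<delta> \<oplus>\<^bsub>Ext C D A\<^esub> \<xi> \<in> xt C D A"
 using Ext_group[of A D] by (simp add: xt_def abelian_group_def abelian_monoid.a_closed)

lemma push_id: "\<delta> \<in> xt C D A \<Longrightarrow> Push C (Id C A) \<delta> = \<delta>"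
 using Push_Id by (auto simp: xt_def)

lemma pull_id: "\<delta> \<in> xt C D A \<Longrightarrow> Pull C (Id C D) \<delta> = \<delta>"
 using Pull_Id by (auto simp: xt_def)

lemma push_comp: "a \<in> mor C A A' \<Longrightarrow> b \<in> mor C A' A'' \<Longrightarrow> \<delta> \<in> xt C D A \<Longrightarrow> Push C (b \<cdot> a) \<delta> = Push C b (Push C a \<delta>)"
 using Push_Comp by (auto simp: mor_def xt_def)

lemma pull_comp: "c \<in> mor C D' D \<Longrightarrow> d \<in> mor C D'' D' \<Longrightarrow> \<delta> \<in> xt C D A \<Longrightarrow> Pull C (c \<cdot> d) \<delta> = Pull C d (Pull C c \<delta>)"
 using Pull_Comp by (auto simp: mor_def xt_def)

lemma push_pull: "a \<in> mor C A B \<Longrightarrow> c \<in> mor C D' D \<Longrightarrow> \<delta> \<in> xt C D A \<Longrightarrow> Push C a (Pull C c \<delta>) = Pull C c (Push C a \<delta>)"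
 using Push_Pull by (auto simp: mor_def xt_def)

lemma push_add:
 "a \<in> mor C A B \<Longrightarrow> \<delta> \<in> xt C D A \<Longrightarrow> \<xi> \<in> xt C D A \<Longrightarrow>
  Push C a (\<delta> \<oplus>\<^bsub>Ext C D A\<^esub> \<xi>) = Push C a \<delta> \<oplus>\<^bsub>Ext C D B\<^esub> Push C a \<xi>"
 using Push_add by (auto simp: mor_def xt_def)

lemma pull_add:
 "c \<in> mor C D' D \<Longrightarrow> \<delta> \<in> xt C D A \<Longrightarrow> \<xi> \<in> xt C D A \<Longrightarrow>
  Pull C c (\<delta> \<oplus>\<^bsub>Ext C D A\<^esub> \<xi>) = Pull C c \<delta> \<oplus>\<^bsub>Ext C D' A\<^esub> Pull C c \<xi>"
 using Pull_add by (auto simp: mor_def xt_def)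

lemma add_push:
 "a \<in> mor C A B \<Longrightarrow> a' \<in> mor C A B \<Longrightarrow> \<delta> \<in> xt C D A \<Longrightarrow>
  Push C (a \<oplus>\<^bsub>Hom C A B\<^esub> a') \<delta> = Push C a \<delta> \<oplus>\<^bsub>Ext C D B\<^esub> Push C a' \<delta>"
 using add_Push by (auto simp: mor_def xt_def)

lemma add_pull:
 "c \<in> mor C D' D \<Longrightarrow> c' \<in> mor C D' D \<Longrightarrow> \<delta> \<in> xt C D A \<Longrightarrow>
  Pull C (c \<oplus>\<^bsub>Hom C D' D\<^esub> c') \<delta> = Pull C c \<delta> \<oplus>\<^bsub>Ext C D' A\<^esub> Pull C c' \<delta>"
 using add_Pull by (auto simp: mor_def xt_def)

lemma push_zero:
 assumes a: "a \<in> mor C A B" and D: "D \<in> Obj C"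
 shows "Push C a \<zero>\<^bsub>Ext C D A\<^esub> = \<zero>\<^bsub>Ext C D B\<^esub>"
proof (rule additive_zero)
 note z = xt_zero[OF D morD(2)[OF a]]
 show "abelian_group (Ext C D A)" "abelian_group (Ext C D B)" using Ext_group D morD(2,3)[OF a] by auto
 show "Push C a \<zero>\<^bsub>Ext C D A\<^esub> \<in> ext C D B" using xtD(1)[OF xt_Push[OF a z]] .
qed (rule push_add[OF a xt_zero[OF D morD(2)[OF a]] xt_zero[OF D morD(2)[OF a]]])

lemma zero_push:
 assumes B: "B \<in> Obj C" and \<delta>: "\<delta> \<in> xt C D A"
 shows "Push C (zero_arr C A B) \<delta> = \<zero>\<^bsub>Ext C D B\<^esub>"
proof (rule additive_zero[where f = "\<lambda>a. Push C a \<delta>"])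
 note z = mor_zero[OF xtD(3)[OF \<delta>] B]
 show "abelian_group (Hom C A B)" "abelian_group (Ext C D B)" using Ext_group Hom_group B xtD(2,3)[OF \<delta>] by auto
 show "Push C (zero_arr C A B) \<delta> \<in> ext C D B" using xtD(1)[OF xt_Push[OF z \<delta>]] .
 show "Push C (zero_arr C A B \<oplus>\<^bsub>Hom C A B\<^esub> zero_arr C A B) \<delta>
  = Push C (zero_arr C A B) \<delta> \<oplus>\<^bsub>Ext C D B\<^esub> Push C (zero_arr C A B) \<delta>"
  by (rule add_push[OF z z \<delta>])
qed

lemma diff_push:
 assumes a: "a \<in> mor C A B" and a': "a' \<in> mor C A B" and \<delta>: "\<delta> \<in> xt C D A"
 shows "Push C (a \<ominus>\<^bsub>Hom C A B\<^esub> a') \<delta> = Push C a \<delta> \<ominus>\<^bsub>Ext C D B\<^esub> Push C a' \<delta>"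
proof (rule additive_minus[where f = "\<lambda>a. Push C a \<delta>"])
 note o = morD(2,3)[OF a]
 show "abelian_group (Hom C A B)" "abelian_group (Ext C D B)" using Ext_group Hom_group o xtD(2,3)[OF \<delta>] by auto
 show "Push C x \<delta> \<in> ext C D B" if "x \<in> arr C A B" for x
  using xtD(1)[OF xt_Push[OF morI[OF that o] \<delta>]] .
 show "Push C (x \<oplus>\<^bsub>Hom C A B\<^esub> y) \<delta> = Push C x \<delta> \<oplus>\<^bsub>Ext C D B\<^esub> Push C y \<delta>" if "x \<in> arr C A B" "y \<in> arr C A B" for x y
  by (rule add_push[OF morI[OF that(1) o] morI[OF that(2) o] \<delta>])
qed (fact morD(1)[OF a] morD(1)[OF a'])+

end

section \<open>The opposite category\<close>

lemma opposite_simps [simp]: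
 "Obj (opposite C) = Obj C" "Hom (opposite C) A B = Hom C B A" "Comp (opposite C) g f = Comp C f g"
 "Id (opposite C) = Id C" "Ext (opposite C) D A = Ext C A D" "Push (opposite C) = Pull C" "Pull (opposite C) = Push C"
 by (simp_all add: opposite_def)

lemma mor_opposite [simp]: "mor (opposite C) A B = mor C B A"
 by (auto simp: mor_def)

lemma xt_opposite [simp]: "xt (opposite C) A B = xt C B A"
 by (auto simp: xt_def)

lemma Real_opposite: "Real (opposite C) D A \<delta> = (\<lambda>X. \<lparr> obs = rev (obs X), diffs = rev (diffs X) \<rparr>) ` Real C A D \<delta>"
 by (simp add: opposite_def)

text \<open>The opposite is an involution, so a statement proved for all categories can be read in the opposite
category and translated back.\<close>

lemma opposite_opposite [simp]: "opposite (opposite C) = (C :: ('o, 'm, 'k, 'e) ecat)"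
proof -
 have eta: "\<lparr>obs = obs X, diffs = diffs X\<rparr> = X" for X :: "('o, 'm) cplx"
  by (cases X) simp
 have "Real (opposite (opposite C)) = Real C"
  by (intro ext) (simp add: Real_opposite image_image eta)
 then show ?thesis by (cases C) (simp add: opposite_def)
qed

lemma zero_object_opposite [simp]: "zero_object (opposite C) Z \<longleftrightarrow> zero_object C Z"
 by (auto simp: zero_object_def)

lemma is_biproduct_opposite [simp]:
 "is_biproduct (opposite C) A B S iA iB pA pB \<longleftrightarrow> is_biproduct C A B S pA pB iA iB"
 by (auto simp: is_biproduct_def)

lemma (in additive_bifunctor) opposite_additive_bifunctor: "additive_bifunctor (opposite C)"
proof -
 have "category (opposite C)"
 proof (unfold_locales, unfold opposite_simps)
  show "A = A' \<and> B = B'" if "A \<in> Obj C" "B \<in> Obj C" "A' \<in> Obj C" "B' \<in> Obj C" "f \<in> arr C B A" "f \<in> arr C B' A'" for A B A' B' f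
   using Hom_disjoint[OF that(2,1,4,3,5,6)] by simp
  show "f \<cdot> (g \<cdot> h) = f \<cdot> g \<cdot> h" if "A \<in> Obj C" "B \<in> Obj C" "D \<in> Obj C" "E \<in> Obj C"
   "f \<in> arr C B A" "g \<in> arr C D B" "h \<in> arr C E D" for A B D E f g h
   using Comp_assoc[OF that(4,3,2,1,7,6,5)] by simp
  show "f \<cdot> g \<in> arr C D A" if "A \<in> Obj C" "B \<in> Obj C" "D \<in> Obj C" "f \<in> arr C B A" "g \<in> arr C D B" for A B D f g
   by (rule Comp_closed[OF that(3,2,1,5,4)])
  show "f \<cdot> Id C B = f" if "A \<in> Obj C" "B \<in> Obj C" "f \<in> arr C B A" for A B f
   by (rule Id_right[OF that(2,1,3)])
  show "Id C A \<cdot> f = f" if "A \<in> Obj C" "B \<in> Obj C" "f \<in> arr C B A" for A B f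
   by (rule Id_left[OF that(2,1,3)])
 qed (rule Id_closed)
 moreover have "preadditive_category_axioms (opposite C)"
  by (rule preadditive_category_axioms.intro)
   (simp_all only: opposite_simps Hom_group Comp_add_left Comp_add_right)
 moreover have "additive_category_axioms (opposite C)"
 proof (rule additive_category_axioms.intro)
  show "\<exists>Z. zero_object (opposite C) Z" using zero_object_exists by simp
  fix A B assume "A \<in> Obj (opposite C)" "B \<in> Obj (opposite C)"
  then obtain S iA iB pA pB where "is_biproduct C A B S iA iB pA pB"
   using biproduct_exists[of A B] by auto
  then have "is_biproduct (opposite C) A B S pA pB iA iB" by simp
  then show "\<exists>S iA iB pA pB. is_biproduct (opposite C) A B S iA iB pA pB" by blast
 qed
 moreover have "additive_bifunctor_axioms (opposite C)"
  by (rule additive_bifunctor_axioms.intro; simp only: opposite_simps;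
    (rule Ext_group xtD(1)[OF xt_Pull[OF morI xtI]] xtD(1)[OF xt_Push[OF morI xtI]]
     pull_id[OF xtI] push_id[OF xtI] pull_comp[OF morI morI xtI] push_comp[OF morI morI xtI]
     push_pull[OF morI morI xtI, symmetric] pull_add[OF morI xtI xtI] push_add[OF morI xtI xtI]
     add_pull[OF morI morI xtI] add_push[OF morI morI xtI]; assumption))
 ultimately show ?thesis
  by (intro additive_bifunctor.intro additive_category.intro preadditive_category.intro)
qed

section \<open>Serre pairs\<close>

text \<open>The setting in which linear algebra with values in \<open>J\<close> is done.  It is closed under passing to the
opposite category.\<close>

locale artinian_ecat = additive_bifunctor C for C :: "('o, 'm, 'k, 'e) ecat" (structure) +
 fixes k :: "('k, 'r) ring_scheme" and J :: "('k, 'j, 'x) module_scheme"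
 assumes k_artinian: "artinian_cring k"
  and J_minimal: "minimal_injective_cogenerator k J"
  and linear: "linear_ecat k C"
  and Ext_fin: "Ext_finite k C"

text \<open>Congruence modulo \<open>n\<close>-injectively trivial morphisms with source \<open>A\<close>; in the opposite category it is
congruence modulo \<open>n\<close>-projectively trivial morphisms.\<close>

definition inj_eq :: "('o, 'm, 'k, 'e) ecat \<Rightarrow> 'o \<Rightarrow> 'm \<Rightarrow> 'm \<Rightarrow> bool" where
 "inj_eq C A f g \<longleftrightarrow> (\<forall>Z. \<forall>\<delta>\<in>xt C Z A. Push C f \<delta> = Push C g \<delta>)"

lemma inj_eqD: "inj_eq C A f g \<Longrightarrow> \<delta> \<in> xt C Z A \<Longrightarrow> Push C f \<delta> = Push C g \<delta>"
 by (simp add: inj_eq_def)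

lemma inj_eqI: "(\<And>Z \<delta>. \<delta> \<in> xt C Z A \<Longrightarrow> Push C f \<delta> = Push C g \<delta>) \<Longrightarrow> inj_eq C A f g"
 by (simp add: inj_eq_def)

text \<open>The functional \<open>\<eta>\<close> represents \<open>D \<bbbE>(U, -)\<close> by \<open>A\<close>, with uniqueness modulo \<open>n\<close>-injectively trivial
morphisms.  A Serre pair has this property together with its dual.\<close>

definition push_universal ::
  "('k, 'r) ring_scheme \<Rightarrow> ('k, 'j, 'x) module_scheme \<Rightarrow> ('o, 'm, 'k, 'e) ecat \<Rightarrow> 'o \<Rightarrow> 'o \<Rightarrow> ('e \<Rightarrow> 'j) \<Rightarrow> bool" where
 "push_universal k J C U A \<eta> \<longleftrightarrow>
   (\<forall>X\<in>Obj C. \<forall>\<phi>. linear_map k (Ext C U X) J \<phi> \<longrightarrow> (\<exists>f\<in>mor C X A. \<forall>\<xi>\<in>xt C U X. \<phi> \<xi> = \<eta> (Push C f \<xi>))) \<and>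
   (\<forall>X. \<forall>f\<in>mor C X A. \<forall>g\<in>mor C X A. (\<forall>\<xi>\<in>xt C U X. \<eta> (Push C f \<xi>) = \<eta> (Push C g \<xi>)) \<longrightarrow> inj_eq C X f g)"

lemma push_universalI:
 assumes "\<And>X \<phi>. X \<in> Obj C \<Longrightarrow> linear_map k (Ext C U X) J \<phi> \<Longrightarrow> \<exists>f\<in>mor C X A. \<forall>\<xi>\<in>xt C U X. \<phi> \<xi> = \<eta> (Push C f \<xi>)"
  and "\<And>X f g. f \<in> mor C X A \<Longrightarrow> g \<in> mor C X A \<Longrightarrow>
    (\<And>\<xi>. \<xi> \<in> xt C U X \<Longrightarrow> \<eta> (Push C f \<xi>) = \<eta> (Push C g \<xi>)) \<Longrightarrow> inj_eq C X f g"
 shows "push_universal k J C U A \<eta>"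
 unfolding push_universal_def using assms by (intro conjI ballI allI impI) simp_all

lemma push_universal_ex:
 assumes "push_universal k J C U A \<eta>" and "X \<in> Obj C" and "linear_map k (Ext C U X) J \<phi>"
 shows "\<exists>f\<in>mor C X A. \<forall>\<xi>\<in>xt C U X. \<phi> \<xi> = \<eta> (Push C f \<xi>)"
 using assms unfolding push_universal_def by (elim conjE) (drule bspec, assumption, drule spec, drule mp, assumption, assumption)

lemma push_universal_inj:
 assumes "push_universal k J C U A \<eta>" and "f \<in> mor C X A" and "g \<in> mor C X A"
  and eq: "\<And>\<xi>. \<xi> \<in> xt C U X \<Longrightarrow> \<eta> (Push C f \<xi>) = \<eta> (Push C g \<xi>)"
 shows "inj_eq C X f g"
proof -
 have "(\<forall>\<xi>\<in>xt C U X. \<eta> (Push C f \<xi>) = \<eta> (Push C g \<xi>)) \<longrightarrow> inj_eq C X f g"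
  using assms(1) unfolding push_universal_def by (elim conjE) (drule spec[of _ X], drule bspec[OF _ assms(2)], drule bspec[OF _ assms(3)], assumption)
 then show ?thesis by (rule mp) (intro ballI eq)
qed

definition serre ::
  "('k, 'r) ring_scheme \<Rightarrow> ('k, 'j, 'x) module_scheme \<Rightarrow> ('o, 'm, 'k, 'e) ecat \<Rightarrow> 'o \<Rightarrow> 'o \<Rightarrow> ('e \<Rightarrow> 'j) \<Rightarrow> bool" where
 "serre k J C U A \<eta> \<longleftrightarrow> U \<in> Obj C \<and> A \<in> Obj C \<and> linear_map k (Ext C U A) J \<eta> \<and>
   push_universal k J C U A \<eta> \<and> push_universal k J (opposite C) A U \<eta>"

lemma serre_opposite [simp]: "serre k J (opposite C) A U \<eta> \<longleftrightarrow> serre k J C U A \<eta>"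
 by (auto simp: serre_def)

lemma serreD:
 assumes "serre k J C U A \<eta>"
 shows "U \<in> Obj C" "A \<in> Obj C" "linear_map k (Ext C U A) J \<eta>"
  "push_universal k J C U A \<eta>" "push_universal k J (opposite C) A U \<eta>"
 using assms by (simp_all add: serre_def)

lemma serreI:
 assumes "U \<in> Obj C" "A \<in> Obj C" "linear_map k (Ext C U A) J \<eta>"
  "push_universal k J C U A \<eta>" "push_universal k J (opposite C) A U \<eta>"
 shows "serre k J C U A \<eta>"
 using assms by (simp add: serre_def)

context artinian_ecat
begin

lemma J_injective: "injective_module k J" and J_cogenerator: "cogenerator k J"
 using J_minimal by (simp_all add: minimal_injective_cogenerator_def)

lemma J_module: "module k J"
 using J_injective unfolding injective_module_def by (rule conjunct1)

lemma J_socle: "multiplicity_free_socle k J"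
 by (rule minimal_injective_cogenerator_socle[OF k_artinian J_minimal])

lemma ext_module: "D \<in> Obj C \<Longrightarrow> A \<in> Obj C \<Longrightarrow> module k (Ext C D A)"
 using linear by (simp add: linear_ecat_def)

lemma hom_module: "D \<in> Obj C \<Longrightarrow> A \<in> Obj C \<Longrightarrow> module k (Hom C D A)"
 using linear by (simp add: linear_ecat_def linear_category_def)

lemma ext_fg: "D \<in> Obj C \<Longrightarrow> A \<in> Obj C \<Longrightarrow> finitely_generated_module k (Ext C D A)"
 using Ext_fin by (simp add: Ext_finite_def)

lemma comp_smult:
 assumes "f \<in> mor C A B" "g \<in> mor C B D" "r \<in> carrier k"
 shows "g \<cdot> (r \<odot>\<^bsub>Hom C A B\<^esub> f) = r \<odot>\<^bsub>Hom C A D\<^esub> (g \<cdot> f)"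
  and "(r \<odot>\<^bsub>Hom C B D\<^esub> g) \<cdot> f = r \<odot>\<^bsub>Hom C A D\<^esub> (g \<cdot> f)"
 using linear assms unfolding linear_ecat_def linear_category_def mor_def by simp_all

lemma xt_smult: "r \<in> carrier k \<Longrightarrow> \<delta> \<in> xt C D A \<Longrightarrow> r \<odot>\<^bsub>Ext C D A\<^esub> \<delta> \<in> xt C D A"
 using module.smult_closed[OF ext_module] by (simp add: xt_def)

lemma mor_smult: "r \<in> carrier k \<Longrightarrow> f \<in> mor C D A \<Longrightarrow> r \<odot>\<^bsub>Hom C D A\<^esub> f \<in> mor C D A"
 using module.smult_closed[OF hom_module] by (simp add: mor_def)

lemma push_pull_homogeneous:
 assumes "f \<in> mor C A B" "\<delta> \<in> xt C B D" "g \<in> mor C D E" "r \<in> carrier k"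
 shows "Push C g (Pull C (r \<odot>\<^bsub>Hom C A B\<^esub> f) \<delta>) = r \<odot>\<^bsub>Ext C A E\<^esub> Push C g (Pull C f \<delta>)"
  and "Push C g (Pull C f (r \<odot>\<^bsub>Ext C B D\<^esub> \<delta>)) = r \<odot>\<^bsub>Ext C A E\<^esub> Push C g (Pull C f \<delta>)"
  and "Push C (r \<odot>\<^bsub>Hom C D E\<^esub> g) (Pull C f \<delta>) = r \<odot>\<^bsub>Ext C A E\<^esub> Push C g (Pull C f \<delta>)"
proof -
 note H = linear[unfolded linear_ecat_def, THEN conjunct2, THEN conjunct2,
   THEN bspec, OF morD(2)[OF assms(1)], THEN bspec, OF morD(3)[OF assms(1)],
   THEN bspec, OF xtD(3)[OF assms(2)], THEN bspec, OF morD(3)[OF assms(3)],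
   THEN bspec, OF assms(4), THEN bspec, OF morD(1)[OF assms(1)],
   THEN bspec, OF xtD(1)[OF assms(2)], THEN bspec, OF morD(1)[OF assms(3)]]
 show "Push C g (Pull C (r \<odot>\<^bsub>Hom C A B\<^esub> f) \<delta>) = r \<odot>\<^bsub>Ext C A E\<^esub> Push C g (Pull C f \<delta>)"
  by (rule H[THEN conjunct1])
 show "Push C g (Pull C f (r \<odot>\<^bsub>Ext C B D\<^esub> \<delta>)) = r \<odot>\<^bsub>Ext C A E\<^esub> Push C g (Pull C f \<delta>)"
  by (rule H[THEN conjunct2, THEN conjunct1])
 show "Push C (r \<odot>\<^bsub>Hom C D E\<^esub> g) (Pull C f \<delta>) = r \<odot>\<^bsub>Ext C A E\<^esub> Push C g (Pull C f \<delta>)"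
  by (rule H[THEN conjunct2, THEN conjunct2])
qed

lemma push_smult:
 assumes a: "a \<in> mor C A B" and \<delta>: "\<delta> \<in> xt C D A" and r: "r \<in> carrier k"
 shows "Push C a (r \<odot>\<^bsub>Ext C D A\<^esub> \<delta>) = r \<odot>\<^bsub>Ext C D B\<^esub> Push C a \<delta>"
 using push_pull_homogeneous(2)[OF mor_Id[OF xtD(2)[OF \<delta>]] \<delta> a r]
 by (simp only: pull_id[OF \<delta>] pull_id[OF xt_smult[OF r \<delta>]])

lemma smult_push:
 assumes a: "a \<in> mor C A B" and \<delta>: "\<delta> \<in> xt C D A" and r: "r \<in> carrier k"
 shows "Push C (r \<odot>\<^bsub>Hom C A B\<^esub> a) \<delta> = r \<odot>\<^bsub>Ext C D B\<^esub> Push C a \<delta>"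
 using push_pull_homogeneous(3)[OF mor_Id[OF xtD(2)[OF \<delta>]] \<delta> a r]
 by (simp only: pull_id[OF \<delta>])

lemma pull_smult:
 assumes a: "a \<in> mor C B D" and \<delta>: "\<delta> \<in> xt C D A" and r: "r \<in> carrier k"
 shows "Pull C a (r \<odot>\<^bsub>Ext C D A\<^esub> \<delta>) = r \<odot>\<^bsub>Ext C B A\<^esub> Pull C a \<delta>"
 using push_pull_homogeneous(2)[OF a \<delta> mor_Id[OF xtD(3)[OF \<delta>]] r]
 by (simp only: push_id[OF xt_Pull[OF a xt_smult[OF r \<delta>]]] push_id[OF xt_Pull[OF a \<delta>]])

lemma smult_pull:
 assumes a: "a \<in> mor C B D" and \<delta>: "\<delta> \<in> xt C D A" and r: "r \<in> carrier k"
 shows "Pull C (r \<odot>\<^bsub>Hom C B D\<^esub> a) \<delta> = r \<odot>\<^bsub>Ext C B A\<^esub> Pull C a \<delta>"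
 using push_pull_homogeneous(1)[OF a \<delta> mor_Id[OF xtD(3)[OF \<delta>]] r]
 by (simp only: push_id[OF xt_Pull[OF mor_smult[OF r a] \<delta>]] push_id[OF xt_Pull[OF a \<delta>]])

lemma push_linear:
 assumes a: "a \<in> mor C A B" and D: "D \<in> Obj C"
 shows "linear_map k (Ext C D A) (Ext C D B) (Push C a)"
proof (rule linear_mapI)
 note I = xtI[OF _ D morD(2)[OF a]]
 show "Push C a x \<in> ext C D B" if "x \<in> ext C D A" for x using xtD(1)[OF xt_Push[OF a I[OF that]]] .
 show "Push C a (x \<oplus>\<^bsub>Ext C D A\<^esub> y) = Push C a x \<oplus>\<^bsub>Ext C D B\<^esub> Push C a y" if "x \<in> ext C D A" "y \<in> ext C D A" for x y
  by (rule push_add[OF a I[OF that(1)] I[OF that(2)]])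
 show "Push C a (r \<odot>\<^bsub>Ext C D A\<^esub> x) = r \<odot>\<^bsub>Ext C D B\<^esub> Push C a x" if "r \<in> carrier k" "x \<in> ext C D A" for r x
  by (rule push_smult[OF a I[OF that(2)] that(1)])
qed

lemma pull_linear:
 assumes a: "a \<in> mor C B D" and A: "A \<in> Obj C"
 shows "linear_map k (Ext C D A) (Ext C B A) (Pull C a)"
proof (rule linear_mapI)
 note I = xtI[OF _ morD(3)[OF a] A]
 show "Pull C a x \<in> ext C B A" if "x \<in> ext C D A" for x using xtD(1)[OF xt_Pull[OF a I[OF that]]] .
 show "Pull C a (x \<oplus>\<^bsub>Ext C D A\<^esub> y) = Pull C a x \<oplus>\<^bsub>Ext C B A\<^esub> Pull C a y" if "x \<in> ext C D A" "y \<in> ext C D A" for x y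
  by (rule pull_add[OF a I[OF that(1)] I[OF that(2)]])
 show "Pull C a (r \<odot>\<^bsub>Ext C D A\<^esub> x) = r \<odot>\<^bsub>Ext C B A\<^esub> Pull C a x" if "r \<in> carrier k" "x \<in> ext C D A" for r x
  by (rule pull_smult[OF a I[OF that(2)] that(1)])
qed

lemma opposite_artinian_ecat: "artinian_ecat (opposite C) k J"
proof (intro artinian_ecat.intro artinian_ecat_axioms.intro opposite_additive_bifunctor k_artinian J_minimal)
 have pc: "preadditive_category (opposite C)"
  using opposite_additive_bifunctor by (simp add: additive_bifunctor_def additive_category_def)
 show "linear_ecat k (opposite C)"
  unfolding linear_ecat_def linear_category_def opposite_simps
 proof (intro conjI ballI pc)
  fix A B assume o: "A \<in> Obj C" "B \<in> Obj C"
  show "module k (Hom C B A)" by (rule hom_module[OF o(2,1)])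
  show "module k (Ext C B A)" by (rule ext_module[OF o(2,1)])
  fix D r f g assume o': "D \<in> Obj C" "r \<in> carrier k" "f \<in> arr C B A" "g \<in> arr C D B"
  show "(r \<odot>\<^bsub>Hom C B A\<^esub> f) \<cdot> g = r \<odot>\<^bsub>Hom C D A\<^esub> (f \<cdot> g)" "f \<cdot> (r \<odot>\<^bsub>Hom C D B\<^esub> g) = r \<odot>\<^bsub>Hom C D A\<^esub> (f \<cdot> g)"
   using comp_smult[OF morI[OF o'(4,1) o(2)] morI[OF o'(3) o(2,1)] o'(2)] by simp_all
 next
  fix A B D E r f \<delta> g
  assume o: "A \<in> Obj C" "B \<in> Obj C" "D \<in> Obj C" "E \<in> Obj C" "r \<in> carrier k"
   and fg: "f \<in> arr C B A" "\<delta> \<in> ext C D B" "g \<in> arr C E D"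
  note f = morI[OF fg(1) o(2,1)] and \<delta> = xtI[OF fg(2) o(3,2)] and g = morI[OF fg(3) o(4,3)]
  note H = push_pull_homogeneous[OF g \<delta> f o(5)]
  note sw = push_pull[OF f g \<delta>] push_pull[OF f g xt_smult[OF o(5) \<delta>]]
   push_pull[OF mor_smult[OF o(5) f] g \<delta>] push_pull[OF f mor_smult[OF o(5) g] \<delta>]
  show "Pull C g (Push C (r \<odot>\<^bsub>Hom C B A\<^esub> f) \<delta>) = r \<odot>\<^bsub>Ext C E A\<^esub> Pull C g (Push C f \<delta>)"
   using H(3) by (simp only: sw)
  show "Pull C g (Push C f (r \<odot>\<^bsub>Ext C D B\<^esub> \<delta>)) = r \<odot>\<^bsub>Ext C E A\<^esub> Pull C g (Push C f \<delta>)"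
   using H(2) by (simp only: sw)
  show "Pull C (r \<odot>\<^bsub>Hom C E D\<^esub> g) (Push C f \<delta>) = r \<odot>\<^bsub>Ext C E A\<^esub> Pull C g (Push C f \<delta>)"
   using H(1) by (simp only: sw)
 qed
 show "Ext_finite k (opposite C)" using ext_fg by (simp add: Ext_finite_def)
qed

lemma push_universal_cong:
 assumes U: "push_universal k J C U A \<eta>" and UO: "U \<in> Obj C" and eq: "\<And>\<xi>. \<xi> \<in> xt C U A \<Longrightarrow> \<eta> \<xi> = \<eta>' \<xi>"
 shows "push_universal k J C U A \<eta>'"
proof (rule push_universalI)
 have e: "\<eta> (Push C f \<xi>) = \<eta>' (Push C f \<xi>)" if "f \<in> mor C X A" "\<xi> \<in> xt C U X" for f \<xi> X
  by (rule eq[OF xt_Push[OF that]])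
 show "\<exists>f\<in>mor C X A. \<forall>\<xi>\<in>xt C U X. \<phi> \<xi> = \<eta>' (Push C f \<xi>)" if X: "X \<in> Obj C" and \<phi>: "linear_map k (Ext C U X) J \<phi>" for X \<phi>
 proof -
  obtain f where f: "f \<in> mor C X A" "\<forall>\<xi>\<in>xt C U X. \<phi> \<xi> = \<eta> (Push C f \<xi>)"
   using push_universal_ex[OF U X \<phi>] by (rule bexE)
  show ?thesis
  proof (intro bexI[OF _ f(1)] ballI)
   fix \<xi> assume \<xi>: "\<xi> \<in> xt C U X"
   show "\<phi> \<xi> = \<eta>' (Push C f \<xi>)" using f(2) \<xi> e[OF f(1) \<xi>] by simp
  qed
 qed
 show "inj_eq C X f g" if f: "f \<in> mor C X A" and g: "g \<in> mor C X A"
  and eqs: "\<And>\<xi>. \<xi> \<in> xt C U X \<Longrightarrow> \<eta>' (Push C f \<xi>) = \<eta>' (Push C g \<xi>)" for X f g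
 proof (rule push_universal_inj[OF U f g])
  fix \<xi> assume \<xi>: "\<xi> \<in> xt C U X"
  show "\<eta> (Push C f \<xi>) = \<eta> (Push C g \<xi>)" using eqs[OF \<xi>] e[OF f \<xi>] e[OF g \<xi>] by simp
 qed
qed

text \<open>The functionals \<open>\<xi> \<mapsto> \<eta> (f\<^sub>* \<xi>)\<close> form a submodule of the dual of \<open>\<bbbE>(U, X)\<close>, and they separate points because
every nonzero \<open>\<xi>\<close> is pushed to \<open>\<delta>\<close> by some \<open>f\<close>.  For uniqueness, a nonzero difference \<open>f\<^sub>* \<xi> - g\<^sub>* \<xi>\<close> with
\<open>\<xi> \<in> \<bbbE>(Z, X)\<close> could be pulled back to \<open>\<delta>\<close>, on which \<open>\<eta>\<close> does not vanish.\<close>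

lemma socle_push_universal:
 assumes \<delta>: "\<delta> \<in> xt C U A" and \<eta>: "linear_map k (Ext C U A) J \<eta>" and \<eta>\<delta>: "\<eta> \<delta> \<noteq> \<zero>\<^bsub>J\<^esub>"
  and push: "\<And>X \<xi>. \<xi> \<in> xt C U X \<Longrightarrow> \<xi> \<noteq> \<zero>\<^bsub>Ext C U X\<^esub> \<Longrightarrow> \<exists>f\<in>mor C X A. Push C f \<xi> = \<delta>"
  and pull: "\<And>X \<xi>. \<xi> \<in> xt C X A \<Longrightarrow> \<xi> \<noteq> \<zero>\<^bsub>Ext C X A\<^esub> \<Longrightarrow> \<exists>c\<in>mor C U X. Pull C c \<xi> = \<delta>"
 shows "push_universal k J C U A \<eta>"
proof (rule push_universalI)
 note UO = xtD(2)[OF \<delta>] and AO = xtD(3)[OF \<delta>]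
 interpret J: module k J by (rule J_module)
 show "\<exists>f\<in>mor C X A. \<forall>\<xi>\<in>xt C U X. \<phi> \<xi> = \<eta> (Push C f \<xi>)" if X: "X \<in> Obj C" and \<phi>: "linear_map k (Ext C U X) J \<phi>" for X \<phi>
 proof -
  have "\<exists>f\<in>mor C X A. \<forall>\<xi>\<in>ext C U X. \<phi> \<xi> = \<eta> (Push C f \<xi>)"
  proof (rule separating_functionals_exhaust[OF k_artinian ext_module[OF UO X] ext_fg[OF UO X] J_module J_socle mor_zero[OF X AO], where s = "\<lambda>f \<xi>. \<eta> (Push C f \<xi>)"])
   show "linear_map k (Ext C U X) J (\<lambda>\<xi>. \<eta> (Push C f \<xi>))" if f: "f \<in> mor C X A" for f
    by (rule linear_map_comp[OF push_linear[OF f UO] \<eta>])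
   show "\<exists>h\<in>mor C X A. \<forall>\<xi>\<in>ext C U X. \<eta> (Push C h \<xi>) = \<eta> (Push C f \<xi>) \<oplus>\<^bsub>J\<^esub> \<eta> (Push C g \<xi>)"
    if f: "f \<in> mor C X A" and g: "g \<in> mor C X A" for f g
   proof (intro bexI[OF _ mor_add[OF f g]] ballI)
    fix \<xi> assume "\<xi> \<in> ext C U X"
    then have \<xi>: "\<xi> \<in> xt C U X" using UO X by (rule xtI)
    show "\<eta> (Push C (f \<oplus>\<^bsub>Hom C X A\<^esub> g) \<xi>) = \<eta> (Push C f \<xi>) \<oplus>\<^bsub>J\<^esub> \<eta> (Push C g \<xi>)"
     unfolding add_push[OF f g \<xi>]
     by (rule linear_mapD(2)[OF \<eta> xtD(1)[OF xt_Push[OF f \<xi>]] xtD(1)[OF xt_Push[OF g \<xi>]]])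
   qed
   show "\<exists>h\<in>mor C X A. \<forall>\<xi>\<in>ext C U X. \<eta> (Push C h \<xi>) = r \<odot>\<^bsub>J\<^esub> \<eta> (Push C f \<xi>)"
    if r: "r \<in> carrier k" and f: "f \<in> mor C X A" for r f
   proof (intro bexI[OF _ mor_smult[OF r f]] ballI)
    fix \<xi> assume "\<xi> \<in> ext C U X"
    then have \<xi>: "\<xi> \<in> xt C U X" using UO X by (rule xtI)
    show "\<eta> (Push C (r \<odot>\<^bsub>Hom C X A\<^esub> f) \<xi>) = r \<odot>\<^bsub>J\<^esub> \<eta> (Push C f \<xi>)"
     unfolding smult_push[OF f \<xi> r] by (rule linear_mapD(3)[OF \<eta> r xtD(1)[OF xt_Push[OF f \<xi>]]])
   qed
   show "\<exists>f\<in>mor C X A. \<eta> (Push C f \<xi>) \<noteq> \<zero>\<^bsub>J\<^esub>" if \<xi>: "\<xi> \<in> ext C U X" "\<xi> \<noteq> \<zero>\<^bsub>Ext C U X\<^esub>" for \<xi>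
   proof -
    obtain f where f: "f \<in> mor C X A" "Push C f \<xi> = \<delta>" using push[OF xtI[OF \<xi>(1) UO X] \<xi>(2)] by (rule bexE)
    show ?thesis using \<eta>\<delta> by (intro bexI[OF _ f(1)]) (simp add: f(2))
   qed
   show "linear_map k (Ext C U X) J \<phi>" by (rule \<phi>)
  qed
  then show ?thesis unfolding xt_def using UO X by simp
 qed
 show "inj_eq C X f g" if f: "f \<in> mor C X A" and g: "g \<in> mor C X A"
  and eqs: "\<And>\<xi>. \<xi> \<in> xt C U X \<Longrightarrow> \<eta> (Push C f \<xi>) = \<eta> (Push C g \<xi>)" for X f g
 proof (rule inj_eqI, rule ccontr)
  fix Z \<rho> assume \<rho>: "\<rho> \<in> xt C Z X" and ne: "Push C f \<rho> \<noteq> Push C g \<rho>"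
  note h = mor_diff[OF f g]
  let ?h = "f \<ominus>\<^bsub>Hom C X A\<^esub> g"
  have "Push C ?h \<rho> \<noteq> \<zero>\<^bsub>Ext C Z A\<^esub>"
   unfolding diff_push[OF f g \<rho>]
   using ne abelian_group.diff_zero_iff[OF xt_group[OF xt_Push[OF f \<rho>]] xtD(1)[OF xt_Push[OF f \<rho>]] xtD(1)[OF xt_Push[OF g \<rho>]]] by simp
  from pull[OF xt_Push[OF h \<rho>] this] obtain c where c: "c \<in> mor C U Z" "Pull C c (Push C ?h \<rho>) = \<delta>" by (rule bexE)
  note cr = xt_Pull[OF c(1) \<rho>]
  have "\<delta> = Push C ?h (Pull C c \<rho>)" using c(2) push_pull[OF h c(1) \<rho>] by simp
  also have "\<dots> = Push C f (Pull C c \<rho>) \<ominus>\<^bsub>Ext C U A\<^esub> Push C g (Pull C c \<rho>)" by (rule diff_push[OF f g cr])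
  finally have "\<eta> \<delta> = \<eta> (Push C f (Pull C c \<rho>)) \<ominus>\<^bsub>J\<^esub> \<eta> (Push C g (Pull C c \<rho>))"
   using linear_map_minus[OF ext_module[OF UO AO] J_module \<eta> xtD(1)[OF xt_Push[OF f cr]] xtD(1)[OF xt_Push[OF g cr]]] by simp
  then have "\<eta> \<delta> = \<zero>\<^bsub>J\<^esub>"
   using eqs[OF cr] J.minus_zero_iff linear_mapD(1)[OF \<eta> xtD(1)[OF xt_Push[OF g cr]]] by simp
  then show False using \<eta>\<delta> by simp
 qed
qed

end

context artinian_ecat
begin

interpretation op: artinian_ecat "opposite C" k J by (rule opposite_artinian_ecat)

lemma socle_serre:
 assumes \<delta>: "\<delta> \<in> xt C U A" and \<delta>0: "\<delta> \<noteq> \<zero>\<^bsub>Ext C U A\<^esub>"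
  and push: "\<And>X \<xi>. \<xi> \<in> xt C U X \<Longrightarrow> \<xi> \<noteq> \<zero>\<^bsub>Ext C U X\<^esub> \<Longrightarrow> \<exists>f\<in>mor C X A. Push C f \<xi> = \<delta>"
  and pull: "\<And>X \<xi>. \<xi> \<in> xt C X A \<Longrightarrow> \<xi> \<noteq> \<zero>\<^bsub>Ext C X A\<^esub> \<Longrightarrow> \<exists>c\<in>mor C U X. Pull C c \<xi> = \<delta>"
 shows "\<exists>\<eta>. serre k J C U A \<eta>"
proof -
 note UO = xtD(2)[OF \<delta>] and AO = xtD(3)[OF \<delta>]
 from nonzero_functional[OF ext_module[OF UO AO] J_injective J_cogenerator xtD(1)[OF \<delta>] \<delta>0]
 obtain \<eta> where \<eta>: "linear_map k (Ext C U A) J \<eta>" "\<eta> \<delta> \<noteq> \<zero>\<^bsub>J\<^esub>" by (elim exE conjE)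
 have 1: "push_universal k J C U A \<eta>"
  by (rule socle_push_universal[OF \<delta> \<eta> push pull])
 have 2: "push_universal k J (opposite C) A U \<eta>"
  by (rule op.socle_push_universal[of \<delta>]) (simp_all add: \<delta> \<eta> push pull)
 show ?thesis by (intro exI[of _ \<eta>] serreI UO AO \<eta>(1) 1 2)
qed

text \<open>Representing objects are unique in the stable category.  A Serre pair can therefore be transported along
mutually inverse morphisms modulo \<open>n\<close>-injectively trivial ones.\<close>

lemma serre_iso_mod_injectives:
 assumes S: "serre k J C U A \<eta>" and f: "f \<in> mor C A' A" and g: "g \<in> mor C A A'"
  and fg: "inj_eq C A (f \<cdot> g) (Id C A)" and gf: "inj_eq C A' (g \<cdot> f) (Id C A')"
 shows "serre k J C U A' (\<lambda>\<xi>. \<eta> (Push C f \<xi>))"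
proof (rule serreI)
 note S' = serreD[OF S]
 show "U \<in> Obj C" "A' \<in> Obj C" using S' morD(2)[OF f] by auto
 show "linear_map k (Ext C U A') J (\<lambda>\<xi>. \<eta> (Push C f \<xi>))"
  by (rule linear_map_comp[OF push_linear[OF f S'(1)] S'(3)])
 have fg': "Push C f (Push C g \<xi>) = \<xi>" if \<xi>: "\<xi> \<in> xt C Z A" for Z \<xi>
  using inj_eqD[OF fg \<xi>] push_comp[OF g f \<xi>] push_id[OF \<xi>] by simp
 have gf': "Push C g (Push C f \<xi>) = \<xi>" if \<xi>: "\<xi> \<in> xt C Z A'" for Z \<xi>
  using inj_eqD[OF gf \<xi>] push_comp[OF f g \<xi>] push_id[OF \<xi>] by simp
 show "push_universal k J C U A' (\<lambda>\<xi>. \<eta> (Push C f \<xi>))"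
 proof (rule push_universalI)
  fix X \<phi> assume X: "X \<in> Obj C" and \<phi>: "linear_map k (Ext C U X) J \<phi>"
  obtain h where h: "h \<in> mor C X A" "\<forall>\<xi>\<in>xt C U X. \<phi> \<xi> = \<eta> (Push C h \<xi>)"
   using push_universal_ex[OF S'(4) X \<phi>] by (rule bexE)
  show "\<exists>h\<in>mor C X A'. \<forall>\<xi>\<in>xt C U X. \<phi> \<xi> = \<eta> (Push C f (Push C h \<xi>))"
  proof (intro bexI[OF _ mor_comp[OF h(1) g]] ballI)
   fix \<xi> assume \<xi>: "\<xi> \<in> xt C U X"
   show "\<phi> \<xi> = \<eta> (Push C f (Push C (g \<cdot> h) \<xi>))"
    unfolding push_comp[OF h(1) g \<xi>] fg'[OF xt_Push[OF h(1) \<xi>]] using h(2) \<xi> by simp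
  qed
 next
  fix X h h' assume h: "h \<in> mor C X A'" and h': "h' \<in> mor C X A'"
   and eqs: "\<And>\<xi>. \<xi> \<in> xt C U X \<Longrightarrow> \<eta> (Push C f (Push C h \<xi>)) = \<eta> (Push C f (Push C h' \<xi>))"
  have e: "inj_eq C X (f \<cdot> h) (f \<cdot> h')"
   by (rule push_universal_inj[OF S'(4) mor_comp[OF h f] mor_comp[OF h' f]])
    (simp only: push_comp[OF h f] push_comp[OF h' f] eqs)
  show "inj_eq C X h h'"
  proof (rule inj_eqI)
   fix Z \<xi> assume \<xi>: "\<xi> \<in> xt C Z X"
   have eq: "Push C f (Push C h \<xi>) = Push C f (Push C h' \<xi>)"
    using inj_eqD[OF e \<xi>] push_comp[OF h f \<xi>] push_comp[OF h' f \<xi>] by simp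
   have "Push C h \<xi> = Push C g (Push C f (Push C h \<xi>))" by (rule gf'[OF xt_Push[OF h \<xi>], symmetric])
   also have "\<dots> = Push C h' \<xi>" unfolding eq by (rule gf'[OF xt_Push[OF h' \<xi>]])
   finally show "Push C h \<xi> = Push C h' \<xi>" .
  qed
 qed
 show "push_universal k J (opposite C) A' U (\<lambda>\<xi>. \<eta> (Push C f \<xi>))"
 proof (rule push_universalI, unfold opposite_simps mor_opposite xt_opposite)
  fix X \<phi> assume X: "X \<in> Obj C" and \<phi>: "linear_map k (Ext C X A') J \<phi>"
  have lin: "linear_map k (Ext C X A) J (\<lambda>\<xi>. \<phi> (Push C g \<xi>))" by (rule linear_map_comp[OF push_linear[OF g X] \<phi>])
  obtain c where c: "c \<in> mor C U X" "\<forall>\<xi>\<in>xt C X A. \<phi> (Push C g \<xi>) = \<eta> (Pull C c \<xi>)"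
   using push_universal_ex[OF S'(5), of X, unfolded opposite_simps mor_opposite xt_opposite, OF X lin] by (rule bexE)
  show "\<exists>c\<in>mor C U X. \<forall>\<xi>\<in>xt C X A'. \<phi> \<xi> = \<eta> (Push C f (Pull C c \<xi>))"
  proof (intro bexI[OF _ c(1)] ballI)
   fix \<xi> assume \<xi>: "\<xi> \<in> xt C X A'"
   show "\<phi> \<xi> = \<eta> (Push C f (Pull C c \<xi>))"
    unfolding push_pull[OF f c(1) \<xi>] using bspec[OF c(2) xt_Push[OF f \<xi>]] gf'[OF \<xi>] by simp
  qed
 next
  fix X c d assume c: "c \<in> mor C U X" and d: "d \<in> mor C U X"
   and eqs: "\<And>\<xi>. \<xi> \<in> xt C X A' \<Longrightarrow> \<eta> (Push C f (Pull C c \<xi>)) = \<eta> (Push C f (Pull C d \<xi>))"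
  show "inj_eq (opposite C) X c d"
  proof (rule push_universal_inj[OF S'(5)], unfold opposite_simps mor_opposite xt_opposite)
   fix \<xi> assume \<xi>: "\<xi> \<in> xt C X A"
   note g\<xi> = xt_Push[OF g \<xi>]
   show "\<eta> (Pull C c \<xi>) = \<eta> (Pull C d \<xi>)"
    using eqs[OF g\<xi>] push_pull[OF f c g\<xi>] push_pull[OF f d g\<xi>] fg'[OF \<xi>] by simp
  qed (rule c d)+
 qed
qed

end

section \<open>Direct sums and zero objects\<close>

lemma is_biproductD:
 assumes "is_biproduct C A B S iA iB pA pB"
 shows "iA \<in> mor C A S" "iB \<in> mor C B S" "pA \<in> mor C S A" "pB \<in> mor C S B"
  "pA \<cdot>\<^bsub>C\<^esub> iA = Id C A" "pB \<cdot>\<^bsub>C\<^esub> iB = Id C B"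
  "pB \<cdot>\<^bsub>C\<^esub> iA = zero_arr C A B" "pA \<cdot>\<^bsub>C\<^esub> iB = zero_arr C B A"
  "iA \<cdot>\<^bsub>C\<^esub> pA \<oplus>\<^bsub>Hom C S S\<^esub> iB \<cdot>\<^bsub>C\<^esub> pB = Id C S"
 using assms unfolding is_biproduct_def mor_def by simp_all

lemma is_biproductI:
 assumes "iA \<in> mor C A S" "iB \<in> mor C B S" "pA \<in> mor C S A" "pB \<in> mor C S B"
  "pA \<cdot>\<^bsub>C\<^esub> iA = Id C A" "pB \<cdot>\<^bsub>C\<^esub> iB = Id C B"
  "pB \<cdot>\<^bsub>C\<^esub> iA = zero_arr C A B" "pA \<cdot>\<^bsub>C\<^esub> iB = zero_arr C B A"
  "iA \<cdot>\<^bsub>C\<^esub> pA \<oplus>\<^bsub>Hom C S S\<^esub> iB \<cdot>\<^bsub>C\<^esub> pB = Id C S"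
 shows "is_biproduct C A B S iA iB pA pB"
 using assms unfolding is_biproduct_def mor_def by simp

context preadditive_category
begin

lemma biproduct_swap:
 assumes "is_biproduct C A B S iA iB pA pB"
 shows "is_biproduct C B A S iB iA pB pA"
proof -
 note b = is_biproductD[OF assms]
 interpret H: abelian_group "Hom C S S" by (rule mor_group[OF mor_comp[OF b(3,1)]])
 have "iB \<cdot> pB \<oplus>\<^bsub>Hom C S S\<^esub> iA \<cdot> pA = Id C S"
  unfolding b(9)[symmetric] by (rule H.a_comm[OF morD(1)[OF mor_comp[OF b(4,2)]] morD(1)[OF mor_comp[OF b(3,1)]]])
 then show ?thesis by (intro is_biproductI b)
qed

lemma zero_objectI:
 assumes Y: "Y \<in> Obj C" and z: "Id C Y = zero_arr C Y Y"
 shows "zero_object C Y"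
 unfolding zero_object_def
proof (intro conjI ballI Y)
 fix A assume A: "A \<in> Obj C"
 show "\<exists>!f. f \<in> arr C A Y"
 proof (rule ex1I)
  show "zero_arr C A Y \<in> arr C A Y" by (rule morD(1)[OF mor_zero[OF A Y]])
  fix f assume "f \<in> arr C A Y"
  then have f: "f \<in> mor C A Y" using A Y by (rule morI)
  show "f = zero_arr C A Y" using id_left[OF f] comp_zero_left[OF f Y] by (simp add: z)
 qed
 show "\<exists>!f. f \<in> arr C Y A"
 proof (rule ex1I)
  show "zero_arr C Y A \<in> arr C Y A" by (rule morD(1)[OF mor_zero[OF Y A]])
  fix f assume "f \<in> arr C Y A"
  then have f: "f \<in> mor C Y A" using Y A by (rule morI)
  show "f = zero_arr C Y A" using id_right[OF f] comp_zero_right[OF Y f] by (simp add: z)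
 qed
qed

lemma zero_objectD:
 assumes Z: "zero_object C Z"
 shows "Z \<in> Obj C" "f \<in> mor C A Z \<Longrightarrow> g \<in> mor C A Z \<Longrightarrow> f = g" "f \<in> mor C Z A \<Longrightarrow> g \<in> mor C Z A \<Longrightarrow> f = g"
proof -
 show "Z \<in> Obj C" using Z by (simp add: zero_object_def)
 show "f = g" if "f \<in> mor C A Z" "g \<in> mor C A Z"
  using Z[unfolded zero_object_def, THEN conjunct2, THEN bspec, OF morD(2)[OF that(1)], THEN conjunct1]
   morD(1)[OF that(1)] morD(1)[OF that(2)] by metis
 show "f = g" if "f \<in> mor C Z A" "g \<in> mor C Z A"
  using Z[unfolded zero_object_def, THEN conjunct2, THEN bspec, OF morD(3)[OF that(1)], THEN conjunct2]
   morD(1)[OF that(1)] morD(1)[OF that(2)] by metis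
qed

lemma mor_finsum:
 assumes "A \<in> Obj C" "B \<in> Obj C" "\<And>i. i \<in> I \<Longrightarrow> f i \<in> mor C A B"
 shows "(\<Oplus>\<^bsub>Hom C A B\<^esub>i\<in>I. f i) \<in> mor C A B"
proof -
 interpret H: abelian_group "Hom C A B" by (rule Hom_group[OF assms(1,2)])
 have "f \<in> I \<rightarrow> arr C A B" by (intro Pi_I morD(1)[OF assms(3)])
 then show ?thesis using assms(1,2) by (intro morI H.finsum_closed)
qed

lemma comp_finsum_right:
 assumes fin: "finite I" and A: "A \<in> Obj C" and g: "g \<in> mor C B D" and f: "\<And>i. i \<in> I \<Longrightarrow> f i \<in> mor C A B"
 shows "g \<cdot> (\<Oplus>\<^bsub>Hom C A B\<^esub>i\<in>I. f i) = (\<Oplus>\<^bsub>Hom C A D\<^esub>i\<in>I. g \<cdot> f i)"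
 using fin f
proof (induction I rule: finite_induct)
 case empty
 interpret H: abelian_group "Hom C A B" by (rule Hom_group[OF A morD(2)[OF g]])
 interpret K: abelian_group "Hom C A D" by (rule Hom_group[OF A morD(3)[OF g]])
 show ?case unfolding H.finsum_empty K.finsum_empty by (rule comp_zero_right[OF A g])
next
 case (insert x F)
 interpret H: abelian_group "Hom C A B" by (rule Hom_group[OF A morD(2)[OF g]])
 interpret K: abelian_group "Hom C A D" by (rule Hom_group[OF A morD(3)[OF g]])
 have fx: "f x \<in> mor C A B" and fF: "\<And>i. i \<in> F \<Longrightarrow> f i \<in> mor C A B" using insert.prems by simp_all
 have c1: "f \<in> F \<rightarrow> arr C A B" by (intro Pi_I morD(1)[OF fF])
 have c2: "(\<lambda>i. g \<cdot> f i) \<in> F \<rightarrow> arr C A D" using morD(1)[OF mor_comp[OF fF g]] by (intro Pi_I)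
 have "g \<cdot> (\<Oplus>\<^bsub>Hom C A B\<^esub>i\<in>insert x F. f i) = g \<cdot> (f x \<oplus>\<^bsub>Hom C A B\<^esub> (\<Oplus>\<^bsub>Hom C A B\<^esub>i\<in>F. f i))"
  by (simp only: H.finsum_insert[OF insert.hyps c1 morD(1)[OF fx]])
 also have "\<dots> = g \<cdot> f x \<oplus>\<^bsub>Hom C A D\<^esub> (\<Oplus>\<^bsub>Hom C A D\<^esub>i\<in>F. g \<cdot> f i)"
  by (simp only: comp_add_right[OF fx mor_finsum[OF A morD(2)[OF g] fF] g] insert.IH[OF fF])
 also have "\<dots> = (\<Oplus>\<^bsub>Hom C A D\<^esub>i\<in>insert x F. g \<cdot> f i)"
  by (simp only: K.finsum_insert[OF insert.hyps c2 morD(1)[OF mor_comp[OF fx g]]])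
 finally show ?case .
qed

lemma comp_finsum_left:
 assumes fin: "finite I" and D: "D \<in> Obj C" and g: "g \<in> mor C A B" and f: "\<And>i. i \<in> I \<Longrightarrow> f i \<in> mor C B D"
 shows "(\<Oplus>\<^bsub>Hom C B D\<^esub>i\<in>I. f i) \<cdot> g = (\<Oplus>\<^bsub>Hom C A D\<^esub>i\<in>I. f i \<cdot> g)"
 using fin f
proof (induction I rule: finite_induct)
 case empty
 interpret H: abelian_group "Hom C B D" by (rule Hom_group[OF morD(3)[OF g] D])
 interpret K: abelian_group "Hom C A D" by (rule Hom_group[OF morD(2)[OF g] D])
 show ?case unfolding H.finsum_empty K.finsum_empty by (rule comp_zero_left[OF g D])
next
 case (insert x F)
 interpret H: abelian_group "Hom C B D" by (rule Hom_group[OF morD(3)[OF g] D])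
 interpret K: abelian_group "Hom C A D" by (rule Hom_group[OF morD(2)[OF g] D])
 have fx: "f x \<in> mor C B D" and fF: "\<And>i. i \<in> F \<Longrightarrow> f i \<in> mor C B D" using insert.prems by simp_all
 have c1: "f \<in> F \<rightarrow> arr C B D" by (intro Pi_I morD(1)[OF fF])
 have c2: "(\<lambda>i. f i \<cdot> g) \<in> F \<rightarrow> arr C A D" using morD(1)[OF mor_comp[OF g fF]] by (intro Pi_I)
 have "(\<Oplus>\<^bsub>Hom C B D\<^esub>i\<in>insert x F. f i) \<cdot> g = (f x \<oplus>\<^bsub>Hom C B D\<^esub> (\<Oplus>\<^bsub>Hom C B D\<^esub>i\<in>F. f i)) \<cdot> g"
  by (simp only: H.finsum_insert[OF insert.hyps c1 morD(1)[OF fx]])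
 also have "\<dots> = f x \<cdot> g \<oplus>\<^bsub>Hom C A D\<^esub> (\<Oplus>\<^bsub>Hom C A D\<^esub>i\<in>F. f i \<cdot> g)"
  by (simp only: comp_add_left[OF g fx mor_finsum[OF morD(3)[OF g] D fF]] insert.IH[OF fF])
 also have "\<dots> = (\<Oplus>\<^bsub>Hom C A D\<^esub>i\<in>insert x F. f i \<cdot> g)"
  by (simp only: K.finsum_insert[OF insert.hyps c2 morD(1)[OF mor_comp[OF g fx]]])
 finally show ?case .
qed

lemma finsum_delta:
 assumes "finite I" "x \<in> I" "c \<in> mor C A B" "\<And>j. j \<in> I \<Longrightarrow> f j = (if j = x then c else zero_arr C A B)"
 shows "(\<Oplus>\<^bsub>Hom C A B\<^esub>j\<in>I. f j) = c"
proof -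
 interpret H: abelian_group "Hom C A B" by (rule mor_group[OF assms(3)])
 have "(\<Oplus>\<^bsub>Hom C A B\<^esub>j\<in>I. f j) = (\<Oplus>\<^bsub>Hom C A B\<^esub>j\<in>I. if x = j then c else zero_arr C A B)"
  by (rule H.finsum_cong') (use assms(3,4) morD(1) in \<open>auto simp: Pi_iff\<close>)
 also have "\<dots> = c" by (rule H.finsum_singleton[OF assms(2,1)]) (use morD(1)[OF assms(3)] in simp)
 finally show ?thesis .
qed

lemma finsum_all_zero:
 assumes "A \<in> Obj C" "B \<in> Obj C" "\<And>j. j \<in> I \<Longrightarrow> f j = zero_arr C A B"
 shows "(\<Oplus>\<^bsub>Hom C A B\<^esub>j\<in>I. f j) = zero_arr C A B"
proof -
 interpret H: abelian_group "Hom C A B" by (rule Hom_group[OF assms(1,2)])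
 have "(\<Oplus>\<^bsub>Hom C A B\<^esub>j\<in>I. f j) = (\<Oplus>\<^bsub>Hom C A B\<^esub>j\<in>I. zero_arr C A B)"
  by (rule H.finsum_cong') (use assms(3) in \<open>simp_all\<close>)
 then show ?thesis by simp
qed

lemma finsum_eqI:
 assumes "A \<in> Obj C" "B \<in> Obj C" "\<And>j. j \<in> I \<Longrightarrow> g j \<in> mor C A B" "\<And>j. j \<in> I \<Longrightarrow> f j = g j"
 shows "(\<Oplus>\<^bsub>Hom C A B\<^esub>j\<in>I. f j) = (\<Oplus>\<^bsub>Hom C A B\<^esub>j\<in>I. g j)"
proof -
 interpret H: abelian_group "Hom C A B" by (rule Hom_group[OF assms(1,2)])
 show ?thesis
 proof (rule H.finsum_cong')
  show "g \<in> I \<rightarrow> arr C A B" by (intro Pi_I morD(1)[OF assms(3)])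
 qed (simp_all add: assms(4))
qed

end

text \<open>A direct sum decomposition with its inclusions \<open>i\<close> and projections \<open>p\<close>.\<close>

definition dsum :: "('o, 'm, 'k, 'z) cat_scheme \<Rightarrow> 'o \<Rightarrow> nat \<Rightarrow> (nat \<Rightarrow> 'o) \<Rightarrow> (nat \<Rightarrow> 'm) \<Rightarrow> (nat \<Rightarrow> 'm) \<Rightarrow> bool" where
 "dsum C A m B i p \<longleftrightarrow> A \<in> Obj C \<and> (\<forall>j<m. i j \<in> mor C (B j) A \<and> p j \<in> mor C A (B j)) \<and>
   (\<forall>x<m. \<forall>y<m. p y \<cdot>\<^bsub>C\<^esub> i x = (if x = y then Id C (B x) else zero_arr C (B x) (B y))) \<and>
   (\<Oplus>\<^bsub>Hom C A A\<^esub>j\<in>{..<m}. i j \<cdot>\<^bsub>C\<^esub> p j) = Id C A"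

lemma is_direct_sum_iff: "is_direct_sum C A m B \<longleftrightarrow> (\<forall>j<m. B j \<in> Obj C) \<and> (\<exists>i p. dsum C A m B i p)"
 unfolding is_direct_sum_def dsum_def mor_def by blast

lemma dsumD:
 assumes "dsum C A m B i p"
 shows "A \<in> Obj C" "j < m \<Longrightarrow> i j \<in> mor C (B j) A" "j < m \<Longrightarrow> p j \<in> mor C A (B j)"
  "j < m \<Longrightarrow> p j \<cdot>\<^bsub>C\<^esub> i j = Id C (B j)"
  "x < m \<Longrightarrow> y < m \<Longrightarrow> x \<noteq> y \<Longrightarrow> p y \<cdot>\<^bsub>C\<^esub> i x = zero_arr C (B x) (B y)"
  "(\<Oplus>\<^bsub>Hom C A A\<^esub>j\<in>{..<m}. i j \<cdot>\<^bsub>C\<^esub> p j) = Id C A"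
 using assms unfolding dsum_def by simp_all

context additive_category
begin

lemma dsum_extend:
 assumes d: "dsum C A m B i p" and b: "is_biproduct C A (B m) S iA iB pA pB"
 shows "dsum C S (Suc m) B (\<lambda>j. if j < m then iA \<cdot> i j else iB) (\<lambda>j. if j < m then p j \<cdot> pA else pB)"
proof -
 note D = dsumD[OF d] and b = is_biproductD[OF b]
 let ?i = "\<lambda>j. if j < m then iA \<cdot> i j else iB" and ?p = "\<lambda>j. if j < m then p j \<cdot> pA else pB"
 have S: "S \<in> Obj C" using morD[OF b(1)] by simp
 have i: "?i j \<in> mor C (B j) S" if "j < Suc m" for j
  using mor_comp[OF D(2) b(1)] b(2) that less_Suc_eq by auto
 have p: "?p j \<in> mor C S (B j)" if "j < Suc m" for j
  using mor_comp[OF b(3) D(3)] b(4) that less_Suc_eq by auto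
 have pA: "pA \<cdot> (iA \<cdot> i x) = i x" if "x < m" for x
  using comp_assoc[OF D(2)[OF that] b(1) b(3)] b(5) id_left[OF D(2)[OF that]] by simp
 have pB: "pB \<cdot> (iA \<cdot> i x) = zero_arr C (B x) (B m)" if "x < m" for x
  using comp_assoc[OF D(2)[OF that] b(1) b(4)] b(7) comp_zero_left[OF D(2)[OF that] morD(3)[OF b(4)]] by simp
 have delta: "?p y \<cdot> ?i x = (if x = y then Id C (B x) else zero_arr C (B x) (B y))" if "x < Suc m" "y < Suc m" for x y
 proof (cases "x < m")
  case x: True
  show ?thesis
  proof (cases "y < m")
   case True
   have "(p y \<cdot> pA) \<cdot> (iA \<cdot> i x) = p y \<cdot> i x"
    using comp_assoc[OF mor_comp[OF D(2)[OF x] b(1)] b(3) D(3)[OF True]] pA[OF x] by simp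
   then show ?thesis using x True D(4)[OF x] D(5)[OF x True] by (cases "x = y") simp_all
  next
   case False
   then show ?thesis using x pB[OF x] that(2) by (simp add: less_Suc_eq)
  qed
 next
  case x: False
  then have xm: "x = m" using that(1) by simp
  show ?thesis
  proof (cases "y < m")
   case True
   have "(p y \<cdot> pA) \<cdot> iB = zero_arr C (B m) (B y)"
    using comp_assoc[OF b(2) b(3) D(3)[OF True]] b(8) comp_zero_right[OF morD(2)[OF b(2)] D(3)[OF True]] by simp
   then show ?thesis using xm True by simp
  next
   case False
   then show ?thesis using xm b(6) that(2) by (simp add: less_Suc_eq)
  qed
 qed
 interpret H: abelian_group "Hom C S S" by (rule Hom_group[OF S S])
 have "(\<Oplus>\<^bsub>Hom C S S\<^esub>j\<in>{..<m}. ?i j \<cdot> ?p j) = (\<Oplus>\<^bsub>Hom C S S\<^esub>j\<in>{..<m}. iA \<cdot> ((i j \<cdot> p j) \<cdot> pA))"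
 proof (rule finsum_eqI[OF S S])
  fix j assume "j \<in> {..<m}"
  then have j: "j < m" by simp
  note ip = mor_comp[OF D(3)[OF j] D(2)[OF j]]
  show "iA \<cdot> ((i j \<cdot> p j) \<cdot> pA) \<in> mor C S S" by (rule mor_comp[OF mor_comp[OF b(3) ip] b(1)])
  show "?i j \<cdot> ?p j = iA \<cdot> ((i j \<cdot> p j) \<cdot> pA)"
   using j comp_assoc[OF mor_comp[OF b(3) D(3)[OF j]] D(2)[OF j] b(1)] comp_assoc[OF b(3) D(3)[OF j] D(2)[OF j]] by simp
 qed
 also have "\<dots> = iA \<cdot> (\<Oplus>\<^bsub>Hom C S A\<^esub>j\<in>{..<m}. (i j \<cdot> p j) \<cdot> pA)"
  by (rule comp_finsum_right[symmetric, OF _ S b(1)]) (use mor_comp[OF b(3) mor_comp[OF D(3) D(2)]] in simp_all)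
 also have "(\<Oplus>\<^bsub>Hom C S A\<^esub>j\<in>{..<m}. (i j \<cdot> p j) \<cdot> pA) = (\<Oplus>\<^bsub>Hom C A A\<^esub>j\<in>{..<m}. i j \<cdot> p j) \<cdot> pA"
  by (rule comp_finsum_left[symmetric, OF _ D(1) b(3)]) (use mor_comp[OF D(3) D(2)] in simp_all)
 also have "\<dots> = pA" using D(6) id_left[OF b(3)] by simp
 finally have s: "(\<Oplus>\<^bsub>Hom C S S\<^esub>j\<in>{..<m}. ?i j \<cdot> ?p j) = iA \<cdot> pA" .
 have cl: "(\<lambda>j. ?i j \<cdot> ?p j) \<in> {..<m} \<rightarrow> arr C S S"
 proof (rule Pi_I)
  fix j assume "j \<in> {..<m}"
  then have j: "j < Suc m" by simp
  show "?i j \<cdot> ?p j \<in> arr C S S" by (rule morD(1)[OF mor_comp[OF p[OF j] i[OF j]]])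
 qed
 have cm: "?i m \<cdot> ?p m \<in> arr C S S" by (rule morD(1)[OF mor_comp[OF p i]]) simp_all
 have "(\<Oplus>\<^bsub>Hom C S S\<^esub>j\<in>{..<Suc m}. ?i j \<cdot> ?p j) = ?i m \<cdot> ?p m \<oplus>\<^bsub>Hom C S S\<^esub> (\<Oplus>\<^bsub>Hom C S S\<^esub>j\<in>{..<m}. ?i j \<cdot> ?p j)"
  unfolding lessThan_Suc by (rule H.finsum_insert[OF _ _ cl cm]) simp_all
 also have "\<dots> = iB \<cdot> pB \<oplus>\<^bsub>Hom C S S\<^esub> iA \<cdot> pA" unfolding s by simp
 also have "\<dots> = Id C S"
  using b(9) H.a_comm[OF morD(1)[OF mor_comp[OF b(3,1)]] morD(1)[OF mor_comp[OF b(4,2)]]] by simp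
 finally have sum: "(\<Oplus>\<^bsub>Hom C S S\<^esub>j\<in>{..<Suc m}. ?i j \<cdot> ?p j) = Id C S" .
 show ?thesis unfolding dsum_def using S i p delta sum by (intro conjI allI impI)
qed

lemma dsum_exists:
 assumes "\<forall>j<m. B j \<in> Obj C"
 shows "\<exists>A i p. dsum C A m B i p"
 using assms
proof (induction m)
 case 0
 obtain Z where Z: "zero_object C Z" using zero_object_exists by (rule exE)
 note ZO = zero_objectD(1)[OF Z]
 interpret H: abelian_group "Hom C Z Z" by (rule Hom_group[OF ZO ZO])
 have "zero_arr C Z Z = Id C Z" by (rule zero_objectD(2)[OF Z mor_zero[OF ZO ZO] mor_Id[OF ZO]])
 then have "dsum C Z 0 B i p" for i p unfolding dsum_def using ZO by simp
 then show ?case by (intro exI)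
next
 case (Suc m)
 have "\<forall>j<m. B j \<in> Obj C" using Suc.prems by simp
 from Suc.IH[OF this] obtain A i p where d: "dsum C A m B i p" by (elim exE)
 have Bm: "B m \<in> Obj C" using Suc.prems by simp
 obtain S iA iB pA pB where b: "is_biproduct C A (B m) S iA iB pA pB"
  using biproduct_exists[OF dsumD(1)[OF d] Bm] by (elim exE)
 show ?case using dsum_extend[OF d b] by (intro exI)
qed

text \<open>The first \<open>m\<close> summands of \<open>A\<close> have a direct sum \<open>A'\<close> of their own, and \<open>A\<close> is the biproduct of \<open>A'\<close> and
the last summand.  The maps between \<open>A\<close> and \<open>A'\<close> are the sums of the composites through the first \<open>m\<close> summands.\<close>

lemma dsum_split_last:
 assumes d: "dsum C A (Suc m) B i p" and d': "dsum C A' m B i' p'"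
 shows "\<exists>iA pA. is_biproduct C A' (B m) A iA (i m) pA (p m)"
proof -
 note D = dsumD[OF d] and D' = dsumD[OF d']
 have m: "m < Suc m" by simp
 have i: "i j \<in> mor C (B j) A" and p: "p j \<in> mor C A (B j)" if "j \<in> {..<m}" for j
  using D(2)[of j] D(3)[of j] that by simp_all
 have i': "i' j \<in> mor C (B j) A'" and p': "p' j \<in> mor C A' (B j)" if "j \<in> {..<m}" for j
  using D'(2)[of j] D'(3)[of j] that by simp_all
 note AO = D(1) and AO' = D'(1) and im = D(2)[OF m] and pm = D(3)[OF m]
 define iA where "iA = (\<Oplus>\<^bsub>Hom C A' A\<^esub>j\<in>{..<m}. i j \<cdot> p' j)"
 define pA where "pA = (\<Oplus>\<^bsub>Hom C A A'\<^esub>j\<in>{..<m}. i' j \<cdot> p j)"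
 have iA: "iA \<in> mor C A' A" unfolding iA_def by (rule mor_finsum[OF AO' AO mor_comp[OF p' i]])
 have pA: "pA \<in> mor C A A'" unfolding pA_def by (rule mor_finsum[OF AO AO' mor_comp[OF p i']])
 have pAi: "pA \<cdot> i x = (\<Oplus>\<^bsub>Hom C (B x) A'\<^esub>j\<in>{..<m}. i' j \<cdot> (p j \<cdot> i x))" if x: "x < Suc m" for x
 proof -
  note ix = D(2)[OF x]
  have "pA \<cdot> i x = (\<Oplus>\<^bsub>Hom C (B x) A'\<^esub>j\<in>{..<m}. (i' j \<cdot> p j) \<cdot> i x)"
   unfolding pA_def by (rule comp_finsum_left[OF _ AO' ix mor_comp[OF p i']]) simp
  also have "\<dots> = (\<Oplus>\<^bsub>Hom C (B x) A'\<^esub>j\<in>{..<m}. i' j \<cdot> (p j \<cdot> i x))"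
   by (rule finsum_eqI[OF morD(2)[OF ix] AO' mor_comp[OF mor_comp[OF ix p] i'] comp_assoc[OF ix p i']])
  finally show ?thesis .
 qed
 have F1: "pA \<cdot> i x = i' x" if x: "x < m" for x
 proof -
  have xm: "x < Suc m" "x \<in> {..<m}" using x by simp_all
  show ?thesis unfolding pAi[OF xm(1)]
  proof (rule finsum_delta[OF _ xm(2) i'[OF xm(2)]])
   fix j assume j: "j \<in> {..<m}"
   then have jm: "j < Suc m" by simp
   show "i' j \<cdot> (p j \<cdot> i x) = (if j = x then i' x else zero_arr C (B x) A')"
   proof (cases "j = x")
    case True
    then show ?thesis using D(4)[OF xm(1)] id_right[OF i'[OF xm(2)]] by simp
   next
    case False
    then have "x \<noteq> j" by simp
    then show ?thesis using False D(5)[OF xm(1) jm] comp_zero_right[OF morD(2)[OF i'[OF xm(2)]] i'[OF j]] by simp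
   qed
  qed simp
 qed
 have F2: "pA \<cdot> i m = zero_arr C (B m) A'"
  unfolding pAi[OF m]
 proof (rule finsum_all_zero[OF morD(2)[OF im] AO'])
  fix j assume j: "j \<in> {..<m}"
  then have "j < Suc m" "m \<noteq> j" by simp_all
  then show "i' j \<cdot> (p j \<cdot> i m) = zero_arr C (B m) A'"
   using D(5)[OF m] comp_zero_right[OF morD(2)[OF im] i'[OF j]] by simp
 qed
 have F3: "iA \<cdot> i' x = i x" if x: "x < m" for x
 proof -
  have xm: "x \<in> {..<m}" using x by simp
  note ix = i'[OF xm]
  have "iA \<cdot> i' x = (\<Oplus>\<^bsub>Hom C (B x) A\<^esub>j\<in>{..<m}. (i j \<cdot> p' j) \<cdot> i' x)"
   unfolding iA_def by (rule comp_finsum_left[OF _ AO ix mor_comp[OF p' i]]) simp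
  also have "\<dots> = i x"
  proof (rule finsum_delta[OF _ xm i[OF xm]])
   fix j assume j: "j \<in> {..<m}"
   then have jm: "j < m" by simp
   show "(i j \<cdot> p' j) \<cdot> i' x = (if j = x then i x else zero_arr C (B x) A)"
    unfolding comp_assoc[OF ix p'[OF j] i[OF j]]
   proof (cases "j = x")
    case True
    then show "i j \<cdot> (p' j \<cdot> i' x) = (if j = x then i x else zero_arr C (B x) A)"
     using D'(4)[OF x] id_right[OF i[OF xm]] by simp
   next
    case False
    then have "x \<noteq> j" by simp
    then show "i j \<cdot> (p' j \<cdot> i' x) = (if j = x then i x else zero_arr C (B x) A)"
     using False D'(5)[OF x jm] comp_zero_right[OF morD(2)[OF ix] i[OF j]] by simp
   qed
  qed simp
  finally show ?thesis .
 qed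
 have pi: "pA \<cdot> iA = Id C A'"
 proof -
  have "pA \<cdot> iA = (\<Oplus>\<^bsub>Hom C A' A'\<^esub>j\<in>{..<m}. pA \<cdot> (i j \<cdot> p' j))"
   unfolding iA_def by (rule comp_finsum_right[OF _ AO' pA mor_comp[OF p' i]]) simp
  also have "\<dots> = (\<Oplus>\<^bsub>Hom C A' A'\<^esub>j\<in>{..<m}. i' j \<cdot> p' j)"
  proof (rule finsum_eqI[OF AO' AO' mor_comp[OF p' i']])
   fix j assume j: "j \<in> {..<m}"
   then have "j < m" by simp
   then show "pA \<cdot> (i j \<cdot> p' j) = i' j \<cdot> p' j" using comp_assoc[OF p'[OF j] i[OF j] pA] F1 by simp
  qed
  finally show ?thesis using D'(6) by simp
 qed
 have ip: "iA \<cdot> pA = (\<Oplus>\<^bsub>Hom C A A\<^esub>j\<in>{..<m}. i j \<cdot> p j)"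
 proof -
  have "iA \<cdot> pA = (\<Oplus>\<^bsub>Hom C A A\<^esub>j\<in>{..<m}. iA \<cdot> (i' j \<cdot> p j))"
   unfolding pA_def by (rule comp_finsum_right[OF _ AO iA mor_comp[OF p i']]) simp
  also have "\<dots> = (\<Oplus>\<^bsub>Hom C A A\<^esub>j\<in>{..<m}. i j \<cdot> p j)"
  proof (rule finsum_eqI[OF AO AO mor_comp[OF p i]])
   fix j assume j: "j \<in> {..<m}"
   then have "j < m" by simp
   then show "iA \<cdot> (i' j \<cdot> p j) = i j \<cdot> p j" using comp_assoc[OF p[OF j] i'[OF j] iA] F3 by simp
  qed
  finally show ?thesis .
 qed
 have pmiA: "p m \<cdot> iA = zero_arr C A' (B m)"
 proof -
  have "p m \<cdot> iA = (\<Oplus>\<^bsub>Hom C A' (B m)\<^esub>j\<in>{..<m}. p m \<cdot> (i j \<cdot> p' j))"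
   unfolding iA_def by (rule comp_finsum_right[OF _ AO' pm mor_comp[OF p' i]]) simp
  also have "\<dots> = zero_arr C A' (B m)"
  proof (rule finsum_all_zero[OF AO' morD(3)[OF pm]])
   fix j assume j: "j \<in> {..<m}"
   then have "j < Suc m" "j \<noteq> m" by simp_all
   then have "p m \<cdot> i j = zero_arr C (B j) (B m)" using D(5)[OF _ m] by simp
   then show "p m \<cdot> (i j \<cdot> p' j) = zero_arr C A' (B m)"
    using comp_assoc[OF p'[OF j] i[OF j] pm] comp_zero_left[OF p'[OF j] morD(3)[OF pm]] by simp
  qed
  finally show ?thesis .
 qed
 interpret H: abelian_group "Hom C A A" by (rule Hom_group[OF AO AO])
 have cl: "(\<lambda>j. i j \<cdot> p j) \<in> {..<m} \<rightarrow> arr C A A" using morD(1)[OF mor_comp[OF p i]] by (intro Pi_I)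
 have cm: "i m \<cdot> p m \<in> arr C A A" by (rule morD(1)[OF mor_comp[OF pm im]])
 have "Id C A = i m \<cdot> p m \<oplus>\<^bsub>Hom C A A\<^esub> (\<Oplus>\<^bsub>Hom C A A\<^esub>j\<in>{..<m}. i j \<cdot> p j)"
  unfolding D(6)[symmetric] lessThan_Suc by (rule H.finsum_insert[OF _ _ cl cm]) simp_all
 also have "\<dots> = iA \<cdot> pA \<oplus>\<^bsub>Hom C A A\<^esub> i m \<cdot> p m"
  unfolding ip[symmetric] by (rule H.a_comm[OF cm morD(1)[OF mor_comp[OF pA iA]]])
 finally have sum: "iA \<cdot> pA \<oplus>\<^bsub>Hom C A A\<^esub> i m \<cdot> p m = Id C A" by (rule sym)
 have "is_biproduct C A' (B m) A iA (i m) pA (p m)"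
  by (rule is_biproductI[OF iA im pA pm pi D(4)[OF m] pmiA F2 sum])
 then show ?thesis by (intro exI)
qed

lemma dsum_induct:
 assumes d: "dsum C A m B i p"
  and zero: "\<And>Z. zero_object C Z \<Longrightarrow> P Z"
  and base: "\<And>j. j < m \<Longrightarrow> P (B j)"
  and step: "\<And>X Y S iX iY pX pY. is_biproduct C X Y S iX iY pX pY \<Longrightarrow> P X \<Longrightarrow> P Y \<Longrightarrow> P S"
 shows "P A"
 using d base
proof (induction m arbitrary: A i p)
 case 0
 note AO = dsumD(1)[OF 0(1)]
 interpret H: abelian_group "Hom C A A" by (rule Hom_group[OF AO AO])
 have "Id C A = zero_arr C A A" using dsumD(6)[OF 0(1)] by simp
 then show ?case by (intro zero zero_objectI AO)
next
 case (Suc m)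
 have "\<forall>j<m. B j \<in> Obj C"
 proof (intro allI impI)
  fix j assume "j < m"
  then have "j < Suc m" by simp
  then show "B j \<in> Obj C" by (rule morD(2)[OF dsumD(2)[OF Suc.prems(1)]])
 qed
 from dsum_exists[OF this] obtain A' i' p' where d': "dsum C A' m B i' p'" by (elim exE)
 obtain iA pA where b: "is_biproduct C A' (B m) A iA (i m) pA (p m)"
  using dsum_split_last[OF Suc.prems(1) d'] by (elim exE)
 have "P A'" by (rule Suc.IH[OF d']) (rule Suc.prems(2), simp)
 then show ?case by (rule step[OF b _ Suc.prems(2)]) simp
qed

end

section \<open>Objects with local endomorphism ring\<close>

text \<open>Locality of the endomorphism ring, in the form that of \<open>f\<close> and \<open>1 - f\<close> one is invertible.\<close>

definition local_object :: "('o, 'm, 'k, 'z) cat_scheme \<Rightarrow> 'o \<Rightarrow> bool" where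
 "local_object C A \<longleftrightarrow> A \<in> Obj C \<and> Id C A \<noteq> zero_arr C A A \<and>
   (\<forall>f\<in>mor C A A. iso_arr C A A f \<or> iso_arr C A A (Id C A \<ominus>\<^bsub>Hom C A A\<^esub> f))"

lemma iso_arr_opposite [simp]: "iso_arr (opposite C) A B f \<longleftrightarrow> iso_arr C B A f"
 by (auto simp: iso_arr_def)

lemma local_object_opposite [simp]: "local_object (opposite C) A \<longleftrightarrow> local_object C A"
 by (simp add: local_object_def)

lemma iso_arrI:
 "f \<in> mor C A B \<Longrightarrow> g \<in> mor C B A \<Longrightarrow> g \<cdot>\<^bsub>C\<^esub> f = Id C A \<Longrightarrow> f \<cdot>\<^bsub>C\<^esub> g = Id C B \<Longrightarrow> iso_arr C A B f"
 unfolding iso_arr_def mor_def by blast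

lemma iso_arrE:
 assumes "iso_arr C A B f" "A \<in> Obj C" "B \<in> Obj C"
 shows "\<exists>g. f \<in> mor C A B \<and> g \<in> mor C B A \<and> g \<cdot>\<^bsub>C\<^esub> f = Id C A \<and> f \<cdot>\<^bsub>C\<^esub> g = Id C B"
 using assms unfolding iso_arr_def mor_def by blast

context preadditive_category
begin

lemma local_objectD:
 assumes "local_object C A"
 shows "A \<in> Obj C" "Id C A \<noteq> zero_arr C A A"
  "f \<in> mor C A A \<Longrightarrow> \<not> iso_arr C A A f \<Longrightarrow> iso_arr C A A (Id C A \<ominus>\<^bsub>Hom C A A\<^esub> f)"
 using assms unfolding local_object_def by blast+

lemma local_ring_local_object:
 assumes A: "A \<in> Obj C" and L: "local_ring (End_ring C A)"
 shows "local_object C A"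
proof -
 let ?R = "End_ring C A"
 have carr: "carrier ?R = arr C A A" and R_add: "add ?R = add (Hom C A A)" and R_zero: "zero ?R = zero_arr C A A"
  by (simp_all add: End_ring_def)
 have id: "ideal (carrier ?R - Units ?R) ?R" using L by (simp add: local_ring_def)
 then have sg: "additive_subgroup (carrier ?R - Units ?R) ?R" by (rule ideal.axioms(1))
 have units: "f \<in> Units ?R \<longleftrightarrow> iso_arr C A A f" for f
  unfolding Units_def iso_arr_def End_ring_def by auto
 have IdA: "Id C A \<in> mor C A A" by (rule mor_Id[OF A])
 have isoId: "iso_arr C A A (Id C A)" by (rule iso_arrI[OF IdA IdA id_left[OF IdA] id_left[OF IdA]])
 interpret H: abelian_group "Hom C A A" by (rule Hom_group[OF A A])
 have "zero_arr C A A \<in> carrier ?R - Units ?R"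
  using additive_subgroup.zero_closed[OF sg] by (simp only: R_zero)
 then have nu: "\<not> iso_arr C A A (zero_arr C A A)" unfolding units[symmetric] Diff_iff by (rule conjunct2)
 have ne: "Id C A \<noteq> zero_arr C A A"
 proof
  assume "Id C A = zero_arr C A A"
  from nu isoId[unfolded this] show False by (rule notE)
 qed
 have "iso_arr C A A f \<or> iso_arr C A A (Id C A \<ominus>\<^bsub>Hom C A A\<^esub> f)" if f: "f \<in> mor C A A" for f
 proof (rule ccontr)
  let ?g = "Id C A \<ominus>\<^bsub>Hom C A A\<^esub> f"
  assume n: "\<not> (iso_arr C A A f \<or> iso_arr C A A ?g)"
  have g: "?g \<in> mor C A A" by (rule mor_diff[OF IdA f])
  have "?g \<in> carrier ?R - Units ?R" "f \<in> carrier ?R - Units ?R"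
   using n morD(1)[OF f] morD(1)[OF g] by (simp_all add: carr units)
  then have "?g \<oplus>\<^bsub>?R\<^esub> f \<in> carrier ?R - Units ?R" by (rule additive_subgroup.a_closed[OF sg])
  moreover have "?g \<oplus>\<^bsub>Hom C A A\<^esub> f = Id C A"
   by (rule H.diff_add_cancel[OF morD(1)[OF IdA] morD(1)[OF f]])
  ultimately show False using isoId by (simp add: R_add units)
 qed
 then show ?thesis unfolding local_object_def using A ne by (intro conjI ballI)
qed

text \<open>The idempotent \<open>f g\<close> or its complement is invertible, and an invertible idempotent is the identity.\<close>

lemma local_left_inverse:
 assumes L: "local_object C A" and f: "f \<in> mor C A A" and g: "g \<in> mor C A A" and gf: "g \<cdot> f = Id C A"
 shows "f \<cdot> g = Id C A"
proof -
 note LD = local_objectD[OF L]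
 let ?e = "f \<cdot> g"
 have e: "?e \<in> mor C A A" by (rule mor_comp[OF g f])
 have ee: "?e \<cdot> ?e = ?e"
  using comp_assoc[OF e g f] comp_assoc[OF g f g] gf id_left[OF g] by simp
 note Id = mor_Id[OF LD(1)]
 show ?thesis
 proof (cases "iso_arr C A A ?e")
  case True
  then obtain h where h: "h \<in> mor C A A" "h \<cdot> ?e = Id C A" by (elim exE[OF iso_arrE[OF _ LD(1) LD(1)]] conjE)
  have "?e = (h \<cdot> ?e) \<cdot> ?e" using h(2) id_left[OF e] by simp
  also have "\<dots> = h \<cdot> (?e \<cdot> ?e)" by (rule comp_assoc[OF e e h(1)])
  also have "\<dots> = Id C A" by (simp only: ee h(2))
  finally show ?thesis .
 next
  case False
  let ?d = "Id C A \<ominus>\<^bsub>Hom C A A\<^esub> ?e"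
  have "iso_arr C A A ?d" by (rule LD(3)[OF e False])
  then obtain h where h: "h \<in> mor C A A" "h \<cdot> ?d = Id C A" and d: "?d \<in> mor C A A"
   by (elim exE[OF iso_arrE[OF _ LD(1) LD(1)]] conjE)
  have "?d \<cdot> ?e = zero_arr C A A"
   using comp_diff_left[OF e Id e] ee id_left[OF e] diff_zero_arr[OF e e] by simp
  then have "h \<cdot> (?d \<cdot> ?e) = zero_arr C A A" using comp_zero_right[OF LD(1) h(1)] by simp
  then have e0: "?e = zero_arr C A A" using comp_assoc[OF e d h(1)] h(2) id_left[OF e] by simp
  have "f = ?e \<cdot> f" using comp_assoc[OF f g f] gf id_right[OF f] by simp
  then have "f = zero_arr C A A" using e0 comp_zero_left[OF f LD(1)] by simp
  then have "Id C A = zero_arr C A A" using gf comp_zero_right[OF LD(1) g] by simp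
  then show ?thesis using LD(2) by simp
 qed
qed

lemma local_iso_left:
 assumes L: "local_object C A" and f: "f \<in> mor C A A" and g: "g \<in> mor C A A" and i: "iso_arr C A A (g \<cdot> f)"
 shows "iso_arr C A A f" "iso_arr C A A g"
proof -
 note O = local_objectD(1)[OF L]
 obtain h where h: "h \<in> mor C A A" "h \<cdot> (g \<cdot> f) = Id C A" "(g \<cdot> f) \<cdot> h = Id C A"
  using i by (elim exE[OF iso_arrE[OF _ O O]] conjE)
 have hg: "h \<cdot> g \<in> mor C A A" and fh: "f \<cdot> h \<in> mor C A A" using mor_comp[OF g h(1)] mor_comp[OF h(1) f] by auto
 have 1: "(h \<cdot> g) \<cdot> f = Id C A" using comp_assoc[OF f g h(1)] h(2) by simp
 show "iso_arr C A A f" by (rule iso_arrI[OF f hg 1 local_left_inverse[OF L f hg 1]])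
 have 2: "g \<cdot> (f \<cdot> h) = Id C A" using comp_assoc[OF h(1) f g] h(3) by simp
 show "iso_arr C A A g" by (rule iso_arrI[OF g fh local_left_inverse[OF L fh g 2] 2])
qed

text \<open>If \<open>f + g\<close> has the inverse \<open>h\<close>, then \<open>f h\<close> and \<open>g h = 1 - f h\<close> cannot both be non-invertible.\<close>

lemma local_noniso_add:
 assumes L: "local_object C A" and f: "f \<in> mor C A A" and g: "g \<in> mor C A A"
  and nf: "\<not> iso_arr C A A f" and ng: "\<not> iso_arr C A A g"
 shows "\<not> iso_arr C A A (f \<oplus>\<^bsub>Hom C A A\<^esub> g)"
proof
 note LD = local_objectD[OF L]
 assume i: "iso_arr C A A (f \<oplus>\<^bsub>Hom C A A\<^esub> g)"
 obtain h where h: "h \<in> mor C A A" "(f \<oplus>\<^bsub>Hom C A A\<^esub> g) \<cdot> h = Id C A"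
  using i by (elim exE[OF iso_arrE[OF _ LD(1) LD(1)]] conjE)
 have fh: "f \<cdot> h \<in> mor C A A" and gh: "g \<cdot> h \<in> mor C A A" using mor_comp[OF h(1)] f g by auto
 interpret H: abelian_group "Hom C A A" by (rule Hom_group[OF LD(1) LD(1)])
 have "g \<cdot> h \<oplus>\<^bsub>Hom C A A\<^esub> f \<cdot> h = Id C A"
  using comp_add_left[OF h(1) f g] h(2) H.a_comm[OF morD(1)[OF fh] morD(1)[OF gh]] by simp
 then have eq: "g \<cdot> h = Id C A \<ominus>\<^bsub>Hom C A A\<^esub> f \<cdot> h"
  using H.eq_diff_iff[OF morD(1)[OF mor_Id[OF LD(1)]] morD(1)[OF fh] morD(1)[OF gh]] by simp
 have "\<not> iso_arr C A A (f \<cdot> h)" using nf local_iso_left(2)[OF L h(1) f] by (rule contrapos_nn)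
 then have "iso_arr C A A (g \<cdot> h)" unfolding eq by (rule LD(3)[OF fh])
 then show False using local_iso_left(2)[OF L h(1) g] ng by simp
qed

lemma local_object_indecomposable:
 assumes L: "local_object C A"
 shows "indecomposable C A"
proof -
 note LD = local_objectD[OF L]
 have split: "zero_object C Y" if b: "is_biproduct C X Y A iX iY pX pY" and i: "iso_arr C A A (iX \<cdot> pX)" for X Y iX iY pX pY
 proof -
  note B = is_biproductD[OF b]
  note YO = morD(2)[OF B(2)]
  obtain g where g: "g \<in> mor C A A" "(iX \<cdot> pX) \<cdot> g = Id C A"
   using i by (elim exE[OF iso_arrE[OF _ LD(1) LD(1)]] conjE)
  have "pY = pY \<cdot> ((iX \<cdot> pX) \<cdot> g)" using g(2) id_right[OF B(4)] by simp
  also have "\<dots> = (pY \<cdot> iX) \<cdot> (pX \<cdot> g)"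
   using comp_assoc[OF g(1) B(3) B(1)] comp_assoc[OF mor_comp[OF g(1) B(3)] B(1) B(4)] by simp
  also have "\<dots> = zero_arr C A Y" unfolding B(7) by (rule comp_zero_left[OF mor_comp[OF g(1) B(3)] YO])
  finally have "pY = zero_arr C A Y" .
  then have "Id C Y = zero_arr C Y Y" using B(6) comp_zero_left[OF B(2) YO] by simp
  then show ?thesis by (rule zero_objectI[OF YO])
 qed
 show ?thesis unfolding indecomposable_def
 proof (intro conjI allI impI LD(1))
  show "\<not> zero_object C A"
   using LD(2) zero_objectD(2)[OF _ mor_Id[OF LD(1)] mor_zero[OF LD(1) LD(1)]] by (rule contrapos_nn)
  fix X Y iX iY pX pY assume b: "is_biproduct C X Y A iX iY pX pY"
  note B = is_biproductD[OF b]
  note e = mor_comp[OF B(3,1)] and e' = mor_comp[OF B(4,2)]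
  interpret H: abelian_group "Hom C A A" by (rule Hom_group[OF LD(1) LD(1)])
  show "zero_object C X \<or> zero_object C Y"
  proof (cases "iso_arr C A A (iX \<cdot> pX)")
   case True
   then show ?thesis using split[OF b] by simp
  next
   case False
   have "iY \<cdot> pY \<oplus>\<^bsub>Hom C A A\<^esub> iX \<cdot> pX = Id C A" by (rule is_biproductD(9)[OF biproduct_swap[OF b]])
   then have eq: "iY \<cdot> pY = Id C A \<ominus>\<^bsub>Hom C A A\<^esub> iX \<cdot> pX"
    using H.eq_diff_iff[OF morD(1)[OF mor_Id[OF LD(1)]] morD(1)[OF e] morD(1)[OF e']] by simp
   have "iso_arr C A A (iY \<cdot> pY)" unfolding eq by (rule LD(3)[OF e False])
   then show ?thesis using split[OF biproduct_swap[OF b]] by simp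
  qed
 qed
qed

end

context additive_category
begin

lemma Krull_Schmidt_induct:
 assumes KS: "Krull_Schmidt C" and A: "A \<in> Obj C"
  and zero: "\<And>Z. zero_object C Z \<Longrightarrow> P Z"
  and base: "\<And>X. local_object C X \<Longrightarrow> P X"
  and step: "\<And>X Y S iX iY pX pY. is_biproduct C X Y S iX iY pX pY \<Longrightarrow> P X \<Longrightarrow> P Y \<Longrightarrow> P S"
 shows "P A"
proof -
 obtain m B where B: "is_direct_sum C A m B" "\<forall>i<m. local_ring (End_ring C (B i))"
  using KS A unfolding Krull_Schmidt_def by blast
 then obtain i p where d: "dsum C A m B i p" and BO: "\<forall>j<m. B j \<in> Obj C" unfolding is_direct_sum_iff by blast
 show ?thesis
 proof (rule dsum_induct[OF d zero _ step])
  fix j assume "j < m"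
  then show "P (B j)" using BO B(2) by (intro base local_ring_local_object) simp_all
 qed
qed

lemma local_object_iso:
 assumes LX: "local_object C X" and B1: "iX \<in> mor C X S" and B3: "pX \<in> mor C S X"
  and pi: "pX \<cdot> iX = Id C X" and ip: "iX \<cdot> pX = Id C S"
 shows "local_object C S"
proof -
 note XO = morD(2)[OF B1] and SO = morD(3)[OF B1]
 note LD = local_objectD[OF LX]
 have trans: "iso_arr C S S (iX \<cdot> (g \<cdot> pX))" if g: "g \<in> mor C X X" "iso_arr C X X g" for g
 proof -
  obtain h where h: "h \<in> mor C X X" "h \<cdot> g = Id C X" "g \<cdot> h = Id C X"
   using g(2) by (elim exE[OF iso_arrE[OF _ XO XO]] conjE)
  have m: "(iX \<cdot> (a \<cdot> pX)) \<cdot> (iX \<cdot> (b \<cdot> pX)) = iX \<cdot> ((a \<cdot> b) \<cdot> pX)" if a: "a \<in> mor C X X" and b: "b \<in> mor C X X" for a b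
  proof -
   note bp = mor_comp[OF B3 b]
   have "(iX \<cdot> (a \<cdot> pX)) \<cdot> (iX \<cdot> (b \<cdot> pX)) = iX \<cdot> ((a \<cdot> pX) \<cdot> (iX \<cdot> (b \<cdot> pX)))"
    by (rule comp_assoc[OF mor_comp[OF bp B1] mor_comp[OF B3 a] B1])
   also have "(a \<cdot> pX) \<cdot> (iX \<cdot> (b \<cdot> pX)) = a \<cdot> (b \<cdot> pX)"
    using comp_assoc[OF mor_comp[OF bp B1] B3 a] comp_assoc[OF bp B1 B3] pi id_left[OF bp] by simp
   also have "\<dots> = (a \<cdot> b) \<cdot> pX" by (rule comp_assoc[OF B3 b a, symmetric])
   finally show ?thesis .
  qed
  show ?thesis
   by (rule iso_arrI[of _ _ _ _ "iX \<cdot> (h \<cdot> pX)"])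
    (simp_all add: mor_comp[OF mor_comp[OF B3 g(1)] B1] mor_comp[OF mor_comp[OF B3 h(1)] B1]
     m[OF g(1) h(1)] m[OF h(1) g(1)] h id_left[OF B3] ip)
 qed
 show ?thesis unfolding local_object_def
 proof (intro conjI ballI SO)
  show "Id C S \<noteq> zero_arr C S S"
  proof
   assume "Id C S = zero_arr C S S"
   then have "pX \<cdot> (Id C S \<cdot> iX) = zero_arr C X X" using comp_zero_left[OF B1 SO] comp_zero_right[OF XO B3] by simp
   then show False using id_left[OF B1] pi LD(2) by simp
  qed
  fix f assume f: "f \<in> mor C S S"
  let ?g = "pX \<cdot> (f \<cdot> iX)"
  note g = mor_comp[OF mor_comp[OF B1 f] B3]
  have retract: "iX \<cdot> ((pX \<cdot> (h \<cdot> iX)) \<cdot> pX) = h" if h: "h \<in> mor C S S" for h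
  proof -
   note hi = mor_comp[OF B1 h]
   have "iX \<cdot> ((pX \<cdot> (h \<cdot> iX)) \<cdot> pX) = (iX \<cdot> (pX \<cdot> (h \<cdot> iX))) \<cdot> pX"
    by (rule comp_assoc[OF B3 mor_comp[OF hi B3] B1, symmetric])
   also have "iX \<cdot> (pX \<cdot> (h \<cdot> iX)) = h \<cdot> iX" using comp_assoc[OF hi B3 B1] ip id_left[OF hi] by simp
   also have "(h \<cdot> iX) \<cdot> pX = h" using comp_assoc[OF B3 B1 h] ip id_right[OF h] by simp
   finally show ?thesis .
  qed
  show "iso_arr C S S f \<or> iso_arr C S S (Id C S \<ominus>\<^bsub>Hom C S S\<^esub> f)"
  proof (cases "iso_arr C X X ?g")
   case True
   then show ?thesis using trans[OF g True] retract[OF f] by simp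
  next
   case False
   have d: "iso_arr C X X (Id C X \<ominus>\<^bsub>Hom C X X\<^esub> ?g)" by (rule LD(3)[OF g False])
   note IdS = mor_Id[OF SO]
   have "Id C X \<ominus>\<^bsub>Hom C X X\<^esub> ?g = pX \<cdot> ((Id C S \<ominus>\<^bsub>Hom C S S\<^esub> f) \<cdot> iX)"
    using comp_diff_left[OF B1 IdS f] id_left[OF B1] comp_diff_right[OF B1 mor_comp[OF B1 f] B3] pi by simp
   then show ?thesis
    using trans[OF _ d] mor_diff[OF mor_Id[OF XO] g] retract[OF mor_diff[OF IdS f]] by simp
  qed
 qed
qed

text \<open>A decomposition of \<open>A\<close> into objects with local endomorphism rings has a nonzero last summand; the
complement of that summand is zero, so \<open>A\<close> is isomorphic to it.\<close>

lemma indecomposable_local_object: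
 assumes KS: "Krull_Schmidt C" and I: "indecomposable C A"
 shows "local_object C A"
proof -
 have A: "A \<in> Obj C" and nz: "\<not> zero_object C A" using I by (simp_all add: indecomposable_def)
 obtain m B where mB: "is_direct_sum C A m B" "\<forall>i<m. local_ring (End_ring C (B i))"
  using KS A unfolding Krull_Schmidt_def by blast
 then obtain i p where d: "dsum C A m B i p" and O: "\<forall>j<m. B j \<in> Obj C" unfolding is_direct_sum_iff by blast
 interpret H: abelian_group "Hom C A A" by (rule Hom_group[OF A A])
 show ?thesis
 proof (cases m)
  case 0
  then have "Id C A = zero_arr C A A" using dsumD(6)[OF d] by simp
  then show ?thesis using zero_objectI[OF A] nz by simp
 next
  case (Suc r)
  have "\<forall>j<r. B j \<in> Obj C" using O Suc by simp
  from dsum_exists[OF this] obtain A' i' p' where d': "dsum C A' r B i' p'" by (elim exE)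
  obtain iA pA where b: "is_biproduct C A' (B r) A iA (i r) pA (p r)" using dsum_split_last[OF d[unfolded Suc] d'] by (elim exE)
  note D = is_biproductD[OF b]
  have Or: "B r \<in> Obj C" and Lr: "local_object C (B r)" using O mB(2) Suc local_ring_local_object by simp_all
  have "\<not> zero_object C (B r)"
   using zero_objectD(2)[OF _ mor_Id[OF Or] mor_zero[OF Or Or]] local_objectD(2)[OF Lr] by blast
  then have Z: "zero_object C A'" using I b unfolding indecomposable_def by blast
  have "pA = zero_arr C A A'" by (rule zero_objectD(2)[OF Z D(3) mor_zero[OF A zero_objectD(1)[OF Z]]])
  then have "i r \<cdot> p r = Id C A"
   using D(9) comp_zero_right[OF A D(1)] H.l_zero[OF morD(1)[OF mor_comp[OF D(4,2)]]] by simp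
  then show ?thesis by (rule local_object_iso[OF Lr D(2,4,6)])
 qed
qed

end

section \<open>Sums of Serre pairs, and projective objects\<close>

context additive_bifunctor
begin

lemma projective_iff:
 assumes U: "U \<in> Obj C"
 shows "projective C U \<longleftrightarrow> (\<forall>Z. \<forall>\<delta>\<in>xt C U Z. \<delta> = \<zero>\<^bsub>Ext C U Z\<^esub>)"
proof -
 have "projective C U \<longleftrightarrow> (\<forall>Z\<in>Obj C. \<forall>\<delta>\<in>ext C U Z. Pull C (Id C U) \<delta> = \<zero>\<^bsub>Ext C U Z\<^esub>)"
  using U Id_closed[OF U] by (simp add: projective_def proj_trivial_def)
 also have "\<dots> \<longleftrightarrow> (\<forall>Z. \<forall>\<delta>\<in>xt C U Z. \<delta> = \<zero>\<^bsub>Ext C U Z\<^esub>)"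
  unfolding xt_def using U Pull_Id by auto
 finally show ?thesis .
qed

lemma injective_iff:
 assumes A: "A \<in> Obj C"
 shows "injective C A \<longleftrightarrow> (\<forall>Z. \<forall>\<delta>\<in>xt C Z A. \<delta> = \<zero>\<^bsub>Ext C Z A\<^esub>)"
proof -
 have "injective C A \<longleftrightarrow> (\<forall>Z\<in>Obj C. \<forall>\<delta>\<in>ext C Z A. Push C (Id C A) \<delta> = \<zero>\<^bsub>Ext C Z A\<^esub>)"
  using A Id_closed[OF A] by (simp add: injective_def inj_trivial_def)
 also have "\<dots> \<longleftrightarrow> (\<forall>Z. \<forall>\<delta>\<in>xt C Z A. \<delta> = \<zero>\<^bsub>Ext C Z A\<^esub>)"
  unfolding xt_def using A Push_Id by auto
 finally show ?thesis .
qed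

lemma iso_annihilating:
 assumes A: "A \<in> Obj C" and i: "iso_arr C A A h" and kill: "\<And>Z \<delta>. \<delta> \<in> xt C Z A \<Longrightarrow> Push C h \<delta> = \<zero>\<^bsub>Ext C Z A\<^esub>"
 shows "injective C A"
 unfolding injective_iff[OF A]
proof (intro allI ballI)
 fix Z \<delta> assume \<delta>: "\<delta> \<in> xt C Z A"
 obtain g where g: "h \<in> mor C A A" "g \<in> mor C A A" "g \<cdot> h = Id C A"
  using i by (elim exE[OF iso_arrE[OF _ A A]] conjE)
 have "\<delta> = Push C (g \<cdot> h) \<delta>" using push_id[OF \<delta>] g(3) by simp
 also have "\<dots> = \<zero>\<^bsub>Ext C Z A\<^esub>" unfolding push_comp[OF g(1,2) \<delta>] kill[OF \<delta>] by (rule push_zero[OF g(2) xtD(2)[OF \<delta>]])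
 finally show "\<delta> = \<zero>\<^bsub>Ext C Z A\<^esub>" .
qed

lemma zero_object_ext:
 assumes Z: "zero_object C Z" and \<delta>: "\<delta> \<in> xt C D Z"
 shows "\<delta> = \<zero>\<^bsub>Ext C D Z\<^esub>"
proof -
 note ZO = zero_objectD(1)[OF Z]
 have "Id C Z = zero_arr C Z Z" by (rule zero_objectD(2)[OF Z mor_Id[OF ZO] mor_zero[OF ZO ZO]])
 then show ?thesis using push_id[OF \<delta>] zero_push[OF ZO \<delta>] by simp
qed

end

lemma injective_opposite [simp]: "injective (opposite C) A \<longleftrightarrow> projective C A"
 by (simp add: injective_def projective_def inj_trivial_def proj_trivial_def)

lemma projective_opposite [simp]: "projective (opposite C) A \<longleftrightarrow> injective C A"
 by (simp add: injective_def projective_def inj_trivial_def proj_trivial_def)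

context artinian_ecat
begin

interpretation op: artinian_ecat "opposite C" k J by (rule opposite_artinian_ecat)

text \<open>A functional on \<open>\<bbbE>(U\<^sub>1 \<oplus> U\<^sub>2, X)\<close> is a pair of functionals, each of which is represented by a morphism to
\<open>A\<^sub>i\<close>; the two morphisms are assembled into one to \<open>A\<^sub>1 \<oplus> A\<^sub>2\<close>.\<close>

lemma push_universal_sum:
 assumes bU: "is_biproduct C U1 U2 U u1 u2 p1 p2" and bA: "is_biproduct C A1 A2 A a1 a2 q1 q2"
  and H1: "push_universal k J C U1 A1 \<eta>1" and H2: "push_universal k J C U2 A2 \<eta>2"
  and l1: "linear_map k (Ext C U1 A1) J \<eta>1" and l2: "linear_map k (Ext C U2 A2) J \<eta>2"
 shows "push_universal k J C U A (\<lambda>\<xi>. \<eta>1 (Push C q1 (Pull C u1 \<xi>)) \<oplus>\<^bsub>J\<^esub> \<eta>2 (Push C q2 (Pull C u2 \<xi>)))"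
proof (rule push_universalI)
 note U = is_biproductD[OF bU] and A = is_biproductD[OF bA]
 note UO = morD(2)[OF U(1)] morD(2)[OF U(2)] morD(3)[OF U(1)]
 note AO = morD(2)[OF A(1)] morD(2)[OF A(2)] morD(3)[OF A(1)]
 interpret J: module k J by (rule J_module)
 have swap: "Push C q (Pull C u (Push C f \<xi>)) = Push C (q \<cdot> f) (Pull C u \<xi>)"
  if "f \<in> mor C X A" "\<xi> \<in> xt C U X" "q \<in> mor C A A'" "u \<in> mor C U' U" for f \<xi> X q A' u U'
  using push_comp[OF that(1,3) xt_Pull[OF that(4,2)]] push_pull[OF that(1,4,2)] by simp
 fix X \<phi> assume X: "X \<in> Obj C" and \<phi>: "linear_map k (Ext C U X) J \<phi>"
 obtain f1 where f1: "f1 \<in> mor C X A1" "\<forall>\<xi>\<in>xt C U1 X. \<phi> (Pull C p1 \<xi>) = \<eta>1 (Push C f1 \<xi>)"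
  by (rule bexE[OF push_universal_ex[OF H1 X linear_map_comp[OF pull_linear[OF U(3) X] \<phi>]]])
 obtain f2 where f2: "f2 \<in> mor C X A2" "\<forall>\<xi>\<in>xt C U2 X. \<phi> (Pull C p2 \<xi>) = \<eta>2 (Push C f2 \<xi>)"
  by (rule bexE[OF push_universal_ex[OF H2 X linear_map_comp[OF pull_linear[OF U(4) X] \<phi>]]])
 note m1 = mor_comp[OF f1(1) A(1)] and m2 = mor_comp[OF f2(1) A(2)]
 let ?f = "a1 \<cdot> f1 \<oplus>\<^bsub>Hom C X A\<^esub> a2 \<cdot> f2"
 have f: "?f \<in> mor C X A" by (rule mor_add[OF m1 m2])
 interpret H1: abelian_group "Hom C X A1" by (rule Hom_group[OF X AO(1)])
 interpret H2: abelian_group "Hom C X A2" by (rule Hom_group[OF X AO(2)])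
 have q1f: "q1 \<cdot> ?f = f1"
  using comp_add_right[OF m1 m2 A(3)] comp_assoc[OF f1(1) A(1) A(3)] comp_assoc[OF f2(1) A(2) A(3)]
   A(5,8) id_left[OF f1(1)] comp_zero_left[OF f2(1) AO(1)] H1.r_zero[OF morD(1)[OF f1(1)]] by simp
 have q2f: "q2 \<cdot> ?f = f2"
  using comp_add_right[OF m1 m2 A(4)] comp_assoc[OF f1(1) A(1) A(4)] comp_assoc[OF f2(1) A(2) A(4)]
   A(6,7) id_left[OF f2(1)] comp_zero_left[OF f1(1) AO(2)] H2.l_zero[OF morD(1)[OF f2(1)]] by simp
 show "\<exists>f\<in>mor C X A. \<forall>\<xi>\<in>xt C U X. \<phi> \<xi> = \<eta>1 (Push C q1 (Pull C u1 (Push C f \<xi>))) \<oplus>\<^bsub>J\<^esub> \<eta>2 (Push C q2 (Pull C u2 (Push C f \<xi>)))"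
 proof (intro bexI[OF _ f] ballI)
  fix \<xi> assume \<xi>: "\<xi> \<in> xt C U X"
  note e1 = xt_Pull[OF U(1) \<xi>] and e2 = xt_Pull[OF U(2) \<xi>]
  have "\<xi> = Pull C (u1 \<cdot> p1 \<oplus>\<^bsub>Hom C U U\<^esub> u2 \<cdot> p2) \<xi>" using U(9) pull_id[OF \<xi>] by simp
  also have "\<dots> = Pull C p1 (Pull C u1 \<xi>) \<oplus>\<^bsub>Ext C U X\<^esub> Pull C p2 (Pull C u2 \<xi>)"
   using add_pull[OF mor_comp[OF U(3,1)] mor_comp[OF U(4,2)] \<xi>] pull_comp[OF U(1,3) \<xi>] pull_comp[OF U(2,4) \<xi>] by simp
  finally have "\<phi> \<xi> = \<phi> (Pull C p1 (Pull C u1 \<xi>)) \<oplus>\<^bsub>J\<^esub> \<phi> (Pull C p2 (Pull C u2 \<xi>))"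
   using linear_mapD(2)[OF \<phi> xtD(1)[OF xt_Pull[OF U(3) e1]] xtD(1)[OF xt_Pull[OF U(4) e2]]] by simp
  also have "\<dots> = \<eta>1 (Push C f1 (Pull C u1 \<xi>)) \<oplus>\<^bsub>J\<^esub> \<eta>2 (Push C f2 (Pull C u2 \<xi>))"
   using bspec[OF f1(2) e1] bspec[OF f2(2) e2] by simp
  finally show "\<phi> \<xi> = \<eta>1 (Push C q1 (Pull C u1 (Push C ?f \<xi>))) \<oplus>\<^bsub>J\<^esub> \<eta>2 (Push C q2 (Pull C u2 (Push C ?f \<xi>)))"
   unfolding swap[OF f \<xi> A(3) U(1)] swap[OF f \<xi> A(4) U(2)] q1f q2f .
 qed
next
 note U = is_biproductD[OF bU] and A = is_biproductD[OF bA]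
 note UO = morD(2)[OF U(1)] morD(2)[OF U(2)] morD(3)[OF U(1)]
 note AO = morD(2)[OF A(1)] morD(2)[OF A(2)] morD(3)[OF A(1)]
 interpret J: module k J by (rule J_module)
 have swap: "Push C q (Pull C u (Push C f \<xi>)) = Push C (q \<cdot> f) (Pull C u \<xi>)"
  if "f \<in> mor C X A" "\<xi> \<in> xt C U X" "q \<in> mor C A A'" "u \<in> mor C U' U" for f \<xi> X q A' u U'
  using push_comp[OF that(1,3) xt_Pull[OF that(4,2)]] push_pull[OF that(1,4,2)] by simp
 fix X f g assume f: "f \<in> mor C X A" and g: "g \<in> mor C X A"
  and eqs: "\<And>\<xi>. \<xi> \<in> xt C U X \<Longrightarrow> \<eta>1 (Push C q1 (Pull C u1 (Push C f \<xi>))) \<oplus>\<^bsub>J\<^esub> \<eta>2 (Push C q2 (Pull C u2 (Push C f \<xi>)))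
   = \<eta>1 (Push C q1 (Pull C u1 (Push C g \<xi>))) \<oplus>\<^bsub>J\<^esub> \<eta>2 (Push C q2 (Pull C u2 (Push C g \<xi>)))"
 note X = morD(2)[OF f]
 have z1: "\<eta>1 \<zero>\<^bsub>Ext C U1 A1\<^esub> = \<zero>\<^bsub>J\<^esub>" by (rule linear_map_zero[OF ext_module[OF UO(1) AO(1)] J_module l1])
 have z2: "\<eta>2 \<zero>\<^bsub>Ext C U2 A2\<^esub> = \<zero>\<^bsub>J\<^esub>" by (rule linear_map_zero[OF ext_module[OF UO(2) AO(2)] J_module l2])
 have left: "\<eta>1 (Push C q1 (Pull C u1 (Push C h (Pull C p1 \<xi>)))) \<oplus>\<^bsub>J\<^esub> \<eta>2 (Push C q2 (Pull C u2 (Push C h (Pull C p1 \<xi>))))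
   = \<eta>1 (Push C (q1 \<cdot> h) \<xi>)" if h: "h \<in> mor C X A" and \<xi>: "\<xi> \<in> xt C U1 X" for h \<xi>
 proof -
  note pe = xt_Pull[OF U(3) \<xi>]
  have "Pull C u1 (Pull C p1 \<xi>) = \<xi>" using pull_comp[OF U(3,1) \<xi>] U(5) pull_id[OF \<xi>] by simp
  moreover have "Pull C u2 (Pull C p1 \<xi>) = \<zero>\<^bsub>Ext C U2 X\<^esub>"
   using pull_comp[OF U(3,2) \<xi>] U(8) op.zero_push[of U2 \<xi> X U1] \<xi> UO by simp
  ultimately show ?thesis
   unfolding swap[OF h pe A(3) U(1)] swap[OF h pe A(4) U(2)]
   using push_zero[OF mor_comp[OF h A(4)] UO(2)] z2 linear_mapD(1)[OF l1 xtD(1)[OF xt_Push[OF mor_comp[OF h A(3)] \<xi>]]] by simp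
 qed
 have right: "\<eta>1 (Push C q1 (Pull C u1 (Push C h (Pull C p2 \<xi>)))) \<oplus>\<^bsub>J\<^esub> \<eta>2 (Push C q2 (Pull C u2 (Push C h (Pull C p2 \<xi>))))
   = \<eta>2 (Push C (q2 \<cdot> h) \<xi>)" if h: "h \<in> mor C X A" and \<xi>: "\<xi> \<in> xt C U2 X" for h \<xi>
 proof -
  note pe = xt_Pull[OF U(4) \<xi>]
  have "Pull C u2 (Pull C p2 \<xi>) = \<xi>" using pull_comp[OF U(4,2) \<xi>] U(6) pull_id[OF \<xi>] by simp
  moreover have "Pull C u1 (Pull C p2 \<xi>) = \<zero>\<^bsub>Ext C U1 X\<^esub>"
   using pull_comp[OF U(4,1) \<xi>] U(7) op.zero_push[of U1 \<xi> X U2] \<xi> UO by simp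
  ultimately show ?thesis
   unfolding swap[OF h pe A(3) U(1)] swap[OF h pe A(4) U(2)]
   using push_zero[OF mor_comp[OF h A(3)] UO(1)] z1 linear_mapD(1)[OF l2 xtD(1)[OF xt_Push[OF mor_comp[OF h A(4)] \<xi>]]] by simp
 qed
 have e1: "inj_eq C X (q1 \<cdot> f) (q1 \<cdot> g)"
 proof (rule push_universal_inj[OF H1 mor_comp[OF f A(3)] mor_comp[OF g A(3)]])
  fix \<xi> assume \<xi>: "\<xi> \<in> xt C U1 X"
  show "\<eta>1 (Push C (q1 \<cdot> f) \<xi>) = \<eta>1 (Push C (q1 \<cdot> g) \<xi>)"
   using eqs[OF xt_Pull[OF U(3) \<xi>]] unfolding left[OF f \<xi>] left[OF g \<xi>] .
 qed
 have e2: "inj_eq C X (q2 \<cdot> f) (q2 \<cdot> g)"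
 proof (rule push_universal_inj[OF H2 mor_comp[OF f A(4)] mor_comp[OF g A(4)]])
  fix \<xi> assume \<xi>: "\<xi> \<in> xt C U2 X"
  show "\<eta>2 (Push C (q2 \<cdot> f) \<xi>) = \<eta>2 (Push C (q2 \<cdot> g) \<xi>)"
   using eqs[OF xt_Pull[OF U(4) \<xi>]] unfolding right[OF f \<xi>] right[OF g \<xi>] .
 qed
 have dec: "Push C h \<rho> = Push C a1 (Push C (q1 \<cdot> h) \<rho>) \<oplus>\<^bsub>Ext C Z A\<^esub> Push C a2 (Push C (q2 \<cdot> h) \<rho>)"
  if h: "h \<in> mor C X A" and \<rho>: "\<rho> \<in> xt C Z X" for h \<rho> Z
 proof -
  note hr = xt_Push[OF h \<rho>]
  have "Push C h \<rho> = Push C (a1 \<cdot> q1 \<oplus>\<^bsub>Hom C A A\<^esub> a2 \<cdot> q2) (Push C h \<rho>)" using A(9) push_id[OF hr] by simp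
  also have "\<dots> = Push C a1 (Push C (q1 \<cdot> h) \<rho>) \<oplus>\<^bsub>Ext C Z A\<^esub> Push C a2 (Push C (q2 \<cdot> h) \<rho>)"
   using add_push[OF mor_comp[OF A(3,1)] mor_comp[OF A(4,2)] hr] push_comp[OF A(3,1) hr] push_comp[OF A(4,2) hr]
    push_comp[OF h A(3) \<rho>] push_comp[OF h A(4) \<rho>] by simp
  finally show ?thesis .
 qed
 show "inj_eq C X f g"
 proof (rule inj_eqI)
  fix Z \<rho> assume \<rho>: "\<rho> \<in> xt C Z X"
  show "Push C f \<rho> = Push C g \<rho>"
   unfolding dec[OF f \<rho>] dec[OF g \<rho>] inj_eqD[OF e1 \<rho>] inj_eqD[OF e2 \<rho>] ..
 qed
qed

end

context artinian_ecat
begin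

interpretation op: artinian_ecat "opposite C" k J by (rule opposite_artinian_ecat)

lemma serre_sum:
 assumes bU: "is_biproduct C U1 U2 U u1 u2 p1 p2" and bA: "is_biproduct C A1 A2 A a1 a2 q1 q2"
  and S1: "serre k J C U1 A1 \<eta>1" and S2: "serre k J C U2 A2 \<eta>2"
 shows "\<exists>\<eta>. serre k J C U A \<eta>"
proof -
 note U = is_biproductD[OF bU] and A = is_biproductD[OF bA]
 note s1 = serreD[OF S1] and s2 = serreD[OF S2]
 interpret J: module k J by (rule J_module)
 let ?\<eta> = "\<lambda>\<xi>. \<eta>1 (Push C q1 (Pull C u1 \<xi>)) \<oplus>\<^bsub>J\<^esub> \<eta>2 (Push C q2 (Pull C u2 \<xi>))"
 note UO = morD(3)[OF U(1)] and AO = morD(3)[OF A(1)]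
 have l1: "linear_map k (Ext C U A) J (\<lambda>\<xi>. \<eta>1 (Push C q1 (Pull C u1 \<xi>)))"
  by (rule linear_map_comp[OF pull_linear[OF U(1) AO] linear_map_comp[OF push_linear[OF A(3) s1(1)] s1(3)]])
 have l2: "linear_map k (Ext C U A) J (\<lambda>\<xi>. \<eta>2 (Push C q2 (Pull C u2 \<xi>)))"
  by (rule linear_map_comp[OF pull_linear[OF U(2) AO] linear_map_comp[OF push_linear[OF A(4) s2(1)] s2(3)]])
 have lin: "linear_map k (Ext C U A) J ?\<eta>"
 proof (rule linear_mapI)
  show "?\<eta> x \<in> carrier J" if x: "x \<in> ext C U A" for x
   using linear_mapD(1)[OF l1 x] linear_mapD(1)[OF l2 x] by simp
  show "?\<eta> (x \<oplus>\<^bsub>Ext C U A\<^esub> y) = ?\<eta> x \<oplus>\<^bsub>J\<^esub> ?\<eta> y" if x: "x \<in> ext C U A" and y: "y \<in> ext C U A" for x y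
   unfolding linear_mapD(2)[OF l1 x y] linear_mapD(2)[OF l2 x y]
   using linear_mapD(1)[OF l1 x] linear_mapD(1)[OF l2 x] linear_mapD(1)[OF l1 y] linear_mapD(1)[OF l2 y]
   by (simp add: J.M.a_ac)
  show "?\<eta> (r \<odot>\<^bsub>Ext C U A\<^esub> x) = r \<odot>\<^bsub>J\<^esub> ?\<eta> x" if r: "r \<in> carrier k" and x: "x \<in> ext C U A" for r x
   unfolding linear_mapD(3)[OF l1 r x] linear_mapD(3)[OF l2 r x]
   using linear_mapD(1)[OF l1 x] linear_mapD(1)[OF l2 x] r by (simp add: J.smult_r_distr)
 qed
 have p1: "push_universal k J C U A ?\<eta>" by (rule push_universal_sum[OF bU bA s1(4) s2(4) s1(3) s2(3)])
 have p2: "push_universal k J (opposite C) A U (\<lambda>\<xi>. \<eta>1 (Pull C u1 (Push C q1 \<xi>)) \<oplus>\<^bsub>J\<^esub> \<eta>2 (Pull C u2 (Push C q2 \<xi>)))"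
  using op.push_universal_sum[of A1 A2 A q1 q2 a1 a2 U1 U2 U p1 p2 u1 u2 \<eta>1 \<eta>2] bU bA s1 s2 by simp
 have p3: "push_universal k J (opposite C) A U ?\<eta>"
  by (rule op.push_universal_cong[OF p2]) (simp_all add: AO push_pull[OF A(3) U(1)] push_pull[OF A(4) U(2)])
 show ?thesis by (intro exI[of _ ?\<eta>] serreI UO AO lin p1 p3)
qed

text \<open>All extension groups of a projective object vanish, so zero represents their duals.\<close>

lemma serre_projective:
 assumes U: "U \<in> Obj C" and P: "projective C U" and Z: "zero_object C Z"
 shows "serre k J C U Z (\<lambda>_. \<zero>\<^bsub>J\<^esub>)"
proof (rule serreI[OF U zero_objectD(1)[OF Z]])
 note ZO = zero_objectD(1)[OF Z]
 interpret J: module k J by (rule J_module)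
 have triv: "\<xi> = \<zero>\<^bsub>Ext C U X\<^esub>" if "\<xi> \<in> xt C U X" for \<xi> X using P that unfolding projective_iff[OF U] by blast
 have triv': "\<xi> = \<zero>\<^bsub>Ext C X Z\<^esub>" if "\<xi> \<in> xt C X Z" for \<xi> X by (rule zero_object_ext[OF Z that])
 show "linear_map k (Ext C U Z) J (\<lambda>_. \<zero>\<^bsub>J\<^esub>)" by (rule linear_mapI) simp_all
 show "push_universal k J C U Z (\<lambda>_. \<zero>\<^bsub>J\<^esub>)"
 proof (rule push_universalI)
  fix X \<phi> assume X: "X \<in> Obj C" and \<phi>: "linear_map k (Ext C U X) J \<phi>"
  show "\<exists>f\<in>mor C X Z. \<forall>\<xi>\<in>xt C U X. \<phi> \<xi> = \<zero>\<^bsub>J\<^esub>"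
  proof (intro bexI[OF _ mor_zero[OF X ZO]] ballI)
   fix \<xi> assume "\<xi> \<in> xt C U X"
   then show "\<phi> \<xi> = \<zero>\<^bsub>J\<^esub>" using triv linear_map_zero[OF ext_module[OF U X] J_module \<phi>] by metis
  qed
 next
  fix X f g assume "f \<in> mor C X Z" "g \<in> mor C X Z"
  then have "f = g" by (rule zero_objectD(2)[OF Z])
  then show "inj_eq C X f g" by (intro inj_eqI) simp
 qed
 show "push_universal k J (opposite C) Z U (\<lambda>_. \<zero>\<^bsub>J\<^esub>)"
 proof (rule push_universalI, unfold opposite_simps mor_opposite xt_opposite)
  fix X \<phi> assume X: "X \<in> Obj C" and \<phi>: "linear_map k (Ext C X Z) J \<phi>"
  show "\<exists>f\<in>mor C U X. \<forall>\<xi>\<in>xt C X Z. \<phi> \<xi> = \<zero>\<^bsub>J\<^esub>"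
  proof (intro bexI[OF _ mor_zero[OF U X]] ballI)
   fix \<xi> assume "\<xi> \<in> xt C X Z"
   then show "\<phi> \<xi> = \<zero>\<^bsub>J\<^esub>" using triv' linear_map_zero[OF ext_module[OF X ZO] J_module \<phi>] by metis
  qed
 next
  fix X f g assume f: "f \<in> mor C U X" and g: "g \<in> mor C U X"
  show "inj_eq (opposite C) X f g"
  proof (rule inj_eqI, unfold opposite_simps xt_opposite)
   fix W \<xi> assume \<xi>: "\<xi> \<in> xt C X W"
   show "Pull C f \<xi> = Pull C g \<xi>" using triv[OF xt_Pull[OF f \<xi>]] triv[OF xt_Pull[OF g \<xi>]] by simp
  qed
 qed
qed

end

section \<open>Serre pairs and almost split extensions\<close>

text \<open>An element that spans the socle of \<open>\<bbbE>(U, -)\<close> and of \<open>\<bbbE>(-, A)\<close> at once.\<close>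

definition almost_split :: "('o, 'm, 'k, 'e) ecat \<Rightarrow> 'o \<Rightarrow> 'o \<Rightarrow> 'e \<Rightarrow> bool" where
 "almost_split C U A \<delta> \<longleftrightarrow> \<delta> \<in> xt C U A \<and> \<delta> \<noteq> \<zero>\<^bsub>Ext C U A\<^esub> \<and>
   (\<forall>A'. \<forall>f\<in>mor C A A'. \<not> split_mono C A A' f \<longrightarrow> Push C f \<delta> = \<zero>\<^bsub>Ext C U A'\<^esub>) \<and>
   (\<forall>U'. \<forall>c\<in>mor C U' U. \<not> split_epi C U' U c \<longrightarrow> Pull C c \<delta> = \<zero>\<^bsub>Ext C U' A\<^esub>)"

context artinian_ecat
begin

interpretation op: artinian_ecat "opposite C" k J by (rule opposite_artinian_ecat)

lemma serre_vanishing: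
 assumes S: "serre k J C U A \<eta>" and z: "\<And>\<xi>. \<xi> \<in> xt C U A \<Longrightarrow> \<xi> = \<zero>\<^bsub>Ext C U A\<^esub>"
 shows "injective C A"
proof -
 note S' = serreD[OF S]
 note AO = S'(2)
 note Id = mor_Id[OF AO] and Z = mor_zero[OF AO AO]
 have e: "inj_eq C A (Id C A) (zero_arr C A A)"
 proof (rule push_universal_inj[OF S'(4) Id Z])
  fix \<xi> assume \<xi>: "\<xi> \<in> xt C U A"
  show "\<eta> (Push C (Id C A) \<xi>) = \<eta> (Push C (zero_arr C A A) \<xi>)"
   using z[OF xt_Push[OF Id \<xi>]] z[OF xt_Push[OF Z \<xi>]] by simp
 qed
 show ?thesis unfolding injective_iff[OF AO]
 proof (intro allI ballI)
  fix W \<delta> assume \<delta>: "\<delta> \<in> xt C W A"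
  show "\<delta> = \<zero>\<^bsub>Ext C W A\<^esub>" using inj_eqD[OF e \<delta>] push_id[OF \<delta>] zero_push[OF AO \<delta>] by simp
 qed
qed

lemma serre_projective_imp_injective:
 assumes S: "serre k J C U A \<eta>" and P: "projective C U"
 shows "injective C A"
proof (rule serre_vanishing[OF S])
 fix \<xi> assume "\<xi> \<in> xt C U A"
 then show "\<xi> = \<zero>\<^bsub>Ext C U A\<^esub>" using P unfolding projective_iff[OF serreD(1)[OF S]] by blast
qed

text \<open>The idempotent of \<open>A\<close> that belongs to \<open>X\<close> corresponds under the two universal properties to an
endomorphism \<open>c\<close> of \<open>U\<close>.  As \<open>U\<close> is local, \<open>c\<close> or \<open>1 - c\<close> is an automorphism, and accordingly \<open>A\<close> is
isomorphic to \<open>X\<close> or to \<open>Y\<close> modulo \<open>n\<close>-injectively trivial morphisms.\<close>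

lemma serre_summand:
 assumes S: "serre k J C U A \<eta>" and U: "local_object C U"
  and b: "is_biproduct C X Y A iX iY pX pY"
 shows "(\<exists>\<eta>'. serre k J C U X \<eta>') \<or> (\<exists>\<eta>'. serre k J C U Y \<eta>')"
proof -
 note S' = serreD[OF S] and UD = local_objectD[OF U]
 note UO = S'(1) and AO = S'(2)
 (* an idempotent of A that is matched with an automorphism of U is congruent to the identity *)
 have main: "\<exists>\<eta>'. serre k J C U X \<eta>'"
  if i: "iX \<in> mor C X A" and p: "pX \<in> mor C A X" and pi: "pX \<cdot> iX = Id C X"
   and c: "c \<in> mor C U U" "iso_arr C U U c"
   and match: "\<And>\<xi>. \<xi> \<in> xt C U A \<Longrightarrow> \<eta> (Push C (iX \<cdot> pX) \<xi>) = \<eta> (Pull C c \<xi>)" for X iX pX c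
 proof -
  let ?e = "iX \<cdot> pX"
  note e = mor_comp[OF p i]
  have ee: "?e \<cdot> ?e = ?e"
   using comp_assoc[OF e p i] comp_assoc[OF p i p] pi id_left[OF p] by simp
  obtain d where d: "d \<in> mor C U U" "c \<cdot> d = Id C U"
   using c(2) by (elim exE[OF iso_arrE[OF _ UO UO]] conjE)
  have "inj_eq C A ?e (Id C A)"
  proof (rule push_universal_inj[OF S'(4) e mor_Id[OF AO]])
   fix \<xi> assume \<xi>: "\<xi> \<in> xt C U A"
   note d\<xi> = xt_Pull[OF d(1) \<xi>]
   have cd: "Pull C d (Pull C c \<xi>') = \<xi>'" if "\<xi>' \<in> xt C U A" for \<xi>'
    using pull_comp[OF c(1) d(1) that] d(2) pull_id[OF that] by simp
   obtain f where f: "f \<in> mor C A A" "\<forall>\<xi>\<in>xt C U A. \<eta> (Pull C d \<xi>) = \<eta> (Push C f \<xi>)"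
    by (rule bexE[OF push_universal_ex[OF S'(4) AO linear_map_comp[OF pull_linear[OF d(1) AO] S'(3)]]])
   have twist: "\<eta> (Pull C c (Pull C d \<xi>')) = \<eta> (Push C ?e (Pull C d \<xi>'))" if "\<xi>' \<in> xt C U A" for \<xi>'
    using match[OF xt_Pull[OF d(1) that]] by simp
   have inv: "\<eta> (Push C ?e (Push C f \<xi>')) = \<eta> \<xi>'" if \<xi>': "\<xi>' \<in> xt C U A" for \<xi>'
   proof -
    note fe = xt_Push[OF f(1) \<xi>'] and ce = xt_Pull[OF c(1) \<xi>']
    have "\<eta> (Push C ?e (Push C f \<xi>')) = \<eta> (Pull C c (Push C f \<xi>'))" by (rule match[OF fe])
    also have "\<dots> = \<eta> (Push C f (Pull C c \<xi>'))" using push_pull[OF f(1) c(1) \<xi>'] by simp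
    also have "\<dots> = \<eta> (Pull C d (Pull C c \<xi>'))" using bspec[OF f(2) ce] by simp
    finally show ?thesis unfolding cd[OF \<xi>'] .
   qed
   have inv2: "inj_eq C A (?e \<cdot> f) (Id C A)"
   proof (rule push_universal_inj[OF S'(4) mor_comp[OF f(1) e] mor_Id[OF AO]])
    fix \<xi>' assume \<xi>': "\<xi>' \<in> xt C U A"
    show "\<eta> (Push C (?e \<cdot> f) \<xi>') = \<eta> (Push C (Id C A) \<xi>')"
     unfolding push_comp[OF f(1) e \<xi>'] push_id[OF \<xi>'] by (rule inv[OF \<xi>'])
   qed
   have ef: "Push C ?e (Push C f \<xi>) = \<xi>"
    using inj_eqD[OF inv2 \<xi>] push_comp[OF f(1) e \<xi>] push_id[OF \<xi>] by simp
   have "Push C ?e \<xi> = Push C ?e (Push C ?e (Push C f \<xi>))" unfolding ef ..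
   also have "\<dots> = Push C ?e (Push C f \<xi>)" using push_comp[OF e e xt_Push[OF f(1) \<xi>]] ee by simp
   also have "\<dots> = Push C (Id C A) \<xi>" unfolding ef push_id[OF \<xi>] ..
   finally show "\<eta> (Push C ?e \<xi>) = \<eta> (Push C (Id C A) \<xi>)" by (rule arg_cong)
  qed
  moreover have "inj_eq C X (pX \<cdot> iX) (Id C X)" unfolding pi by (rule inj_eqI) (rule refl)
  ultimately show ?thesis by (intro exI) (rule serre_iso_mod_injectives[OF S i p])
 qed
 note B = is_biproductD[OF b]
 note eX = mor_comp[OF B(3,1)] and eY = mor_comp[OF B(4,2)]
 obtain c where c: "c \<in> mor C U U" "\<forall>\<xi>\<in>xt C U A. \<eta> (Push C (iX \<cdot> pX) \<xi>) = \<eta> (Pull C c \<xi>)"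
  by (rule bexE[OF push_universal_ex[OF S'(5), of U, unfolded opposite_simps mor_opposite xt_opposite,
     OF UO linear_map_comp[OF push_linear[OF eX UO] S'(3)]]])
 show ?thesis
 proof (cases "iso_arr C U U c")
  case True
  show ?thesis by (rule disjI1, rule main[OF B(1,3,5) c(1) True bspec[OF c(2)]])
 next
  case False
  let ?d = "Id C U \<ominus>\<^bsub>Hom C U U\<^esub> c"
  note IdU = mor_Id[OF UO] and IdA = mor_Id[OF AO]
  note d = mor_diff[OF IdU c(1)]
  interpret H: abelian_group "Hom C A A" by (rule Hom_group[OF AO AO])
  have eYeq: "iY \<cdot> pY = Id C A \<ominus>\<^bsub>Hom C A A\<^esub> iX \<cdot> pX"
   using H.eq_diff_iff[OF morD(1)[OF IdA] morD(1)[OF eX] morD(1)[OF eY]] is_biproductD(9)[OF biproduct_swap[OF b]] by simp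
  have match: "\<eta> (Push C (iY \<cdot> pY) \<xi>) = \<eta> (Pull C ?d \<xi>)" if \<xi>: "\<xi> \<in> xt C U A" for \<xi>
  proof -
   note E = ext_module[OF UO AO]
   have "\<eta> (Push C (iY \<cdot> pY) \<xi>) = \<eta> \<xi> \<ominus>\<^bsub>J\<^esub> \<eta> (Push C (iX \<cdot> pX) \<xi>)"
    unfolding eYeq diff_push[OF IdA eX \<xi>] push_id[OF \<xi>]
    by (rule linear_map_minus[OF E J_module S'(3) xtD(1)[OF \<xi>] xtD(1)[OF xt_Push[OF eX \<xi>]]])
   also have "\<dots> = \<eta> \<xi> \<ominus>\<^bsub>J\<^esub> \<eta> (Pull C c \<xi>)" using bspec[OF c(2) \<xi>] by simp
   also have "\<dots> = \<eta> (Pull C ?d \<xi>)"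
    using op.diff_push[of "Id C U" U U c \<xi> A] IdU c(1) \<xi> pull_id[OF \<xi>]
     linear_map_minus[OF E J_module S'(3) xtD(1)[OF \<xi>] xtD(1)[OF xt_Pull[OF c(1) \<xi>]]] by simp
   finally show ?thesis .
  qed
  show ?thesis by (rule disjI2, rule main[OF B(2,4,6) d UD(3)[OF c(1) False] match])
 qed
qed

end

context artinian_ecat
begin

interpretation op: artinian_ecat "opposite C" k J by (rule opposite_artinian_ecat)

lemma serre_local_right:
 assumes KS: "Krull_Schmidt C" and S: "serre k J C U A \<eta>" and U: "local_object C U" and nP: "\<not> projective C U"
 shows "\<exists>A' \<eta>'. local_object C A' \<and> serre k J C U A' \<eta>'"
proof -
 have "(\<exists>\<eta>. serre k J C U A \<eta>) \<longrightarrow> (\<exists>A' \<eta>'. local_object C A' \<and> serre k J C U A' \<eta>')"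
 proof (rule Krull_Schmidt_induct[OF KS serreD(2)[OF S]])
  fix Z assume Z: "zero_object C Z"
  show "(\<exists>\<eta>. serre k J C U Z \<eta>) \<longrightarrow> (\<exists>A' \<eta>'. local_object C A' \<and> serre k J C U A' \<eta>')"
  proof (intro impI, elim exE)
   fix \<eta> assume S: "serre k J C U Z \<eta>"
   have "injective (opposite C) U"
    by (rule op.serre_vanishing[of Z U \<eta>]) (use S zero_object_ext[OF Z] in simp_all)
   then show "\<exists>A' \<eta>'. local_object C A' \<and> serre k J C U A' \<eta>'" using nP by simp
  qed
 next
  fix X assume "local_object C X"
  then show "(\<exists>\<eta>. serre k J C U X \<eta>) \<longrightarrow> (\<exists>A' \<eta>'. local_object C A' \<and> serre k J C U A' \<eta>')" by blast
 next
  fix X Y A iX iY pX pY assume b: "is_biproduct C X Y A iX iY pX pY"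
   and IX: "(\<exists>\<eta>. serre k J C U X \<eta>) \<longrightarrow> (\<exists>A' \<eta>'. local_object C A' \<and> serre k J C U A' \<eta>')"
   and IY: "(\<exists>\<eta>. serre k J C U Y \<eta>) \<longrightarrow> (\<exists>A' \<eta>'. local_object C A' \<and> serre k J C U A' \<eta>')"
  show "(\<exists>\<eta>. serre k J C U A \<eta>) \<longrightarrow> (\<exists>A' \<eta>'. local_object C A' \<and> serre k J C U A' \<eta>')"
  proof (intro impI, elim exE)
   fix \<eta> assume S: "serre k J C U A \<eta>"
   show "\<exists>A' \<eta>'. local_object C A' \<and> serre k J C U A' \<eta>'"
    by (rule disjE[OF serre_summand[OF S U b] IX[THEN mp] IY[THEN mp]])
  qed
 qed
 then show ?thesis using S by blast
qed

lemma serre_local_left: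
 assumes KS: "Krull_Schmidt C" and S: "serre k J C U A \<eta>" and A: "local_object C A" and nI: "\<not> injective C A"
 shows "\<exists>U' \<eta>'. local_object C U' \<and> serre k J C U' A \<eta>'"
proof -
 have "(\<exists>\<eta>. serre k J C U A \<eta>) \<longrightarrow> (\<exists>U' \<eta>'. local_object C U' \<and> serre k J C U' A \<eta>')"
 proof (rule Krull_Schmidt_induct[OF KS serreD(1)[OF S]])
  fix Z assume Z: "zero_object C Z"
  show "(\<exists>\<eta>. serre k J C Z A \<eta>) \<longrightarrow> (\<exists>U' \<eta>'. local_object C U' \<and> serre k J C U' A \<eta>')"
  proof (intro impI, elim exE)
   fix \<eta> assume S: "serre k J C Z A \<eta>"
   have "\<xi> = \<zero>\<^bsub>Ext C Z A\<^esub>" if "\<xi> \<in> xt C Z A" for \<xi>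
    using op.zero_object_ext[of Z \<xi> A] Z that by simp
   from serre_vanishing[OF S this] show "\<exists>U' \<eta>'. local_object C U' \<and> serre k J C U' A \<eta>'" using nI by simp
  qed
 next
  fix X assume "local_object C X"
  then show "(\<exists>\<eta>. serre k J C X A \<eta>) \<longrightarrow> (\<exists>U' \<eta>'. local_object C U' \<and> serre k J C U' A \<eta>')" by blast
 next
  fix X Y U iX iY pX pY assume b: "is_biproduct C X Y U iX iY pX pY"
   and IX: "(\<exists>\<eta>. serre k J C X A \<eta>) \<longrightarrow> (\<exists>U' \<eta>'. local_object C U' \<and> serre k J C U' A \<eta>')"
   and IY: "(\<exists>\<eta>. serre k J C Y A \<eta>) \<longrightarrow> (\<exists>U' \<eta>'. local_object C U' \<and> serre k J C U' A \<eta>')"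
  show "(\<exists>\<eta>. serre k J C U A \<eta>) \<longrightarrow> (\<exists>U' \<eta>'. local_object C U' \<and> serre k J C U' A \<eta>')"
  proof (intro impI, elim exE)
   fix \<eta> assume S: "serre k J C U A \<eta>"
   have "(\<exists>\<eta>'. serre k J C X A \<eta>') \<or> (\<exists>\<eta>'. serre k J C Y A \<eta>')"
    using op.serre_summand[of A U \<eta> X Y pX pY iX iY] S A b by simp
   then show "\<exists>U' \<eta>'. local_object C U' \<and> serre k J C U' A \<eta>'"
    by (rule disjE[OF _ IX[THEN mp] IY[THEN mp]])
  qed
 qed
 then show ?thesis using S by blast
qed

text \<open>The functionals \<open>\<xi> \<mapsto> \<eta> (c\<^sup>* \<xi>)\<close> with \<open>c\<close> in the radical of \<open>End U\<close> form a submodule of \<open>D \<bbbE>(U, A)\<close>.  If they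
separated points, then \<open>\<eta>\<close> would be one of them, so \<open>1 - c\<close> would be \<open>n\<close>-projectively trivial for a
non-automorphism \<open>c\<close>; but \<open>1 - c\<close> is invertible, and \<open>U\<close> would be projective.  Hence they have a common zero
\<open>\<delta> \<noteq> 0\<close>, and \<open>\<eta> (c\<^sup>* \<delta>) \<noteq> 0\<close> forces \<open>c\<close> to be an automorphism.\<close>

lemma serre_almost_split:
 assumes S: "serre k J C U A \<eta>" and U: "local_object C U" and A: "local_object C A"
  and nP: "\<not> projective C U" and nI: "\<not> injective C A"
 shows "\<exists>\<delta>. almost_split C U A \<delta>"
proof -
 note S' = serreD[OF S] and UD = local_objectD[OF U] and AD = local_objectD[OF A]
 note UO = S'(1) and AO = S'(2)
 note \<eta> = S'(3) and E = ext_module[OF UO AO]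
 note IdU = mor_Id[OF UO] and IdA = mor_Id[OF AO]
 interpret J: module k J by (rule J_module)
 have op_univ: "\<exists>c\<in>mor C U X. \<forall>\<xi>\<in>xt C X A. \<phi> \<xi> = \<eta> (Pull C c \<xi>)"
  if "X \<in> Obj C" "linear_map k (Ext C X A) J \<phi>" for X \<phi>
  by (rule push_universal_ex[OF S'(5), of X, unfolded opposite_simps mor_opposite xt_opposite, OF that])
 \<comment> \<open>the radical of the endomorphism ring of \<open>U\<close>\<close>
 let ?V = "{c \<in> mor C U U. \<not> iso_arr C U U c}"
 have ex: "\<exists>\<delta>\<in>ext C U A. \<delta> \<noteq> \<zero>\<^bsub>Ext C U A\<^esub> \<and> (\<forall>c\<in>?V. \<eta> (Pull C c \<delta>) = \<zero>\<^bsub>J\<^esub>)"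
 proof (rule ccontr)
  assume no: "\<not> ?thesis"
  have "\<exists>c\<in>?V. \<forall>\<xi>\<in>ext C U A. \<eta> \<xi> = \<eta> (Pull C c \<xi>)"
  proof (rule separating_functionals_exhaust[OF k_artinian E ext_fg[OF UO AO] J_module J_socle, where s = "\<lambda>c \<xi>. \<eta> (Pull C c \<xi>)"])
   have "\<not> iso_arr C U U (zero_arr C U U)"
   proof
    assume i: "iso_arr C U U (zero_arr C U U)"
    obtain g where g: "g \<in> mor C U U" "g \<cdot> zero_arr C U U = Id C U"
     using i by (elim exE[OF iso_arrE[OF _ UO UO]] conjE)
    then have "Id C U = zero_arr C U U" using comp_zero_right[OF UO g(1)] by simp
    with UD(2) show False by (rule notE)
   qed
   then show "zero_arr C U U \<in> ?V" using mor_zero[OF UO UO] by simp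
   show "linear_map k (Ext C U A) J (\<lambda>\<xi>. \<eta> (Pull C c \<xi>))" if c: "c \<in> ?V" for c
    by (rule linear_map_comp[OF pull_linear[OF _ AO] \<eta>]) (use c in simp)
   show "\<exists>v\<in>?V. \<forall>\<xi>\<in>ext C U A. \<eta> (Pull C v \<xi>) = \<eta> (Pull C c \<xi>) \<oplus>\<^bsub>J\<^esub> \<eta> (Pull C d \<xi>)"
    if cV: "c \<in> ?V" and dV: "d \<in> ?V" for c d
   proof -
    have c: "c \<in> mor C U U" "\<not> iso_arr C U U c" and d: "d \<in> mor C U U" "\<not> iso_arr C U U d" using cV dV by simp_all
    have m: "c \<oplus>\<^bsub>Hom C U U\<^esub> d \<in> ?V" using mor_add[OF c(1) d(1)] local_noniso_add[OF U c(1) d(1) c(2) d(2)] by simp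
    show ?thesis
    proof (intro bexI[OF _ m] ballI)
     fix \<xi> assume "\<xi> \<in> ext C U A"
     then have \<xi>: "\<xi> \<in> xt C U A" using UO AO by (rule xtI)
     show "\<eta> (Pull C (c \<oplus>\<^bsub>Hom C U U\<^esub> d) \<xi>) = \<eta> (Pull C c \<xi>) \<oplus>\<^bsub>J\<^esub> \<eta> (Pull C d \<xi>)"
      unfolding add_pull[OF c(1) d(1) \<xi>]
      by (rule linear_mapD(2)[OF \<eta> xtD(1)[OF xt_Pull[OF c(1) \<xi>]] xtD(1)[OF xt_Pull[OF d(1) \<xi>]]])
    qed
   qed
   show "\<exists>v\<in>?V. \<forall>\<xi>\<in>ext C U A. \<eta> (Pull C v \<xi>) = r \<odot>\<^bsub>J\<^esub> \<eta> (Pull C c \<xi>)"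
    if r: "r \<in> carrier k" and cV: "c \<in> ?V" for r c
   proof -
    have c: "c \<in> mor C U U" "\<not> iso_arr C U U c" using cV by simp_all
    note rc = mor_smult[OF r c(1)] and rI = mor_smult[OF r IdU]
    have "r \<odot>\<^bsub>Hom C U U\<^esub> c = (r \<odot>\<^bsub>Hom C U U\<^esub> Id C U) \<cdot> c"
     using comp_smult(2)[OF c(1) IdU r] id_left[OF c(1)] by simp
    then have "\<not> iso_arr C U U (r \<odot>\<^bsub>Hom C U U\<^esub> c)" using local_iso_left(1)[OF U c(1) rI] c(2) by metis
    then have m: "r \<odot>\<^bsub>Hom C U U\<^esub> c \<in> ?V" using rc by simp
    show ?thesis
    proof (intro bexI[OF _ m] ballI)
     fix \<xi> assume "\<xi> \<in> ext C U A"
     then have \<xi>: "\<xi> \<in> xt C U A" using UO AO by (rule xtI)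
     show "\<eta> (Pull C (r \<odot>\<^bsub>Hom C U U\<^esub> c) \<xi>) = r \<odot>\<^bsub>J\<^esub> \<eta> (Pull C c \<xi>)"
      unfolding smult_pull[OF c(1) \<xi> r] by (rule linear_mapD(3)[OF \<eta> r xtD(1)[OF xt_Pull[OF c(1) \<xi>]]])
    qed
   qed
   show "\<exists>c\<in>?V. \<eta> (Pull C c x) \<noteq> \<zero>\<^bsub>J\<^esub>" if "x \<in> ext C U A" "x \<noteq> \<zero>\<^bsub>Ext C U A\<^esub>" for x
    using no that by blast
   show "linear_map k (Ext C U A) J \<eta>" by (rule \<eta>)
  qed
  then obtain c where cV: "c \<in> ?V" and ce: "\<forall>\<xi>\<in>ext C U A. \<eta> \<xi> = \<eta> (Pull C c \<xi>)" by (rule bexE)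
  have c: "c \<in> mor C U U" "\<not> iso_arr C U U c" using cV by simp_all
  have eq: "inj_eq (opposite C) U (Id C U) c"
  proof (rule push_universal_inj[OF S'(5)], unfold opposite_simps mor_opposite xt_opposite)
   fix \<xi> assume \<xi>: "\<xi> \<in> xt C U A"
   show "\<eta> (Pull C (Id C U) \<xi>) = \<eta> (Pull C c \<xi>)" unfolding pull_id[OF \<xi>] by (rule bspec[OF ce xtD(1)[OF \<xi>]])
  qed (rule IdU c(1))+
  have "injective (opposite C) U"
  proof (rule op.iso_annihilating[of U "Id C U \<ominus>\<^bsub>Hom C U U\<^esub> c"], unfold opposite_simps xt_opposite iso_arr_opposite)
   show "U \<in> Obj C" by (rule UO)
   show "iso_arr C U U (Id C U \<ominus>\<^bsub>Hom C U U\<^esub> c)" by (rule UD(3)[OF c])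
   fix Z \<delta> assume \<delta>: "\<delta> \<in> xt C U Z"
   note cd = xt_Pull[OF c(1) \<delta>]
   have "Pull C (Id C U \<ominus>\<^bsub>Hom C U U\<^esub> c) \<delta> = Pull C (Id C U) \<delta> \<ominus>\<^bsub>Ext C U Z\<^esub> Pull C c \<delta>"
    using op.diff_push[of "Id C U" U U c \<delta> Z] IdU c(1) \<delta> by simp
   also have "\<dots> = Pull C c \<delta> \<ominus>\<^bsub>Ext C U Z\<^esub> Pull C c \<delta>"
    using inj_eqD[OF eq, of \<delta> Z] \<delta> by simp
   also have "\<dots> = \<zero>\<^bsub>Ext C U Z\<^esub>"
    using abelian_group.diff_zero_iff[OF xt_group[OF cd] xtD(1)[OF cd] xtD(1)[OF cd]] by simp
   finally show "Pull C (Id C U \<ominus>\<^bsub>Hom C U U\<^esub> c) \<delta> = \<zero>\<^bsub>Ext C U Z\<^esub>" .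
  qed
  then show False using nP by simp
 qed
 then obtain \<delta> where \<delta>e: "\<delta> \<in> ext C U A" and \<delta>0: "\<delta> \<noteq> \<zero>\<^bsub>Ext C U A\<^esub>"
  and killed: "\<forall>c\<in>?V. \<eta> (Pull C c \<delta>) = \<zero>\<^bsub>J\<^esub>" by (elim bexE conjE)
 have \<delta>: "\<delta> \<in> xt C U A" by (rule xtI[OF \<delta>e UO AO])
 have iso: "iso_arr C U U c" if "c \<in> mor C U U" "\<eta> (Pull C c \<delta>) \<noteq> \<zero>\<^bsub>J\<^esub>" for c
  using killed that by blast
 have epi: "Pull C c \<delta> = \<zero>\<^bsub>Ext C U' A\<^esub>" if c: "c \<in> mor C U' U" and ns: "\<not> split_epi C U' U c" for U' c
 proof (rule ccontr)
  assume n: "Pull C c \<delta> \<noteq> \<zero>\<^bsub>Ext C U' A\<^esub>"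
  note cd = xt_Pull[OF c \<delta>] and U'O = morD(2)[OF c]
  obtain \<phi> where \<phi>: "linear_map k (Ext C U' A) J \<phi>" "\<phi> (Pull C c \<delta>) \<noteq> \<zero>\<^bsub>J\<^esub>"
   using nonzero_functional[OF ext_module[OF U'O AO] J_injective J_cogenerator xtD(1)[OF cd] n] by (elim exE conjE)
  obtain g where g: "g \<in> mor C U U'" "\<forall>\<xi>\<in>xt C U' A. \<phi> \<xi> = \<eta> (Pull C g \<xi>)"
   by (rule bexE[OF op_univ[OF U'O \<phi>(1)]])
  have "\<eta> (Pull C (c \<cdot> g) \<delta>) \<noteq> \<zero>\<^bsub>J\<^esub>"
   unfolding pull_comp[OF c g(1) \<delta>] using bspec[OF g(2) cd] \<phi>(2) by simp
  then have i: "iso_arr C U U (c \<cdot> g)" by (rule iso[OF mor_comp[OF g(1) c]])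
  obtain h where h: "h \<in> mor C U U" "(c \<cdot> g) \<cdot> h = Id C U"
   using i by (elim exE[OF iso_arrE[OF _ UO UO]] conjE)
  note gh = mor_comp[OF h(1) g(1)]
  have "c \<cdot> (g \<cdot> h) = Id C U" using comp_assoc[OF h(1) g(1) c] h(2) by simp
  then have "split_epi C U' U c"
   unfolding split_epi_def by (intro conjI bexI[of _ "g \<cdot> h"] morD(1)[OF c] morD(1)[OF gh])
  with ns show False by (rule notE)
 qed
 have mono: "Push C a \<delta> = \<zero>\<^bsub>Ext C U A'\<^esub>" if a: "a \<in> mor C A A'" and ns: "\<not> split_mono C A A' a" for A' a
 proof (rule ccontr)
  assume n: "Push C a \<delta> \<noteq> \<zero>\<^bsub>Ext C U A'\<^esub>"
  note ad = xt_Push[OF a \<delta>] and A'O = morD(3)[OF a]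
  obtain \<phi> where \<phi>: "linear_map k (Ext C U A') J \<phi>" "\<phi> (Push C a \<delta>) \<noteq> \<zero>\<^bsub>J\<^esub>"
   using nonzero_functional[OF ext_module[OF UO A'O] J_injective J_cogenerator xtD(1)[OF ad] n] by (elim exE conjE)
  obtain f where f: "f \<in> mor C A' A" "\<forall>\<xi>\<in>xt C U A'. \<phi> \<xi> = \<eta> (Push C f \<xi>)"
   by (rule bexE[OF push_universal_ex[OF S'(4) A'O \<phi>(1)]])
  let ?b = "f \<cdot> a"
  note b = mor_comp[OF a f(1)]
  have nz: "\<eta> (Push C ?b \<delta>) \<noteq> \<zero>\<^bsub>J\<^esub>"
   unfolding push_comp[OF a f(1) \<delta>] using bspec[OF f(2) ad] \<phi>(2) by simp
  have nb: "\<not> iso_arr C A A ?b"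
  proof
   assume i: "iso_arr C A A ?b"
   obtain h where h: "h \<in> mor C A A" "h \<cdot> ?b = Id C A"
    using i by (elim exE[OF iso_arrE[OF _ AO AO]] conjE)
   note hf = mor_comp[OF f(1) h(1)]
   have "(h \<cdot> f) \<cdot> a = Id C A" using comp_assoc[OF a f(1) h(1)] h(2) by simp
   then have "split_mono C A A' a"
    unfolding split_mono_def by (intro conjI bexI[of _ "h \<cdot> f"] morD(1)[OF a] morD(1)[OF hf])
   with ns show False by (rule notE)
  qed
  obtain c where c: "c \<in> mor C U U" "\<forall>\<xi>\<in>xt C U A. \<eta> (Push C ?b \<xi>) = \<eta> (Pull C c \<xi>)"
   by (rule bexE[OF op_univ[OF UO linear_map_comp[OF push_linear[OF b UO] \<eta>]]])
  have "\<eta> (Pull C c \<delta>) \<noteq> \<zero>\<^bsub>J\<^esub>" using bspec[OF c(2) \<delta>] nz by simp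
  then have i: "iso_arr C U U c" by (rule iso[OF c(1)])
  obtain d where d: "d \<in> mor C U U" "d \<cdot> c = Id C U"
   using i by (elim exE[OF iso_arrE[OF _ UO UO]] conjE)
  obtain b' where b': "b' \<in> mor C A A" "\<forall>\<xi>\<in>xt C U A. \<eta> (Pull C d \<xi>) = \<eta> (Push C b' \<xi>)"
   by (rule bexE[OF push_universal_ex[OF S'(4) AO linear_map_comp[OF pull_linear[OF d(1) AO] \<eta>]]])
  note bb = mor_comp[OF b b'(1)]
  have eq: "inj_eq C A (b' \<cdot> ?b) (Id C A)"
  proof (rule push_universal_inj[OF S'(4) bb IdA])
   fix \<xi> assume \<xi>: "\<xi> \<in> xt C U A"
   note be = xt_Push[OF b \<xi>] and de = xt_Pull[OF d(1) \<xi>]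
   have "\<eta> (Push C (b' \<cdot> ?b) \<xi>) = \<eta> (Push C b' (Push C ?b \<xi>))" unfolding push_comp[OF b b'(1) \<xi>] ..
   also have "\<dots> = \<eta> (Pull C d (Push C ?b \<xi>))" using bspec[OF b'(2) be] by simp
   also have "\<dots> = \<eta> (Push C ?b (Pull C d \<xi>))" unfolding push_pull[OF b d(1) \<xi>] ..
   also have "\<dots> = \<eta> (Pull C c (Pull C d \<xi>))" using bspec[OF c(2) de] by simp
   also have "\<dots> = \<eta> (Push C (Id C A) \<xi>)" unfolding pull_comp[OF d(1) c(1) \<xi>, symmetric] d(2) pull_id[OF \<xi>] push_id[OF \<xi>] ..
   finally show "\<eta> (Push C (b' \<cdot> ?b) \<xi>) = \<eta> (Push C (Id C A) \<xi>)" .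
  qed
  have nbb: "\<not> iso_arr C A A (b' \<cdot> ?b)"
   using nb local_iso_left(1)[OF A b b'(1)] by (rule contrapos_nn)
  have "injective C A"
  proof (rule iso_annihilating[OF AO AD(3)[OF bb nbb]])
   fix Z \<rho> assume \<rho>: "\<rho> \<in> xt C Z A"
   note br = xt_Push[OF bb \<rho>]
   show "Push C (Id C A \<ominus>\<^bsub>Hom C A A\<^esub> b' \<cdot> ?b) \<rho> = \<zero>\<^bsub>Ext C Z A\<^esub>"
    unfolding diff_push[OF IdA bb \<rho>] inj_eqD[OF eq \<rho>]
    using abelian_group.diff_zero_iff[OF xt_group[OF \<rho>] xtD(1)[OF \<rho>] xtD(1)[OF \<rho>]] push_id[OF \<rho>] by simp
  qed
  with nI show False by (rule notE)
 qed
 have "almost_split C U A \<delta>" unfolding almost_split_def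
  by (intro conjI \<delta> \<delta>0 allI ballI impI mono epi)
 then show ?thesis by (rule exI)
qed

theorem almost_split_of_serre_right:
 assumes KS: "Krull_Schmidt C" and ex: "\<exists>A \<eta>. serre k J C U A \<eta>" and U: "local_object C U" and nP: "\<not> projective C U"
 shows "\<exists>A \<delta>. local_object C A \<and> almost_split C U A \<delta>"
proof -
 obtain A0 \<eta>0 where "serre k J C U A0 \<eta>0" using ex by (elim exE)
 from serre_local_right[OF KS this U nP]
 obtain A \<eta> where A: "local_object C A" and S: "serre k J C U A \<eta>" by (elim exE conjE)
 have nI: "\<not> injective C A"
 proof
  assume "injective C A"
  then have "injective (opposite C) U" by (intro op.serre_projective_imp_injective[of A U \<eta>]) (simp_all add: S)
  then show False using nP by simp
 qed
 obtain \<delta> where "almost_split C U A \<delta>" using serre_almost_split[OF S U A nP nI] by (rule exE)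
 with A show ?thesis by (intro exI conjI)
qed

theorem almost_split_of_serre_left:
 assumes KS: "Krull_Schmidt C" and ex: "\<exists>U \<eta>. serre k J C U A \<eta>" and A: "local_object C A" and nI: "\<not> injective C A"
 shows "\<exists>U \<delta>. local_object C U \<and> almost_split C U A \<delta>"
proof -
 obtain U0 \<eta>0 where "serre k J C U0 A \<eta>0" using ex by (elim exE)
 from serre_local_left[OF KS this A nI]
 obtain U \<eta> where U: "local_object C U" and S: "serre k J C U A \<eta>" by (elim exE conjE)
 have nP: "\<not> projective C U" using nI serre_projective_imp_injective[OF S] by (rule contrapos_nn)
 obtain \<delta> where "almost_split C U A \<delta>" using serre_almost_split[OF S U A nP nI] by (rule exE)
 with U show ?thesis by (intro exI conjI)
qed

text \<open>Conversely, Serre pairs for the indecomposable objects add up to Serre pairs for all.\<close>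

theorem serre_right_exists:
 assumes KS: "Krull_Schmidt C" and U: "U \<in> Obj C"
  and ind: "\<And>V. local_object C V \<Longrightarrow> \<not> projective C V \<Longrightarrow> \<exists>A \<eta>. serre k J C V A \<eta>"
 shows "\<exists>A \<eta>. serre k J C U A \<eta>"
proof (rule Krull_Schmidt_induct[OF KS U])
 obtain Z0 where Z0: "zero_object C Z0" using zero_object_exists by (rule exE)
 have proj: "\<exists>A \<eta>. serre k J C V A \<eta>" if "V \<in> Obj C" "projective C V" for V
  by (intro exI) (rule serre_projective[OF that Z0])
 show "\<exists>A \<eta>. serre k J C Z A \<eta>" if Z: "zero_object C Z" for Z
 proof (rule proj[OF zero_objectD(1)[OF Z]])
  show "projective C Z" unfolding projective_iff[OF zero_objectD(1)[OF Z]]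
  proof (intro allI ballI)
   fix W \<delta> assume "\<delta> \<in> xt C Z W"
   then show "\<delta> = \<zero>\<^bsub>Ext C Z W\<^esub>" using op.zero_object_ext[of Z \<delta> W] Z by simp
  qed
 qed
 show "\<exists>A \<eta>. serre k J C V A \<eta>" if V: "local_object C V" for V
 proof (cases "projective C V")
  case True
  then show ?thesis by (rule proj[OF local_objectD(1)[OF V]])
 next
  case False
  then show ?thesis by (rule ind[OF V])
 qed
 fix X Y S iX iY pX pY assume b: "is_biproduct C X Y S iX iY pX pY"
  and "\<exists>A \<eta>. serre k J C X A \<eta>" "\<exists>A \<eta>. serre k J C Y A \<eta>"
 then obtain A1 \<eta>1 A2 \<eta>2 where s: "serre k J C X A1 \<eta>1" "serre k J C Y A2 \<eta>2" by (elim exE)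
 obtain A a1 a2 q1 q2 where "is_biproduct C A1 A2 A a1 a2 q1 q2"
  using biproduct_exists[OF serreD(2)[OF s(1)] serreD(2)[OF s(2)]] by (elim exE)
 from serre_sum[OF b this s] show "\<exists>A \<eta>. serre k J C S A \<eta>" by (rule exI)
qed

theorem serre_left_exists:
 assumes KS: "Krull_Schmidt C" and A: "A \<in> Obj C"
  and ind: "\<And>B. local_object C B \<Longrightarrow> \<not> injective C B \<Longrightarrow> \<exists>U \<eta>. serre k J C U B \<eta>"
 shows "\<exists>U \<eta>. serre k J C U A \<eta>"
proof (rule Krull_Schmidt_induct[OF KS A])
 obtain Z0 where Z0: "zero_object C Z0" using zero_object_exists by (rule exE)
 have inj: "\<exists>U \<eta>. serre k J C U B \<eta>" if "B \<in> Obj C" "injective C B" for B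
  using op.serre_projective[of B Z0] that Z0 by (intro exI[of _ Z0] exI[of _ "\<lambda>_. \<zero>\<^bsub>J\<^esub>"]) simp
 show "\<exists>U \<eta>. serre k J C U Z \<eta>" if Z: "zero_object C Z" for Z
 proof (rule inj[OF zero_objectD(1)[OF Z]])
  show "injective C Z" unfolding injective_iff[OF zero_objectD(1)[OF Z]]
   by (intro allI ballI) (rule zero_object_ext[OF Z])
 qed
 show "\<exists>U \<eta>. serre k J C U B \<eta>" if B: "local_object C B" for B
 proof (cases "injective C B")
  case True
  then show ?thesis by (rule inj[OF local_objectD(1)[OF B]])
 next
  case False
  then show ?thesis by (rule ind[OF B])
 qed
 fix X Y S iX iY pX pY assume b: "is_biproduct C X Y S iX iY pX pY"
  and "\<exists>U \<eta>. serre k J C U X \<eta>" "\<exists>U \<eta>. serre k J C U Y \<eta>"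
 then obtain U1 \<eta>1 U2 \<eta>2 where s: "serre k J C U1 X \<eta>1" "serre k J C U2 Y \<eta>2" by (elim exE)
 obtain U u1 u2 p1 p2 where "is_biproduct C U1 U2 U u1 u2 p1 p2"
  using biproduct_exists[OF serreD(1)[OF s(1)] serreD(1)[OF s(2)]] by (elim exE)
 from serre_sum[OF this b s] show "\<exists>U \<eta>. serre k J C U S \<eta>" by (rule exI)
qed

end

section \<open>Equivalences of categories\<close>

lemma is_functorD:
 assumes "is_functor C D Fo Fm"
 shows "A \<in> Obj C \<Longrightarrow> Fo A \<in> Obj D" "A \<in> Obj C \<Longrightarrow> Fm (Id C A) = Id D (Fo A)"
  "f \<in> mor C A B \<Longrightarrow> Fm f \<in> mor D (Fo A) (Fo B)"
  "f \<in> mor C A B \<Longrightarrow> g \<in> mor C B E \<Longrightarrow> Fm (g \<cdot>\<^bsub>C\<^esub> f) = Fm g \<cdot>\<^bsub>D\<^esub> Fm f"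
proof -
 note F = assms[unfolded is_functor_def]
 show o: "A \<in> Obj C \<Longrightarrow> Fo A \<in> Obj D" for A using F[THEN conjunct1] by blast
 show "A \<in> Obj C \<Longrightarrow> Fm (Id C A) = Id D (Fo A)" using F[THEN conjunct1] by blast
 show "f \<in> mor C A B \<Longrightarrow> Fm f \<in> mor D (Fo A) (Fo B)"
  using F[THEN conjunct2, THEN conjunct1] o unfolding mor_def by blast
 show "f \<in> mor C A B \<Longrightarrow> g \<in> mor C B E \<Longrightarrow> Fm (g \<cdot>\<^bsub>C\<^esub> f) = Fm g \<cdot>\<^bsub>D\<^esub> Fm f"
  using F[THEN conjunct2, THEN conjunct2] unfolding mor_def by blast
qed

lemma is_functorI:
 assumes "\<And>A. A \<in> Obj C \<Longrightarrow> Fo A \<in> Obj D" "\<And>A. A \<in> Obj C \<Longrightarrow> Fm (Id C A) = Id D (Fo A)"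
  "\<And>A B f. f \<in> mor C A B \<Longrightarrow> Fm f \<in> mor D (Fo A) (Fo B)"
  "\<And>A B E f g. f \<in> mor C A B \<Longrightarrow> g \<in> mor C B E \<Longrightarrow> Fm (g \<cdot>\<^bsub>C\<^esub> f) = Fm g \<cdot>\<^bsub>D\<^esub> Fm f"
 shows "is_functor C D Fo Fm"
 unfolding is_functor_def
proof (intro conjI ballI Pi_I)
 fix A assume A: "A \<in> Obj C"
 show "Fo A \<in> Obj D" "Fm (Id C A) = Id D (Fo A)" using assms(1,2)[OF A] by simp_all
 fix B assume B: "B \<in> Obj C"
 show "Fm f \<in> arr D (Fo A) (Fo B)" if "f \<in> arr C A B" for f
  by (rule morD(1)[OF assms(3)[OF morI[OF that A B]]])
 fix E f g assume E: "E \<in> Obj C" and f: "f \<in> arr C A B" and g: "g \<in> arr C B E"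
 show "Fm (g \<cdot>\<^bsub>C\<^esub> f) = Fm g \<cdot>\<^bsub>D\<^esub> Fm f" by (rule assms(4)[OF morI[OF f A B] morI[OF g B E]])
qed

lemma naturally_isomorphicI:
 assumes "\<And>A. A \<in> Obj C \<Longrightarrow> iso_arr D (Fo A) (Go A) (\<eta> A)"
  and "\<And>A B f. f \<in> mor C A B \<Longrightarrow> \<eta> B \<cdot>\<^bsub>D\<^esub> Fm f = Gm f \<cdot>\<^bsub>D\<^esub> \<eta> A"
 shows "naturally_isomorphic C D Fo Fm Go Gm"
 unfolding naturally_isomorphic_def
proof (intro exI[of _ \<eta>] conjI ballI)
 show "iso_arr D (Fo A) (Go A) (\<eta> A)" if "A \<in> Obj C" for A by (rule assms(1)[OF that])
 show "\<eta> B \<cdot>\<^bsub>D\<^esub> Fm f = Gm f \<cdot>\<^bsub>D\<^esub> \<eta> A" if "A \<in> Obj C" "B \<in> Obj C" "f \<in> arr C A B" for A B f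
  by (rule assms(2)[OF morI[OF that(3,1,2)]])
qed

text \<open>A fully faithful and dense functor is an equivalence: a quasi-inverse is obtained by choosing
 preimages of objects up to isomorphism and transporting morphisms along the chosen isomorphisms.\<close>

lemma fully_faithful_dense_equivalence:
 assumes CC: "category C" and DD: "category D" and F: "is_functor C D Fo Fm"
  and full: "\<And>A B h. A \<in> Obj C \<Longrightarrow> B \<in> Obj C \<Longrightarrow> h \<in> mor D (Fo A) (Fo B) \<Longrightarrow> \<exists>f\<in>mor C A B. Fm f = h"
  and faithful: "\<And>A B f g. f \<in> mor C A B \<Longrightarrow> g \<in> mor C A B \<Longrightarrow> Fm f = Fm g \<Longrightarrow> f = g"
  and dense: "\<And>Y. Y \<in> Obj D \<Longrightarrow> \<exists>X\<in>Obj C. \<exists>e. iso_arr D (Fo X) Y e"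
 shows "is_equivalence C D Fo Fm"
proof -
 interpret C: category C by fact
 interpret D: category D by fact
 note FD = is_functorD[OF F]
 have "\<forall>Y\<in>Obj D. \<exists>t. fst t \<in> Obj C \<and> fst (snd t) \<in> mor D (Fo (fst t)) Y \<and> snd (snd t) \<in> mor D Y (Fo (fst t)) \<and>
   snd (snd t) \<cdot>\<^bsub>D\<^esub> fst (snd t) = Id D (Fo (fst t)) \<and> fst (snd t) \<cdot>\<^bsub>D\<^esub> snd (snd t) = Id D Y"
 proof
  fix Y assume Y: "Y \<in> Obj D"
  obtain X e where X: "X \<in> Obj C" and e: "iso_arr D (Fo X) Y e" using dense[OF Y] by (elim bexE exE)
  obtain e' where "e \<in> mor D (Fo X) Y" "e' \<in> mor D Y (Fo X)" "e' \<cdot>\<^bsub>D\<^esub> e = Id D (Fo X)" "e \<cdot>\<^bsub>D\<^esub> e' = Id D Y"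
   using iso_arrE[OF e FD(1)[OF X] Y] by (elim exE conjE)
  then show "\<exists>t. fst t \<in> Obj C \<and> fst (snd t) \<in> mor D (Fo (fst t)) Y \<and> snd (snd t) \<in> mor D Y (Fo (fst t)) \<and>
   snd (snd t) \<cdot>\<^bsub>D\<^esub> fst (snd t) = Id D (Fo (fst t)) \<and> fst (snd t) \<cdot>\<^bsub>D\<^esub> snd (snd t) = Id D Y"
   using X by (intro exI[of _ "(X, e, e')"]) simp
 qed
 from bchoice[OF this] obtain t where t: "\<forall>Y\<in>Obj D. fst (t Y) \<in> Obj C \<and> fst (snd (t Y)) \<in> mor D (Fo (fst (t Y))) Y \<and>
   snd (snd (t Y)) \<in> mor D Y (Fo (fst (t Y))) \<and>
   snd (snd (t Y)) \<cdot>\<^bsub>D\<^esub> fst (snd (t Y)) = Id D (Fo (fst (t Y))) \<and> fst (snd (t Y)) \<cdot>\<^bsub>D\<^esub> snd (snd (t Y)) = Id D Y" by (rule exE)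
 define G where "G Y = fst (t Y)" for Y
 define e where "e Y = fst (snd (t Y))" for Y
 define e' where "e' Y = snd (snd (t Y))" for Y
 have G: "G Y \<in> Obj C" and e: "e Y \<in> mor D (Fo (G Y)) Y" and e': "e' Y \<in> mor D Y (Fo (G Y))"
  and e'e: "e' Y \<cdot>\<^bsub>D\<^esub> e Y = Id D (Fo (G Y))" and ee': "e Y \<cdot>\<^bsub>D\<^esub> e' Y = Id D Y" if "Y \<in> Obj D" for Y
  using bspec[OF t that] unfolding G_def e_def e'_def by simp_all
 define Gm where "Gm h = (SOME m. \<exists>Y Y'. h \<in> mor D Y Y' \<and> m \<in> mor C (G Y) (G Y') \<and> Fm m = e' Y' \<cdot>\<^bsub>D\<^esub> (h \<cdot>\<^bsub>D\<^esub> e Y))" for h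
 have Gm: "Gm h \<in> mor C (G Y) (G Y') \<and> Fm (Gm h) = e' Y' \<cdot>\<^bsub>D\<^esub> (h \<cdot>\<^bsub>D\<^esub> e Y)" if h: "h \<in> mor D Y Y'" for h Y Y'
 proof -
  note Y = morD(2)[OF h] and Y' = morD(3)[OF h]
  have "e' Y' \<cdot>\<^bsub>D\<^esub> (h \<cdot>\<^bsub>D\<^esub> e Y) \<in> mor D (Fo (G Y)) (Fo (G Y'))"
   by (rule D.mor_comp[OF D.mor_comp[OF e[OF Y] h] e'[OF Y']])
  from full[OF G[OF Y] G[OF Y'] this]
  obtain m where m: "m \<in> mor C (G Y) (G Y')" "Fm m = e' Y' \<cdot>\<^bsub>D\<^esub> (h \<cdot>\<^bsub>D\<^esub> e Y)" by (rule bexE)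
  have "\<exists>Z Z'. h \<in> mor D Z Z' \<and> Gm h \<in> mor C (G Z) (G Z') \<and> Fm (Gm h) = e' Z' \<cdot>\<^bsub>D\<^esub> (h \<cdot>\<^bsub>D\<^esub> e Z)"
   unfolding Gm_def
  proof (rule someI[where P = "\<lambda>m. \<exists>Z Z'. h \<in> mor D Z Z' \<and> m \<in> mor C (G Z) (G Z') \<and> Fm m = e' Z' \<cdot>\<^bsub>D\<^esub> (h \<cdot>\<^bsub>D\<^esub> e Z)"])
   show "\<exists>Z Z'. h \<in> mor D Z Z' \<and> m \<in> mor C (G Z) (G Z') \<and> Fm m = e' Z' \<cdot>\<^bsub>D\<^esub> (h \<cdot>\<^bsub>D\<^esub> e Z)"
    by (intro exI[of _ Y] exI[of _ Y'] conjI h m)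
  qed
  then obtain Z Z' where z: "h \<in> mor D Z Z'" "Gm h \<in> mor C (G Z) (G Z')" "Fm (Gm h) = e' Z' \<cdot>\<^bsub>D\<^esub> (h \<cdot>\<^bsub>D\<^esub> e Z)"
   by (elim exE conjE)
  have "Y = Z \<and> Y' = Z'"
   by (rule D.Hom_disjoint[OF Y Y' morD(2)[OF z(1)] morD(3)[OF z(1)] morD(1)[OF h] morD(1)[OF z(1)]])
  then show ?thesis using z(2,3) by simp
 qed
 note Gm1 = conjunct1[OF Gm] and Gm2 = conjunct2[OF Gm]
 have push: "e Y' \<cdot>\<^bsub>D\<^esub> Fm (Gm h) = h \<cdot>\<^bsub>D\<^esub> e Y" if h: "h \<in> mor D Y Y'" for h Y Y'
 proof -
  note Y = morD(2)[OF h] and Y' = morD(3)[OF h]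
  note he = D.mor_comp[OF e[OF Y] h]
  have "e Y' \<cdot>\<^bsub>D\<^esub> (e' Y' \<cdot>\<^bsub>D\<^esub> (h \<cdot>\<^bsub>D\<^esub> e Y)) = (e Y' \<cdot>\<^bsub>D\<^esub> e' Y') \<cdot>\<^bsub>D\<^esub> (h \<cdot>\<^bsub>D\<^esub> e Y)"
   by (rule D.comp_assoc[OF he e'[OF Y'] e[OF Y'], symmetric])
  then show ?thesis unfolding Gm2[OF h] ee'[OF Y'] D.id_left[OF he] .
 qed
 have cancel: "a = b" if a: "a \<in> mor D X (Fo (G Y))" and b: "b \<in> mor D X (Fo (G Y))" and Y: "Y \<in> Obj D"
  and eq: "e Y \<cdot>\<^bsub>D\<^esub> a = e Y \<cdot>\<^bsub>D\<^esub> b" for a b X Y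
 proof -
  have "a = e' Y \<cdot>\<^bsub>D\<^esub> (e Y \<cdot>\<^bsub>D\<^esub> a)" using D.comp_assoc[OF a e[OF Y] e'[OF Y]] e'e[OF Y] D.id_left[OF a] by simp
  also have "\<dots> = b" unfolding eq using D.comp_assoc[OF b e[OF Y] e'[OF Y]] e'e[OF Y] D.id_left[OF b] by simp
  finally show ?thesis .
 qed
 have GF: "is_functor D C G Gm"
 proof (rule is_functorI)
  show "G Y \<in> Obj C" if "Y \<in> Obj D" for Y by (rule G[OF that])
  show "Gm h \<in> mor C (G Y) (G Y')" if "h \<in> mor D Y Y'" for h Y Y' by (rule Gm1[OF that])
  show "Gm (Id D Y) = Id C (G Y)" if Y: "Y \<in> Obj D" for Y
  proof (rule faithful[OF Gm1[OF D.mor_Id[OF Y]] C.mor_Id[OF G[OF Y]]])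
   show "Fm (Gm (Id D Y)) = Fm (Id C (G Y))"
    unfolding Gm2[OF D.mor_Id[OF Y]] D.id_left[OF e[OF Y]] e'e[OF Y] FD(2)[OF G[OF Y]] ..
  qed
  show "Gm (g \<cdot>\<^bsub>D\<^esub> f) = Gm g \<cdot>\<^bsub>C\<^esub> Gm f" if f: "f \<in> mor D A B" and g: "g \<in> mor D B E" for A B E f g
  proof (rule faithful[OF Gm1[OF D.mor_comp[OF f g]] C.mor_comp[OF Gm1[OF f] Gm1[OF g]]])
   note Ff = FD(3)[OF Gm1[OF f]] and Fg = FD(3)[OF Gm1[OF g]] and gf = D.mor_comp[OF f g]
   note A = morD(2)[OF f] and B = morD(3)[OF f] and E = morD(3)[OF g]
   show "Fm (Gm (g \<cdot>\<^bsub>D\<^esub> f)) = Fm (Gm g \<cdot>\<^bsub>C\<^esub> Gm f)"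
    unfolding FD(4)[OF Gm1[OF f] Gm1[OF g]]
   proof (rule cancel[OF FD(3)[OF Gm1[OF gf]] D.mor_comp[OF Ff Fg] E])
    have "e E \<cdot>\<^bsub>D\<^esub> (Fm (Gm g) \<cdot>\<^bsub>D\<^esub> Fm (Gm f)) = (g \<cdot>\<^bsub>D\<^esub> e B) \<cdot>\<^bsub>D\<^esub> Fm (Gm f)"
     using D.comp_assoc[OF Ff Fg e[OF E]] push[OF g] by simp
    also have "\<dots> = g \<cdot>\<^bsub>D\<^esub> (f \<cdot>\<^bsub>D\<^esub> e A)" using D.comp_assoc[OF Ff e[OF B] g] push[OF f] by simp
    also have "\<dots> = (g \<cdot>\<^bsub>D\<^esub> f) \<cdot>\<^bsub>D\<^esub> e A" by (rule D.comp_assoc[OF e[OF A] f g, symmetric])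
    finally show "e E \<cdot>\<^bsub>D\<^esub> Fm (Gm (g \<cdot>\<^bsub>D\<^esub> f)) = e E \<cdot>\<^bsub>D\<^esub> (Fm (Gm g) \<cdot>\<^bsub>D\<^esub> Fm (Gm f))"
     using push[OF gf] by simp
   qed
  qed
 qed
 have "\<forall>A\<in>Obj C. \<exists>u. u \<in> mor C (G (Fo A)) A \<and> Fm u = e (Fo A)"
 proof
  fix A assume A: "A \<in> Obj C"
  from full[OF G[OF FD(1)[OF A]] A e[OF FD(1)[OF A]]]
  show "\<exists>u. u \<in> mor C (G (Fo A)) A \<and> Fm u = e (Fo A)" by blast
 qed
 from bchoice[OF this] obtain u where u: "\<forall>A\<in>Obj C. u A \<in> mor C (G (Fo A)) A \<and> Fm (u A) = e (Fo A)" by (rule exE)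
 have u1: "u A \<in> mor C (G (Fo A)) A" and u2: "Fm (u A) = e (Fo A)" if "A \<in> Obj C" for A
  using bspec[OF u that] by simp_all
 have N1: "naturally_isomorphic C C (G \<circ> Fo) (Gm \<circ> Fm) id id"
 proof (rule naturally_isomorphicI, unfold o_apply id_apply)
  fix A assume A: "A \<in> Obj C"
  note FA = FD(1)[OF A]
  obtain v where v: "v \<in> mor C A (G (Fo A))" "Fm v = e' (Fo A)"
   using full[OF A G[OF FA] e'[OF FA]] by (rule bexE)
  show "iso_arr C (G (Fo A)) A (u A)"
  proof (rule iso_arrI[OF u1[OF A] v(1)])
   show "v \<cdot>\<^bsub>C\<^esub> u A = Id C (G (Fo A))"
    by (rule faithful[OF C.mor_comp[OF u1[OF A] v(1)] C.mor_Id[OF G[OF FA]]])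
     (simp only: FD(4)[OF u1[OF A] v(1)] v(2) u2[OF A] e'e[OF FA] FD(2)[OF G[OF FA]])
   show "u A \<cdot>\<^bsub>C\<^esub> v = Id C A"
    by (rule faithful[OF C.mor_comp[OF v(1) u1[OF A]] C.mor_Id[OF A]])
     (simp only: FD(4)[OF v(1) u1[OF A]] v(2) u2[OF A] ee'[OF FA] FD(2)[OF A])
  qed
 next
  fix A B f assume f: "f \<in> mor C A B"
  note A = morD(2)[OF f] and B = morD(3)[OF f]
  note Gf = Gm1[OF FD(3)[OF f]]
  show "u B \<cdot>\<^bsub>C\<^esub> Gm (Fm f) = f \<cdot>\<^bsub>C\<^esub> u A"
   by (rule faithful[OF C.mor_comp[OF Gf u1[OF B]] C.mor_comp[OF u1[OF A] f]])
    (simp only: FD(4)[OF Gf u1[OF B]] FD(4)[OF u1[OF A] f] u2[OF A] u2[OF B] push[OF FD(3)[OF f]])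
 qed
 have N2: "naturally_isomorphic D D (Fo \<circ> G) (Fm \<circ> Gm) id id"
 proof (rule naturally_isomorphicI, unfold o_apply id_apply)
  show "iso_arr D (Fo (G Y)) Y (e Y)" if "Y \<in> Obj D" for Y
   by (rule iso_arrI[OF e[OF that] e'[OF that] e'e[OF that] ee'[OF that]])
  show "e Y' \<cdot>\<^bsub>D\<^esub> Fm (Gm h) = h \<cdot>\<^bsub>D\<^esub> e Y" if "h \<in> mor D Y Y'" for Y Y' h by (rule push[OF that])
 qed
 show ?thesis unfolding is_equivalence_def using F GF N1 N2 by blast
qed

text \<open>A functor that is naturally isomorphic to the identity is injective on morphisms.\<close>

lemma natural_iso_faithful:
 assumes CC: "category C" and F: "is_functor C D Fo Fm" and G: "is_functor D C Go Gm"
  and N: "naturally_isomorphic C C (Go \<circ> Fo) (Gm \<circ> Fm) id id"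
  and f: "f \<in> mor C A B" and g: "g \<in> mor C A B" and eq: "Fm f = Fm g"
 shows "f = g"
proof -
 interpret C: category C by fact
 obtain \<eta> where \<eta>: "\<forall>A\<in>Obj C. iso_arr C (Go (Fo A)) A (\<eta> A)"
  and nat: "\<forall>A\<in>Obj C. \<forall>B\<in>Obj C. \<forall>f\<in>arr C A B. \<eta> B \<cdot>\<^bsub>C\<^esub> Gm (Fm f) = f \<cdot>\<^bsub>C\<^esub> \<eta> A"
  using N unfolding naturally_isomorphic_def o_apply id_apply by (elim exE conjE)
 note A = morD(2)[OF f] and B = morD(3)[OF f]
 note GFA = is_functorD(1)[OF G is_functorD(1)[OF F A]]
 obtain \<theta> where \<theta>: "\<eta> A \<in> mor C (Go (Fo A)) A" "\<theta> \<in> mor C A (Go (Fo A))" "\<eta> A \<cdot>\<^bsub>C\<^esub> \<theta> = Id C A"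
  using iso_arrE[OF bspec[OF \<eta> A] GFA A] by (elim exE conjE)
 have "f \<cdot>\<^bsub>C\<^esub> \<eta> A = g \<cdot>\<^bsub>C\<^esub> \<eta> A"
  using bspec[OF bspec[OF bspec[OF nat A] B] morD(1)[OF f]] bspec[OF bspec[OF bspec[OF nat A] B] morD(1)[OF g]] eq by simp
 then have "(f \<cdot>\<^bsub>C\<^esub> \<eta> A) \<cdot>\<^bsub>C\<^esub> \<theta> = (g \<cdot>\<^bsub>C\<^esub> \<eta> A) \<cdot>\<^bsub>C\<^esub> \<theta>" by simp
 then show ?thesis
  unfolding C.comp_assoc[OF \<theta>(2,1) f] C.comp_assoc[OF \<theta>(2,1) g] \<theta>(3) C.id_right[OF f] C.id_right[OF g] .
qed

lemma equivalence_fully_faithful_dense: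
 assumes CC: "category C" and DD: "category D" and E: "is_equivalence C D Fo Fm"
 shows "A \<in> Obj C \<Longrightarrow> B \<in> Obj C \<Longrightarrow> h \<in> mor D (Fo A) (Fo B) \<Longrightarrow> \<exists>f\<in>mor C A B. Fm f = h"
  and "f \<in> mor C A B \<Longrightarrow> g \<in> mor C A B \<Longrightarrow> Fm f = Fm g \<Longrightarrow> f = g"
  and "Y \<in> Obj D \<Longrightarrow> \<exists>X\<in>Obj C. \<exists>e. iso_arr D (Fo X) Y e"
proof -
 interpret C: category C by fact
 interpret D: category D by fact
 from E obtain Go Gm where F: "is_functor C D Fo Fm" and G: "is_functor D C Go Gm"
  and N1: "naturally_isomorphic C C (Go \<circ> Fo) (Gm \<circ> Fm) id id"
  and N2: "naturally_isomorphic D D (Fo \<circ> Go) (Fm \<circ> Gm) id id"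
  unfolding is_equivalence_def by (elim exE conjE)
 note FD = is_functorD[OF F] and GD = is_functorD[OF G]
 show "f = g" if "f \<in> mor C A B" "g \<in> mor C A B" "Fm f = Fm g"
  by (rule natural_iso_faithful[OF CC F G N1 that])
 show "\<exists>X\<in>Obj C. \<exists>e. iso_arr D (Fo X) Y e" if Y: "Y \<in> Obj D"
 proof -
  obtain \<eta> where "\<forall>A\<in>Obj D. iso_arr D (Fo (Go A)) A (\<eta> A)"
   using N2 unfolding naturally_isomorphic_def o_apply id_apply by (elim exE conjE)
  then show ?thesis using GD(1)[OF Y] Y by blast
 qed
 show "\<exists>f\<in>mor C A B. Fm f = h" if A: "A \<in> Obj C" and B: "B \<in> Obj C" and h: "h \<in> mor D (Fo A) (Fo B)"
 proof -
  obtain \<eta> where \<eta>: "\<forall>A\<in>Obj C. iso_arr C (Go (Fo A)) A (\<eta> A)"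
   and nat: "\<forall>A\<in>Obj C. \<forall>B\<in>Obj C. \<forall>f\<in>arr C A B. \<eta> B \<cdot>\<^bsub>C\<^esub> Gm (Fm f) = f \<cdot>\<^bsub>C\<^esub> \<eta> A"
   using N1 unfolding naturally_isomorphic_def o_apply id_apply by (elim exE conjE)
  note FA = FD(1)[OF A] and FB = FD(1)[OF B]
  obtain \<theta> where \<theta>: "\<eta> A \<in> mor C (Go (Fo A)) A" "\<theta> \<in> mor C A (Go (Fo A))" "\<theta> \<cdot>\<^bsub>C\<^esub> \<eta> A = Id C (Go (Fo A))"
   using iso_arrE[OF bspec[OF \<eta> A] GD(1)[OF FA] A] by (elim exE conjE)
  obtain \<zeta> where \<zeta>: "\<eta> B \<in> mor C (Go (Fo B)) B" "\<zeta> \<in> mor C B (Go (Fo B))" "\<zeta> \<cdot>\<^bsub>C\<^esub> \<eta> B = Id C (Go (Fo B))"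
   using iso_arrE[OF bspec[OF \<eta> B] GD(1)[OF FB] B] by (elim exE conjE)
  note Gh = GD(3)[OF h]
  let ?f = "\<eta> B \<cdot>\<^bsub>C\<^esub> (Gm h \<cdot>\<^bsub>C\<^esub> \<theta>)"
  have f: "?f \<in> mor C A B" by (rule C.mor_comp[OF C.mor_comp[OF \<theta>(2) Gh] \<zeta>(1)])
  note GFf = GD(3)[OF FD(3)[OF f]]
  have "\<eta> B \<cdot>\<^bsub>C\<^esub> Gm (Fm ?f) = ?f \<cdot>\<^bsub>C\<^esub> \<eta> A" by (rule bspec[OF bspec[OF bspec[OF nat A] B] morD(1)[OF f]])
  also have "\<dots> = \<eta> B \<cdot>\<^bsub>C\<^esub> Gm h"
   using C.comp_assoc[OF \<theta>(1) C.mor_comp[OF \<theta>(2) Gh] \<zeta>(1)] C.comp_assoc[OF \<theta>(1,2) Gh] \<theta>(3) C.id_right[OF Gh] by simp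
  finally have eq: "\<eta> B \<cdot>\<^bsub>C\<^esub> Gm (Fm ?f) = \<eta> B \<cdot>\<^bsub>C\<^esub> Gm h" .
  have "Gm (Fm ?f) = \<zeta> \<cdot>\<^bsub>C\<^esub> (\<eta> B \<cdot>\<^bsub>C\<^esub> Gm (Fm ?f))"
   using C.comp_assoc[OF GFf \<zeta>(1,2)] \<zeta>(3) C.id_left[OF GFf] by simp
  also have "\<dots> = Gm h" unfolding eq using C.comp_assoc[OF Gh \<zeta>(1,2)] \<zeta>(3) C.id_left[OF Gh] by simp
  finally have "Gm (Fm ?f) = Gm h" .
  from natural_iso_faithful[OF DD G F N2 FD(3)[OF f] h this] f show ?thesis by (intro bexI)
 qed
qed

section \<open>Quotient categories\<close>

definition hom_ideal :: "('k, 'r) ring_scheme \<Rightarrow> ('o, 'm, 'k, 'z) cat_scheme \<Rightarrow> ('o \<Rightarrow> 'o \<Rightarrow> 'm set) \<Rightarrow> bool" where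
 "hom_ideal k C I \<longleftrightarrow> (\<forall>A\<in>Obj C. \<forall>B\<in>Obj C. submodule (I A B) k (Hom C A B)) \<and>
   (\<forall>A B D f g. f \<in> I A B \<longrightarrow> f \<in> mor C A B \<longrightarrow> g \<in> mor C B D \<longrightarrow> g \<cdot>\<^bsub>C\<^esub> f \<in> I A D) \<and>
   (\<forall>A B D f g. f \<in> mor C A B \<longrightarrow> g \<in> I B D \<longrightarrow> g \<in> mor C B D \<longrightarrow> g \<cdot>\<^bsub>C\<^esub> f \<in> I A D)"

text \<open>The coset of a morphism in the quotient category.\<close>

definition cls :: "('o, 'm, 'k, 'z) cat_scheme \<Rightarrow> ('o \<Rightarrow> 'o \<Rightarrow> 'm set) \<Rightarrow> 'o \<Rightarrow> 'o \<Rightarrow> 'm \<Rightarrow> 'm set" where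
 "cls C I A B f = I A B +>\<^bsub>Hom C A B\<^esub> f"

lemma quotient_category_simps:
 "Obj (quotient_category C I) = Obj C"
 "Hom (quotient_category C I) A B = quotient_module (Hom C A B) (I A B)"
 "Id (quotient_category C I) A = cls C I A A (Id C A)"
 by (simp_all add: quotient_category_def cls_def)

context artinian_ecat
begin

lemma cls_eq_iff:
 assumes I: "hom_ideal k C I" and f: "f \<in> mor C A B" and g: "g \<in> mor C A B"
 shows "cls C I A B f = cls C I A B g \<longleftrightarrow> f \<ominus>\<^bsub>Hom C A B\<^esub> g \<in> I A B"
 unfolding cls_def
 by (rule module.coset_eq_iff[OF hom_module[OF morD(2,3)[OF f]] _ morD(1)[OF f] morD(1)[OF g]])
  (use I morD(2,3)[OF f] in \<open>simp add: hom_ideal_def\<close>)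

lemma cls_mem:
 assumes I: "hom_ideal k C I" and f: "f \<in> mor C A B"
 shows "f' \<in> cls C I A B f \<longleftrightarrow> f' \<in> mor C A B \<and> f' \<ominus>\<^bsub>Hom C A B\<^esub> f \<in> I A B"
proof -
 have "submodule (I A B) k (Hom C A B)" using I morD(2,3)[OF f] by (simp add: hom_ideal_def)
 from module.mem_coset[OF hom_module[OF morD(2,3)[OF f]] this morD(1)[OF f], of f']
 show ?thesis unfolding cls_def using morD(2,3)[OF f] by (simp add: mor_def)
qed

lemma mem_quotient_mor:
 assumes A: "A \<in> Obj C" and B: "B \<in> Obj C"
 shows "F \<in> mor (quotient_category C I) A B \<longleftrightarrow> (\<exists>f\<in>mor C A B. F = cls C I A B f)"
 unfolding mor_def quotient_category_simps module.quotient_carrier[OF hom_module[OF A B]] cls_def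
 using A B by blast

lemma cls_mor: "f \<in> mor C A B \<Longrightarrow> cls C I A B f \<in> mor (quotient_category C I) A B"
 using mem_quotient_mor[OF morD(2,3)] by blast

lemma quotient_morE:
 assumes "F \<in> mor (quotient_category C I) A B"
 shows "\<exists>f\<in>mor C A B. F = cls C I A B f"
proof -
 have "A \<in> Obj C" "B \<in> Obj C" using morD(2,3)[OF assms] by (simp_all add: quotient_category_simps)
 from mem_quotient_mor[OF this] assms show ?thesis by blast
qed

text \<open>The composition in the quotient category is defined as a union of cosets; the ideal property makes all
members of this union equal.\<close>

lemma cls_comp:
 assumes I: "hom_ideal k C I" and f: "f \<in> mor C A B" and g: "g \<in> mor C B D"
 shows "cls C I B D g \<cdot>\<^bsub>quotient_category C I\<^esub> cls C I A B f = cls C I A D (g \<cdot> f)"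
proof -
 note gf = mor_comp[OF f g]
 have key: "cls C I A D (g' \<cdot> f') = cls C I A D (g \<cdot> f)"
  if f': "f' \<in> cls C I A B f" and g': "g' \<in> cls C I B D g" for f' g'
 proof -
  have f'': "f' \<in> mor C A B" "f' \<ominus>\<^bsub>Hom C A B\<^esub> f \<in> I A B" using f' cls_mem[OF I f] by blast+
  have g'': "g' \<in> mor C B D" "g' \<ominus>\<^bsub>Hom C B D\<^esub> g \<in> I B D" using g' cls_mem[OF I g] by blast+
  note gf' = mor_comp[OF f g''(1)] and gf'' = mor_comp[OF f''(1) g''(1)]
  have "g' \<cdot> (f' \<ominus>\<^bsub>Hom C A B\<^esub> f) \<in> I A D"
   using I f''(2) mor_diff[OF f''(1) f] g''(1) unfolding hom_ideal_def by blast
  then have 1: "cls C I A D (g' \<cdot> f') = cls C I A D (g' \<cdot> f)"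
   unfolding cls_eq_iff[OF I gf'' gf'] comp_diff_right[OF f''(1) f g''(1)] .
  have "(g' \<ominus>\<^bsub>Hom C B D\<^esub> g) \<cdot> f \<in> I A D"
   using I g''(2) mor_diff[OF g''(1) g] f unfolding hom_ideal_def by blast
  then have 2: "cls C I A D (g' \<cdot> f) = cls C I A D (g \<cdot> f)"
   unfolding cls_eq_iff[OF I gf' gf] comp_diff_left[OF f g''(1) g] .
  show ?thesis using 1 2 by simp
 qed
 have self: "f \<in> cls C I A B f" if f: "f \<in> mor C A B" for f A B
 proof -
  have "submodule (I A B) k (Hom C A B)" using I morD(2,3)[OF f] by (simp add: hom_ideal_def)
  from module.submoduleD(2)[OF hom_module[OF morD(2,3)[OF f]] this]
  show ?thesis unfolding cls_mem[OF I f] using f diff_zero_arr[OF f f] by simp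
 qed
 let ?S = "{I A' D' +>\<^bsub>Hom C A' D'\<^esub> (g' \<cdot> f') | A' B' D' f' g'.
   A' \<in> Obj C \<and> B' \<in> Obj C \<and> D' \<in> Obj C \<and> f' \<in> cls C I A B f \<inter> arr C A' B' \<and> g' \<in> cls C I B D g \<inter> arr C B' D'}"
 have "?S = {cls C I A D (g \<cdot> f)}"
 proof (rule equalityI)
  show "?S \<subseteq> {cls C I A D (g \<cdot> f)}"
  proof
   fix S assume "S \<in> ?S"
   then obtain A' B' D' f' g' where S: "S = I A' D' +>\<^bsub>Hom C A' D'\<^esub> (g' \<cdot> f')"
    and O: "A' \<in> Obj C" "B' \<in> Obj C" "D' \<in> Obj C"
    and f': "f' \<in> cls C I A B f" "f' \<in> arr C A' B'" and g': "g' \<in> cls C I B D g" "g' \<in> arr C B' D'" by blast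
   have "f' \<in> mor C A B" "g' \<in> mor C B D" using f'(1) g'(1) cls_mem[OF I f] cls_mem[OF I g] by blast+
   then have "A' = A" "D' = D"
    using Hom_disjoint[OF O(1,2) morD(2,3)[OF f] f'(2)] Hom_disjoint[OF O(2,3) morD(2,3)[OF g] g'(2)] morD(1) by metis+
   then have "S = cls C I A D (g' \<cdot> f')" using S by (simp add: cls_def)
   then show "S \<in> {cls C I A D (g \<cdot> f)}" using key[OF f'(1) g'(1)] by simp
  qed
  have "cls C I A D (g \<cdot> f) \<in> ?S"
   unfolding cls_def[of C I A D]
   using self[OF f] self[OF g] morD[OF f] morD[OF g] by blast
  then show "{cls C I A D (g \<cdot> f)} \<subseteq> ?S" by simp
 qed
 then have "\<Union>?S = cls C I A D (g \<cdot> f)" by simp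
 then show ?thesis by (simp add: quotient_category_def)
qed

lemma quotient_category_category:
 assumes I: "hom_ideal k C I"
 shows "category (quotient_category C I)"
proof -
 let ?Q = "quotient_category C I"
 have Q: "F \<in> arr ?Q A B \<Longrightarrow> A \<in> Obj ?Q \<Longrightarrow> B \<in> Obj ?Q \<Longrightarrow> \<exists>f\<in>mor C A B. F = cls C I A B f" for F A B
  by (rule quotient_morE[OF morI])
 show ?thesis
 proof
  fix A B A' B' F assume O: "A \<in> Obj ?Q" "B \<in> Obj ?Q" "A' \<in> Obj ?Q" "B' \<in> Obj ?Q"
   and F: "F \<in> arr ?Q A B" "F \<in> arr ?Q A' B'"
  obtain f where f: "f \<in> mor C A B" "F = cls C I A B f" using Q[OF F(1) O(1,2)] by (rule bexE)
  obtain g where g: "g \<in> mor C A' B'" "F = cls C I A' B' g" using Q[OF F(2) O(3,4)] by (rule bexE)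
  have "submodule (I A B) k (Hom C A B)" using I morD(2,3)[OF f(1)] by (simp add: hom_ideal_def)
  from module.submoduleD(2)[OF hom_module[OF morD(2,3)[OF f(1)]] this]
  have "f \<in> cls C I A B f" unfolding cls_mem[OF I f(1)] using f(1) diff_zero_arr[OF f(1) f(1)] by simp
  then have "f \<in> cls C I A' B' g" using f(2) g(2) by simp
  then have f': "f \<in> mor C A' B'" using cls_mem[OF I g(1)] by blast
  show "A = A' \<and> B = B'"
   by (rule Hom_disjoint[OF morD(2,3)[OF f(1)] morD(2,3)[OF f'] morD(1)[OF f(1)] morD(1)[OF f']])
 next
  fix A assume "A \<in> Obj ?Q"
  then have A: "A \<in> Obj C" by (simp add: quotient_category_simps)
  show "Id ?Q A \<in> arr ?Q A A" unfolding quotient_category_simps(3) by (rule morD(1)[OF cls_mor[OF mor_Id[OF A]]])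
 next
  fix A B D F G assume O: "A \<in> Obj ?Q" "B \<in> Obj ?Q" "D \<in> Obj ?Q" and F: "F \<in> arr ?Q A B" and G: "G \<in> arr ?Q B D"
  obtain f where f: "f \<in> mor C A B" "F = cls C I A B f" using Q[OF F O(1,2)] by (rule bexE)
  obtain g where g: "g \<in> mor C B D" "G = cls C I B D g" using Q[OF G O(2,3)] by (rule bexE)
  show "G \<cdot>\<^bsub>?Q\<^esub> F \<in> arr ?Q A D" unfolding f(2) g(2) cls_comp[OF I f(1) g(1)] by (rule morD(1)[OF cls_mor[OF mor_comp[OF f(1) g(1)]]])
 next
  fix A B D E F G H assume O: "A \<in> Obj ?Q" "B \<in> Obj ?Q" "D \<in> Obj ?Q" "E \<in> Obj ?Q"
   and F: "F \<in> arr ?Q A B" and G: "G \<in> arr ?Q B D" and H: "H \<in> arr ?Q D E"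
  obtain f where f: "f \<in> mor C A B" "F = cls C I A B f" using Q[OF F O(1,2)] by (rule bexE)
  obtain g where g: "g \<in> mor C B D" "G = cls C I B D g" using Q[OF G O(2,3)] by (rule bexE)
  obtain h where h: "h \<in> mor C D E" "H = cls C I D E h" using Q[OF H O(3,4)] by (rule bexE)
  show "(H \<cdot>\<^bsub>?Q\<^esub> G) \<cdot>\<^bsub>?Q\<^esub> F = H \<cdot>\<^bsub>?Q\<^esub> (G \<cdot>\<^bsub>?Q\<^esub> F)"
   unfolding f(2) g(2) h(2) cls_comp[OF I f(1) g(1)] cls_comp[OF I g(1) h(1)]
    cls_comp[OF I mor_comp[OF f(1) g(1)] h(1)] cls_comp[OF I f(1) mor_comp[OF g(1) h(1)]]
    comp_assoc[OF f(1) g(1) h(1)] ..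
 next
  fix A B F assume O: "A \<in> Obj ?Q" "B \<in> Obj ?Q" and F: "F \<in> arr ?Q A B"
  obtain f where f: "f \<in> mor C A B" "F = cls C I A B f" using Q[OF F O] by (rule bexE)
  note A = morD(2)[OF f(1)] and B = morD(3)[OF f(1)]
  show "Id ?Q B \<cdot>\<^bsub>?Q\<^esub> F = F"
   unfolding f(2) quotient_category_simps(3) cls_comp[OF I f(1) mor_Id[OF B]] id_left[OF f(1)] ..
  show "F \<cdot>\<^bsub>?Q\<^esub> Id ?Q A = F"
   unfolding f(2) quotient_category_simps(3) cls_comp[OF I mor_Id[OF A] f(1)] id_right[OF f(1)] ..
 qed
qed

lemma cls_add:
 assumes I: "hom_ideal k C I" and f: "f \<in> mor C A B" and g: "g \<in> mor C A B"
 shows "cls C I A B f \<oplus>\<^bsub>Hom (quotient_category C I) A B\<^esub> cls C I A B g = cls C I A B (f \<oplus>\<^bsub>Hom C A B\<^esub> g)"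
 unfolding cls_def quotient_category_simps
 by (rule module.quotient_add[OF hom_module[OF morD(2,3)[OF f]] _ morD(1)[OF f] morD(1)[OF g]])
  (use I morD(2,3)[OF f] in \<open>simp add: hom_ideal_def\<close>)

lemma cls_smult:
 assumes I: "hom_ideal k C I" and f: "f \<in> mor C A B" and r: "r \<in> carrier k"
 shows "r \<odot>\<^bsub>Hom (quotient_category C I) A B\<^esub> cls C I A B f = cls C I A B (r \<odot>\<^bsub>Hom C A B\<^esub> f)"
 unfolding cls_def quotient_category_simps
 by (rule module.quotient_smult[OF hom_module[OF morD(2,3)[OF f]] _ morD(1)[OF f] r])
  (use I morD(2,3)[OF f] in \<open>simp add: hom_ideal_def\<close>)

text \<open>The ideal of \<open>n\<close>-injectively trivial morphisms induces the congruence \<open>inj_eq\<close>.\<close>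

lemma inj_trivial_iff:
 assumes f: "f \<in> mor C A B" and g: "g \<in> mor C A B"
 shows "f \<ominus>\<^bsub>Hom C A B\<^esub> g \<in> inj_trivial C A B \<longleftrightarrow> inj_eq C A f g"
proof -
 have "f \<ominus>\<^bsub>Hom C A B\<^esub> g \<in> inj_trivial C A B \<longleftrightarrow> (\<forall>Z. \<forall>\<delta>\<in>xt C Z A. Push C (f \<ominus>\<^bsub>Hom C A B\<^esub> g) \<delta> = \<zero>\<^bsub>Ext C Z B\<^esub>)"
  unfolding inj_trivial_def xt_def using morD[OF mor_diff[OF f g]] by auto
 also have "\<dots> \<longleftrightarrow> inj_eq C A f g"
  unfolding inj_eq_def
 proof (intro all_cong1 ball_cong refl)
  fix Z \<delta> assume \<delta>: "\<delta> \<in> xt C Z A"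
  note a = xt_Push[OF f \<delta>] and b = xt_Push[OF g \<delta>]
  show "Push C (f \<ominus>\<^bsub>Hom C A B\<^esub> g) \<delta> = \<zero>\<^bsub>Ext C Z B\<^esub> \<longleftrightarrow> Push C f \<delta> = Push C g \<delta>"
   unfolding diff_push[OF f g \<delta>] by (rule abelian_group.diff_zero_iff[OF xt_group[OF a] xtD(1)[OF a] xtD(1)[OF b]])
 qed
 finally show ?thesis .
qed

lemma inj_trivial_ideal: "hom_ideal k C (inj_trivial C)"
proof -
 have mem: "f \<in> inj_trivial C A B \<longleftrightarrow> (\<forall>Z. \<forall>\<delta>\<in>xt C Z A. Push C f \<delta> = \<zero>\<^bsub>Ext C Z B\<^esub>)" if "f \<in> mor C A B" for f A B
  unfolding inj_trivial_def xt_def using morD[OF that] by auto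
 have sub: "f \<in> arr C A B" if "f \<in> inj_trivial C A B" for f A B using that by (simp add: inj_trivial_def)
 show ?thesis unfolding hom_ideal_def
 proof (intro conjI ballI allI impI)
  fix A B assume A: "A \<in> Obj C" and B: "B \<in> Obj C"
  interpret H: module k "Hom C A B" by (rule hom_module[OF A B])
  have zz: "zero_arr C A B \<in> mor C A B" by (rule mor_zero[OF A B])
  have sub': "f \<in> mor C A B" if "f \<in> inj_trivial C A B" for f by (rule morI[OF sub[OF that] A B])
  show "submodule (inj_trivial C A B) k (Hom C A B)"
  proof (rule H.submodule_criterion)
   show "inj_trivial C A B \<subseteq> arr C A B" using sub by blast
   show "zero_arr C A B \<in> inj_trivial C A B" unfolding mem[OF zz] using zero_push[OF B] by blast
   fix f assume f: "f \<in> inj_trivial C A B"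
   note f1 = sub'[OF f]
   show "r \<odot>\<^bsub>Hom C A B\<^esub> f \<in> inj_trivial C A B" if r: "r \<in> carrier k" for r
    unfolding mem[OF mor_smult[OF r f1]]
   proof (intro allI ballI)
    fix Z \<delta> assume \<delta>: "\<delta> \<in> xt C Z A"
    have "Push C f \<delta> = \<zero>\<^bsub>Ext C Z B\<^esub>" using f \<delta> mem[OF f1] by blast
    then show "Push C (r \<odot>\<^bsub>Hom C A B\<^esub> f) \<delta> = \<zero>\<^bsub>Ext C Z B\<^esub>"
     using smult_push[OF f1 \<delta> r] module.smult_r_null[OF ext_module[OF xtD(2)[OF \<delta>] B] r] by simp
   qed
   fix g assume g: "g \<in> inj_trivial C A B"
   note g1 = sub'[OF g]
   show "f \<oplus>\<^bsub>Hom C A B\<^esub> g \<in> inj_trivial C A B"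
    unfolding mem[OF mor_add[OF f1 g1]]
   proof (intro allI ballI)
    fix Z \<delta> assume \<delta>: "\<delta> \<in> xt C Z A"
    interpret E: abelian_group "Ext C Z B" by (rule xt_group[OF xt_Push[OF f1 \<delta>]])
    have "Push C f \<delta> = \<zero>\<^bsub>Ext C Z B\<^esub>" "Push C g \<delta> = \<zero>\<^bsub>Ext C Z B\<^esub>"
     using f g \<delta> mem[OF f1] mem[OF g1] by blast+
    then show "Push C (f \<oplus>\<^bsub>Hom C A B\<^esub> g) \<delta> = \<zero>\<^bsub>Ext C Z B\<^esub>" using add_push[OF f1 g1 \<delta>] by simp
   qed
  qed
 next
  fix A B D f g assume f: "f \<in> inj_trivial C A B" "f \<in> mor C A B" and g: "g \<in> mor C B D"
  show "g \<cdot> f \<in> inj_trivial C A D"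
   unfolding mem[OF mor_comp[OF f(2) g]]
  proof (intro allI ballI)
   fix Z \<delta> assume \<delta>: "\<delta> \<in> xt C Z A"
   have "Push C f \<delta> = \<zero>\<^bsub>Ext C Z B\<^esub>" using f(1) \<delta> mem[OF f(2)] by blast
   then show "Push C (g \<cdot> f) \<delta> = \<zero>\<^bsub>Ext C Z D\<^esub>" using push_comp[OF f(2) g \<delta>] push_zero[OF g xtD(2)[OF \<delta>]] by simp
  qed
 next
  fix A B D f g assume f: "f \<in> mor C A B" and g: "g \<in> inj_trivial C B D" "g \<in> mor C B D"
  show "g \<cdot> f \<in> inj_trivial C A D"
   unfolding mem[OF mor_comp[OF f g(2)]]
  proof (intro allI ballI)
   fix Z \<delta> assume \<delta>: "\<delta> \<in> xt C Z A"
   show "Push C (g \<cdot> f) \<delta> = \<zero>\<^bsub>Ext C Z D\<^esub>"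
    unfolding push_comp[OF f g(2) \<delta>] using g(1) xt_Push[OF f \<delta>] mem[OF g(2)] by blast
  qed
 qed
qed

end

lemma proj_trivial_opposite: "proj_trivial C A B = inj_trivial (opposite C) B A"
 by (simp add: proj_trivial_def inj_trivial_def)

context artinian_ecat
begin

interpretation op: artinian_ecat "opposite C" k J by (rule opposite_artinian_ecat)

lemma proj_trivial_iff:
 assumes f: "f \<in> mor C A B" and g: "g \<in> mor C A B"
 shows "f \<ominus>\<^bsub>Hom C A B\<^esub> g \<in> proj_trivial C A B \<longleftrightarrow> inj_eq (opposite C) B f g"
 unfolding proj_trivial_opposite using op.inj_trivial_iff[of f B A g] f g by simp

lemma proj_trivial_ideal: "hom_ideal k C (proj_trivial C)"
 using op.inj_trivial_ideal unfolding hom_ideal_def proj_trivial_opposite by simp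

end

section \<open>Auslander-Reiten-Serre duality in terms of Serre pairs\<close>

lemma Hom_module_simps:
 "carrier (Hom_module R M N) = {f \<in> extensional (carrier M). linear_map R M N f}"
 "f \<oplus>\<^bsub>Hom_module R M N\<^esub> g = (\<lambda>x\<in>carrier M. f x \<oplus>\<^bsub>N\<^esub> g x)"
 "r \<odot>\<^bsub>Hom_module R M N\<^esub> f = (\<lambda>x\<in>carrier M. r \<odot>\<^bsub>N\<^esub> f x)"
 by (simp_all add: Hom_module_def)

lemma linear_map_cong:
 assumes f: "linear_map R M N f" and M: "module R M" and eq: "\<And>x. x \<in> carrier M \<Longrightarrow> g x = f x"
 shows "linear_map R M N g"
proof -
 interpret M: module R M by fact
 show ?thesis by (rule linear_mapI) (simp_all add: eq linear_mapD[OF f])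
qed

lemma restrict_Hom_module:
 assumes "linear_map R M N f" and M: "module R M"
 shows "restrict f (carrier M) \<in> carrier (Hom_module R M N)"
 unfolding Hom_module_simps using linear_map_cong[OF assms, of "restrict f (carrier M)"] by simp

context artinian_ecat
begin

abbreviation pcls :: "'o \<Rightarrow> 'o \<Rightarrow> 'm \<Rightarrow> 'm set" where "pcls \<equiv> cls C (proj_trivial C)"
abbreviation icls :: "'o \<Rightarrow> 'o \<Rightarrow> 'm \<Rightarrow> 'm set" where "icls \<equiv> cls C (inj_trivial C)"

lemma pcls_eq_iff: "f \<in> mor C A B \<Longrightarrow> g \<in> mor C A B \<Longrightarrow> pcls A B f = pcls A B g \<longleftrightarrow> inj_eq (opposite C) B f g"
 by (simp only: cls_eq_iff[OF proj_trivial_ideal] proj_trivial_iff)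

lemma icls_eq_iff: "f \<in> mor C A B \<Longrightarrow> g \<in> mor C A B \<Longrightarrow> icls A B f = icls A B g \<longleftrightarrow> inj_eq C A f g"
 by (simp only: cls_eq_iff[OF inj_trivial_ideal] inj_trivial_iff)

lemma proj_stable_category: "category (proj_stable C)"
 unfolding proj_stable_def by (rule quotient_category_category[OF proj_trivial_ideal])

lemma inj_stable_category: "category (inj_stable C)"
 unfolding inj_stable_def by (rule quotient_category_category[OF inj_trivial_ideal])

lemma stable_simps:
 "Obj (proj_stable C) = Obj C" "Obj (inj_stable C) = Obj C"
 "Id (proj_stable C) A = pcls A A (Id C A)" "Id (inj_stable C) A = icls A A (Id C A)"
 by (simp_all add: proj_stable_def inj_stable_def quotient_category_simps)

lemma pcls_mor: "f \<in> mor C A B \<Longrightarrow> pcls A B f \<in> mor (proj_stable C) A B"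
 unfolding proj_stable_def by (rule cls_mor)

lemma icls_mor: "f \<in> mor C A B \<Longrightarrow> icls A B f \<in> mor (inj_stable C) A B"
 unfolding inj_stable_def by (rule cls_mor)

lemma proj_stable_morE: "F \<in> mor (proj_stable C) A B \<Longrightarrow> \<exists>f\<in>mor C A B. F = pcls A B f"
 unfolding proj_stable_def by (rule quotient_morE)

lemma inj_stable_morE: "F \<in> mor (inj_stable C) A B \<Longrightarrow> \<exists>f\<in>mor C A B. F = icls A B f"
 unfolding inj_stable_def by (rule quotient_morE)

lemma pcls_comp: "f \<in> mor C A B \<Longrightarrow> g \<in> mor C B D \<Longrightarrow> pcls B D g \<cdot>\<^bsub>proj_stable C\<^esub> pcls A B f = pcls A D (g \<cdot> f)"
 unfolding proj_stable_def by (rule cls_comp[OF proj_trivial_ideal])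

lemma icls_comp: "f \<in> mor C A B \<Longrightarrow> g \<in> mor C B D \<Longrightarrow> icls B D g \<cdot>\<^bsub>inj_stable C\<^esub> icls A B f = icls A D (g \<cdot> f)"
 unfolding inj_stable_def by (rule cls_comp[OF inj_trivial_ideal])

lemma cls_linear:
 shows "f \<in> mor C A B \<Longrightarrow> g \<in> mor C A B \<Longrightarrow> pcls A B f \<oplus>\<^bsub>Hom (proj_stable C) A B\<^esub> pcls A B g = pcls A B (f \<oplus>\<^bsub>Hom C A B\<^esub> g)"
  and "f \<in> mor C A B \<Longrightarrow> r \<in> carrier k \<Longrightarrow> r \<odot>\<^bsub>Hom (proj_stable C) A B\<^esub> pcls A B f = pcls A B (r \<odot>\<^bsub>Hom C A B\<^esub> f)"
  and "f \<in> mor C A B \<Longrightarrow> g \<in> mor C A B \<Longrightarrow> icls A B f \<oplus>\<^bsub>Hom (inj_stable C) A B\<^esub> icls A B g = icls A B (f \<oplus>\<^bsub>Hom C A B\<^esub> g)"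
  and "f \<in> mor C A B \<Longrightarrow> r \<in> carrier k \<Longrightarrow> r \<odot>\<^bsub>Hom (inj_stable C) A B\<^esub> icls A B f = icls A B (r \<odot>\<^bsub>Hom C A B\<^esub> f)"
 unfolding proj_stable_def inj_stable_def
 by (rule cls_add[OF proj_trivial_ideal] cls_smult[OF proj_trivial_ideal] cls_add[OF inj_trivial_ideal] cls_smult[OF inj_trivial_ideal]; assumption)+

text \<open>Choose a Serre pair \<open>(U, T U)\<close> with functional \<open>H U\<close> for every \<open>U\<close>.  Morphisms \<open>x : X \<rightarrow> X'\<close> and
\<open>f : T X \<rightarrow> T X'\<close> are matched if \<open>H X (x\<^sup>* \<xi>) = H X' (f\<^sub>* \<xi>)\<close> for all \<open>\<xi> \<in> \<bbbE>(X', T X)\<close>.  Matching is an additive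
and multiplicative relation that is total on both sides, and the two congruences correspond under it.
It is thus the graph of the morphism part of a fully faithful functor between the stable categories.  The
isomorphism \<open>\<Phi>\<close> sends a functional to the class of the morphism that represents it.\<close>

theorem serre_imp_duality:
 assumes right: "\<forall>U\<in>Obj C. \<exists>A \<eta>. serre k J C U A \<eta>" and left: "\<forall>A\<in>Obj C. \<exists>U \<eta>. serre k J C U A \<eta>"
 shows "has_AR_Serre_duality k J C"
proof -
 interpret J: module k J by (rule J_module)
 have "\<forall>U\<in>Obj C. \<exists>t. serre k J C U (fst t) (snd t)"
 proof
  fix U assume "U \<in> Obj C"
  then obtain A \<eta> where "serre k J C U A \<eta>" using right by blast
  then show "\<exists>t. serre k J C U (fst t) (snd t)" by (intro exI[of _ "(A, \<eta>)"]) simp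
 qed
 from bchoice[OF this] obtain t where t: "\<forall>U\<in>Obj C. serre k J C U (fst (t U)) (snd (t U))" by (rule exE)
 define T where "T U = fst (t U)" for U
 define H where "H U = snd (t U)" for U
 have S: "serre k J C U (T U) (H U)" if "U \<in> Obj C" for U using bspec[OF t that] by (simp add: T_def H_def)
 have TO: "T U \<in> Obj C" if "U \<in> Obj C" for U by (rule serreD(2)[OF S[OF that]])
 have Hlin: "linear_map k (Ext C U (T U)) J (H U)" if "U \<in> Obj C" for U by (rule serreD(3)[OF S[OF that]])
 have univ: "\<exists>f\<in>mor C Y (T U). \<forall>\<xi>\<in>xt C U Y. \<phi> \<xi> = H U (Push C f \<xi>)"
  if "U \<in> Obj C" "Y \<in> Obj C" "linear_map k (Ext C U Y) J \<phi>" for U Y \<phi>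
  by (rule push_universal_ex[OF serreD(4)[OF S[OF that(1)]] that(2,3)])
 have inj: "inj_eq C Y f g"
  if "U \<in> Obj C" "f \<in> mor C Y (T U)" "g \<in> mor C Y (T U)" "\<And>\<xi>. \<xi> \<in> xt C U Y \<Longrightarrow> H U (Push C f \<xi>) = H U (Push C g \<xi>)" for U Y f g
  by (rule push_universal_inj[OF serreD(4)[OF S[OF that(1)]] that(2-4)])
 have op_univ: "\<exists>x\<in>mor C U X. \<forall>\<xi>\<in>xt C X (T U). \<phi> \<xi> = H U (Pull C x \<xi>)"
  if "U \<in> Obj C" "X \<in> Obj C" "linear_map k (Ext C X (T U)) J \<phi>" for U X \<phi>
  by (rule push_universal_ex[OF serreD(5)[OF S[OF that(1)]], of X, unfolded opposite_simps mor_opposite xt_opposite, OF that(2,3)])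
 have op_inj: "inj_eq (opposite C) X x y"
  if "U \<in> Obj C" "x \<in> mor C U X" "y \<in> mor C U X" "\<And>\<xi>. \<xi> \<in> xt C X (T U) \<Longrightarrow> H U (Pull C x \<xi>) = H U (Pull C y \<xi>)" for U X x y
  by (rule push_universal_inj[OF serreD(5)[OF S[OF that(1)]], of x X y, unfolded opposite_simps mor_opposite xt_opposite, OF that(2-4)])
 \<comment> \<open>the matching of \<open>x\<close> with \<open>f\<close>\<close>
 define mt where "mt X X' x f \<longleftrightarrow> x \<in> mor C X X' \<and> f \<in> mor C (T X) (T X') \<and>
   (\<forall>\<xi>\<in>xt C X' (T X). H X (Pull C x \<xi>) = H X' (Push C f \<xi>))" for X X' x f
 have mtD: "x \<in> mor C X X'" "f \<in> mor C (T X) (T X')" "\<xi> \<in> xt C X' (T X) \<Longrightarrow> H X (Pull C x \<xi>) = H X' (Push C f \<xi>)"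
  if "mt X X' x f" for X X' x f \<xi> using that unfolding mt_def by simp_all
 have mt_ex: "\<exists>f. mt X X' x f" if x: "x \<in> mor C X X'" for X X' x
 proof -
  note O = morD(2,3)[OF x]
  obtain f where f: "f \<in> mor C (T X) (T X')" "\<forall>\<xi>\<in>xt C X' (T X). H X (Pull C x \<xi>) = H X' (Push C f \<xi>)"
   by (rule bexE[OF univ[OF O(2) TO[OF O(1)] linear_map_comp[OF pull_linear[OF x TO[OF O(1)]] Hlin[OF O(1)]]]])
  then show ?thesis unfolding mt_def using x by (intro exI conjI)
 qed
 have mt_ex': "\<exists>x. mt X X' x f" if X: "X \<in> Obj C" and X': "X' \<in> Obj C" and f: "f \<in> mor C (T X) (T X')" for X X' f
 proof -
  obtain x where x: "x \<in> mor C X X'" "\<forall>\<xi>\<in>xt C X' (T X). H X' (Push C f \<xi>) = H X (Pull C x \<xi>)"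
   by (rule bexE[OF op_univ[OF X X' linear_map_comp[OF push_linear[OF f X'] Hlin[OF X']]]])
  have "\<forall>\<xi>\<in>xt C X' (T X). H X (Pull C x \<xi>) = H X' (Push C f \<xi>)" using x(2) by simp
  then show ?thesis unfolding mt_def using x(1) f by (intro exI conjI)
 qed
 have mt_eq: "inj_eq C (T X) f g \<longleftrightarrow> inj_eq (opposite C) X' x y" if m: "mt X X' x f" and n: "mt X X' y g" for X X' x y f g
 proof
  note M = mtD[OF m] and N = mtD[OF n]
  note O = morD(2,3)[OF M(1)]
  { assume e: "inj_eq C (T X) f g"
   show "inj_eq (opposite C) X' x y"
   proof (rule op_inj[OF O(1) M(1) N(1)])
    fix \<xi> assume \<xi>: "\<xi> \<in> xt C X' (T X)"
    show "H X (Pull C x \<xi>) = H X (Pull C y \<xi>)" unfolding M(3)[OF \<xi>] N(3)[OF \<xi>] inj_eqD[OF e \<xi>] ..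
   qed }
  { assume e: "inj_eq (opposite C) X' x y"
   show "inj_eq C (T X) f g"
   proof (rule inj[OF O(2) M(2) N(2)])
    fix \<xi> assume \<xi>: "\<xi> \<in> xt C X' (T X)"
    have "Pull C x \<xi> = Pull C y \<xi>" using inj_eqD[OF e, of \<xi> "T X"] \<xi> by simp
    then show "H X' (Push C f \<xi>) = H X' (Push C g \<xi>)" unfolding M(3)[OF \<xi>, symmetric] N(3)[OF \<xi>, symmetric] by simp
   qed }
 qed
 \<comment> \<open>stable morphisms are single cosets, so a choice of representatives recovers ends and morphism\<close>
 define Fm where "Fm F = (SOME G. \<exists>X X' x f. F = pcls X X' x \<and> mt X X' x f \<and> G = icls (T X) (T X') f)" for F
 interpret P: category "proj_stable C" by (rule proj_stable_category)
 interpret I: category "inj_stable C" by (rule inj_stable_category)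
 have Fm: "Fm (pcls X X' x) = icls (T X) (T X') f" if m: "mt X X' x f" for X X' x f
 proof -
  note M = mtD[OF m]
  have "\<exists>Y Y' y g. pcls X X' x = pcls Y Y' y \<and> mt Y Y' y g \<and> Fm (pcls X X' x) = icls (T Y) (T Y') g"
   unfolding Fm_def
  proof (rule someI[where P = "\<lambda>G. \<exists>Y Y' y g. pcls X X' x = pcls Y Y' y \<and> mt Y Y' y g \<and> G = icls (T Y) (T Y') g"])
   show "\<exists>Y Y' y g. pcls X X' x = pcls Y Y' y \<and> mt Y Y' y g \<and> icls (T X) (T X') f = icls (T Y) (T Y') g"
    by (intro exI[of _ X] exI[of _ X'] exI[of _ x] exI[of _ f] conjI refl m)
  qed
  then obtain Y Y' y g where y: "pcls X X' x = pcls Y Y' y" "mt Y Y' y g" "Fm (pcls X X' x) = icls (T Y) (T Y') g"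
   by (elim exE conjE)
  note N = mtD[OF y(2)]
  note px = pcls_mor[OF M(1)] and py = pcls_mor[OF N(1)]
  have "X = Y \<and> X' = Y'"
   by (rule P.Hom_disjoint[OF morD(2)[OF px] morD(3)[OF px] morD(2)[OF py] morD(3)[OF py] morD(1)[OF px]])
    (simp only: y(1) morD(1)[OF py])
  then have XY: "Y = X" "Y' = X'" by simp_all
  note y = y[unfolded XY]
  note N = mtD[OF y(2)]
  have "inj_eq (opposite C) X' x y" using y(1) pcls_eq_iff[OF M(1) N(1)] by simp
  then have "inj_eq C (T X) f g" using mt_eq[OF m y(2)] by simp
  then show ?thesis using y(3) icls_eq_iff[OF M(2) N(2)] by simp
 qed
 have mt_id: "mt X X (Id C X) (Id C (T X))" if X: "X \<in> Obj C" for X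
  unfolding mt_def
 proof (intro conjI ballI mor_Id X TO)
  fix \<xi> assume \<xi>: "\<xi> \<in> xt C X (T X)"
  show "H X (Pull C (Id C X) \<xi>) = H X (Push C (Id C (T X)) \<xi>)" unfolding pull_id[OF \<xi>] push_id[OF \<xi>] ..
 qed
 have mt_comp: "mt X X'' (y \<cdot> x) (g \<cdot> f)" if m: "mt X X' x f" and n: "mt X' X'' y g" for X X' X'' x y f g
  unfolding mt_def
 proof (intro conjI ballI mor_comp[OF mtD(1)[OF m] mtD(1)[OF n]] mor_comp[OF mtD(2)[OF m] mtD(2)[OF n]])
  note M = mtD[OF m] and N = mtD[OF n]
  fix \<xi> assume \<xi>: "\<xi> \<in> xt C X'' (T X)"
  have "H X (Pull C (y \<cdot> x) \<xi>) = H X (Pull C x (Pull C y \<xi>))" unfolding pull_comp[OF N(1) M(1) \<xi>] ..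
  also have "\<dots> = H X' (Push C f (Pull C y \<xi>))" by (rule M(3)[OF xt_Pull[OF N(1) \<xi>]])
  also have "\<dots> = H X' (Pull C y (Push C f \<xi>))" unfolding push_pull[OF M(2) N(1) \<xi>] ..
  also have "\<dots> = H X'' (Push C g (Push C f \<xi>))" by (rule N(3)[OF xt_Push[OF M(2) \<xi>]])
  also have "\<dots> = H X'' (Push C (g \<cdot> f) \<xi>)" unfolding push_comp[OF M(2) N(2) \<xi>] ..
  finally show "H X (Pull C (y \<cdot> x) \<xi>) = H X'' (Push C (g \<cdot> f) \<xi>)" .
 qed
 have mt_add: "mt X X' (x \<oplus>\<^bsub>Hom C X X'\<^esub> y) (f \<oplus>\<^bsub>Hom C (T X) (T X')\<^esub> g)" if m: "mt X X' x f" and n: "mt X X' y g" for X X' x y f g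
  unfolding mt_def
 proof (intro conjI ballI mor_add mtD(1,2)[OF m] mtD(1,2)[OF n])
  note M = mtD[OF m] and N = mtD[OF n]
  note O = morD(2,3)[OF M(1)]
  fix \<xi> assume \<xi>: "\<xi> \<in> xt C X' (T X)"
  have "H X (Pull C (x \<oplus>\<^bsub>Hom C X X'\<^esub> y) \<xi>) = H X (Pull C x \<xi>) \<oplus>\<^bsub>J\<^esub> H X (Pull C y \<xi>)"
   unfolding add_pull[OF M(1) N(1) \<xi>]
   by (rule linear_mapD(2)[OF Hlin[OF O(1)] xtD(1)[OF xt_Pull[OF M(1) \<xi>]] xtD(1)[OF xt_Pull[OF N(1) \<xi>]]])
  also have "\<dots> = H X' (Push C f \<xi>) \<oplus>\<^bsub>J\<^esub> H X' (Push C g \<xi>)" unfolding M(3)[OF \<xi>] N(3)[OF \<xi>] ..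
  also have "\<dots> = H X' (Push C (f \<oplus>\<^bsub>Hom C (T X) (T X')\<^esub> g) \<xi>)"
   unfolding add_push[OF M(2) N(2) \<xi>]
   by (rule linear_mapD(2)[OF Hlin[OF O(2)] xtD(1)[OF xt_Push[OF M(2) \<xi>]] xtD(1)[OF xt_Push[OF N(2) \<xi>]], symmetric])
  finally show "H X (Pull C (x \<oplus>\<^bsub>Hom C X X'\<^esub> y) \<xi>) = H X' (Push C (f \<oplus>\<^bsub>Hom C (T X) (T X')\<^esub> g) \<xi>)" .
 qed
 have mt_smult: "mt X X' (r \<odot>\<^bsub>Hom C X X'\<^esub> x) (r \<odot>\<^bsub>Hom C (T X) (T X')\<^esub> f)" if m: "mt X X' x f" and r: "r \<in> carrier k" for X X' x f r
  unfolding mt_def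
 proof (intro conjI ballI mor_smult r mtD(1,2)[OF m])
  note M = mtD[OF m]
  note O = morD(2,3)[OF M(1)]
  fix \<xi> assume \<xi>: "\<xi> \<in> xt C X' (T X)"
  have "H X (Pull C (r \<odot>\<^bsub>Hom C X X'\<^esub> x) \<xi>) = r \<odot>\<^bsub>J\<^esub> H X (Pull C x \<xi>)"
   unfolding smult_pull[OF M(1) \<xi> r] by (rule linear_mapD(3)[OF Hlin[OF O(1)] r xtD(1)[OF xt_Pull[OF M(1) \<xi>]]])
  also have "\<dots> = r \<odot>\<^bsub>J\<^esub> H X' (Push C f \<xi>)" unfolding M(3)[OF \<xi>] ..
  also have "\<dots> = H X' (Push C (r \<odot>\<^bsub>Hom C (T X) (T X')\<^esub> f) \<xi>)"
   unfolding smult_push[OF M(2) \<xi> r] by (rule linear_mapD(3)[OF Hlin[OF O(2)] r xtD(1)[OF xt_Push[OF M(2) \<xi>]], symmetric])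
  finally show "H X (Pull C (r \<odot>\<^bsub>Hom C X X'\<^esub> x) \<xi>) = H X' (Push C (r \<odot>\<^bsub>Hom C (T X) (T X')\<^esub> f) \<xi>)" .
 qed
 have repP: "\<exists>x f. F = pcls X X' x \<and> mt X X' x f" if F: "F \<in> mor (proj_stable C) X X'" for F X X'
 proof -
  obtain x where x: "x \<in> mor C X X'" "F = pcls X X' x" by (rule bexE[OF proj_stable_morE[OF F]])
  obtain f where "mt X X' x f" using mt_ex[OF x(1)] by (rule exE)
  then show ?thesis using x(2) by (intro exI conjI)
 qed
 have fctr: "is_functor (proj_stable C) (inj_stable C) T Fm"
 proof (rule is_functorI)
  show "T A \<in> Obj (inj_stable C)" if "A \<in> Obj (proj_stable C)" for A using TO that by (simp add: stable_simps)
  show "Fm (Id (proj_stable C) A) = Id (inj_stable C) (T A)" if "A \<in> Obj (proj_stable C)" for A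
   unfolding stable_simps by (rule Fm[OF mt_id]) (use that in \<open>simp add: stable_simps\<close>)
  show "Fm F \<in> mor (inj_stable C) (T A) (T B)" if F: "F \<in> mor (proj_stable C) A B" for A B F
  proof -
   obtain x f where m: "F = pcls A B x" "mt A B x f" using repP[OF F] by (elim exE conjE)
   show ?thesis unfolding m(1) Fm[OF m(2)] by (rule icls_mor[OF mtD(2)[OF m(2)]])
  qed
  show "Fm (G \<cdot>\<^bsub>proj_stable C\<^esub> F) = Fm G \<cdot>\<^bsub>inj_stable C\<^esub> Fm F"
   if F: "F \<in> mor (proj_stable C) A B" and G: "G \<in> mor (proj_stable C) B E" for A B E F G
  proof -
   obtain x f where m: "F = pcls A B x" "mt A B x f" using repP[OF F] by (elim exE conjE)
   obtain y g where n: "G = pcls B E y" "mt B E y g" using repP[OF G] by (elim exE conjE)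
   show ?thesis unfolding m(1) n(1) pcls_comp[OF mtD(1)[OF m(2)] mtD(1)[OF n(2)]]
     Fm[OF mt_comp[OF m(2) n(2)]] Fm[OF m(2)] Fm[OF n(2)] icls_comp[OF mtD(2)[OF m(2)] mtD(2)[OF n(2)]] ..
  qed
 qed
 have equiv: "is_equivalence (proj_stable C) (inj_stable C) T Fm"
 proof (rule fully_faithful_dense_equivalence[OF proj_stable_category inj_stable_category fctr])
  fix A B G assume O: "A \<in> Obj (proj_stable C)" "B \<in> Obj (proj_stable C)" and G: "G \<in> mor (inj_stable C) (T A) (T B)"
  obtain f where f: "f \<in> mor C (T A) (T B)" "G = icls (T A) (T B) f" by (rule bexE[OF inj_stable_morE[OF G]])
  obtain x where x: "mt A B x f" using mt_ex'[OF O[unfolded stable_simps] f(1)] by (rule exE)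
  show "\<exists>F\<in>mor (proj_stable C) A B. Fm F = G"
   by (rule bexI[of _ "pcls A B x"]) (simp_all only: Fm[OF x] f(2) pcls_mor[OF mtD(1)[OF x]])
 next
  fix A B F G assume F: "F \<in> mor (proj_stable C) A B" and G: "G \<in> mor (proj_stable C) A B" and eq: "Fm F = Fm G"
  obtain x f where m: "F = pcls A B x" "mt A B x f" using repP[OF F] by (elim exE conjE)
  obtain y g where n: "G = pcls A B y" "mt A B y g" using repP[OF G] by (elim exE conjE)
  have "icls (T A) (T B) f = icls (T A) (T B) g" using eq unfolding m(1) n(1) Fm[OF m(2)] Fm[OF n(2)] .
  then have "inj_eq C (T A) f g" using icls_eq_iff[OF mtD(2)[OF m(2)] mtD(2)[OF n(2)]] by simp
  then have "inj_eq (opposite C) B x y" using mt_eq[OF m(2) n(2)] by simp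
  then show "F = G" unfolding m(1) n(1) using pcls_eq_iff[OF mtD(1)[OF m(2)] mtD(1)[OF n(2)]] by simp
 next
  fix Y assume "Y \<in> Obj (inj_stable C)"
  then have Y: "Y \<in> Obj C" by (simp add: stable_simps)
  obtain V \<eta> where SV: "serre k J C V Y \<eta>" using left Y by blast
  note V = serreD(1)[OF SV]
  obtain f where f: "f \<in> mor C Y (T V)" "\<forall>\<xi>\<in>xt C V Y. \<eta> \<xi> = H V (Push C f \<xi>)"
   by (rule bexE[OF univ[OF V Y serreD(3)[OF SV]]])
  obtain g where g: "g \<in> mor C (T V) Y" "\<forall>\<xi>\<in>xt C V (T V). H V \<xi> = \<eta> (Push C g \<xi>)"
   by (rule bexE[OF push_universal_ex[OF serreD(4)[OF SV] TO[OF V] Hlin[OF V]]])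
  note fg = mor_comp[OF g(1) f(1)] and gf = mor_comp[OF f(1) g(1)]
  have 1: "inj_eq C (T V) (f \<cdot> g) (Id C (T V))"
  proof (rule inj[OF V fg mor_Id[OF TO[OF V]]])
   fix \<xi> assume \<xi>: "\<xi> \<in> xt C V (T V)"
   show "H V (Push C (f \<cdot> g) \<xi>) = H V (Push C (Id C (T V)) \<xi>)"
    unfolding push_comp[OF g(1) f(1) \<xi>] push_id[OF \<xi>] using bspec[OF f(2) xt_Push[OF g(1) \<xi>]] bspec[OF g(2) \<xi>] by simp
  qed
  have 2: "inj_eq C Y (g \<cdot> f) (Id C Y)"
  proof (rule push_universal_inj[OF serreD(4)[OF SV] gf mor_Id[OF Y]])
   fix \<xi> assume \<xi>: "\<xi> \<in> xt C V Y"
   show "\<eta> (Push C (g \<cdot> f) \<xi>) = \<eta> (Push C (Id C Y) \<xi>)"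
    unfolding push_comp[OF f(1) g(1) \<xi>] push_id[OF \<xi>] using bspec[OF g(2) xt_Push[OF f(1) \<xi>]] bspec[OF f(2) \<xi>] by simp
  qed
  have "iso_arr (inj_stable C) (T V) Y (icls (T V) Y g)"
  proof (rule iso_arrI[OF icls_mor[OF g(1)] icls_mor[OF f(1)]])
   show "icls Y (T V) f \<cdot>\<^bsub>inj_stable C\<^esub> icls (T V) Y g = Id (inj_stable C) (T V)"
    unfolding icls_comp[OF g(1) f(1)] stable_simps icls_eq_iff[OF fg mor_Id[OF TO[OF V]]] by (rule 1)
   show "icls (T V) Y g \<cdot>\<^bsub>inj_stable C\<^esub> icls Y (T V) f = Id (inj_stable C) Y"
    unfolding icls_comp[OF f(1) g(1)] stable_simps icls_eq_iff[OF gf mor_Id[OF Y]] by (rule 2)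
  qed
  then show "\<exists>X\<in>Obj (proj_stable C). \<exists>e. iso_arr (inj_stable C) (T X) Y e"
   using V by (intro bexI[of _ V] exI) (simp_all only: stable_simps)
 qed
 have lequiv: "is_linear_equivalence k (proj_stable C) (inj_stable C) T Fm"
  unfolding is_linear_equivalence_def
 proof (intro conjI ballI equiv)
  fix A B assume O: "A \<in> Obj (proj_stable C)" "B \<in> Obj (proj_stable C)"
  have rep: "\<exists>x f. F = pcls A B x \<and> mt A B x f" if "F \<in> arr (proj_stable C) A B" for F
   by (rule repP[OF morI[OF that O]])
  show "linear_map k (Hom (proj_stable C) A B) (Hom (inj_stable C) (T A) (T B)) Fm"
  proof (rule linear_mapI)
   fix F assume F: "F \<in> arr (proj_stable C) A B"
   obtain x f where m: "F = pcls A B x" "mt A B x f" using rep[OF F] by (elim exE conjE)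
   show "Fm F \<in> arr (inj_stable C) (T A) (T B)"
    unfolding m(1) Fm[OF m(2)] by (rule morD(1)[OF icls_mor[OF mtD(2)[OF m(2)]]])
   show "Fm (r \<odot>\<^bsub>Hom (proj_stable C) A B\<^esub> F) = r \<odot>\<^bsub>Hom (inj_stable C) (T A) (T B)\<^esub> Fm F" if r: "r \<in> carrier k" for r
    unfolding m(1) cls_linear(2)[OF mtD(1)[OF m(2)] r] Fm[OF mt_smult[OF m(2) r]] Fm[OF m(2)] cls_linear(4)[OF mtD(2)[OF m(2)] r] ..
   fix G assume G: "G \<in> arr (proj_stable C) A B"
   obtain y g where n: "G = pcls A B y" "mt A B y g" using rep[OF G] by (elim exE conjE)
   show "Fm (F \<oplus>\<^bsub>Hom (proj_stable C) A B\<^esub> G) = Fm F \<oplus>\<^bsub>Hom (inj_stable C) (T A) (T B)\<^esub> Fm G"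
    unfolding m(1) n(1) cls_linear(1)[OF mtD(1)[OF m(2)] mtD(1)[OF n(2)]] Fm[OF mt_add[OF m(2) n(2)]]
     Fm[OF m(2)] Fm[OF n(2)] cls_linear(3)[OF mtD(2)[OF m(2)] mtD(2)[OF n(2)]] ..
  qed
 qed
 \<comment> \<open>\<open>f\<close> represents the functional \<open>\<phi>\<close>\<close>
 define rp where "rp X Y \<phi> f \<longleftrightarrow> f \<in> mor C Y (T X) \<and> (\<forall>\<xi>\<in>xt C X Y. \<phi> \<xi> = H X (Push C f \<xi>))" for X Y \<phi> f
 define \<Phi> where "\<Phi> X Y \<phi> = icls Y (T X) (SOME f. rp X Y \<phi> f)" for X Y \<phi>
 have rpD: "f \<in> mor C Y (T X)" "\<xi> \<in> xt C X Y \<Longrightarrow> \<phi> \<xi> = H X (Push C f \<xi>)" if "rp X Y \<phi> f" for X Y \<phi> f \<xi>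
  using that unfolding rp_def by simp_all
 have \<Phi>: "\<Phi> X Y \<phi> = icls Y (T X) f" if X: "X \<in> Obj C" and f: "rp X Y \<phi> f" for X Y \<phi> f
 proof -
  have g: "rp X Y \<phi> (SOME f. rp X Y \<phi> f)" by (rule someI[of "rp X Y \<phi>", OF f])
  have "inj_eq C Y (SOME f. rp X Y \<phi> f) f"
  proof (rule inj[OF X rpD(1)[OF g] rpD(1)[OF f]])
   fix \<xi> assume \<xi>: "\<xi> \<in> xt C X Y"
   show "H X (Push C (SOME f. rp X Y \<phi> f) \<xi>) = H X (Push C f \<xi>)" unfolding rpD(2)[OF g \<xi>, symmetric] by (rule rpD(2)[OF f \<xi>])
  qed
  then show ?thesis unfolding \<Phi>_def icls_eq_iff[OF rpD(1)[OF g] rpD(1)[OF f]] .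
 qed
 have rp_ex: "\<exists>f. rp X Y \<phi> f" if X: "X \<in> Obj C" and Y: "Y \<in> Obj C" and \<phi>: "\<phi> \<in> carrier (Hom_module k (Ext C X Y) J)" for X Y \<phi>
 proof -
  have l: "linear_map k (Ext C X Y) J \<phi>" using \<phi> unfolding Hom_module_simps by simp
  obtain f where f: "f \<in> mor C Y (T X)" "\<forall>\<xi>\<in>xt C X Y. \<phi> \<xi> = H X (Push C f \<xi>)" by (rule bexE[OF univ[OF X Y l]])
  show ?thesis unfolding rp_def by (intro exI[of _ f] conjI f)
 qed
 have restr: "rp X Y (\<lambda>\<delta>\<in>ext C X Y. \<psi> \<delta>) f" if "f \<in> mor C Y (T X)" "\<And>\<xi>. \<xi> \<in> xt C X Y \<Longrightarrow> \<psi> \<xi> = H X (Push C f \<xi>)" for X Y \<psi> f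
  unfolding rp_def using that by (simp add: xtD(1))
 have lin\<Phi>: "linear_map k (Hom_module k (Ext C X Y) J) (Hom (inj_stable C) Y (T X)) (\<Phi> X Y)" if X: "X \<in> Obj C" and Y: "Y \<in> Obj C" for X Y
 proof (rule linear_mapI)
  fix \<phi> assume \<phi>: "\<phi> \<in> carrier (Hom_module k (Ext C X Y) J)"
  obtain f where f: "rp X Y \<phi> f" using rp_ex[OF X Y \<phi>] by (rule exE)
  show "\<Phi> X Y \<phi> \<in> arr (inj_stable C) Y (T X)" unfolding \<Phi>[OF X f] by (rule morD(1)[OF icls_mor[OF rpD(1)[OF f]]])
  show "\<Phi> X Y (r \<odot>\<^bsub>Hom_module k (Ext C X Y) J\<^esub> \<phi>) = r \<odot>\<^bsub>Hom (inj_stable C) Y (T X)\<^esub> \<Phi> X Y \<phi>" if r: "r \<in> carrier k" for r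
  proof -
   have "rp X Y (r \<odot>\<^bsub>Hom_module k (Ext C X Y) J\<^esub> \<phi>) (r \<odot>\<^bsub>Hom C Y (T X)\<^esub> f)"
    unfolding Hom_module_simps
   proof (rule restr[OF mor_smult[OF r rpD(1)[OF f]]])
    fix \<xi> assume \<xi>: "\<xi> \<in> xt C X Y"
    show "r \<odot>\<^bsub>J\<^esub> \<phi> \<xi> = H X (Push C (r \<odot>\<^bsub>Hom C Y (T X)\<^esub> f) \<xi>)"
     unfolding smult_push[OF rpD(1)[OF f] \<xi> r] rpD(2)[OF f \<xi>]
     by (rule linear_mapD(3)[OF Hlin[OF X] r xtD(1)[OF xt_Push[OF rpD(1)[OF f] \<xi>]], symmetric])
   qed
   from \<Phi>[OF X this] show ?thesis unfolding \<Phi>[OF X f] cls_linear(4)[OF rpD(1)[OF f] r] .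
  qed
  fix \<psi> assume \<psi>: "\<psi> \<in> carrier (Hom_module k (Ext C X Y) J)"
  obtain g where g: "rp X Y \<psi> g" using rp_ex[OF X Y \<psi>] by (rule exE)
  have "rp X Y (\<phi> \<oplus>\<^bsub>Hom_module k (Ext C X Y) J\<^esub> \<psi>) (f \<oplus>\<^bsub>Hom C Y (T X)\<^esub> g)"
   unfolding Hom_module_simps
  proof (rule restr[OF mor_add[OF rpD(1)[OF f] rpD(1)[OF g]]])
   fix \<xi> assume \<xi>: "\<xi> \<in> xt C X Y"
   show "\<phi> \<xi> \<oplus>\<^bsub>J\<^esub> \<psi> \<xi> = H X (Push C (f \<oplus>\<^bsub>Hom C Y (T X)\<^esub> g) \<xi>)"
    unfolding add_push[OF rpD(1)[OF f] rpD(1)[OF g] \<xi>] rpD(2)[OF f \<xi>] rpD(2)[OF g \<xi>]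
    by (rule linear_mapD(2)[OF Hlin[OF X] xtD(1)[OF xt_Push[OF rpD(1)[OF f] \<xi>]] xtD(1)[OF xt_Push[OF rpD(1)[OF g] \<xi>]], symmetric])
  qed
  from \<Phi>[OF X this] show "\<Phi> X Y (\<phi> \<oplus>\<^bsub>Hom_module k (Ext C X Y) J\<^esub> \<psi>) = \<Phi> X Y \<phi> \<oplus>\<^bsub>Hom (inj_stable C) Y (T X)\<^esub> \<Phi> X Y \<psi>"
   unfolding \<Phi>[OF X f] \<Phi>[OF X g] cls_linear(3)[OF rpD(1)[OF f] rpD(1)[OF g]] .
 qed
 have bij\<Phi>: "bij_betw (\<Phi> X Y) (carrier (Hom_module k (Ext C X Y) J)) (arr (inj_stable C) Y (T X))" if X: "X \<in> Obj C" and Y: "Y \<in> Obj C" for X Y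
  unfolding bij_betw_def
 proof (intro conjI inj_onI equalityI subsetI)
  fix \<phi> \<psi> assume \<phi>: "\<phi> \<in> carrier (Hom_module k (Ext C X Y) J)" and \<psi>: "\<psi> \<in> carrier (Hom_module k (Ext C X Y) J)"
   and eq: "\<Phi> X Y \<phi> = \<Phi> X Y \<psi>"
  obtain f where f: "rp X Y \<phi> f" using rp_ex[OF X Y \<phi>] by (rule exE)
  obtain g where g: "rp X Y \<psi> g" using rp_ex[OF X Y \<psi>] by (rule exE)
  have e: "inj_eq C Y f g" using eq unfolding \<Phi>[OF X f] \<Phi>[OF X g] icls_eq_iff[OF rpD(1)[OF f] rpD(1)[OF g]] .
  have ext: "\<phi> \<in> extensional (ext C X Y)" "\<psi> \<in> extensional (ext C X Y)" using \<phi> \<psi> unfolding Hom_module_simps by simp_all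
  show "\<phi> = \<psi>"
  proof (rule extensionalityI[OF ext])
   fix \<xi> assume "\<xi> \<in> ext C X Y"
   then have \<xi>: "\<xi> \<in> xt C X Y" using X Y by (rule xtI)
   show "\<phi> \<xi> = \<psi> \<xi>" unfolding rpD(2)[OF f \<xi>] rpD(2)[OF g \<xi>] inj_eqD[OF e \<xi>] ..
  qed
 next
  fix F assume "F \<in> \<Phi> X Y ` carrier (Hom_module k (Ext C X Y) J)"
  then show "F \<in> arr (inj_stable C) Y (T X)" using linear_mapD(1)[OF lin\<Phi>[OF X Y]] by blast
 next
  fix F assume F: "F \<in> arr (inj_stable C) Y (T X)"
  have "F \<in> mor (inj_stable C) Y (T X)" by (rule morI[OF F]) (simp_all only: stable_simps Y TO[OF X])
  then obtain f where f: "f \<in> mor C Y (T X)" "F = icls Y (T X) f" by (rule bexE[OF inj_stable_morE])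
  let ?\<phi> = "\<lambda>\<delta>\<in>ext C X Y. H X (Push C f \<delta>)"
  have "?\<phi> \<in> carrier (Hom_module k (Ext C X Y) J)"
   by (rule restrict_Hom_module[OF linear_map_comp[OF push_linear[OF f(1) X] Hlin[OF X]] ext_module[OF X Y]])
  moreover have "F = \<Phi> X Y ?\<phi>" using \<Phi>[OF X restr[OF f(1)]] f(2) by simp
  ultimately show "F \<in> \<Phi> X Y ` carrier (Hom_module k (Ext C X Y) J)" by (simp only: image_eqI)
 qed
 have nat1: "\<Phi> X' Y (\<lambda>\<delta>\<in>ext C X' Y. \<phi> (Pull C x \<delta>)) = Fm (pcls X X' x) \<cdot>\<^bsub>inj_stable C\<^esub> \<Phi> X Y \<phi>"
  if X: "X \<in> Obj C" and X': "X' \<in> Obj C" and Y: "Y \<in> Obj C" and x: "x \<in> arr C X X'"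
   and \<phi>: "\<phi> \<in> carrier (Hom_module k (Ext C X Y) J)" for X X' Y x \<phi>
 proof -
  have xm: "x \<in> mor C X X'" by (rule morI[OF x X X'])
  obtain g where g: "mt X X' x g" using mt_ex[OF xm] by (rule exE)
  obtain f where f: "rp X Y \<phi> f" using rp_ex[OF X Y \<phi>] by (rule exE)
  note G = mtD[OF g] and F = rpD[OF f]
  have "rp X' Y (\<lambda>\<delta>\<in>ext C X' Y. \<phi> (Pull C x \<delta>)) (g \<cdot> f)"
  proof (rule restr[OF mor_comp[OF F(1) G(2)]])
   fix \<xi> assume \<xi>: "\<xi> \<in> xt C X' Y"
   have "\<phi> (Pull C x \<xi>) = H X (Push C f (Pull C x \<xi>))" by (rule F(2)[OF xt_Pull[OF xm \<xi>]])
   also have "\<dots> = H X (Pull C x (Push C f \<xi>))" unfolding push_pull[OF F(1) xm \<xi>] ..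
   also have "\<dots> = H X' (Push C g (Push C f \<xi>))" by (rule G(3)[OF xt_Push[OF F(1) \<xi>]])
   finally show "\<phi> (Pull C x \<xi>) = H X' (Push C (g \<cdot> f) \<xi>)" unfolding push_comp[OF F(1) G(2) \<xi>] .
  qed
  from \<Phi>[OF X' this] show ?thesis unfolding Fm[OF g] \<Phi>[OF X f] icls_comp[OF F(1) G(2)] .
 qed
 have nat2: "\<Phi> X Y' (\<lambda>\<delta>\<in>ext C X Y'. \<phi> (Push C y \<delta>)) = \<Phi> X Y \<phi> \<cdot>\<^bsub>inj_stable C\<^esub> icls Y' Y y"
  if X: "X \<in> Obj C" and Y: "Y \<in> Obj C" and Y': "Y' \<in> Obj C" and y: "y \<in> arr C Y' Y"
   and \<phi>: "\<phi> \<in> carrier (Hom_module k (Ext C X Y) J)" for X Y Y' y \<phi>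
 proof -
  have ym: "y \<in> mor C Y' Y" by (rule morI[OF y Y' Y])
  obtain f where f: "rp X Y \<phi> f" using rp_ex[OF X Y \<phi>] by (rule exE)
  note F = rpD[OF f]
  have "rp X Y' (\<lambda>\<delta>\<in>ext C X Y'. \<phi> (Push C y \<delta>)) (f \<cdot> y)"
  proof (rule restr[OF mor_comp[OF ym F(1)]])
   fix \<xi> assume \<xi>: "\<xi> \<in> xt C X Y'"
   show "\<phi> (Push C y \<xi>) = H X (Push C (f \<cdot> y) \<xi>)" unfolding push_comp[OF ym F(1) \<xi>] by (rule F(2)[OF xt_Push[OF ym \<xi>]])
  qed
  from \<Phi>[OF X this] show ?thesis unfolding \<Phi>[OF X f] icls_comp[OF ym F(1)] .
 qed
 show ?thesis
  unfolding has_AR_Serre_duality_def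
  by (rule exI[of _ T], rule exI[of _ Fm], rule conjI[OF lequiv], rule exI[of _ \<Phi>], unfold cls_def[symmetric])
   (intro conjI ballI lin\<Phi> bij\<Phi> nat1 nat2)
qed

text \<open>The functional \<open>\<eta>\<close> on \<open>\<bbbE>(X, T X)\<close> that corresponds under \<open>\<Phi>\<close> to the identity of \<open>T X\<close> is universal: by
naturality in the second argument the functional \<open>\<xi> \<mapsto> \<eta> (f\<^sub>* \<xi>)\<close> corresponds to the class of \<open>f\<close>, and by
naturality in the first argument \<open>\<xi> \<mapsto> \<eta> (c\<^sup>* \<xi>)\<close> corresponds to the image of \<open>c\<close> under the equivalence.
Density of \<open>T\<close> gives Serre pairs with a prescribed right member.\<close>

theorem duality_imp_serre:
 assumes D: "has_AR_Serre_duality k J C"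
 shows "\<forall>U\<in>Obj C. \<exists>A \<eta>. serre k J C U A \<eta>" and "\<forall>A\<in>Obj C. \<exists>U \<eta>. serre k J C U A \<eta>"
proof -
 obtain T Fm \<Phi> where le: "is_linear_equivalence k (proj_stable C) (inj_stable C) T Fm"
  and b: "\<forall>X\<in>Obj C. \<forall>Y\<in>Obj C.
      linear_map k (Hom_module k (Ext C X Y) J) (Hom (inj_stable C) Y (T X)) (\<Phi> X Y) \<and>
      bij_betw (\<Phi> X Y) (carrier (Hom_module k (Ext C X Y) J)) (arr (inj_stable C) Y (T X))"
  and n1: "\<forall>X\<in>Obj C. \<forall>X'\<in>Obj C. \<forall>Y\<in>Obj C. \<forall>x\<in>arr C X X'. \<forall>\<phi>\<in>carrier (Hom_module k (Ext C X Y) J).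
      \<Phi> X' Y (\<lambda>\<delta>\<in>ext C X' Y. \<phi> (Pull C x \<delta>)) = Fm (pcls X X' x) \<cdot>\<^bsub>inj_stable C\<^esub> \<Phi> X Y \<phi>"
  and n2: "\<forall>X\<in>Obj C. \<forall>Y\<in>Obj C. \<forall>Y'\<in>Obj C. \<forall>y\<in>arr C Y' Y. \<forall>\<phi>\<in>carrier (Hom_module k (Ext C X Y) J).
      \<Phi> X Y' (\<lambda>\<delta>\<in>ext C X Y'. \<phi> (Push C y \<delta>)) = \<Phi> X Y \<phi> \<cdot>\<^bsub>inj_stable C\<^esub> icls Y' Y y"
  using D unfolding has_AR_Serre_duality_def cls_def by (elim exE conjE)
 note bij = conjunct2[OF bspec[OF bspec[OF b]]]
 note nat1 = bspec[OF bspec[OF bspec[OF bspec[OF bspec[OF n1]]]]]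
 note nat2 = bspec[OF bspec[OF bspec[OF bspec[OF bspec[OF n2]]]]]
 have eq: "is_equivalence (proj_stable C) (inj_stable C) T Fm" using le by (simp add: is_linear_equivalence_def)
 then have F: "is_functor (proj_stable C) (inj_stable C) T Fm" by (simp add: is_equivalence_def)
 note E = equivalence_fully_faithful_dense[OF proj_stable_category inj_stable_category eq, unfolded stable_simps]
 note FD = is_functorD[OF F, unfolded stable_simps]
 interpret I: category "inj_stable C" by (rule inj_stable_category)
 have S: "\<exists>\<eta>. serre k J C X (T X) \<eta>" if X: "X \<in> Obj C" for X
 proof -
  let ?A = "T X"
  note A = FD(1)[OF X]
  note IdA = mor_Id[OF A]
  let ?D = "\<lambda>X Y. carrier (Hom_module k (Ext C X Y) J)"
  have "icls ?A ?A (Id C ?A) \<in> \<Phi> X ?A ` ?D X ?A"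
   using bij_betw_imp_surj_on[OF bij[OF X A]] morD(1)[OF icls_mor[OF IdA]] by simp
  then obtain \<eta> where \<eta>D: "\<eta> \<in> ?D X ?A" and \<eta>: "icls ?A ?A (Id C ?A) = \<Phi> X ?A \<eta>" by (rule imageE)
  have \<eta>lin: "linear_map k (Ext C X ?A) J \<eta>" using \<eta>D unfolding Hom_module_simps by simp
  have push: "\<Phi> X Y (\<lambda>\<delta>\<in>ext C X Y. \<eta> (Push C f \<delta>)) = icls Y ?A f" if f: "f \<in> mor C Y ?A" for Y f
   unfolding nat2[OF X A morD(2)[OF f] morD(1)[OF f] \<eta>D] \<eta>[symmetric] icls_comp[OF f IdA] id_left[OF f] ..
  have pull: "\<Phi> X' ?A (\<lambda>\<delta>\<in>ext C X' ?A. \<eta> (Pull C x \<delta>)) = Fm (pcls X X' x)" if x: "x \<in> mor C X X'" for X' x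
  proof -
   note Fx = FD(3)[OF pcls_mor[OF x]]
   show ?thesis
    unfolding nat1[OF X morD(3)[OF x] A morD(1)[OF x] \<eta>D] \<eta>[symmetric] stable_simps(4)[symmetric]
    by (rule I.id_right[OF Fx])
  qed
  have restr_eq: "\<phi> \<xi> = \<psi> \<xi>" if "(\<lambda>\<delta>\<in>ext C X' Y. \<phi> \<delta>) = (\<lambda>\<delta>\<in>ext C X' Y. \<psi> \<delta>)" "\<xi> \<in> xt C X' Y" for \<phi> \<psi> :: "'e \<Rightarrow> 'j" and X' Y \<xi>
   using fun_cong[OF that(1), of \<xi>] xtD(1)[OF that(2)] by simp
  have "push_universal k J C X ?A \<eta>"
  proof (rule push_universalI)
   fix Y \<phi> assume Y: "Y \<in> Obj C" and \<phi>: "linear_map k (Ext C X Y) J \<phi>"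
   note r = restrict_Hom_module[OF \<phi> ext_module[OF X Y]]
   have "\<Phi> X Y (restrict \<phi> (ext C X Y)) \<in> arr (inj_stable C) Y ?A" by (rule bij_betwE[OF bij[OF X Y], rule_format, OF r])
   then have "\<Phi> X Y (restrict \<phi> (ext C X Y)) \<in> mor (inj_stable C) Y ?A"
    by (rule morI) (simp_all only: stable_simps Y A)
   then obtain f where f: "f \<in> mor C Y ?A" "\<Phi> X Y (restrict \<phi> (ext C X Y)) = icls Y ?A f" by (rule bexE[OF inj_stable_morE])
   note r' = restrict_Hom_module[OF linear_map_comp[OF push_linear[OF f(1) X] \<eta>lin] ext_module[OF X Y]]
   have "restrict \<phi> (ext C X Y) = (\<lambda>\<delta>\<in>ext C X Y. \<eta> (Push C f \<delta>))"
    by (rule inj_onD[OF bij_betw_imp_inj_on[OF bij[OF X Y]] _ r r']) (simp only: f(2) push[OF f(1)])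
   then show "\<exists>f\<in>mor C Y ?A. \<forall>\<xi>\<in>xt C X Y. \<phi> \<xi> = \<eta> (Push C f \<xi>)"
    by (intro bexI[OF _ f(1)] ballI) (rule restr_eq)
  next
   fix Y f g assume f: "f \<in> mor C Y ?A" and g: "g \<in> mor C Y ?A"
    and eqs: "\<And>\<xi>. \<xi> \<in> xt C X Y \<Longrightarrow> \<eta> (Push C f \<xi>) = \<eta> (Push C g \<xi>)"
   note Y = morD(2)[OF f]
   have "(\<lambda>\<delta>\<in>ext C X Y. \<eta> (Push C f \<delta>)) = (\<lambda>\<delta>\<in>ext C X Y. \<eta> (Push C g \<delta>))"
    by (rule restrict_ext) (rule eqs[OF xtI[OF _ X Y]])
   then have "icls Y ?A f = icls Y ?A g" using push[OF f] push[OF g] by simp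
   then show "inj_eq C Y f g" using icls_eq_iff[OF f g] by simp
  qed
  moreover have "push_universal k J (opposite C) ?A X \<eta>"
  proof (rule push_universalI, unfold opposite_simps mor_opposite xt_opposite)
   fix X' \<phi> assume X': "X' \<in> Obj C" and \<phi>: "linear_map k (Ext C X' ?A) J \<phi>"
   note r = restrict_Hom_module[OF \<phi> ext_module[OF X' A]]
   have "\<Phi> X' ?A (restrict \<phi> (ext C X' ?A)) \<in> arr (inj_stable C) ?A (T X')" by (rule bij_betwE[OF bij[OF X' A], rule_format, OF r])
   then have "\<Phi> X' ?A (restrict \<phi> (ext C X' ?A)) \<in> mor (inj_stable C) ?A (T X')"
    by (rule morI) (simp_all only: stable_simps A FD(1)[OF X'])
   then obtain F where F: "F \<in> mor (proj_stable C) X X'" "Fm F = \<Phi> X' ?A (restrict \<phi> (ext C X' ?A))"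
    by (rule bexE[OF E(1)[OF X X']])
   obtain x where x: "x \<in> mor C X X'" "F = pcls X X' x" by (rule bexE[OF proj_stable_morE[OF F(1)]])
   note r' = restrict_Hom_module[OF linear_map_comp[OF pull_linear[OF x(1) A] \<eta>lin] ext_module[OF X' A]]
   have "restrict \<phi> (ext C X' ?A) = (\<lambda>\<delta>\<in>ext C X' ?A. \<eta> (Pull C x \<delta>))"
    by (rule inj_onD[OF bij_betw_imp_inj_on[OF bij[OF X' A]] _ r r']) (simp only: F(2)[symmetric] x(2) pull[OF x(1)])
   then show "\<exists>x\<in>mor C X X'. \<forall>\<xi>\<in>xt C X' ?A. \<phi> \<xi> = \<eta> (Pull C x \<xi>)"
    by (intro bexI[OF _ x(1)] ballI) (rule restr_eq)
  next
   fix X' x y assume x: "x \<in> mor C X X'" and y: "y \<in> mor C X X'"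
    and eqs: "\<And>\<xi>. \<xi> \<in> xt C X' ?A \<Longrightarrow> \<eta> (Pull C x \<xi>) = \<eta> (Pull C y \<xi>)"
   note X' = morD(3)[OF x]
   have "(\<lambda>\<delta>\<in>ext C X' ?A. \<eta> (Pull C x \<delta>)) = (\<lambda>\<delta>\<in>ext C X' ?A. \<eta> (Pull C y \<delta>))"
    by (rule restrict_ext) (rule eqs[OF xtI[OF _ X' A]])
   then have "Fm (pcls X X' x) = Fm (pcls X X' y)" using pull[OF x] pull[OF y] by simp
   then have "pcls X X' x = pcls X X' y" by (rule E(2)[OF pcls_mor[OF x] pcls_mor[OF y]])
   then show "inj_eq (opposite C) X' x y" using pcls_eq_iff[OF x y] by simp
  qed
  ultimately show ?thesis by (intro exI[of _ \<eta>] serreI X A \<eta>lin)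
 qed
 show "\<forall>U\<in>Obj C. \<exists>A \<eta>. serre k J C U A \<eta>"
 proof
  fix U assume "U \<in> Obj C"
  from S[OF this] show "\<exists>A \<eta>. serre k J C U A \<eta>" by (rule exI)
 qed
 show "\<forall>A\<in>Obj C. \<exists>U \<eta>. serre k J C U A \<eta>"
 proof
  fix Y assume Y: "Y \<in> Obj C"
  obtain X e where X: "X \<in> Obj C" and e: "iso_arr (inj_stable C) (T X) Y e" using E(3)[OF Y] by (elim bexE exE)
  note A = FD(1)[OF X]
  have "\<exists>e'. e \<in> mor (inj_stable C) (T X) Y \<and> e' \<in> mor (inj_stable C) Y (T X) \<and>
    e' \<cdot>\<^bsub>inj_stable C\<^esub> e = Id (inj_stable C) (T X) \<and> e \<cdot>\<^bsub>inj_stable C\<^esub> e' = Id (inj_stable C) Y"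
   by (rule iso_arrE[OF e]) (simp_all only: stable_simps A Y)
  then obtain e' where e1: "e \<in> mor (inj_stable C) (T X) Y" and e2: "e' \<in> mor (inj_stable C) Y (T X)"
   and e'e: "e' \<cdot>\<^bsub>inj_stable C\<^esub> e = Id (inj_stable C) (T X)" and ee': "e \<cdot>\<^bsub>inj_stable C\<^esub> e' = Id (inj_stable C) Y"
   by (elim exE conjE)
  obtain g where g: "g \<in> mor C (T X) Y" "e = icls (T X) Y g" by (rule bexE[OF inj_stable_morE[OF e1]])
  obtain f where f: "f \<in> mor C Y (T X)" "e' = icls Y (T X) f" by (rule bexE[OF inj_stable_morE[OF e2]])
  have fg: "inj_eq C (T X) (f \<cdot> g) (Id C (T X))"
   using e'e unfolding f(2) g(2) icls_comp[OF g(1) f(1)] stable_simps icls_eq_iff[OF mor_comp[OF g(1) f(1)] mor_Id[OF A]] .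
  have gf: "inj_eq C Y (g \<cdot> f) (Id C Y)"
   using ee' unfolding f(2) g(2) icls_comp[OF f(1) g(1)] stable_simps icls_eq_iff[OF mor_comp[OF f(1) g(1)] mor_Id[OF Y]] .
  obtain \<eta> where "serre k J C X (T X) \<eta>" using S[OF X] by (rule exE)
  from serre_iso_mod_injectives[OF this f(1) g(1) fg gf] show "\<exists>U \<eta>. serre k J C U Y \<eta>" by (intro exI)
 qed
qed

end

section \<open>Complexes and their reversal\<close>

lemma is_complexD:
 assumes "is_complex C n X"
 shows "length (obs X) = n + 2" "length (diffs X) = n + 1"
  and "i \<le> n + 1 \<Longrightarrow> ob X i \<in> Obj C"
  and "i \<le> n \<Longrightarrow> df X i \<in> mor C (ob X i) (ob X (i + 1))"
  and "i < n \<Longrightarrow> df X (i + 1) \<cdot>\<^bsub>C\<^esub> df X i = zero_arr C (ob X i) (ob X (i + 2))"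
 using assms by (simp_all add: is_complex_def mor_def)

lemma is_complexI:
 assumes "length (obs X) = n + 2" "length (diffs X) = n + 1"
  and "\<And>i. i \<le> n \<Longrightarrow> df X i \<in> mor C (ob X i) (ob X (i + 1))"
  and "\<And>i. i < n \<Longrightarrow> df X (i + 1) \<cdot>\<^bsub>C\<^esub> df X i = zero_arr C (ob X i) (ob X (i + 2))"
 shows "is_complex C n X"
proof -
 have "ob X i \<in> Obj C" if "i \<le> n + 1" for i
  using that assms(3)[of i] assms(3)[of "i - 1"] by (cases "i \<le> n") (auto simp: mor_def le_Suc_eq)
 then show ?thesis using assms by (simp add: is_complex_def mor_def)
qed

text \<open>The reversed complex lives in the opposite category.\<close>

definition rev_cplx :: "('o, 'm) cplx \<Rightarrow> ('o, 'm) cplx" where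
 "rev_cplx X = \<lparr>obs = rev (obs X), diffs = rev (diffs X)\<rparr>"

lemma rev_rev_cplx [simp]: "rev_cplx (rev_cplx X) = X"
 by (simp add: rev_cplx_def)

lemma rev_cplx_nth:
 assumes "is_complex C n X"
 shows "i \<le> n + 1 \<Longrightarrow> ob (rev_cplx X) i = ob X (n + 1 - i)" "i \<le> n \<Longrightarrow> df (rev_cplx X) i = df X (n - i)"
 using is_complexD(1,2)[OF assms] by (simp_all add: rev_cplx_def rev_nth)

lemma is_complex_rev:
 fixes C :: "('o, 'm, 'k, 'e) ecat"
 assumes X: "is_complex C n X"
 shows "is_complex (opposite C) n (rev_cplx X)"
proof (rule is_complexI)
 note N = rev_cplx_nth[OF X]
 show "length (obs (rev_cplx X)) = n + 2" "length (diffs (rev_cplx X)) = n + 1"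
  using is_complexD(1,2)[OF X] by (simp_all add: rev_cplx_def)
 fix i
 show "df (rev_cplx X) i \<in> mor (opposite C) (ob (rev_cplx X) i) (ob (rev_cplx X) (i + 1))" if "i \<le> n"
  using that N(1)[of i] N(1)[of "i + 1"] N(2)[of i] is_complexD(4)[OF X, of "n - i"] by (simp add: Suc_diff_le)
 show "df (rev_cplx X) (i + 1) \<cdot>\<^bsub>opposite C\<^esub> df (rev_cplx X) i
   = zero_arr (opposite C) (ob (rev_cplx X) i) (ob (rev_cplx X) (i + 2))" if i: "i < n"
 proof -
  obtain j where j: "n = Suc (i + j)" using less_imp_Suc_add[OF i] by auto
  show ?thesis using N(1)[of i] N(1)[of "i + 2"] N(2)[of i] N(2)[of "i + 1"] is_complexD(5)[OF X, of j] unfolding j by simp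
 qed
qed

lemma distinguished_rev:
 fixes C :: "('o, 'm, 'k, 'e) ecat"
 assumes d: "distinguished C n X \<delta>"
 shows "distinguished (opposite C) n (rev_cplx X) \<delta>"
proof -
 have X: "is_complex C n X" using d by (simp add: distinguished_def)
 have e: "ob (rev_cplx X) 0 = ob X (n + 1)" "ob (rev_cplx X) (n + 1) = ob X 0"
  using rev_cplx_nth(1)[OF X, of 0] rev_cplx_nth(1)[OF X, of "n + 1"] by simp_all
 show ?thesis using d is_complex_rev[OF X] unfolding distinguished_def e opposite_simps Real_opposite rev_cplx_def[symmetric]
  by (simp add: image_eqI)
qed

lemma is_exangle_rev:
 fixes C :: "('o, 'm, 'k, 'e) ecat"
 assumes ex: "is_exangle C n X \<delta>"
 shows "is_exangle (opposite C) n (rev_cplx X) \<delta>"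
proof -
 have X: "is_complex C n X" using ex by (simp add: is_exangle_def)
 note N = rev_cplx_nth[OF X]
 have e: "ob (rev_cplx X) 0 = ob X (n + 1)" "ob (rev_cplx X) 1 = ob X n" "ob (rev_cplx X) n = ob X 1"
  "ob (rev_cplx X) (n + 1) = ob X 0" "df (rev_cplx X) 0 = df X n" "df (rev_cplx X) n = df X 0"
  using N(1)[of 0] N(1)[of 1] N(1)[of n] N(1)[of "n + 1"] N(2)[of 0] N(2)[of n] by simp_all
 note ex' = ex[unfolded is_exangle_def]
 have middle: "ob (rev_cplx X) i = ob X (n - 1 - i + 2) \<and> ob (rev_cplx X) (i + 1) = ob X (n - 1 - i + 1) \<and>
   ob (rev_cplx X) (i + 2) = ob X (n - 1 - i) \<and>
   df (rev_cplx X) i = df X (n - 1 - i + 1) \<and> df (rev_cplx X) (i + 1) = df X (n - 1 - i) \<and> n - 1 - i < n" if i: "i < n" for i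
 proof -
  obtain j where j: "n = Suc (i + j)" using less_imp_Suc_add[OF i] by auto
  show ?thesis using N(1)[of i] N(1)[of "i + 1"] N(1)[of "i + 2"] N(2)[of i] N(2)[of "i + 1"] unfolding j by simp
 qed
 show ?thesis unfolding is_exangle_def e opposite_simps
 proof (intro conjI ballI allI impI is_complex_rev[OF X])
  fix W i assume W: "W \<in> Obj C" and i: "i < n"
  note m = middle[OF i]
  show "(\<lambda>g. g \<cdot>\<^bsub>C\<^esub> df (rev_cplx X) i) ` arr C (ob (rev_cplx X) i) W =
   {f \<in> arr C (ob (rev_cplx X) (i + 1)) W. f \<cdot>\<^bsub>C\<^esub> df (rev_cplx X) (i + 1) = zero_arr C (ob (rev_cplx X) (i + 2)) W}"
   using m ex' W by simp
  show "(\<lambda>g. df (rev_cplx X) (i + 1) \<cdot>\<^bsub>C\<^esub> g) ` arr C W (ob (rev_cplx X) (i + 2)) =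
   {f \<in> arr C W (ob (rev_cplx X) (i + 1)). df (rev_cplx X) i \<cdot>\<^bsub>C\<^esub> f = zero_arr C W (ob (rev_cplx X) i)}"
   using m ex' W by simp
 qed (use ex' in simp_all)
qed

text \<open>The exactness conditions at the two ends, in terms of factorizations.\<close>

lemma is_exangle_factor:
 assumes ex: "is_exangle C n X \<delta>"
 shows "is_complex C n X" "\<delta> \<in> xt C (ob X (n + 1)) (ob X 0)"
  "Push C (df X 0) \<delta> = \<zero>\<^bsub>Ext C (ob X (n + 1)) (ob X 1)\<^esub>"
  "Pull C (df X n) \<delta> = \<zero>\<^bsub>Ext C (ob X n) (ob X 0)\<^esub>"
  "f \<in> mor C W (ob X (n + 1)) \<Longrightarrow> Pull C f \<delta> = \<zero>\<^bsub>Ext C W (ob X 0)\<^esub> \<Longrightarrow> \<exists>g\<in>mor C W (ob X n). f = df X n \<cdot>\<^bsub>C\<^esub> g"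
  "f \<in> mor C (ob X 0) W \<Longrightarrow> Push C f \<delta> = \<zero>\<^bsub>Ext C (ob X (n + 1)) W\<^esub> \<Longrightarrow> \<exists>g\<in>mor C (ob X 1) W. f = g \<cdot>\<^bsub>C\<^esub> df X 0"
proof -
 note ex' = ex[unfolded is_exangle_def]
 show X: "is_complex C n X" using ex' by simp
 note XD = is_complexD[OF X]
 have O: "ob X 0 \<in> Obj C" "ob X 1 \<in> Obj C" "ob X n \<in> Obj C" "ob X (n + 1) \<in> Obj C" using XD(3) by simp_all
 show "\<delta> \<in> xt C (ob X (n + 1)) (ob X 0)" using ex' O by (intro xtI) simp_all
 show "Push C (df X 0) \<delta> = \<zero>\<^bsub>Ext C (ob X (n + 1)) (ob X 1)\<^esub>" using ex' by simp
 show "Pull C (df X n) \<delta> = \<zero>\<^bsub>Ext C (ob X n) (ob X 0)\<^esub>" using ex' by simp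
 show "\<exists>g\<in>mor C W (ob X n). f = df X n \<cdot>\<^bsub>C\<^esub> g" if f: "f \<in> mor C W (ob X (n + 1))" and z: "Pull C f \<delta> = \<zero>\<^bsub>Ext C W (ob X 0)\<^esub>"
 proof -
  have "(\<lambda>g. df X n \<cdot>\<^bsub>C\<^esub> g) ` arr C W (ob X n) = {f \<in> arr C W (ob X (n+1)). Pull C f \<delta> = \<zero>\<^bsub>Ext C W (ob X 0)\<^esub>}"
   using ex' morD(2)[OF f] by simp
  moreover have "f \<in> {f \<in> arr C W (ob X (n+1)). Pull C f \<delta> = \<zero>\<^bsub>Ext C W (ob X 0)\<^esub>}" using morD(1)[OF f] z by simp
  ultimately have "f \<in> (\<lambda>g. df X n \<cdot>\<^bsub>C\<^esub> g) ` arr C W (ob X n)" by simp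
  then obtain g where "g \<in> arr C W (ob X n)" "f = df X n \<cdot>\<^bsub>C\<^esub> g" by (rule imageE)
  then show ?thesis using morI[OF _ morD(2)[OF f] O(3)] by blast
 qed
 show "\<exists>g\<in>mor C (ob X 1) W. f = g \<cdot>\<^bsub>C\<^esub> df X 0" if f: "f \<in> mor C (ob X 0) W" and z: "Push C f \<delta> = \<zero>\<^bsub>Ext C (ob X (n + 1)) W\<^esub>"
 proof -
  have "(\<lambda>g. g \<cdot>\<^bsub>C\<^esub> df X 0) ` arr C (ob X 1) W = {f \<in> arr C (ob X 0) W. Push C f \<delta> = \<zero>\<^bsub>Ext C (ob X (n+1)) W\<^esub>}"
   using ex' morD(3)[OF f] by simp
  moreover have "f \<in> {f \<in> arr C (ob X 0) W. Push C f \<delta> = \<zero>\<^bsub>Ext C (ob X (n+1)) W\<^esub>}" using morD(1)[OF f] z by simp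
  ultimately have "f \<in> (\<lambda>g. g \<cdot>\<^bsub>C\<^esub> df X 0) ` arr C (ob X 1) W" by simp
  then obtain g where "g \<in> arr C (ob X 1) W" "f = g \<cdot>\<^bsub>C\<^esub> df X 0" by (rule imageE)
  then show ?thesis using morI[OF _ O(2) morD(3)[OF f]] by blast
 qed
qed

section \<open>Almost split extensions and Auslander-Reiten exangles\<close>

lemma split_opposite [simp]:
 fixes C :: "('o, 'm, 'k, 'e) ecat"
 shows "split_mono (opposite C) A B f \<longleftrightarrow> split_epi C B A f" "split_epi (opposite C) A B f \<longleftrightarrow> split_mono C B A f"
  "left_almost_split (opposite C) A B f \<longleftrightarrow> right_almost_split C B A f"
 by (simp_all add: split_mono_def split_epi_def left_almost_split_def right_almost_split_def)

lemma almost_split_opposite [simp]: "almost_split (opposite C) A U \<delta> \<longleftrightarrow> almost_split C U A \<delta>"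
 unfolding almost_split_def by (simp add: conj_commute)

lemma almost_splitI:
 assumes "\<delta> \<in> xt C U A" "\<delta> \<noteq> \<zero>\<^bsub>Ext C U A\<^esub>"
  and "\<And>A' f. f \<in> mor C A A' \<Longrightarrow> \<not> split_mono C A A' f \<Longrightarrow> Push C f \<delta> = \<zero>\<^bsub>Ext C U A'\<^esub>"
  and "\<And>U' c. c \<in> mor C U' U \<Longrightarrow> \<not> split_epi C U' U c \<Longrightarrow> Pull C c \<delta> = \<zero>\<^bsub>Ext C U' A\<^esub>"
 shows "almost_split C U A \<delta>"
 using assms by (simp add: almost_split_def)

lemma almost_splitD:
 assumes "almost_split C U A \<delta>"
 shows "\<delta> \<in> xt C U A" "\<delta> \<noteq> \<zero>\<^bsub>Ext C U A\<^esub>"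
  and "f \<in> mor C A A' \<Longrightarrow> \<not> split_mono C A A' f \<Longrightarrow> Push C f \<delta> = \<zero>\<^bsub>Ext C U A'\<^esub>"
  and "c \<in> mor C U' U \<Longrightarrow> \<not> split_epi C U' U c \<Longrightarrow> Pull C c \<delta> = \<zero>\<^bsub>Ext C U' A\<^esub>"
 using assms by (simp_all add: almost_split_def)

context additive_bifunctor
begin

lemma split_push_nonzero:
 assumes s: "split_mono C A B f" and B: "B \<in> Obj C" and \<delta>: "\<delta> \<in> xt C U A" and z: "Push C f \<delta> = \<zero>\<^bsub>Ext C U B\<^esub>"
 shows "\<delta> = \<zero>\<^bsub>Ext C U A\<^esub>"
proof -
 obtain g where g: "g \<in> arr C B A" "g \<cdot> f = Id C A" and f: "f \<in> arr C A B" using s unfolding split_mono_def by (elim conjE bexE)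
 have fm: "f \<in> mor C A B" and gm: "g \<in> mor C B A" using f g(1) B xtD(3)[OF \<delta>] by (simp_all add: morI)
 have "\<delta> = Push C (g \<cdot> f) \<delta>" using push_id[OF \<delta>] g(2) by simp
 also have "\<dots> = Push C g (Push C f \<delta>)" by (rule push_comp[OF fm gm \<delta>])
 also have "\<dots> = \<zero>\<^bsub>Ext C U A\<^esub>" unfolding z by (rule push_zero[OF gm xtD(2)[OF \<delta>]])
 finally show ?thesis .
qed

text \<open>By exactness, \<open>f\<^sub>* \<delta> = 0\<close> iff \<open>f\<close> factors through the inflation.  Hence \<open>\<delta> \<noteq> 0\<close> iff the inflation is not a split
monomorphism, and \<open>\<delta>\<close> is killed by \<open>f\<close> iff \<open>f\<close> has the factorization that a left almost split morphism provides.\<close>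

lemma left_almost_split_push:
 assumes ex: "is_exangle C n X \<delta>" and l: "left_almost_split C (ob X 0) (ob X 1) (df X 0)"
 shows "\<delta> \<noteq> \<zero>\<^bsub>Ext C (ob X (n + 1)) (ob X 0)\<^esub>"
  and "f \<in> mor C (ob X 0) A' \<Longrightarrow> \<not> split_mono C (ob X 0) A' f \<Longrightarrow> Push C f \<delta> = \<zero>\<^bsub>Ext C (ob X (n + 1)) A'\<^esub>"
proof -
 note F = is_exangle_factor[OF ex]
 have d: "df X 0 \<in> mor C (ob X 0) (ob X 1)" using is_complexD(4)[OF F(1), of 0] by simp
 note \<delta> = F(2)
 show "\<delta> \<noteq> \<zero>\<^bsub>Ext C (ob X (n + 1)) (ob X 0)\<^esub>"
 proof
  assume "\<delta> = \<zero>\<^bsub>Ext C (ob X (n + 1)) (ob X 0)\<^esub>"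
  then have "Push C (Id C (ob X 0)) \<delta> = \<zero>\<^bsub>Ext C (ob X (n + 1)) (ob X 0)\<^esub>" using push_id[OF \<delta>] by simp
  then obtain g where g: "g \<in> mor C (ob X 1) (ob X 0)" "Id C (ob X 0) = g \<cdot> df X 0"
   by (rule bexE[OF F(6)[OF mor_Id[OF xtD(3)[OF \<delta>]]]])
  have "split_mono C (ob X 0) (ob X 1) (df X 0)" unfolding split_mono_def using morD(1)[OF d] morD(1)[OF g(1)] g(2)[symmetric] by (intro conjI bexI)
  then show False using l by (simp add: left_almost_split_def)
 qed
 show "Push C f \<delta> = \<zero>\<^bsub>Ext C (ob X (n + 1)) A'\<^esub>" if f: "f \<in> mor C (ob X 0) A'" and ns: "\<not> split_mono C (ob X 0) A' f"
 proof -
  obtain g where g: "g \<in> arr C (ob X 1) A'" "f = g \<cdot> df X 0"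
   using l morD(1,3)[OF f] ns unfolding left_almost_split_def by blast
  note gm = morI[OF g(1) morD(3)[OF d] morD(3)[OF f]]
  show ?thesis unfolding g(2) push_comp[OF d gm \<delta>] F(3) by (rule push_zero[OF gm xtD(2)[OF \<delta>]])
 qed
qed

lemma almost_split_left:
 assumes ex: "is_exangle C n X \<delta>" and a: "almost_split C (ob X (n + 1)) (ob X 0) \<delta>"
 shows "left_almost_split C (ob X 0) (ob X 1) (df X 0)"
proof -
 note F = is_exangle_factor[OF ex] and S = almost_splitD[OF a]
 have d: "df X 0 \<in> mor C (ob X 0) (ob X 1)" using is_complexD(4)[OF F(1), of 0] by simp
 show ?thesis unfolding left_almost_split_def
 proof (intro conjI ballI impI morD(1)[OF d])
  show "\<not> split_mono C (ob X 0) (ob X 1) (df X 0)" using split_push_nonzero[OF _ morD(3)[OF d] S(1) F(3)] S(2) by blast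
  fix A' f assume A': "A' \<in> Obj C" and f: "f \<in> arr C (ob X 0) A'" and ns: "\<not> split_mono C (ob X 0) A' f"
  note fm = morI[OF f morD(2)[OF d] A']
  obtain g where "g \<in> mor C (ob X 1) A'" "f = g \<cdot> df X 0" by (rule bexE[OF F(6)[OF fm S(3)[OF fm ns]]])
  then show "\<exists>g\<in>arr C (ob X 1) A'. f = g \<cdot> df X 0" by (intro bexI[OF _ morD(1)])
 qed
qed

end

lemma (in additive_bifunctor) almost_split_iff:
 assumes ex: "is_exangle C n X \<delta>"
 shows "almost_split C (ob X (n + 1)) (ob X 0) \<delta> \<longleftrightarrow>
  left_almost_split C (ob X 0) (ob X 1) (df X 0) \<and> right_almost_split C (ob X n) (ob X (n + 1)) (df X n)"
proof -
 interpret op: additive_bifunctor "opposite C" by (rule opposite_additive_bifunctor)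
 note F = is_exangle_factor[OF ex]
 note N = rev_cplx_nth[OF F(1)]
 have e: "ob (rev_cplx X) 0 = ob X (n + 1)" "ob (rev_cplx X) 1 = ob X n" "ob (rev_cplx X) (n + 1) = ob X 0"
  "df (rev_cplx X) 0 = df X n"
  using N(1)[of 0] N(1)[of 1] N(1)[of "n + 1"] N(2)[of 0] by simp_all
 note ex' = is_exangle_rev[OF ex]
 show ?thesis
 proof (intro iffI conjI; (elim conjE)?)
  assume a: "almost_split C (ob X (n + 1)) (ob X 0) \<delta>"
  show "left_almost_split C (ob X 0) (ob X 1) (df X 0)" by (rule almost_split_left[OF ex a])
  show "right_almost_split C (ob X n) (ob X (n + 1)) (df X n)"
   using op.almost_split_left[OF ex', unfolded e almost_split_opposite split_opposite, OF a] .
 next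
  assume l: "left_almost_split C (ob X 0) (ob X 1) (df X 0)" and r: "right_almost_split C (ob X n) (ob X (n + 1)) (df X n)"
  note L = left_almost_split_push[OF ex l]
  note R = op.left_almost_split_push[OF ex', unfolded e split_opposite opposite_simps mor_opposite, OF r]
  show "almost_split C (ob X (n + 1)) (ob X 0) \<delta>"
   by (rule almost_splitI[OF F(2) L(1)]) (erule (1) L(2) R(2))+
 qed
qed

section \<open>Exactness of extensions along distinguished exangles\<close>

text \<open>A self-dual set of consequences of the axioms of an \<open>n\<close>-exangulated category: existence of
realizations, exactness, and the mapping cone axiom on both sides.\<close>

locale realized_bifunctor = additive_bifunctor C for C :: "('o, 'm, 'k, 'e) ecat" (structure) +
 fixes n :: nat
 assumes n_pos: "n \<ge> 1"
  and realization: "\<delta> \<in> xt C D A \<Longrightarrow> \<exists>X. distinguished C n X \<delta> \<and> ob X 0 = A \<and> ob X (n + 1) = D"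
  and exangle: "distinguished C n X \<delta> \<Longrightarrow> is_exangle C n X \<delta>"
  and cone_left: "EA2 C n"
  and cone_right: "EA2 (opposite C) n"

lemma (in realized_bifunctor) opposite_realized_bifunctor: "realized_bifunctor (opposite C) n"
proof -
 interpret op: additive_bifunctor "opposite C" by (rule opposite_additive_bifunctor)
 show ?thesis
 proof (unfold_locales, unfold opposite_opposite)
  show "n \<ge> 1" by (rule n_pos)
  show "EA2 (opposite C) n" "EA2 C n" by (rule cone_right cone_left)+
  show "\<exists>X. distinguished (opposite C) n X \<delta> \<and> ob X 0 = A \<and> ob X (n + 1) = D" if \<delta>: "\<delta> \<in> xt (opposite C) D A" for \<delta> D A
  proof -
   have \<delta>': "\<delta> \<in> xt C A D" using \<delta> by simp
   obtain X where X: "distinguished C n X \<delta>" "ob X 0 = D" "ob X (n + 1) = A" using realization[OF \<delta>'] by (elim exE conjE)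
   have c: "is_complex C n X" using X(1) by (simp add: distinguished_def)
   show ?thesis using distinguished_rev[OF X(1)] rev_cplx_nth(1)[OF c, of 0] rev_cplx_nth(1)[OF c, of "n + 1"] X(2,3)
    by (intro exI[of _ "rev_cplx X"]) simp
  qed
  show "is_exangle (opposite C) n X \<delta>" if d: "distinguished (opposite C) n X \<delta>" for X \<delta>
   using is_exangle_rev[OF exangle[OF distinguished_rev[OF d, unfolded opposite_opposite]]] by simp
 qed
qed

context realized_bifunctor
begin

lemma mapping_cone_exists:
 assumes X: "is_complex C n X" and Y: "is_complex C n Y"
 shows "\<exists>M. is_mapping_cone C n X Y f M"
proof -
 have "\<forall>i\<in>{1..n}. \<exists>S. \<exists>iA iB pA pB. is_biproduct C (ob X (i + 1)) (ob Y i) S iA iB pA pB"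
  using is_complexD(3)[OF X] is_complexD(3)[OF Y] by (intro ballI biproduct_exists) simp_all
 from bchoice[OF this] obtain S where "\<forall>i\<in>{1..n}. \<exists>iA iB pA pB. is_biproduct C (ob X (i + 1)) (ob Y i) (S i) iA iB pA pB" ..
 from bchoice[OF this] obtain a where "\<forall>i\<in>{1..n}. \<exists>iB pA pB. is_biproduct C (ob X (i + 1)) (ob Y i) (S i) (a i) iB pA pB" ..
 from bchoice[OF this] obtain b where "\<forall>i\<in>{1..n}. \<exists>pA pB. is_biproduct C (ob X (i + 1)) (ob Y i) (S i) (a i) (b i) pA pB" ..
 from bchoice[OF this] obtain p where "\<forall>i\<in>{1..n}. \<exists>pB. is_biproduct C (ob X (i + 1)) (ob Y i) (S i) (a i) (b i) (p i) pB" ..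
 from bchoice[OF this] obtain q where B: "\<forall>i\<in>{1..n}. is_biproduct C (ob X (i + 1)) (ob Y i) (S i) (a i) (b i) (p i) (q i)" ..
 define ob' where "ob' i = (if i = 0 then ob X 1 else if i = n + 1 then ob Y (n + 1) else S i)" for i
 define df' where "df' i = (if i = 0 then
    a 1 \<cdot> (\<ominus>\<^bsub>Hom C (ob X 1) (ob X 2)\<^esub> df X 1) \<oplus>\<^bsub>Hom C (ob' 0) (ob' 1)\<^esub> b 1 \<cdot> f 1
   else if i = n then f (n + 1) \<cdot> p n \<oplus>\<^bsub>Hom C (ob' n) (ob' (n + 1))\<^esub> df Y n \<cdot> q n
   else a (i+1) \<cdot> (\<ominus>\<^bsub>Hom C (ob X (i+1)) (ob X (i+2))\<^esub> df X (i+1)) \<cdot> p i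
      \<oplus>\<^bsub>Hom C (ob' i) (ob' (i+1))\<^esub> b (i+1) \<cdot> f (i+1) \<cdot> p i
      \<oplus>\<^bsub>Hom C (ob' i) (ob' (i+1))\<^esub> b (i+1) \<cdot> df Y i \<cdot> q i)" for i
 define M where "M = \<lparr>obs = map ob' [0..<n + 2], diffs = map df' [0..<n + 1]\<rparr>"
 have o: "ob M i = ob' i" if "i \<le> n + 1" for i
 proof -
  have "i < length [0..<n + 2]" using that by simp
  then show ?thesis unfolding M_def cplx.simps by (subst nth_map) (simp_all del: upt_Suc)
 qed
 have d: "df M i = df' i" if "i \<le> n" for i
 proof -
  have "i < length [0..<n + 1]" using that by simp
  then show ?thesis unfolding M_def cplx.simps by (subst nth_map) (simp_all del: upt_Suc)
 qed
 have l: "length (obs M) = n + 2" "length (diffs M) = n + 1" by (simp_all add: M_def)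
 have o0: "ob M 0 = ob' 0" "ob M 1 = ob' 1" "ob M n = ob' n" "ob M (n + 1) = ob' (n + 1)" by (rule o; simp)+
 have h: "ob M 0 = ob X 1" "ob M (n + 1) = ob Y (n + 1)" unfolding o0 ob'_def by simp_all
 have h3: "\<forall>i\<in>{1..n}. is_biproduct C (ob X (i + 1)) (ob Y i) (ob M i) (a i) (b i) (p i) (q i)"
  proof
   fix i assume i: "i \<in> {1..n}"
   have "ob M i = S i" using o[of i] i by (simp add: ob'_def)
   then show "is_biproduct C (ob X (i + 1)) (ob Y i) (ob M i) (a i) (b i) (p i) (q i)" using bspec[OF B i] by simp
  qed
 have h4: "df M 0 = a 1 \<cdot> (\<ominus>\<^bsub>Hom C (ob X 1) (ob X 2)\<^esub> df X 1) \<oplus>\<^bsub>Hom C (ob M 0) (ob M 1)\<^esub> b 1 \<cdot> f 1"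
   unfolding o0 d[OF le0] by (simp add: df'_def)
 have h6: "df M n = f (n + 1) \<cdot> p n \<oplus>\<^bsub>Hom C (ob M n) (ob M (n + 1))\<^esub> df Y n \<cdot> q n"
   unfolding o0 d[OF order_refl] using n_pos by (simp add: df'_def)
 have h5: "\<forall>i\<in>{1..<n}. df M i = a (i+1) \<cdot> (\<ominus>\<^bsub>Hom C (ob X (i+1)) (ob X (i+2))\<^esub> df X (i+1)) \<cdot> p i
      \<oplus>\<^bsub>Hom C (ob M i) (ob M (i+1))\<^esub> b (i+1) \<cdot> f (i+1) \<cdot> p i
      \<oplus>\<^bsub>Hom C (ob M i) (ob M (i+1))\<^esub> b (i+1) \<cdot> df Y i \<cdot> q i"
  proof
   fix i assume i: "i \<in> {1..<n}"
   have i1: "i \<le> n + 1" "i + 1 \<le> n + 1" "i \<le> n" "i \<noteq> 0" "i \<noteq> n" using i by auto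
   show "df M i = a (i+1) \<cdot> (\<ominus>\<^bsub>Hom C (ob X (i+1)) (ob X (i+2))\<^esub> df X (i+1)) \<cdot> p i
      \<oplus>\<^bsub>Hom C (ob M i) (ob M (i+1))\<^esub> b (i+1) \<cdot> f (i+1) \<cdot> p i
      \<oplus>\<^bsub>Hom C (ob M i) (ob M (i+1))\<^esub> b (i+1) \<cdot> df Y i \<cdot> q i"
    unfolding o[OF i1(1)] o[OF i1(2)] d[OF i1(3)] df'_def using i1(4,5) by (simp only: if_False)
  qed
 have "is_mapping_cone C n X Y f M" unfolding is_mapping_cone_def
  by (rule conjI[OF l(1) conjI[OF l(2) conjI[OF h(1) conjI[OF h(2)]]]], rule exI[of _ a], rule exI[of _ b],
    rule exI[of _ p], rule exI[of _ q]) (intro conjI h3 h4 h5 h6)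
 then show ?thesis ..
qed

text \<open>Exactness of \<open>\<C>(D, C') \<rightarrow> \<bbbE>(D, A) \<rightarrow> \<bbbE>(D, X\<^sub>1)\<close> for a distinguished exangle \<open>\<langle>X, \<nu>\<rangle>\<close> with ends \<open>A\<close> and \<open>C'\<close>.
Combine \<open>\<nu>\<close> and \<open>\<delta>\<close> to an extension \<open>\<omega>\<close> of \<open>S = C' \<oplus> D\<close> that restricts to \<open>\<nu>\<close> and \<open>\<delta>\<close>, and realize it by \<open>Y\<close>.  The cone
of the lift of the inclusion \<open>C' \<rightarrow> S\<close> realizes \<open>(d\<^sub>0)\<^sub>* \<omega> = 0\<close>, so its deflation \<open>C' \<oplus> Y\<^sub>n \<rightarrow> S\<close> splits.  Since \<open>\<omega>\<close>
vanishes on \<open>Y\<^sub>n\<close>, the splitting expresses \<open>\<omega>\<close>, and with it \<open>\<delta>\<close>, as a pullback of \<open>\<nu>\<close>.\<close>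

lemma push_exact:
 assumes dX: "distinguished C n X \<nu>" and \<delta>: "\<delta> \<in> xt C D (ob X 0)"
  and z: "Push C (df X 0) \<delta> = \<zero>\<^bsub>Ext C D (ob X 1)\<^esub>"
 shows "\<exists>c\<in>mor C D (ob X (n + 1)). Pull C c \<nu> = \<delta>"
proof -
 let ?A = "ob X 0" and ?C = "ob X (n + 1)"
 note F = is_exangle_factor[OF exangle[OF dX]]
 note XD = is_complexD[OF F(1)]
 note \<nu> = F(2)
 note CO = xtD(2)[OF \<nu>] and DO = xtD(2)[OF \<delta>] and AO = xtD(3)[OF \<nu>]
 have d0: "df X 0 \<in> mor C ?A (ob X 1)" using XD(4)[of 0] by simp
 obtain S iC iD pC pD where b: "is_biproduct C ?C D S iC iD pC pD"
  using biproduct_exists[OF CO DO] by (elim exE)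
 note B = is_biproductD[OF b]
 note SO = morD(3)[OF B(1)]
 \<comment> \<open>the extension of \<open>C\' \<oplus> D\<close> with restrictions \<open>\<nu>\<close> and \<open>\<delta>\<close>\<close>
 define \<omega> where "\<omega> = Pull C pC \<nu> \<oplus>\<^bsub>Ext C S ?A\<^esub> Pull C pD \<delta>"
 note p1 = xt_Pull[OF B(3) \<nu>] and p2 = xt_Pull[OF B(4) \<delta>]
 have \<omega>: "\<omega> \<in> xt C S ?A" unfolding \<omega>_def by (rule xt_add[OF p1 p2])
 have zero_ext: "\<xi> \<oplus>\<^bsub>Ext C D' A'\<^esub> \<zero>\<^bsub>Ext C D' A'\<^esub> = \<xi>" "\<zero>\<^bsub>Ext C D' A'\<^esub> \<oplus>\<^bsub>Ext C D' A'\<^esub> \<xi> = \<xi>"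
  if e: "\<xi> \<in> xt C D' A'" for \<xi> D' A'
 proof -
  interpret E: abelian_group "Ext C D' A'" by (rule xt_group[OF e])
  show "\<xi> \<oplus>\<^bsub>Ext C D' A'\<^esub> \<zero>\<^bsub>Ext C D' A'\<^esub> = \<xi>" "\<zero>\<^bsub>Ext C D' A'\<^esub> \<oplus>\<^bsub>Ext C D' A'\<^esub> \<xi> = \<xi>" using xtD(1)[OF e] by simp_all
 qed
 have zp: "Pull C (zero_arr C B' D') \<xi> = \<zero>\<^bsub>Ext C B' A'\<^esub>" if "B' \<in> Obj C" "\<xi> \<in> xt C D' A'" for B' D' A' \<xi>
  using additive_bifunctor.zero_push[OF opposite_additive_bifunctor, of B' \<xi> A' D'] that by simp
 have pz: "Pull C c \<zero>\<^bsub>Ext C D' A'\<^esub> = \<zero>\<^bsub>Ext C B' A'\<^esub>" if "c \<in> mor C B' D'" "A' \<in> Obj C" for c B' D' A'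
  using additive_bifunctor.push_zero[OF opposite_additive_bifunctor, of c D' B' A'] that by simp
 have \<omega>1: "Pull C iC \<omega> = \<nu>"
 proof -
  have "Pull C iC \<omega> = Pull C iC (Pull C pC \<nu>) \<oplus>\<^bsub>Ext C ?C ?A\<^esub> Pull C iC (Pull C pD \<delta>)" unfolding \<omega>_def by (rule pull_add[OF B(1) p1 p2])
  also have "\<dots> = Pull C (pC \<cdot> iC) \<nu> \<oplus>\<^bsub>Ext C ?C ?A\<^esub> Pull C (pD \<cdot> iC) \<delta>"
   unfolding pull_comp[OF B(3) B(1) \<nu>] pull_comp[OF B(4) B(1) \<delta>] ..
  also have "\<dots> = \<nu>" unfolding B(5) B(7) pull_id[OF \<nu>] zp[OF CO \<delta>] by (rule zero_ext(1)[OF \<nu>])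
  finally show ?thesis .
 qed
 have \<omega>2: "Pull C iD \<omega> = \<delta>"
 proof -
  have "Pull C iD \<omega> = Pull C iD (Pull C pC \<nu>) \<oplus>\<^bsub>Ext C D ?A\<^esub> Pull C iD (Pull C pD \<delta>)" unfolding \<omega>_def by (rule pull_add[OF B(2) p1 p2])
  also have "\<dots> = Pull C (pC \<cdot> iD) \<nu> \<oplus>\<^bsub>Ext C D ?A\<^esub> Pull C (pD \<cdot> iD) \<delta>"
   unfolding pull_comp[OF B(3) B(2) \<nu>] pull_comp[OF B(4) B(2) \<delta>] ..
  also have "\<dots> = \<delta>" unfolding B(6) B(8) pull_id[OF \<delta>] zp[OF DO \<nu>] by (rule zero_ext(2)[OF \<delta>])
  finally show ?thesis .
 qed
 have \<omega>z: "Push C (df X 0) \<omega> = \<zero>\<^bsub>Ext C S (ob X 1)\<^esub>"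
 proof -
  have "Push C (df X 0) \<omega> = Push C (df X 0) (Pull C pC \<nu>) \<oplus>\<^bsub>Ext C S (ob X 1)\<^esub> Push C (df X 0) (Pull C pD \<delta>)"
   unfolding \<omega>_def by (rule push_add[OF d0 p1 p2])
  also have "\<dots> = Pull C pC (Push C (df X 0) \<nu>) \<oplus>\<^bsub>Ext C S (ob X 1)\<^esub> Pull C pD (Push C (df X 0) \<delta>)"
   unfolding push_pull[OF d0 B(3) \<nu>] push_pull[OF d0 B(4) \<delta>] ..
  also have "\<dots> = \<zero>\<^bsub>Ext C S (ob X 1)\<^esub> \<oplus>\<^bsub>Ext C S (ob X 1)\<^esub> \<zero>\<^bsub>Ext C S (ob X 1)\<^esub>"
   unfolding F(3) z pz[OF B(3) morD(3)[OF d0]] pz[OF B(4) morD(3)[OF d0]] ..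
  also have "\<dots> = \<zero>\<^bsub>Ext C S (ob X 1)\<^esub>" by (rule zero_ext(1)[OF xt_zero[OF SO morD(3)[OF d0]]])
  finally show ?thesis .
 qed
 obtain Y where Y: "distinguished C n Y \<omega>" "ob Y 0 = ?A" "ob Y (n + 1) = S" using realization[OF \<omega>] by (elim exE conjE)
 note G = is_exangle_factor[OF exangle[OF Y(1)]]
 have dY: "df Y n \<in> mor C (ob Y n) S" using is_complexD(4)[OF G(1), of n] Y(3) by simp
 have dX': "distinguished C n X (Pull C iC \<omega>)" unfolding \<omega>1 by (rule dX)
 have "\<exists>f. chain_map C n X Y f \<and> f 0 = Id C ?A \<and> f (n + 1) = iC \<and>
      (\<forall>M. is_mapping_cone C n X Y f M \<longrightarrow> distinguished C n M (Push C (df X 0) \<omega>))"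
  using cone_left AO SO CO xtD(1)[OF \<omega>] morD(1)[OF B(1)] dX' Y unfolding EA2_def by blast
 then obtain f where f: "f (n + 1) = iC" and cone: "\<forall>M. is_mapping_cone C n X Y f M \<longrightarrow> distinguished C n M (Push C (df X 0) \<omega>)"
  by (elim exE conjE)
 obtain M where M: "is_mapping_cone C n X Y f M" using mapping_cone_exists[OF F(1) G(1)] by (rule exE)
 have dM: "distinguished C n M \<zero>\<^bsub>Ext C S (ob X 1)\<^esub>" using mp[OF spec[OF cone] M] unfolding \<omega>z .
 have ends: "ob M 0 = ob X 1" "ob M (n + 1) = S" using M Y(3) by (simp_all add: is_mapping_cone_def)
 obtain pi pi' \<iota> \<iota>' where cn: "is_biproduct C ?C (ob Y n) (ob M n) \<iota> \<iota>' pi pi'"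
   "df M n = iC \<cdot> pi \<oplus>\<^bsub>Hom C (ob M n) S\<^esub> df Y n \<cdot> pi'"
 proof -
  from M obtain i0 i' p p' where
   bp: "\<forall>i\<in>{1..n}. is_biproduct C (ob X (i + 1)) (ob Y i) (ob M i) (i0 i) (i' i) (p i) (p' i)"
   and e: "df M n = f (n + 1) \<cdot> p n \<oplus>\<^bsub>Hom C (ob M n) (ob M (n + 1))\<^esub> df Y n \<cdot> p' n"
   unfolding is_mapping_cone_def by (elim exE conjE)
  show thesis using that[OF bspec[OF bp]] e n_pos unfolding f ends by simp
 qed
 note Bn = is_biproductD[OF cn(1)]
 note H = is_exangle_factor[OF exangle[OF dM], unfolded ends]
 have "Pull C (Id C S) \<zero>\<^bsub>Ext C S (ob X 1)\<^esub> = \<zero>\<^bsub>Ext C S (ob X 1)\<^esub>" by (rule pull_id[OF xt_zero[OF SO morD(3)[OF d0]]])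
 \<comment> \<open>the extension realized by the cone is zero, so the deflation of the cone has a section\<close>
 then obtain t where t: "t \<in> mor C S (ob M n)" "Id C S = df M n \<cdot> t"
  by (rule bexE[OF H(5)[OF mor_Id[OF SO]]])
 note s = mor_comp[OF t(1) Bn(3)] and s' = mor_comp[OF t(1) Bn(4)]
 let ?s = "pi \<cdot> t" and ?s' = "pi' \<cdot> t"
 have Id: "Id C S = iC \<cdot> ?s \<oplus>\<^bsub>Hom C S S\<^esub> df Y n \<cdot> ?s'"
  unfolding t(2) cn(2) comp_add_left[OF t(1) mor_comp[OF Bn(3) B(1)] mor_comp[OF Bn(4) dY]]
   comp_assoc[OF t(1) Bn(3) B(1)] comp_assoc[OF t(1) Bn(4) dY] ..
 have "\<omega> = Pull C (iC \<cdot> ?s \<oplus>\<^bsub>Hom C S S\<^esub> df Y n \<cdot> ?s') \<omega>" unfolding Id[symmetric] pull_id[OF \<omega>] ..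
 also have "\<dots> = Pull C (iC \<cdot> ?s) \<omega> \<oplus>\<^bsub>Ext C S ?A\<^esub> Pull C (df Y n \<cdot> ?s') \<omega>"
  by (rule add_pull[OF mor_comp[OF s B(1)] mor_comp[OF s' dY] \<omega>])
 also have "\<dots> = Pull C ?s \<nu> \<oplus>\<^bsub>Ext C S ?A\<^esub> Pull C ?s' (Pull C (df Y n) \<omega>)"
  unfolding pull_comp[OF B(1) s \<omega>] pull_comp[OF dY s' \<omega>] \<omega>1 ..
 also have "\<dots> = Pull C ?s \<nu>"
  unfolding G(4)[unfolded Y(2)] pz[OF s' AO] by (rule zero_ext(1)[OF xt_Pull[OF s \<nu>]])
 finally have "\<omega> = Pull C ?s \<nu>" .
 then have "\<delta> = Pull C iD (Pull C ?s \<nu>)" using \<omega>2 by simp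
 also have "\<dots> = Pull C (?s \<cdot> iD) \<nu>" by (rule pull_comp[OF s B(2) \<nu>, symmetric])
 finally show ?thesis using mor_comp[OF B(2) s] by (intro bexI[of _ "?s \<cdot> iD"]) simp_all
qed

text \<open>In a realization of \<open>\<xi> \<noteq> 0\<close> the inflation does not split, hence it kills \<open>\<delta>\<close>, and \<open>push_exact\<close> applies.\<close>

lemma almost_split_socle:
 assumes a: "almost_split C U A \<delta>" and \<xi>: "\<xi> \<in> xt C X A" and nz: "\<xi> \<noteq> \<zero>\<^bsub>Ext C X A\<^esub>"
 shows "\<exists>c\<in>mor C U X. Pull C c \<xi> = \<delta>"
proof -
 note S = almost_splitD[OF a]
 obtain Z where Z: "distinguished C n Z \<xi>" "ob Z 0 = A" "ob Z (n + 1) = X" using realization[OF \<xi>] by (elim exE conjE)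
 note F = is_exangle_factor[OF exangle[OF Z(1)], unfolded Z(2,3)]
 have d: "df Z 0 \<in> mor C A (ob Z 1)" using is_complexD(4)[OF F(1), of 0] Z(2) by simp
 have ns: "\<not> split_mono C A (ob Z 1) (df Z 0)" using split_push_nonzero[OF _ morD(3)[OF d] \<xi> F(3)] nz by blast
 have \<delta>: "\<delta> \<in> xt C U (ob Z 0)" unfolding Z(2) by (rule S(1))
 show ?thesis using push_exact[OF Z(1) \<delta> S(3)[OF d ns]] unfolding Z(3) .
qed

end

lemma (in artinian_ecat) almost_split_serre:
 assumes R: "realized_bifunctor C n" and a: "almost_split C U A \<delta>"
 shows "\<exists>\<eta>. serre k J C U A \<eta>"
proof -
 interpret R: realized_bifunctor C n by (rule R)
 interpret op: realized_bifunctor "opposite C" n by (rule R.opposite_realized_bifunctor)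
 note S = almost_splitD[OF a]
 show ?thesis
  by (rule socle_serre[OF S(1,2)])
   (rule op.almost_split_socle[unfolded almost_split_opposite xt_opposite opposite_simps mor_opposite, OF a]
    R.almost_split_socle[OF a]; assumption)+
qed

section \<open>The radical of a Krull-Schmidt category\<close>

context abelian_group
begin

lemma diff_diff_cancel: "x \<in> carrier G \<Longrightarrow> y \<in> carrier G \<Longrightarrow> x \<ominus> (x \<ominus> y) = y"
 by (rule eq_diff_iff[THEN iffD2, symmetric]) (simp_all add: a_comm[of y] diff_add_cancel)

lemma diff_swap:
 assumes "x \<in> carrier G" "y \<in> carrier G" "z \<in> carrier G" "x \<ominus> y = z"
 shows "y = x \<ominus> z"
 using assms diff_diff_cancel[of x y] by simp

lemma diff_of_sum:
 "x \<in> carrier G \<Longrightarrow> y \<in> carrier G \<Longrightarrow> z \<in> carrier G \<Longrightarrow> x \<ominus> (y \<oplus> z) = (x \<ominus> y) \<ominus> z"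
 by (simp add: a_minus_def minus_add a_assoc)

lemma diff_telescope:
 assumes "x \<in> carrier G" "y \<in> carrier G" "z \<in> carrier G"
 shows "(x \<ominus> y) \<oplus> (y \<ominus> z) = x \<ominus> z"
proof -
 have "(x \<ominus> y) \<oplus> (y \<ominus> z) = ((x \<ominus> y) \<oplus> y) \<ominus> z" using assms by (simp add: a_minus_def a_assoc)
 then show ?thesis using assms by (simp add: diff_add_cancel)
qed

lemma diff_minus_self: "x \<in> carrier G \<Longrightarrow> y \<in> carrier G \<Longrightarrow> (x \<ominus> y) \<ominus> x = \<zero> \<ominus> y"
 by (simp add: a_minus_def a_comm[of x] a_assoc r_neg)

lemma add_interchange:
 "a \<in> carrier G \<Longrightarrow> b \<in> carrier G \<Longrightarrow> c \<in> carrier G \<Longrightarrow> d \<in> carrier G \<Longrightarrow>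
  (a \<oplus> b) \<oplus> (c \<oplus> d) = (a \<oplus> c) \<oplus> (b \<oplus> d)"
 by (simp add: a_ac)

end

context preadditive_category
begin

lemma iso_comp:
 assumes f: "iso_arr C A A f" and g: "iso_arr C A A g" and A: "A \<in> Obj C"
 shows "iso_arr C A A (g \<cdot> f)"
proof -
 obtain f' where f': "f \<in> mor C A A" "f' \<in> mor C A A" "f' \<cdot> f = Id C A" "f \<cdot> f' = Id C A" using iso_arrE[OF f A A] by (elim exE conjE)
 obtain g' where g': "g \<in> mor C A A" "g' \<in> mor C A A" "g' \<cdot> g = Id C A" "g \<cdot> g' = Id C A" using iso_arrE[OF g A A] by (elim exE conjE)
 note gf = mor_comp[OF f'(1) g'(1)]
 show ?thesis
 proof (rule iso_arrI[OF gf mor_comp[OF g'(2) f'(2)]])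
  show "(f' \<cdot> g') \<cdot> (g \<cdot> f) = Id C A"
   unfolding comp_assoc[OF gf g'(2) f'(2)] comp_assoc[OF f'(1) g'(1) g'(2), symmetric] g'(3) id_left[OF f'(1)] f'(3) ..
  show "(g \<cdot> f) \<cdot> (f' \<cdot> g') = Id C A"
   unfolding comp_assoc[OF mor_comp[OF g'(2) f'(2)] f'(1) g'(1)] comp_assoc[OF g'(2) f'(2) f'(1), symmetric] f'(4) id_left[OF g'(2)] g'(4) ..
 qed
qed

lemma Units_End_ring: "Units (End_ring C A) = {f. iso_arr C A A f}"
 by (auto simp: Units_def End_ring_def iso_arr_def)

lemma radI:
 assumes f: "f \<in> mor C A B" and i: "\<And>g. g \<in> mor C B A \<Longrightarrow> iso_arr C A A (Id C A \<ominus>\<^bsub>Hom C A A\<^esub> g \<cdot> f)"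
 shows "f \<in> rad C A B"
 unfolding rad_def Units_End_ring using morD(1)[OF f] i morI[OF _ morD(3,2)[OF f]] by simp

lemma radD:
 assumes f: "f \<in> rad C A B" and g: "g \<in> mor C B A"
 shows "f \<in> mor C A B" "iso_arr C A A (Id C A \<ominus>\<^bsub>Hom C A A\<^esub> g \<cdot> f)"
 using f morD[OF g] morI unfolding rad_def Units_End_ring by auto

lemma radD_mor: "f \<in> rad C A B \<Longrightarrow> A \<in> Obj C \<Longrightarrow> B \<in> Obj C \<Longrightarrow> f \<in> mor C A B"
 by (rule radD(1)[OF _ mor_zero])

lemma rad_comp_left:
 assumes f: "f \<in> rad C A B" and A: "A \<in> Obj C" and h: "h \<in> mor C B D"
 shows "h \<cdot> f \<in> rad C A D"
proof (rule radI)
 note fm = radD_mor[OF f A morD(2)[OF h]]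
 show "h \<cdot> f \<in> mor C A D" by (rule mor_comp[OF fm h])
 fix g assume g: "g \<in> mor C D A"
 show "iso_arr C A A (Id C A \<ominus>\<^bsub>Hom C A A\<^esub> g \<cdot> (h \<cdot> f))"
  using radD(2)[OF f mor_comp[OF h g]] unfolding comp_assoc[OF fm h g] .
qed

text \<open>Jacobson's identity: an inverse \<open>u\<close> of \<open>1 - yx\<close> yields the inverse \<open>1 + xuy\<close> of \<open>1 - xy\<close>.\<close>

lemma iso_one_minus_swap:
 assumes x: "x \<in> mor C A B" and y: "y \<in> mor C B A" and i: "iso_arr C A A (Id C A \<ominus>\<^bsub>Hom C A A\<^esub> y \<cdot> x)"
 shows "iso_arr C B B (Id C B \<ominus>\<^bsub>Hom C B B\<^esub> x \<cdot> y)"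
proof -
 note AO = morD(2)[OF x] and BO = morD(3)[OF x]
 note IA = mor_Id[OF AO] and IB = mor_Id[OF BO]
 interpret HA: abelian_group "Hom C A A" by (rule Hom_group[OF AO AO])
 interpret HB: abelian_group "Hom C B B" by (rule Hom_group[OF BO BO])
 note yx = mor_comp[OF x y] and xy = mor_comp[OF y x]
 obtain u where u: "u \<in> mor C A A" "u \<cdot> (Id C A \<ominus>\<^bsub>Hom C A A\<^esub> y \<cdot> x) = Id C A" "(Id C A \<ominus>\<^bsub>Hom C A A\<^esub> y \<cdot> x) \<cdot> u = Id C A"
  using iso_arrE[OF i AO AO] by (elim exE conjE)
 have u1: "(y \<cdot> x) \<cdot> u = u \<ominus>\<^bsub>Hom C A A\<^esub> Id C A"
 proof (rule HA.diff_swap)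
  show "u \<ominus>\<^bsub>Hom C A A\<^esub> (y \<cdot> x) \<cdot> u = Id C A" using u(3) unfolding comp_diff_left[OF u(1) IA yx] id_left[OF u(1)] .
 qed (rule morD(1)[OF u(1)] morD(1)[OF mor_comp[OF u(1) yx]] morD(1)[OF IA])+
 have u2: "u \<cdot> (y \<cdot> x) = u \<ominus>\<^bsub>Hom C A A\<^esub> Id C A"
 proof (rule HA.diff_swap)
  show "u \<ominus>\<^bsub>Hom C A A\<^esub> u \<cdot> (y \<cdot> x) = Id C A" using u(2) unfolding comp_diff_right[OF IA yx u(1)] id_right[OF u(1)] .
 qed (rule morD(1)[OF u(1)] morD(1)[OF mor_comp[OF yx u(1)]] morD(1)[OF IA])+
 let ?w = "x \<cdot> (u \<cdot> y)"
 note uy = mor_comp[OF y u(1)]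
 note w = mor_comp[OF uy x]
 have mid: "x \<cdot> ((u \<ominus>\<^bsub>Hom C A A\<^esub> Id C A) \<cdot> y) = ?w \<ominus>\<^bsub>Hom C B B\<^esub> x \<cdot> y"
  unfolding comp_diff_left[OF y u(1) IA] id_left[OF y] by (rule comp_diff_right[OF uy y x])
 have "(x \<cdot> y) \<cdot> ?w = x \<cdot> (((y \<cdot> x) \<cdot> u) \<cdot> y)"
  unfolding comp_assoc[OF w y x] comp_assoc[OF uy x y, symmetric] comp_assoc[OF y u(1) yx] ..
 then have l: "(x \<cdot> y) \<cdot> ?w = ?w \<ominus>\<^bsub>Hom C B B\<^esub> x \<cdot> y" unfolding u1 mid .
 have "?w \<cdot> (x \<cdot> y) = x \<cdot> ((u \<cdot> (y \<cdot> x)) \<cdot> y)"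
  unfolding comp_assoc[OF xy uy x] comp_assoc[OF xy y u(1)] comp_assoc[OF y x y, symmetric] comp_assoc[OF y yx u(1)] ..
 then have r: "?w \<cdot> (x \<cdot> y) = ?w \<ominus>\<^bsub>Hom C B B\<^esub> x \<cdot> y" unfolding u2 mid .
 note D = mor_diff[OF IB xy]
 show ?thesis
 proof (rule iso_arrI[OF D mor_add[OF IB w]])
  have "(Id C B \<oplus>\<^bsub>Hom C B B\<^esub> ?w) \<cdot> (Id C B \<ominus>\<^bsub>Hom C B B\<^esub> x \<cdot> y)
   = (Id C B \<ominus>\<^bsub>Hom C B B\<^esub> x \<cdot> y) \<oplus>\<^bsub>Hom C B B\<^esub> (?w \<ominus>\<^bsub>Hom C B B\<^esub> ?w \<cdot> (x \<cdot> y))"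
   unfolding comp_add_left[OF D IB w] id_left[OF D] comp_diff_right[OF IB xy w] id_right[OF w] ..
  then show "(Id C B \<oplus>\<^bsub>Hom C B B\<^esub> ?w) \<cdot> (Id C B \<ominus>\<^bsub>Hom C B B\<^esub> x \<cdot> y) = Id C B"
   unfolding r HB.diff_diff_cancel[OF morD(1)[OF w] morD(1)[OF xy]] HB.diff_add_cancel[OF morD(1)[OF IB] morD(1)[OF xy]] .
  have "(Id C B \<ominus>\<^bsub>Hom C B B\<^esub> x \<cdot> y) \<cdot> (Id C B \<oplus>\<^bsub>Hom C B B\<^esub> ?w)
   = (Id C B \<ominus>\<^bsub>Hom C B B\<^esub> x \<cdot> y) \<oplus>\<^bsub>Hom C B B\<^esub> (?w \<ominus>\<^bsub>Hom C B B\<^esub> (x \<cdot> y) \<cdot> ?w)"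
   unfolding comp_add_right[OF IB w D] id_right[OF D] comp_diff_left[OF w IB xy] id_left[OF w] ..
  then show "(Id C B \<ominus>\<^bsub>Hom C B B\<^esub> x \<cdot> y) \<cdot> (Id C B \<oplus>\<^bsub>Hom C B B\<^esub> ?w) = Id C B"
   unfolding l HB.diff_diff_cancel[OF morD(1)[OF w] morD(1)[OF xy]] HB.diff_add_cancel[OF morD(1)[OF IB] morD(1)[OF xy]] .
 qed
qed

lemma rad_comp_right:
 assumes f: "f \<in> rad C A B" and B: "B \<in> Obj C" and h: "h \<in> mor C D A"
 shows "f \<cdot> h \<in> rad C D B"
proof (rule radI)
 note fm = radD_mor[OF f morD(3)[OF h] B]
 show "f \<cdot> h \<in> mor C D B" by (rule mor_comp[OF h fm])
 fix g assume g: "g \<in> mor C B D"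
 have "iso_arr C A A (Id C A \<ominus>\<^bsub>Hom C A A\<^esub> h \<cdot> (g \<cdot> f))"
  using radD(2)[OF f mor_comp[OF g h]] unfolding comp_assoc[OF fm g h] .
 then have "iso_arr C D D (Id C D \<ominus>\<^bsub>Hom C D D\<^esub> (g \<cdot> f) \<cdot> h)" by (rule iso_one_minus_swap[OF mor_comp[OF fm g] h])
 then show "iso_arr C D D (Id C D \<ominus>\<^bsub>Hom C D D\<^esub> g \<cdot> (f \<cdot> h))" unfolding comp_assoc[OF h fm g] .
qed

lemma rad_add:
 assumes f: "f \<in> rad C A B" and f': "f' \<in> rad C A B" and A: "A \<in> Obj C" and B: "B \<in> Obj C"
 shows "f \<oplus>\<^bsub>Hom C A B\<^esub> f' \<in> rad C A B"
proof (rule radI)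
 note fm = radD_mor[OF f A B] and fm' = radD_mor[OF f' A B]
 show "f \<oplus>\<^bsub>Hom C A B\<^esub> f' \<in> mor C A B" by (rule mor_add[OF fm fm'])
 fix g assume g: "g \<in> mor C B A"
 note gf = mor_comp[OF fm g] and gf' = mor_comp[OF fm' g] and Id = mor_Id[OF A]
 interpret H: abelian_group "Hom C A A" by (rule Hom_group[OF A A])
 let ?a = "Id C A \<ominus>\<^bsub>Hom C A A\<^esub> g \<cdot> f"
 note a = mor_diff[OF Id gf]
 obtain a' where a': "a' \<in> mor C A A" "?a \<cdot> a' = Id C A" using iso_arrE[OF radD(2)[OF f g] A A] by (elim exE conjE)
 have "Id C A \<ominus>\<^bsub>Hom C A A\<^esub> g \<cdot> (f \<oplus>\<^bsub>Hom C A B\<^esub> f') = ?a \<ominus>\<^bsub>Hom C A A\<^esub> g \<cdot> f'"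
  unfolding comp_add_right[OF fm fm' g] by (rule H.diff_of_sum[OF morD(1)[OF Id] morD(1)[OF gf] morD(1)[OF gf']])
 also have "\<dots> = ?a \<cdot> Id C A \<ominus>\<^bsub>Hom C A A\<^esub> ?a \<cdot> (a' \<cdot> (g \<cdot> f'))"
  unfolding id_right[OF a] comp_assoc[OF gf' a'(1) a, symmetric] a'(2) id_left[OF gf'] ..
 also have "\<dots> = ?a \<cdot> (Id C A \<ominus>\<^bsub>Hom C A A\<^esub> (a' \<cdot> g) \<cdot> f')"
  unfolding comp_assoc[OF fm' g a'(1)] comp_diff_right[OF Id mor_comp[OF gf' a'(1)] a] ..
 finally have e: "Id C A \<ominus>\<^bsub>Hom C A A\<^esub> g \<cdot> (f \<oplus>\<^bsub>Hom C A B\<^esub> f') = ?a \<cdot> (Id C A \<ominus>\<^bsub>Hom C A A\<^esub> (a' \<cdot> g) \<cdot> f')" .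
 show "iso_arr C A A (Id C A \<ominus>\<^bsub>Hom C A A\<^esub> g \<cdot> (f \<oplus>\<^bsub>Hom C A B\<^esub> f'))"
  unfolding e by (rule iso_comp[OF radD(2)[OF f' mor_comp[OF g a'(1)]] radD(2)[OF f g] A])
qed

lemma rad_zero:
 assumes A: "A \<in> Obj C" and B: "B \<in> Obj C"
 shows "zero_arr C A B \<in> rad C A B"
proof (rule radI[OF mor_zero[OF A B]])
 fix g assume g: "g \<in> mor C B A"
 interpret H: abelian_group "Hom C A A" by (rule Hom_group[OF A A])
 note Id = mor_Id[OF A]
 have "Id C A \<ominus>\<^bsub>Hom C A A\<^esub> g \<cdot> zero_arr C A B = Id C A"
  unfolding comp_zero_right[OF A g] using morD(1)[OF Id] by (simp add: a_minus_def)
 then show "iso_arr C A A (Id C A \<ominus>\<^bsub>Hom C A A\<^esub> g \<cdot> zero_arr C A B)" using iso_arrI[OF Id Id id_left[OF Id] id_left[OF Id]] by simp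
qed

lemma rad_finsum:
 assumes A: "A \<in> Obj C" and B: "B \<in> Obj C" and fin: "finite I" and f: "\<And>j. j \<in> I \<Longrightarrow> f j \<in> rad C A B"
 shows "(\<Oplus>\<^bsub>Hom C A B\<^esub>j\<in>I. f j) \<in> rad C A B"
proof -
 interpret H: abelian_group "Hom C A B" by (rule Hom_group[OF A B])
 from fin f show ?thesis
 proof (induction I rule: finite_induct)
  case empty
  show ?case using rad_zero[OF A B] by simp
 next
  case (insert x F)
  have x: "f x \<in> rad C A B" by (rule insert.prems[OF insertI1])
  have F: "f j \<in> rad C A B" if "j \<in> F" for j using insert.prems that by simp
  have F': "f \<in> F \<rightarrow> arr C A B" by (intro Pi_I morD(1)[OF radD_mor[OF F A B]])
  show ?case unfolding H.finsum_insert[OF insert.hyps F' morD(1)[OF radD_mor[OF x A B]]]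
   by (rule rad_add[OF x insert.IH[OF F] A B])
 qed
qed

text \<open>If \<open>g f\<close> were invertible, then \<open>f k\<close> with \<open>k f = 1\<close> would be an idempotent of the local ring \<open>End B\<close>, so it
would be \<open>1\<close>, which makes \<open>f\<close> invertible, or \<open>0\<close>, which makes \<open>A\<close> zero.\<close>

lemma local_noniso_rad:
 assumes LA: "local_object C A" and LB: "local_object C B" and f: "f \<in> mor C A B" and ni: "\<not> iso_arr C A B f"
 shows "f \<in> rad C A B"
proof (rule radI[OF f])
 fix g assume g: "g \<in> mor C B A"
 note A = local_objectD[OF LA] and B = local_objectD[OF LB]
 note gf = mor_comp[OF f g]
 have "\<not> iso_arr C A A (g \<cdot> f)"
 proof
  assume "iso_arr C A A (g \<cdot> f)"
  then obtain h where h: "h \<in> mor C A A" "h \<cdot> (g \<cdot> f) = Id C A" by (elim exE[OF iso_arrE[OF _ A(1) A(1)]] conjE)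
  let ?k = "h \<cdot> g"
  note k = mor_comp[OF g h(1)]
  have kf: "?k \<cdot> f = Id C A" using comp_assoc[OF f g h(1)] h(2) by simp
  let ?e = "f \<cdot> ?k"
  note e = mor_comp[OF k f] and Id = mor_Id[OF B(1)]
  have ef: "?e \<cdot> f = f" unfolding comp_assoc[OF f k f] kf by (rule id_right[OF f])
  have ee: "?e \<cdot> ?e = ?e" unfolding comp_assoc[OF k f e, symmetric] ef ..
  show False
  proof (cases "iso_arr C B B ?e")
   case True
   then obtain c where c: "c \<in> mor C B B" "c \<cdot> ?e = Id C B" by (elim exE[OF iso_arrE[OF _ B(1) B(1)]] conjE)
   have "?e = Id C B" using comp_assoc[OF e e c(1)] unfolding c(2) ee id_left[OF e] .
   then have "iso_arr C A B f" by (rule iso_arrI[OF f k kf])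
   then show False using ni by simp
  next
   case False
   let ?d = "Id C B \<ominus>\<^bsub>Hom C B B\<^esub> ?e"
   obtain c where c: "c \<in> mor C B B" "c \<cdot> ?d = Id C B" using iso_arrE[OF B(3)[OF e False] B(1) B(1)] by (elim exE conjE)
   note d = mor_diff[OF Id e]
   have "?d \<cdot> f = f \<ominus>\<^bsub>Hom C A B\<^esub> f" unfolding comp_diff_left[OF f Id e] ef id_left[OF f] ..
   then have "?d \<cdot> f = zero_arr C A B" using diff_zero_arr[OF f f] by simp
   then have "f = zero_arr C A B" using comp_assoc[OF f d c(1)] unfolding c(2) id_left[OF f] using comp_zero_right[OF A(1) c(1)] by simp
   then have "Id C A = zero_arr C A A" using kf comp_zero_right[OF A(1) k] by simp
   then show False using A(2) by simp
  qed
 qed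
 then show "iso_arr C A A (Id C A \<ominus>\<^bsub>Hom C A A\<^esub> g \<cdot> f)" by (rule A(3)[OF gf])
qed

text \<open>The radical is an ideal of the category, so a morphism is radical as soon as its matrix entries are.\<close>

lemma rad_entries:
 assumes d: "dsum C A m B i p" and d': "dsum C A' m' B' i' p'" and f: "f \<in> mor C A A'"
  and entries: "\<And>x y. x < m \<Longrightarrow> y < m' \<Longrightarrow> p' y \<cdot> (f \<cdot> i x) \<in> rad C (B x) (B' y)"
 shows "f \<in> rad C A A'"
proof -
 note D = dsumD[OF d] and D' = dsumD[OF d']
 have col: "f \<cdot> i x \<in> rad C (B x) A'" if x: "x < m" for x
 proof -
  note ix = D(2)[OF x]
  note fi = mor_comp[OF ix f]
  have t: "i' y \<cdot> p' y \<in> mor C A' A'" if "y \<in> {..<m'}" for y using that mor_comp[OF D'(3) D'(2)] by simp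
  have "f \<cdot> i x = (\<Oplus>\<^bsub>Hom C A' A'\<^esub>y\<in>{..<m'}. i' y \<cdot> p' y) \<cdot> (f \<cdot> i x)" unfolding D'(6) id_left[OF fi] ..
  also have "\<dots> = (\<Oplus>\<^bsub>Hom C (B x) A'\<^esub>y\<in>{..<m'}. (i' y \<cdot> p' y) \<cdot> (f \<cdot> i x))"
   by (rule comp_finsum_left[OF finite_lessThan D'(1) fi t])
  also have "\<dots> \<in> rad C (B x) A'"
  proof (rule rad_finsum[OF morD(2)[OF ix] D'(1) finite_lessThan])
   fix y assume "y \<in> {..<m'}"
   then have y: "y < m'" by simp
   show "(i' y \<cdot> p' y) \<cdot> (f \<cdot> i x) \<in> rad C (B x) A'"
    unfolding comp_assoc[OF fi D'(3)[OF y] D'(2)[OF y]] by (rule rad_comp_left[OF entries[OF x y] morD(2)[OF ix] D'(2)[OF y]])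
  qed
  finally show ?thesis .
 qed
 have t: "i x \<cdot> p x \<in> mor C A A" if "x \<in> {..<m}" for x using that mor_comp[OF D(3) D(2)] by simp
 have "f = f \<cdot> (\<Oplus>\<^bsub>Hom C A A\<^esub>x\<in>{..<m}. i x \<cdot> p x)" unfolding D(6) id_right[OF f] ..
 also have "\<dots> = (\<Oplus>\<^bsub>Hom C A A'\<^esub>x\<in>{..<m}. f \<cdot> (i x \<cdot> p x))"
  by (rule comp_finsum_right[OF finite_lessThan D(1) f t])
 also have "\<dots> \<in> rad C A A'"
 proof (rule rad_finsum[OF D(1) D'(1) finite_lessThan])
  fix x assume "x \<in> {..<m}"
  then have x: "x < m" by simp
  show "f \<cdot> (i x \<cdot> p x) \<in> rad C A A'"
   unfolding comp_assoc[OF D(3)[OF x] D(2)[OF x] f, symmetric] by (rule rad_comp_right[OF col[OF x] D'(1) D(3)[OF x]])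
 qed
 finally show ?thesis .
qed

end

section \<open>Homotopy classes of complexes\<close>

lemma chain_mapD:
 assumes "chain_map C n X Y f" "is_complex C n X" "is_complex C n Y"
 shows "j \<le> n + 1 \<Longrightarrow> f j \<in> mor C (ob X j) (ob Y j)"
  and "j \<le> n \<Longrightarrow> f (j + 1) \<cdot>\<^bsub>C\<^esub> df X j = df Y j \<cdot>\<^bsub>C\<^esub> f j"
 using assms by (simp_all add: chain_map_def is_complex_def mor_def)

lemma chain_mapI:
 assumes "\<And>j. j \<le> n + 1 \<Longrightarrow> f j \<in> mor C (ob X j) (ob Y j)"
  and "\<And>j. j \<le> n \<Longrightarrow> f (j + 1) \<cdot>\<^bsub>C\<^esub> df X j = df Y j \<cdot>\<^bsub>C\<^esub> f j"
 shows "chain_map C n X Y f"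
 unfolding chain_map_def using assms by (simp add: morD)

lemma homotopic_cong:
 assumes "\<And>j. j \<le> n + 1 \<Longrightarrow> f j = f' j" "homotopic C n X Y f g"
 shows "homotopic C n X Y f' g"
proof -
 obtain \<phi> where \<phi>: "\<forall>i\<in>{1..n+1}. \<phi> i \<in> arr C (ob X i) (ob Y (i-1))"
  "f 0 \<ominus>\<^bsub>Hom C (ob X 0) (ob Y 0)\<^esub> g 0 = \<phi> 1 \<cdot>\<^bsub>C\<^esub> df X 0"
  "\<forall>i\<in>{1..n}. f i \<ominus>\<^bsub>Hom C (ob X i) (ob Y i)\<^esub> g i = df Y (i-1) \<cdot>\<^bsub>C\<^esub> \<phi> i \<oplus>\<^bsub>Hom C (ob X i) (ob Y i)\<^esub> \<phi> (i+1) \<cdot>\<^bsub>C\<^esub> df X i"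
  "f (n+1) \<ominus>\<^bsub>Hom C (ob X (n+1)) (ob Y (n+1))\<^esub> g (n+1) = df Y n \<cdot>\<^bsub>C\<^esub> \<phi> (n+1)"
  using assms(2) unfolding homotopic_def by (elim exE conjE)
 have e: "f' 0 = f 0" "f' (n + 1) = f (n + 1)" "\<And>i. i \<in> {1..n} \<Longrightarrow> f' i = f i" using assms(1) by simp_all
 show ?thesis unfolding homotopic_def e using \<phi> e(3) by (intro exI[of _ \<phi>] conjI) simp_all
qed

context preadditive_category
begin

lemma homotopicI:
 assumes "\<And>i. 1 \<le> i \<Longrightarrow> i \<le> n + 1 \<Longrightarrow> \<phi> i \<in> mor C (ob X i) (ob Y (i - 1))"
  and "f 0 \<ominus>\<^bsub>Hom C (ob X 0) (ob Y 0)\<^esub> g 0 = \<phi> 1 \<cdot> df X 0"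
  and "\<And>i. 1 \<le> i \<Longrightarrow> i \<le> n \<Longrightarrow> f i \<ominus>\<^bsub>Hom C (ob X i) (ob Y i)\<^esub> g i =
      df Y (i - 1) \<cdot> \<phi> i \<oplus>\<^bsub>Hom C (ob X i) (ob Y i)\<^esub> \<phi> (i + 1) \<cdot> df X i"
  and "f (n + 1) \<ominus>\<^bsub>Hom C (ob X (n + 1)) (ob Y (n + 1))\<^esub> g (n + 1) = df Y n \<cdot> \<phi> (n + 1)"
 shows "homotopic C n X Y f g"
 unfolding homotopic_def using assms by (intro exI[of _ \<phi>] conjI ballI) (simp_all add: mor_def)

lemma homotopic_Id:
 assumes X: "is_complex C n X" and f: "\<And>j. j \<le> n + 1 \<Longrightarrow> f j = Id C (ob X j)"
 shows "homotopic C n X X f (\<lambda>j. Id C (ob X j))"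
proof (rule homotopicI[of _ "\<lambda>j. zero_arr C (ob X j) (ob X (j - 1))"])
 note XD = is_complexD[OF X]
 have self: "Id C A \<ominus>\<^bsub>Hom C A A\<^esub> Id C A = zero_arr C A A" if "A \<in> Obj C" for A
  using diff_zero_arr[OF mor_Id[OF that] mor_Id[OF that]] by simp
 show "zero_arr C (ob X i) (ob X (i - 1)) \<in> mor C (ob X i) (ob X (i - 1))" if "1 \<le> i" "i \<le> n + 1" for i
  by (rule mor_zero; rule XD(3)) (use that in simp_all)
 show "f 0 \<ominus>\<^bsub>Hom C (ob X 0) (ob X 0)\<^esub> Id C (ob X 0) = zero_arr C (ob X 1) (ob X (1 - 1)) \<cdot> df X 0"
  using self[OF XD(3)[of 0]] f[of 0] comp_zero_left[OF XD(4)[of 0] XD(3)[of 0]] by simp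
 show "f (n + 1) \<ominus>\<^bsub>Hom C (ob X (n + 1)) (ob X (n + 1))\<^esub> Id C (ob X (n + 1)) = df X n \<cdot> zero_arr C (ob X (n + 1)) (ob X (n + 1 - 1))"
  using self[OF XD(3)[of "n + 1"]] f[of "n + 1"] comp_zero_right[OF XD(3)[of "n + 1"] XD(4)[of n]] by simp
 fix i assume i: "1 \<le> i" "i \<le> n"
 have o: "ob X i \<in> Obj C" using XD(3) i by simp
 have d: "df X (i - 1) \<in> mor C (ob X (i - 1)) (ob X i)" "df X i \<in> mor C (ob X i) (ob X (i + 1))"
  using XD(4)[of "i - 1"] XD(4)[of i] i by simp_all
 interpret H: abelian_group "Hom C (ob X i) (ob X i)" by (rule Hom_group[OF o o])
 have "i + 1 - 1 = i" by simp
 then show "f i \<ominus>\<^bsub>Hom C (ob X i) (ob X i)\<^esub> Id C (ob X i) = df X (i - 1) \<cdot> zero_arr C (ob X i) (ob X (i - 1))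
   \<oplus>\<^bsub>Hom C (ob X i) (ob X i)\<^esub> zero_arr C (ob X (i + 1)) (ob X (i + 1 - 1)) \<cdot> df X i"
  using self[OF o] f[of i] i comp_zero_right[OF o d(1)] comp_zero_left[OF d(2) o] by simp
qed

text \<open>If \<open>\<psi>\<close> is a homotopy from \<open>h\<close> to the identity of \<open>Y\<close> and \<open>\<phi>\<close> one from \<open>g f\<close> to the identity of \<open>X\<close>, then
\<open>g \<psi> f + \<phi>\<close> is a homotopy from \<open>g h f\<close> to the identity of \<open>X\<close>.\<close>

lemma homotopic_conjugate:
 assumes X: "is_complex C n X" and Y: "is_complex C n Y"
  and f: "chain_map C n X Y f" and g: "chain_map C n Y X g"
  and h: "\<And>j. j \<le> n + 1 \<Longrightarrow> h j \<in> mor C (ob Y j) (ob Y j)"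
  and hY: "homotopic C n Y Y h (\<lambda>j. Id C (ob Y j))"
  and hX: "homotopic C n X X (\<lambda>j. g j \<cdot> f j) (\<lambda>j. Id C (ob X j))"
 shows "homotopic C n X X (\<lambda>j. g j \<cdot> (h j \<cdot> f j)) (\<lambda>j. Id C (ob X j))"
proof -
 note XD = is_complexD[OF X] and YD = is_complexD[OF Y] and F = chain_mapD[OF f X Y] and G = chain_mapD[OF g Y X]
 obtain \<psi> where \<psi>': "\<forall>i\<in>{1..n+1}. \<psi> i \<in> arr C (ob Y i) (ob Y (i-1))"
  and \<psi>0: "h 0 \<ominus>\<^bsub>Hom C (ob Y 0) (ob Y 0)\<^esub> Id C (ob Y 0) = \<psi> 1 \<cdot> df Y 0"
  and \<psi>i: "\<forall>i\<in>{1..n}. h i \<ominus>\<^bsub>Hom C (ob Y i) (ob Y i)\<^esub> Id C (ob Y i) = df Y (i-1) \<cdot> \<psi> i \<oplus>\<^bsub>Hom C (ob Y i) (ob Y i)\<^esub> \<psi> (i+1) \<cdot> df Y i"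
  and \<psi>n: "h (n+1) \<ominus>\<^bsub>Hom C (ob Y (n+1)) (ob Y (n+1))\<^esub> Id C (ob Y (n+1)) = df Y n \<cdot> \<psi> (n+1)"
  using hY unfolding homotopic_def by (elim exE conjE)
 obtain \<phi> where \<phi>': "\<forall>i\<in>{1..n+1}. \<phi> i \<in> arr C (ob X i) (ob X (i-1))"
  and \<phi>0: "g 0 \<cdot> f 0 \<ominus>\<^bsub>Hom C (ob X 0) (ob X 0)\<^esub> Id C (ob X 0) = \<phi> 1 \<cdot> df X 0"
  and \<phi>i: "\<forall>i\<in>{1..n}. g i \<cdot> f i \<ominus>\<^bsub>Hom C (ob X i) (ob X i)\<^esub> Id C (ob X i) = df X (i-1) \<cdot> \<phi> i \<oplus>\<^bsub>Hom C (ob X i) (ob X i)\<^esub> \<phi> (i+1) \<cdot> df X i"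
  and \<phi>n: "g (n+1) \<cdot> f (n+1) \<ominus>\<^bsub>Hom C (ob X (n+1)) (ob X (n+1))\<^esub> Id C (ob X (n+1)) = df X n \<cdot> \<phi> (n+1)"
  using hX unfolding homotopic_def by (elim exE conjE)
 have \<psi>: "\<psi> (j + 1) \<in> mor C (ob Y (j + 1)) (ob Y j)" if "j \<le> n" for j
  using bspec[OF \<psi>', of "j + 1"] that YD(3)[of j] YD(3)[of "j + 1"] by (simp add: mor_def)
 have \<phi>: "\<phi> (j + 1) \<in> mor C (ob X (j + 1)) (ob X j)" if "j \<le> n" for j
  using bspec[OF \<phi>', of "j + 1"] that XD(3)[of j] XD(3)[of "j + 1"] by (simp add: mor_def)
 let ?k = "\<lambda>j. g j \<cdot> (\<psi> (j + 1) \<cdot> f (j + 1))"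
 have km: "?k j \<in> mor C (ob X (j + 1)) (ob X j)" if j: "j \<le> n" for j
  using mor_comp[OF mor_comp[OF F(1) \<psi>[OF j]] G(1)] j by simp
 have expand: "g j \<cdot> (h j \<cdot> f j) \<ominus>\<^bsub>Hom C (ob X j) (ob X j)\<^esub> Id C (ob X j)
  = g j \<cdot> ((h j \<ominus>\<^bsub>Hom C (ob Y j) (ob Y j)\<^esub> Id C (ob Y j)) \<cdot> f j) \<oplus>\<^bsub>Hom C (ob X j) (ob X j)\<^esub>
   (g j \<cdot> f j \<ominus>\<^bsub>Hom C (ob X j) (ob X j)\<^esub> Id C (ob X j))" if j: "j \<le> n + 1" for j
 proof -
  note fj = F(1)[OF j] and gj = G(1)[OF j] and hj = h[OF j]
  note hf = mor_comp[OF fj hj]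
  interpret H: abelian_group "Hom C (ob X j) (ob X j)" by (rule Hom_group[OF XD(3)[OF j] XD(3)[OF j]])
  have "g j \<cdot> ((h j \<ominus>\<^bsub>Hom C (ob Y j) (ob Y j)\<^esub> Id C (ob Y j)) \<cdot> f j) = g j \<cdot> (h j \<cdot> f j) \<ominus>\<^bsub>Hom C (ob X j) (ob X j)\<^esub> g j \<cdot> f j"
   unfolding comp_diff_left[OF fj hj mor_Id[OF YD(3)[OF j]]] id_left[OF fj] by (rule comp_diff_right[OF hf fj gj])
  then show ?thesis
   using H.diff_telescope[OF morD(1)[OF mor_comp[OF hf gj]] morD(1)[OF mor_comp[OF fj gj]] morD(1)[OF mor_Id[OF XD(3)[OF j]]]] by simp
 qed
 have T1: "g j \<cdot> ((\<psi> (j + 1) \<cdot> df Y j) \<cdot> f j) = ?k j \<cdot> df X j" if j: "j \<le> n" for j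
 proof -
  have j': "j \<le> n + 1" "j + 1 \<le> n + 1" using j by simp_all
  note fj = F(1)[OF j'(1)] and gj = G(1)[OF j'(1)] and fs = F(1)[OF j'(2)] and \<psi>j = \<psi>[OF j] and dX = XD(4)[OF j] and dY = YD(4)[OF j]
  show ?thesis
   unfolding comp_assoc[OF fj dY \<psi>j] F(2)[OF j, symmetric] comp_assoc[OF dX fs \<psi>j, symmetric]
    comp_assoc[OF dX mor_comp[OF fs \<psi>j] gj] ..
 qed
 have T2: "g (j + 1) \<cdot> ((df Y j \<cdot> \<psi> (j + 1)) \<cdot> f (j + 1)) = df X j \<cdot> ?k j" if j: "j \<le> n" for j
 proof -
  have j': "j \<le> n + 1" "j + 1 \<le> n + 1" using j by simp_all
  note gj = G(1)[OF j'(1)] and gs = G(1)[OF j'(2)] and fs = F(1)[OF j'(2)] and \<psi>j = \<psi>[OF j] and dX = XD(4)[OF j] and dY = YD(4)[OF j]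
  note pf = mor_comp[OF fs \<psi>j]
  show ?thesis
   unfolding comp_assoc[OF fs \<psi>j dY] comp_assoc[OF pf dY gs, symmetric] G(2)[OF j] comp_assoc[OF pf gj dX] ..
 qed
 let ?\<theta> = "\<lambda>j. ?k (j - 1) \<oplus>\<^bsub>Hom C (ob X j) (ob X (j - 1))\<^esub> \<phi> j"
 show ?thesis
 proof (rule homotopicI[of _ ?\<theta>])
  fix i assume i: "1 \<le> i" "i \<le> n + 1"
  then obtain j where j: "i = j + 1" "j \<le> n" by (metis add_le_cancel_right le_add_diff_inverse2)
  show "?\<theta> i \<in> mor C (ob X i) (ob X (i - 1))" using mor_add[OF km[OF j(2)] \<phi>[OF j(2)]] unfolding j(1) by simp
 next
  note d0 = XD(4)[OF le0, unfolded add_0] and k0 = km[OF le0, unfolded add_0] and p0 = \<phi>[OF le0, unfolded add_0]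
  show "g 0 \<cdot> (h 0 \<cdot> f 0) \<ominus>\<^bsub>Hom C (ob X 0) (ob X 0)\<^esub> Id C (ob X 0) = ?\<theta> 1 \<cdot> df X 0"
   using comp_add_left[OF d0 k0 p0] expand[OF le0] \<psi>0 \<phi>0 T1[OF le0, unfolded add_0] by simp
 next
  have e: "?\<theta> (n + 1) = ?k n \<oplus>\<^bsub>Hom C (ob X (n + 1)) (ob X n)\<^esub> \<phi> (n + 1)" by simp
  show "g (n + 1) \<cdot> (h (n + 1) \<cdot> f (n + 1)) \<ominus>\<^bsub>Hom C (ob X (n + 1)) (ob X (n + 1))\<^esub> Id C (ob X (n + 1)) = df X n \<cdot> ?\<theta> (n + 1)"
   unfolding e comp_add_right[OF km[OF order_refl] \<phi>[OF order_refl] XD(4)[OF order_refl]] expand[OF order_refl] \<psi>n \<phi>n T2[OF order_refl] ..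
 next
  fix i assume i: "1 \<le> i" "i \<le> n"
  have "i = Suc (i - 1)" using i by simp
  then obtain j where j: "i = j + 1" by (metis Suc_eq_plus1)
  have jn: "j \<le> n" "j + 1 \<le> n" "j + 1 \<le> n + 1" "j + 1 \<in> {1..n}" "j + 1 - 1 = j" "j + 1 + 1 - 1 = j + 1" using i j by simp_all
  let ?H = "Hom C (ob X (j + 1)) (ob X (j + 1))" and ?HY = "Hom C (ob Y (j + 1)) (ob Y (j + 1))"
  note o = XD(3)[OF jn(3)]
  interpret H: abelian_group ?H by (rule Hom_group[OF o o])
  note fj = F(1)[OF jn(3)] and gj = G(1)[OF jn(3)]
  note y1 = mor_comp[OF \<psi>[OF jn(1)] YD(4)[OF jn(1)]] and y2 = mor_comp[OF YD(4)[OF jn(2)] \<psi>[OF jn(2)]]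
  note x1 = mor_comp[OF \<phi>[OF jn(1)] XD(4)[OF jn(1)]] and x2 = mor_comp[OF XD(4)[OF jn(2)] \<phi>[OF jn(2)]]
  note k1 = mor_comp[OF km[OF jn(1)] XD(4)[OF jn(1)]] and k2 = mor_comp[OF XD(4)[OF jn(2)] km[OF jn(2)]]
  have "g (j + 1) \<cdot> ((h (j + 1) \<ominus>\<^bsub>?HY\<^esub> Id C (ob Y (j + 1))) \<cdot> f (j + 1))
   = g (j + 1) \<cdot> ((df Y j \<cdot> \<psi> (j + 1)) \<cdot> f (j + 1)) \<oplus>\<^bsub>?H\<^esub> g (j + 1) \<cdot> ((\<psi> (j + 1 + 1) \<cdot> df Y (j + 1)) \<cdot> f (j + 1))"
   unfolding bspec[OF \<psi>i jn(4), unfolded jn(5)] comp_add_left[OF fj y1 y2]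
   by (rule comp_add_right[OF mor_comp[OF fj y1] mor_comp[OF fj y2] gj])
  also have "\<dots> = df X j \<cdot> ?k j \<oplus>\<^bsub>?H\<^esub> ?k (j + 1) \<cdot> df X (j + 1)" unfolding T1[OF jn(2)] T2[OF jn(1)] ..
  finally have "g (j + 1) \<cdot> (h (j + 1) \<cdot> f (j + 1)) \<ominus>\<^bsub>?H\<^esub> Id C (ob X (j + 1))
   = (df X j \<cdot> ?k j \<oplus>\<^bsub>?H\<^esub> ?k (j + 1) \<cdot> df X (j + 1)) \<oplus>\<^bsub>?H\<^esub> (df X j \<cdot> \<phi> (j + 1) \<oplus>\<^bsub>?H\<^esub> \<phi> (j + 1 + 1) \<cdot> df X (j + 1))"
   unfolding expand[OF jn(3)] bspec[OF \<phi>i jn(4), unfolded jn(5)] by (rule arg_cong2[where f = "add ?H"]) (rule refl)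
  also have "\<dots> = (df X j \<cdot> ?k j \<oplus>\<^bsub>?H\<^esub> df X j \<cdot> \<phi> (j + 1)) \<oplus>\<^bsub>?H\<^esub> (?k (j + 1) \<cdot> df X (j + 1) \<oplus>\<^bsub>?H\<^esub> \<phi> (j + 1 + 1) \<cdot> df X (j + 1))"
   by (rule H.add_interchange) (rule morD(1)[OF k1] morD(1)[OF k2] morD(1)[OF x1] morD(1)[OF x2])+
  finally show "g i \<cdot> (h i \<cdot> f i) \<ominus>\<^bsub>Hom C (ob X i) (ob X i)\<^esub> Id C (ob X i)
   = df X (i - 1) \<cdot> ?\<theta> i \<oplus>\<^bsub>Hom C (ob X i) (ob X i)\<^esub> ?\<theta> (i + 1) \<cdot> df X i"
   unfolding j jn(5,6) comp_add_right[OF km[OF jn(1)] \<phi>[OF jn(1)] XD(4)[OF jn(1)]]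
    comp_add_left[OF XD(4)[OF jn(2)] km[OF jn(2)] \<phi>[OF jn(2)]] .
 qed
qed

lemma chain_map_comp:
 assumes X: "is_complex C n X" and Y: "is_complex C n Y" and Z: "is_complex C n Z"
  and f: "chain_map C n X Y f" and g: "chain_map C n Y Z g"
 shows "chain_map C n X Z (\<lambda>j. g j \<cdot> f j)"
proof (rule chain_mapI)
 note F = chain_mapD[OF f X Y] and G = chain_mapD[OF g Y Z] and XD = is_complexD[OF X] and YD = is_complexD[OF Y] and ZD = is_complexD[OF Z]
 show "g j \<cdot> f j \<in> mor C (ob X j) (ob Z j)" if "j \<le> n + 1" for j by (rule mor_comp[OF F(1)[OF that] G(1)[OF that]])
 fix j assume j: "j \<le> n"
 then have j': "j \<le> n + 1" "j + 1 \<le> n + 1" by simp_all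
 show "(g (j + 1) \<cdot> f (j + 1)) \<cdot> df X j = df Z j \<cdot> (g j \<cdot> f j)"
  unfolding comp_assoc[OF XD(4)[OF j] F(1)[OF j'(2)] G(1)[OF j'(2)]] F(2)[OF j]
   comp_assoc[OF F(1)[OF j'(1)] YD(4)[OF j] G(1)[OF j'(2)], symmetric] G(2)[OF j]
   comp_assoc[OF F(1)[OF j'(1)] G(1)[OF j'(1)] ZD(4)[OF j]] ..
qed

lemma homotopy_class_refl:
 assumes X: "is_complex C n X"
 shows "X \<in> homotopy_class C n X"
proof -
 note XD = is_complexD[OF X]
 have c: "end_fixing_map C n X X (\<lambda>j. Id C (ob X j))"
  unfolding end_fixing_map_def
 proof (intro conjI chain_mapI)
  show "Id C (ob X j) \<in> mor C (ob X j) (ob X j)" if "j \<le> n + 1" for j by (rule mor_Id[OF XD(3)[OF that]])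
  show "Id C (ob X (j + 1)) \<cdot> df X j = df X j \<cdot> Id C (ob X j)" if "j \<le> n" for j
   unfolding id_left[OF XD(4)[OF that]] id_right[OF XD(4)[OF that]] ..
 qed simp_all
 have "homotopic C n X X (\<lambda>j. Id C (ob X j) \<cdot> Id C (ob X j)) (\<lambda>j. Id C (ob X j))"
  by (rule homotopic_Id[OF X id_left[OF mor_Id[OF XD(3)]]])
 then show ?thesis unfolding homotopy_class_def using X c by blast
qed

lemma homotopy_class_trans:
 assumes X: "is_complex C n X" and Y: "Y \<in> homotopy_class C n X" and Z: "Z \<in> homotopy_class C n Y"
 shows "Z \<in> homotopy_class C n X"
proof -
 have cY: "is_complex C n Y" and eY: "ob Y 0 = ob X 0" "ob Y (n+1) = ob X (n+1)" using Y by (simp_all add: homotopy_class_def)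
 have cZ: "is_complex C n Z" and eZ: "ob Z 0 = ob Y 0" "ob Z (n+1) = ob Y (n+1)" using Z by (simp_all add: homotopy_class_def)
 obtain f g where f: "end_fixing_map C n X Y f" and g: "end_fixing_map C n Y X g"
  and gf: "homotopic C n X X (\<lambda>i. g i \<cdot> f i) (\<lambda>i. Id C (ob X i))"
  and fg: "homotopic C n Y Y (\<lambda>i. f i \<cdot> g i) (\<lambda>i. Id C (ob Y i))"
  using Y unfolding homotopy_class_def mem_Collect_eq by (elim exE conjE)
 obtain f' g' where f': "end_fixing_map C n Y Z f'" and g': "end_fixing_map C n Z Y g'"
  and gf': "homotopic C n Y Y (\<lambda>i. g' i \<cdot> f' i) (\<lambda>i. Id C (ob Y i))"
  and fg': "homotopic C n Z Z (\<lambda>i. f' i \<cdot> g' i) (\<lambda>i. Id C (ob Z i))"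
  using Z unfolding homotopy_class_def mem_Collect_eq by (elim exE conjE)
 have c: "chain_map C n X Y f" "chain_map C n Y X g" "chain_map C n Y Z f'" "chain_map C n Z Y g'"
  using f g f' g' by (simp_all add: end_fixing_map_def)
 note F = chain_mapD(1)[OF c(1) X cY] and G = chain_mapD(1)[OF c(2) cY X] and F' = chain_mapD(1)[OF c(3) cY cZ] and G' = chain_mapD(1)[OF c(4) cZ cY]
 have I: "Id C (ob X 0) \<cdot> Id C (ob X 0) = Id C (ob X 0)" "Id C (ob X (n+1)) \<cdot> Id C (ob X (n+1)) = Id C (ob X (n+1))"
  using id_left[OF mor_Id] is_complexD(3)[OF X] by simp_all
 have e1: "end_fixing_map C n X Z (\<lambda>j. f' j \<cdot> f j)"
  unfolding end_fixing_map_def using chain_map_comp[OF X cY cZ c(1,3)] f f' eY I by (simp add: end_fixing_map_def)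
 have e2: "end_fixing_map C n Z X (\<lambda>j. g j \<cdot> g' j)"
  unfolding end_fixing_map_def using chain_map_comp[OF cZ cY X c(4,2)] g g' eY eZ I by (simp add: end_fixing_map_def)
 have h1: "homotopic C n X X (\<lambda>j. (g j \<cdot> g' j) \<cdot> (f' j \<cdot> f j)) (\<lambda>j. Id C (ob X j))"
 proof (rule homotopic_cong)
  show "homotopic C n X X (\<lambda>j. g j \<cdot> ((g' j \<cdot> f' j) \<cdot> f j)) (\<lambda>j. Id C (ob X j))"
   by (rule homotopic_conjugate[OF X cY c(1,2) mor_comp[OF F' G'] gf' gf])
  fix j assume j: "j \<le> n + 1"
  show "g j \<cdot> ((g' j \<cdot> f' j) \<cdot> f j) = (g j \<cdot> g' j) \<cdot> (f' j \<cdot> f j)"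
   unfolding comp_assoc[OF F[OF j] F'[OF j] G'[OF j]] comp_assoc[OF mor_comp[OF F[OF j] F'[OF j]] G'[OF j] G[OF j]] ..
 qed
 have h2: "homotopic C n Z Z (\<lambda>j. (f' j \<cdot> f j) \<cdot> (g j \<cdot> g' j)) (\<lambda>j. Id C (ob Z j))"
 proof (rule homotopic_cong)
  show "homotopic C n Z Z (\<lambda>j. f' j \<cdot> ((f j \<cdot> g j) \<cdot> g' j)) (\<lambda>j. Id C (ob Z j))"
   by (rule homotopic_conjugate[OF cZ cY c(4,3) mor_comp[OF G F] fg fg'])
  fix j assume j: "j \<le> n + 1"
  show "f' j \<cdot> ((f j \<cdot> g j) \<cdot> g' j) = (f' j \<cdot> f j) \<cdot> (g j \<cdot> g' j)"
   unfolding comp_assoc[OF G'[OF j] G[OF j] F[OF j]] comp_assoc[OF mor_comp[OF G'[OF j] G[OF j]] F[OF j] F'[OF j]] ..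
 qed
 show ?thesis unfolding homotopy_class_def mem_Collect_eq
  by (intro conjI cZ exI[of _ "\<lambda>j. f' j \<cdot> f j"] exI[of _ "\<lambda>j. g j \<cdot> g' j"] e1 e2 h1 h2) (simp_all only: eY eZ)
qed

text \<open>A chain endomorphism \<open>G F\<close> that is homotopic to the identity and splits degreewise with \<open>F G = 1\<close>
yields a complex on the objects \<open>Y\<close>, with differentials \<open>F d G\<close>, in the same homotopy class.\<close>

lemma homotopy_class_retract:
 assumes X: "is_complex C n X"
  and F: "\<And>j. j \<le> n + 1 \<Longrightarrow> F j \<in> mor C (ob X j) (Y j)"
  and G: "\<And>j. j \<le> n + 1 \<Longrightarrow> G j \<in> mor C (Y j) (ob X j)"
  and FG: "\<And>j. j \<le> n + 1 \<Longrightarrow> F j \<cdot> G j = Id C (Y j)"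
  and commute: "\<And>j. j \<le> n \<Longrightarrow> (G (j + 1) \<cdot> F (j + 1)) \<cdot> df X j = df X j \<cdot> (G j \<cdot> F j)"
  and ends: "Y 0 = ob X 0" "Y (n + 1) = ob X (n + 1)" "F 0 = Id C (ob X 0)" "F (n + 1) = Id C (ob X (n + 1))"
   "G 0 = Id C (ob X 0)" "G (n + 1) = Id C (ob X (n + 1))"
  and hom: "homotopic C n X X (\<lambda>j. G j \<cdot> F j) (\<lambda>j. Id C (ob X j))"
 shows "\<exists>X'. X' \<in> homotopy_class C n X \<and> (\<forall>j\<le>n + 1. ob X' j = Y j)"
proof -
 note XD = is_complexD[OF X]
 define d where "d j = F (j + 1) \<cdot> (df X j \<cdot> G j)" for j
 define X' where "X' = \<lparr>obs = map Y [0..<n + 2], diffs = map d [0..<n + 1]\<rparr>"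
 have o: "ob X' j = Y j" if "j \<le> n + 1" for j
 proof -
  have "j < length [0..<n + 2]" using that by simp
  then show ?thesis unfolding X'_def cplx.simps by (subst nth_map) (simp_all del: upt_Suc)
 qed
 have df': "df X' j = d j" if "j \<le> n" for j
 proof -
  have "j < length [0..<n + 1]" using that by simp
  then show ?thesis unfolding X'_def cplx.simps by (subst nth_map) (simp_all del: upt_Suc)
 qed
 have le: "j \<le> n + 1" "j + 1 \<le> n + 1" if "j \<le> n" for j using that by simp_all
 have dm: "d j \<in> mor C (Y j) (Y (j + 1))" if j: "j \<le> n" for j
  unfolding d_def by (rule mor_comp[OF mor_comp[OF G[OF le(1)[OF j]] XD(4)[OF j]] F[OF le(2)[OF j]]])
 have Gd: "G (j + 1) \<cdot> d j = df X j \<cdot> G j" if j: "j \<le> n" for j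
 proof -
  note Gj = G[OF le(1)[OF j]] and Fj = F[OF le(1)[OF j]] and Gs = G[OF le(2)[OF j]] and Fs = F[OF le(2)[OF j]] and x = XD(4)[OF j]
  have "G (j + 1) \<cdot> d j = ((G (j + 1) \<cdot> F (j + 1)) \<cdot> df X j) \<cdot> G j"
   unfolding d_def comp_assoc[OF Gj x mor_comp[OF Fs Gs]] comp_assoc[OF mor_comp[OF Gj x] Fs Gs] ..
  also have "\<dots> = df X j \<cdot> (G j \<cdot> (F j \<cdot> G j))"
   unfolding commute[OF j] comp_assoc[OF Gj mor_comp[OF Fj Gj] x] comp_assoc[OF Gj Fj Gj] ..
  also have "\<dots> = df X j \<cdot> G j" unfolding FG[OF le(1)[OF j]] id_right[OF Gj] ..
  finally show ?thesis .
 qed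
 have Fd: "F (j + 1) \<cdot> df X j = d j \<cdot> F j" if j: "j \<le> n" for j
 proof -
  note Gj = G[OF le(1)[OF j]] and Fj = F[OF le(1)[OF j]] and Gs = G[OF le(2)[OF j]] and Fs = F[OF le(2)[OF j]] and x = XD(4)[OF j]
  have "F (j + 1) \<cdot> df X j = ((F (j + 1) \<cdot> G (j + 1)) \<cdot> F (j + 1)) \<cdot> df X j"
   unfolding FG[OF le(2)[OF j]] id_left[OF Fs] ..
  also have "\<dots> = F (j + 1) \<cdot> (df X j \<cdot> (G j \<cdot> F j))"
   unfolding comp_assoc[OF Fs Gs Fs] comp_assoc[OF x mor_comp[OF Fs Gs] Fs] commute[OF j] ..
  also have "\<dots> = d j \<cdot> F j"
   unfolding d_def comp_assoc[OF Fj mor_comp[OF Gj x] Fs] comp_assoc[OF Fj Gj x] ..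
  finally show ?thesis .
 qed
 have cX': "is_complex C n X'"
 proof (rule is_complexI)
  show "length (obs X') = n + 2" "length (diffs X') = n + 1" by (simp_all add: X'_def)
  show "df X' j \<in> mor C (ob X' j) (ob X' (j + 1))" if j: "j \<le> n" for j
   unfolding o[OF le(1)[OF j]] o[OF le(2)[OF j]] df'[OF j] by (rule dm[OF j])
  fix j assume "j < n"
  then have j: "j \<le> n" "j + 1 \<le> n" "j + 2 \<le> n + 1" "j < n" "j + 1 + 1 = j + 2" by simp_all
  note x = XD(4)[OF j(1)] and x' = XD(4)[OF j(2), unfolded j(5)] and Gj = G[OF le(1)[OF j(1)]] and Gs = G[OF le(2)[OF j(1)]] and Fs = F[OF j(3)]
  have "d (j + 1) \<cdot> d j = F (j + 2) \<cdot> (df X (j + 1) \<cdot> (df X j \<cdot> G j))"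
   unfolding d_def[of "j + 1"] j(5) comp_assoc[OF dm[OF j(1)] mor_comp[OF Gs x'] Fs] comp_assoc[OF dm[OF j(1)] Gs x'] Gd[OF j(1)] ..
  also have "\<dots> = zero_arr C (Y j) (Y (j + 2))"
   unfolding comp_assoc[OF Gj x x', symmetric] XD(5)[OF j(4)] comp_zero_left[OF Gj XD(3)[OF j(3)]]
   by (rule comp_zero_right[OF morD(2)[OF Gj] Fs])
  finally show "df X' (j + 1) \<cdot> df X' j = zero_arr C (ob X' j) (ob X' (j + 2))"
   unfolding o[OF le(1)[OF j(1)]] o[OF j(3)] df'[OF j(1)] df'[OF j(2)] .
 qed
 have oe: "ob X' 0 = ob X 0" "ob X' (n + 1) = ob X (n + 1)" using o[of 0] o[of "n + 1"] ends by simp_all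
 have f: "end_fixing_map C n X X' F"
  unfolding end_fixing_map_def
 proof (intro conjI chain_mapI ends)
  show "F j \<in> mor C (ob X j) (ob X' j)" if j: "j \<le> n + 1" for j unfolding o[OF j] by (rule F[OF j])
  show "F (j + 1) \<cdot> df X j = df X' j \<cdot> F j" if j: "j \<le> n" for j unfolding df'[OF j] by (rule Fd[OF j])
 qed
 have g: "end_fixing_map C n X' X G"
  unfolding end_fixing_map_def oe
 proof (intro conjI chain_mapI ends)
  show "G j \<in> mor C (ob X' j) (ob X j)" if j: "j \<le> n + 1" for j unfolding o[OF j] by (rule G[OF j])
  show "G (j + 1) \<cdot> df X' j = df X j \<cdot> G j" if j: "j \<le> n" for j unfolding df'[OF j] by (rule Gd[OF j])
 qed
 have fg: "homotopic C n X' X' (\<lambda>j. F j \<cdot> G j) (\<lambda>j. Id C (ob X' j))"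
  by (rule homotopic_Id[OF cX']) (simp add: FG o)
 have "X' \<in> homotopy_class C n X" unfolding homotopy_class_def mem_Collect_eq
  by (intro conjI cX' oe exI[of _ F] exI[of _ G] f g hom fg)
 then show ?thesis using o by blast
qed

end

section \<open>Minimal complexes\<close>

context preadditive_category
begin

text \<open>The homotopy with single component \<open>-h\<close> connects the identity with the chain endomorphism that
is \<open>1 - h d\<close> in degree \<open>i\<close>, \<open>1 - d h\<close> in degree \<open>i + 1\<close> and the identity elsewhere.  A splitting of these two
idempotents removes their complementary summands from the complex.\<close>

lemma homotopy_class_cancel:
 assumes X: "is_complex C n X" and i: "1 \<le> i" "i < n"
  and h: "h \<in> mor C (ob X (i + 1)) (ob X i)"
  and a: "a \<in> mor C Y (ob X i)" and b: "b \<in> mor C (ob X i) Y" and ba: "b \<cdot> a = Id C Y"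
  and ab: "a \<cdot> b = Id C (ob X i) \<ominus>\<^bsub>Hom C (ob X i) (ob X i)\<^esub> h \<cdot> df X i"
  and a': "a' \<in> mor C Y' (ob X (i + 1))" and b': "b' \<in> mor C (ob X (i + 1)) Y'" and ba': "b' \<cdot> a' = Id C Y'"
  and ab': "a' \<cdot> b' = Id C (ob X (i + 1)) \<ominus>\<^bsub>Hom C (ob X (i + 1)) (ob X (i + 1))\<^esub> df X i \<cdot> h"
 shows "\<exists>X'. X' \<in> homotopy_class C n X \<and> ob X' i = Y \<and> ob X' (i + 1) = Y' \<and>
  (\<forall>j\<le>n + 1. j \<noteq> i \<longrightarrow> j \<noteq> i + 1 \<longrightarrow> ob X' j = ob X j)"
proof -
 note XD = is_complexD[OF X]
 define T where "T j = (if j = i then Y else if j = i + 1 then Y' else ob X j)" for j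
 define F where "F j = (if j = i then b else if j = i + 1 then b' else Id C (ob X j))" for j
 define G where "G j = (if j = i then a else if j = i + 1 then a' else Id C (ob X j))" for j
 have Ti: "T i = Y" "F i = b" "G i = a" "T (i + 1) = Y'" "F (i + 1) = b'" "G (i + 1) = a'"
  by (simp_all add: T_def F_def G_def)
 have To: "T j = ob X j" "F j = Id C (ob X j)" "G j = Id C (ob X j)" if "j \<noteq> i" "j \<noteq> i + 1" for j
  using that by (simp_all add: T_def F_def G_def)
 have Fm: "F j \<in> mor C (ob X j) (T j)" and Gm: "G j \<in> mor C (T j) (ob X j)" and FG: "F j \<cdot> G j = Id C (T j)"
  if j: "j \<le> n + 1" for j
 proof -
  note Id = mor_Id[OF XD(3)[OF j]]
  consider "j = i" | "j = i + 1" | "j \<noteq> i" "j \<noteq> i + 1" by blast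
  then have "F j \<in> mor C (ob X j) (T j) \<and> G j \<in> mor C (T j) (ob X j) \<and> F j \<cdot> G j = Id C (T j)"
  proof cases
   case 1 show ?thesis unfolding 1 Ti using a b ba by simp
  next
   case 2 show ?thesis unfolding 2 Ti using a' b' ba' by simp
  next
   case 3 show ?thesis unfolding To[OF 3] using Id id_left[OF Id] by simp
  qed
  then show "F j \<in> mor C (ob X j) (T j)" "G j \<in> mor C (T j) (ob X j)" "F j \<cdot> G j = Id C (T j)" by simp_all
 qed
 have GF: "G j \<cdot> F j = Id C (ob X j)" if "j \<le> n + 1" "j \<noteq> i" "j \<noteq> i + 1" for j
  unfolding To[OF that(2,3)] by (rule id_left[OF mor_Id[OF XD(3)[OF that(1)]]])
 have i': "i - 1 \<le> n" "i \<le> n" "i + 1 \<le> n" "i + 1 \<le> n + 1" "i \<le> n + 1" "i - 1 + 1 = i" "i - 1 < n" "i - 1 + 2 = i + 1" using i by simp_all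
 note di = XD(4)[OF i'(2)] and dp = XD(4)[OF i'(1), unfolded i'(6)] and ds = XD(4)[OF i'(3)]
 note ddp = XD(5)[OF i'(7), unfolded i'(6,8)] and dds = XD(5)[OF i(2)]
 note O = XD(3)[OF i'(5)] and O' = XD(3)[OF i'(4)]
 note hd = mor_comp[OF di h] and dh = mor_comp[OF h di] and Id = mor_Id[OF O] and Id' = mor_Id[OF O']
 have minus_zero: "f \<ominus>\<^bsub>Hom C A B\<^esub> zero_arr C A B = f" if f: "f \<in> mor C A B" for f A B
 proof -
  interpret H: abelian_group "Hom C A B" by (rule mor_group[OF f])
  show ?thesis using morD(1)[OF f] by (simp add: a_minus_def)
 qed
 show ?thesis
 proof -
  have "\<exists>X'. X' \<in> homotopy_class C n X \<and> (\<forall>j\<le>n + 1. ob X' j = T j)"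
  proof (rule homotopy_class_retract[OF X Fm Gm FG])
   show "T 0 = ob X 0" "F 0 = Id C (ob X 0)" "G 0 = Id C (ob X 0)" using To[of 0] i by simp_all
   show "T (n + 1) = ob X (n + 1)" "F (n + 1) = Id C (ob X (n + 1))" "G (n + 1) = Id C (ob X (n + 1))"
    using To[of "n + 1"] i by simp_all
   show "(G (j + 1) \<cdot> F (j + 1)) \<cdot> df X j = df X j \<cdot> (G j \<cdot> F j)" if j: "j \<le> n" for j
   proof -
    note x = XD(4)[OF j]
    have j1: "j \<le> n + 1" "j + 1 \<le> n + 1" using j by simp_all
    consider "j = i" | "j = i + 1" | "j + 1 = i" | "j \<noteq> i" "j \<noteq> i + 1" "j + 1 \<noteq> i" by blast
    then show ?thesis
    proof cases
     case 1
     show ?thesis unfolding 1 Ti ab ab' comp_diff_left[OF di Id' dh] comp_diff_right[OF Id hd di]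
       id_left[OF di] id_right[OF di] comp_assoc[OF di h di] ..
    next
     case 2
     have "df X (i + 1) \<cdot> (df X i \<cdot> h) = zero_arr C (ob X (i + 1)) (ob X (i + 2))"
      unfolding comp_assoc[OF h di ds, symmetric] dds[unfolded i'(6)] by (rule comp_zero_left[OF h morD(3)[OF ds, unfolded add.assoc one_add_one]])
     then have e: "df X (i + 1) \<cdot> (a' \<cdot> b') = df X (i + 1)"
      unfolding ab' comp_diff_right[OF Id' dh ds] id_right[OF ds] using minus_zero[OF ds] by (simp add: numeral_2_eq_2)
     have "G (i + 1 + 1) \<cdot> F (i + 1 + 1) = Id C (ob X (i + 1 + 1))" by (rule GF) (use j1 2 in simp_all)
     then show ?thesis unfolding 2 Ti e using id_left[OF ds] by simp
    next
     case 3
     have j3: "j = i - 1" using 3 by simp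
     have "(h \<cdot> df X i) \<cdot> df X (i - 1) = zero_arr C (ob X (i - 1)) (ob X i)"
      unfolding comp_assoc[OF dp di h] ddp by (rule comp_zero_right[OF morD(2)[OF dp] h])
     then have e: "(a \<cdot> b) \<cdot> df X (i - 1) = df X (i - 1)"
      unfolding ab comp_diff_left[OF dp Id hd] id_left[OF dp] using minus_zero[OF dp] by simp
     have "G (i - 1) \<cdot> F (i - 1) = Id C (ob X (i - 1))" by (rule GF) (use j1 3 i in simp_all)
     then show ?thesis unfolding j3 i'(6) Ti e using id_right[OF dp] by simp
    next
     case 4
     have "G j \<cdot> F j = Id C (ob X j)" by (rule GF[OF j1(1) 4(1,2)])
     moreover have "G (j + 1) \<cdot> F (j + 1) = Id C (ob X (j + 1))" by (rule GF[OF j1(2)]) (use 4 in simp_all)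
     ultimately show ?thesis using id_left[OF x] id_right[OF x] by simp
    qed
   qed
   let ?k = "zero_arr C (ob X (i + 1)) (ob X i) \<ominus>\<^bsub>Hom C (ob X (i + 1)) (ob X i)\<^esub> h"
   note z = mor_zero[OF O' O]
   note km = mor_diff[OF z h]
   \<comment> \<open>the homotopy is \<open>-h\<close> in degree \<open>i + 1\<close> and zero in all other degrees\<close>
   define \<phi> where "\<phi> j = (if j = i + 1 then ?k else zero_arr C (ob X j) (ob X (j - 1)))" for j
   have \<phi>k: "\<phi> (i + 1) = ?k" by (simp add: \<phi>_def)
   have \<phi>0: "\<phi> j = zero_arr C (ob X j) (ob X (j - 1))" if "j \<noteq> i + 1" for j using that by (simp add: \<phi>_def)
   have self: "Id C A \<ominus>\<^bsub>Hom C A A\<^esub> Id C A = zero_arr C A A" if "A \<in> Obj C" for A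
    using diff_zero_arr[OF mor_Id[OF that] mor_Id[OF that]] by simp
   have plus_zero: "f \<oplus>\<^bsub>Hom C A B\<^esub> zero_arr C A B = f" "zero_arr C A B \<oplus>\<^bsub>Hom C A B\<^esub> f = f" if f: "f \<in> mor C A B" for f A B
   proof -
    interpret H: abelian_group "Hom C A B" by (rule mor_group[OF f])
    show "f \<oplus>\<^bsub>Hom C A B\<^esub> zero_arr C A B = f" "zero_arr C A B \<oplus>\<^bsub>Hom C A B\<^esub> f = f" using morD(1)[OF f] by simp_all
   qed
   show "homotopic C n X X (\<lambda>j. G j \<cdot> F j) (\<lambda>j. Id C (ob X j))"
   proof (rule homotopicI[of _ \<phi>])
    show "\<phi> j \<in> mor C (ob X j) (ob X (j - 1))" if j: "1 \<le> j" "j \<le> n + 1" for j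
    proof (cases "j = i + 1")
     case True then show ?thesis using km \<phi>k by simp
    next
     case False
     then show ?thesis using mor_zero[OF XD(3)[OF j(2)] XD(3)[of "j - 1"]] j \<phi>0[OF False] by simp
    qed
    have "\<phi> 1 = zero_arr C (ob X 1) (ob X 0)" using i \<phi>0[of 1] by simp
    then show "G 0 \<cdot> F 0 \<ominus>\<^bsub>Hom C (ob X 0) (ob X 0)\<^esub> Id C (ob X 0) = \<phi> 1 \<cdot> df X 0"
     using GF[of 0] i self[OF XD(3)[of 0]] comp_zero_left[OF XD(4)[of 0] XD(3)[of 0]] by simp
    have "\<phi> (n + 1) = zero_arr C (ob X (n + 1)) (ob X n)" using i \<phi>0[of "n + 1"] by simp
    then show "G (n + 1) \<cdot> F (n + 1) \<ominus>\<^bsub>Hom C (ob X (n + 1)) (ob X (n + 1))\<^esub> Id C (ob X (n + 1)) = df X n \<cdot> \<phi> (n + 1)"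
     using GF[of "n + 1"] i self[OF XD(3)[of "n + 1"]] comp_zero_right[OF XD(3)[of "n + 1"] XD(4)[of n]] by simp
    fix j assume j: "1 \<le> j" "j \<le> n"
    have j1: "j \<le> n + 1" "j - 1 \<le> n" "j - 1 + 1 = j" "j + 1 - 1 = j" using j by simp_all
    note x = XD(4)[OF j(2)] and y = XD(4)[OF j1(2), unfolded j1(3)] and oj = XD(3)[OF j1(1)]
    note zj = mor_zero[OF oj oj]
    consider "j = i" | "j = i + 1" | "j \<noteq> i" "j \<noteq> i + 1" by blast
    then show "G j \<cdot> F j \<ominus>\<^bsub>Hom C (ob X j) (ob X j)\<^esub> Id C (ob X j)
     = df X (j - 1) \<cdot> \<phi> j \<oplus>\<^bsub>Hom C (ob X j) (ob X j)\<^esub> \<phi> (j + 1) \<cdot> df X j"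
    proof cases
     case 1
     interpret H: abelian_group "Hom C (ob X i) (ob X i)" by (rule Hom_group[OF O O])
     have k: "?k \<cdot> df X i = zero_arr C (ob X i) (ob X i) \<ominus>\<^bsub>Hom C (ob X i) (ob X i)\<^esub> h \<cdot> df X i"
      unfolding comp_diff_left[OF di z h] comp_zero_left[OF di O] ..
     have p: "\<phi> i = zero_arr C (ob X i) (ob X (i - 1))" by (rule \<phi>0) simp
     note kd = mor_comp[OF di km]
     show ?thesis unfolding 1 Ti ab H.diff_minus_self[OF morD(1)[OF Id] morD(1)[OF hd]] p \<phi>k comp_zero_right[OF O dp] k plus_zero(2)[OF kd, unfolded k] ..
    next
     case 2
     interpret H: abelian_group "Hom C (ob X (i + 1)) (ob X (i + 1))" by (rule Hom_group[OF O' O'])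
     have k: "df X i \<cdot> ?k = zero_arr C (ob X (i + 1)) (ob X (i + 1)) \<ominus>\<^bsub>Hom C (ob X (i + 1)) (ob X (i + 1))\<^esub> df X i \<cdot> h"
      unfolding comp_diff_right[OF z h di] comp_zero_right[OF O' di] ..
     have p: "\<phi> (i + 1 + 1) = zero_arr C (ob X (i + 1 + 1)) (ob X (i + 1))" using \<phi>0[of "i + 1 + 1"] by simp
     note dk = mor_comp[OF km di]
     show ?thesis unfolding 2 Ti ab' H.diff_minus_self[OF morD(1)[OF Id'] morD(1)[OF dh]] p \<phi>k add_diff_cancel_right' comp_zero_left[OF ds O'] k plus_zero(1)[OF dk, unfolded k] ..
    next
     case 3
     have l: "G j \<cdot> F j \<ominus>\<^bsub>Hom C (ob X j) (ob X j)\<^esub> Id C (ob X j) = zero_arr C (ob X j) (ob X j)"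
      unfolding GF[OF j1(1) 3] by (rule self[OF oj])
     have p: "\<phi> j = zero_arr C (ob X j) (ob X (j - 1))" "\<phi> (j + 1) = zero_arr C (ob X (j + 1)) (ob X j)" using 3 \<phi>0[of j] \<phi>0[of "j + 1"] by simp_all
     show ?thesis unfolding l p comp_zero_right[OF oj y] comp_zero_left[OF x oj] plus_zero(1)[OF zj] ..
    qed
   qed
  qed
  then obtain X' where X': "X' \<in> homotopy_class C n X" "\<forall>j\<le>n + 1. ob X' j = T j" by (elim exE conjE)
  show ?thesis
  proof (intro exI[of _ X'] conjI X'(1) allI impI)
   show "ob X' i = Y" "ob X' (i + 1) = Y'" using X'(2) i' Ti by simp_all
   show "ob X' j = ob X j" if "j \<le> n + 1" "j \<noteq> i" "j \<noteq> i + 1" for j using X'(2) that To(1)[OF that(2,3)] by simp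
  qed
 qed
qed

end

text \<open>The object is a direct sum of \<open>m\<close> objects with local endomorphism rings.\<close>

definition local_sum :: "('o, 'm, 'k, 'z) cat_scheme \<Rightarrow> 'o \<Rightarrow> nat \<Rightarrow> bool" where
 "local_sum C A m \<longleftrightarrow> (\<exists>B i p. dsum C A m B i p \<and> (\<forall>j<m. local_object C (B j)))"

context additive_category
begin

lemma Krull_Schmidt_local_sum:
 assumes KS: "Krull_Schmidt C" and A: "A \<in> Obj C"
 shows "\<exists>m. local_sum C A m"
proof -
 obtain m B where mB: "is_direct_sum C A m B" "\<forall>j<m. local_ring (End_ring C (B j))"
  using KS A unfolding Krull_Schmidt_def by blast
 then obtain i p where d: "dsum C A m B i p" and O: "\<forall>j<m. B j \<in> Obj C" unfolding is_direct_sum_iff by blast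
 have "\<forall>j<m. local_object C (B j)" using mB(2) O local_ring_local_object by blast
 then show ?thesis unfolding local_sum_def using d by blast
qed

lemma local_sum_split:
 assumes d: "dsum C A m B i p" and L: "\<And>x. x < m \<Longrightarrow> local_object C (B x)" and j: "j < m"
 shows "\<exists>m' Y iY pY. m = Suc m' \<and> local_sum C Y m' \<and> is_biproduct C Y (B j) A iY (i j) pY (p j)"
proof -
 obtain m' where m': "m = Suc m'" using j by (cases m) simp_all
 (* the transposition that moves the summand j to the end *)
 define s where "s x = (if x = j then m' else if x = m' then j else x)" for x
 have sl: "s x < m" if "x < m" for x using that j m' by (auto simp: s_def)
 have ss: "s (s x) = x" for x by (auto simp: s_def)
 have inj: "inj_on s {..<m}" by (metis inj_onI ss)
 have im: "s ` {..<m} = {..<m}"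
 proof (intro equalityI subsetI)
  fix x assume "x \<in> s ` {..<m}" then show "x \<in> {..<m}" using sl by auto
 next
  fix x assume "x \<in> {..<m}"
  then show "x \<in> s ` {..<m}" using sl[of x] ss[of x] by (intro image_eqI[of _ _ "s x"]) auto
 qed
 note D = dsumD[OF d]
 interpret H: abelian_group "Hom C A A" by (rule Hom_group[OF D(1) D(1)])
 have d': "dsum C A m (\<lambda>x. B (s x)) (\<lambda>x. i (s x)) (\<lambda>x. p (s x))"
  unfolding dsum_def
 proof (intro conjI allI impI D(1))
  show "i (s x) \<in> mor C (B (s x)) A" "p (s x) \<in> mor C A (B (s x))" if "x < m" for x
   by (rule D(2,3)[OF sl[OF that]])+
  show "p (s y) \<cdot> i (s x) = (if x = y then Id C (B (s x)) else zero_arr C (B (s x)) (B (s y)))" if x: "x < m" and y: "y < m" for x y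
  proof (cases "x = y")
   case True then show ?thesis using D(4)[OF sl[OF x]] by simp
  next
   case False
   then have "s x \<noteq> s y" using ss by metis
   then show ?thesis using False D(5)[OF sl[OF x] sl[OF y]] by simp
  qed
  have "(\<Oplus>\<^bsub>Hom C A A\<^esub>x\<in>s ` {..<m}. i x \<cdot> p x) = (\<Oplus>\<^bsub>Hom C A A\<^esub>x\<in>{..<m}. i (s x) \<cdot> p (s x))"
  proof (rule H.finsum_reindex[OF _ inj])
   show "(\<lambda>x. i x \<cdot> p x) \<in> s ` {..<m} \<rightarrow> arr C A A"
    unfolding im by (intro Pi_I morD(1)[OF mor_comp[OF D(3) D(2)]]) simp_all
  qed
  then show "(\<Oplus>\<^bsub>Hom C A A\<^esub>x\<in>{..<m}. i (s x) \<cdot> p (s x)) = Id C A" unfolding im D(6) ..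
 qed
 have L': "local_object C (B (s x))" if "x < m'" for x by (rule L[OF sl]) (use that m' in simp)
 have "\<forall>x<m'. B (s x) \<in> Obj C" using L' local_objectD(1) by blast
 from dsum_exists[OF this] obtain Y i' p' where Y: "dsum C Y m' (\<lambda>x. B (s x)) i' p'" by (elim exE)
 obtain iY pY where "is_biproduct C Y (B (s m')) A iY (i (s m')) pY (p (s m'))"
  using dsum_split_last[OF d'[unfolded m'] Y] by (elim exE)
 moreover have "s m' = j" by (simp add: s_def)
 moreover have "local_sum C Y m'" unfolding local_sum_def using Y L' by blast
 ultimately show ?thesis using m' by (intro exI[of _ m'] exI[of _ Y] exI[of _ iY] exI[of _ pY] conjI) simp_all
qed

text \<open>A differential outside the radical has an invertible entry \<open>e = v d u\<close> between summands \<open>K\<close> of \<open>X\<^sub>i\<close> and \<open>K'\<close> of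
\<open>X\<^sub>i\<^sub>+\<^sub>1\<close>.  For \<open>h = u e\<^sup>-\<^sup>1 v\<close> the maps \<open>h d\<close> and \<open>d h\<close> are idempotents with images isomorphic to \<open>K\<close> and \<open>K'\<close>, and
these summands are cancelled.\<close>

lemma cancel_nonradical:
 assumes X: "is_complex C n X" and i: "1 \<le> i" "i < n"
  and s: "local_sum C (ob X i) m" and s': "local_sum C (ob X (i + 1)) m'"
  and nr: "df X i \<notin> rad C (ob X i) (ob X (i + 1))"
 shows "\<exists>X' r r'. X' \<in> homotopy_class C n X \<and> m = Suc r \<and> m' = Suc r' \<and> local_sum C (ob X' i) r \<and>
  local_sum C (ob X' (i + 1)) r' \<and> (\<forall>j\<le>n + 1. j \<noteq> i \<longrightarrow> j \<noteq> i + 1 \<longrightarrow> ob X' j = ob X j)"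
proof -
 let ?A = "ob X i" and ?A' = "ob X (i + 1)" and ?d = "df X i"
 have d: "?d \<in> mor C ?A ?A'" using is_complexD(4)[OF X, of i] i by simp
 obtain B \<iota> \<pi> where S: "dsum C ?A m B \<iota> \<pi>" and L: "\<forall>x<m. local_object C (B x)" using s unfolding local_sum_def by (elim exE conjE)
 obtain B' \<iota>' \<pi>' where S': "dsum C ?A' m' B' \<iota>' \<pi>'" and L': "\<forall>x<m'. local_object C (B' x)" using s' unfolding local_sum_def by (elim exE conjE)
 note SD = dsumD[OF S] and SD' = dsumD[OF S']
 have "\<exists>x<m. \<exists>y<m'. iso_arr C (B x) (B' y) (\<pi>' y \<cdot> (?d \<cdot> \<iota> x))"
 proof (rule ccontr)
  assume no: "\<not> (\<exists>x<m. \<exists>y<m'. iso_arr C (B x) (B' y) (\<pi>' y \<cdot> (?d \<cdot> \<iota> x)))"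
  have "?d \<in> rad C ?A ?A'"
  proof (rule rad_entries[OF S S' d])
   fix x y assume x: "x < m" and y: "y < m'"
   have lx: "local_object C (B x)" and ly: "local_object C (B' y)" using L L' x y by simp_all
   show "\<pi>' y \<cdot> (?d \<cdot> \<iota> x) \<in> rad C (B x) (B' y)"
    by (rule local_noniso_rad[OF lx ly mor_comp[OF mor_comp[OF SD(2)[OF x] d] SD'(3)[OF y]]]) (use no x y in blast)
  qed
  then show False using nr by simp
 qed
 then obtain x y where x: "x < m" and y: "y < m'" and iso: "iso_arr C (B x) (B' y) (\<pi>' y \<cdot> (?d \<cdot> \<iota> x))" by blast
 let ?K = "B x" and ?K' = "B' y" and ?u = "\<iota> x" and ?v = "\<pi>' y"
 obtain r Y iY pY where r: "m = Suc r" "local_sum C Y r" and bY: "is_biproduct C Y ?K ?A iY ?u pY (\<pi> x)"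
  using local_sum_split[OF S _ x] L by blast
 obtain r' Y' iY' pY' where r': "m' = Suc r'" "local_sum C Y' r'" and bY': "is_biproduct C Y' ?K' ?A' iY' (\<iota>' y) pY' ?v"
  using local_sum_split[OF S' _ y] L' by blast
 note D = is_biproductD[OF bY] and D' = is_biproductD[OF bY']
 let ?e = "?v \<cdot> (?d \<cdot> ?u)"
 obtain e' where e': "e' \<in> mor C ?K' ?K" "e' \<cdot> ?e = Id C ?K" "?e \<cdot> e' = Id C ?K'"
  using iso_arrE[OF iso morD(2)[OF D(2)] morD(2)[OF D'(2)]] by (elim exE conjE)
 note u = D(2) and v = D'(4)
 note du = mor_comp[OF u d] and vd = mor_comp[OF d v]
 note ev = mor_comp[OF v e'(1)] and ue = mor_comp[OF e'(1) u]
 let ?h = "?u \<cdot> (e' \<cdot> ?v)"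
 note h = mor_comp[OF ev u]
 note hd = mor_comp[OF d h] and dh = mor_comp[OF h d]
 note Id = mor_Id[OF SD(1)] and Id' = mor_Id[OF SD'(1)]
 interpret H: abelian_group "Hom C ?A ?A" by (rule Hom_group[OF SD(1) SD(1)])
 interpret H': abelian_group "Hom C ?A' ?A'" by (rule Hom_group[OF SD'(1) SD'(1)])
 have hdu: "(?h \<cdot> ?d) \<cdot> ?u = ?u"
  unfolding comp_assoc[OF u d h] comp_assoc[OF du ev u] comp_assoc[OF du v e'(1)] e'(2) by (rule id_right[OF u])
 have vdh: "?v \<cdot> (?d \<cdot> ?h) = ?v"
 proof -
  have "?v \<cdot> (?d \<cdot> ?h) = ?e \<cdot> (e' \<cdot> ?v)"
   unfolding comp_assoc[OF ev u d, symmetric] comp_assoc[OF ev du v] ..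
  also have "\<dots> = ?v" unfolding comp_assoc[OF v e'(1) mor_comp[OF du v], symmetric] e'(3) by (rule id_left[OF v])
  finally show ?thesis .
 qed
 let ?q = "Id C ?A \<ominus>\<^bsub>Hom C ?A ?A\<^esub> ?h \<cdot> ?d" and ?q' = "Id C ?A' \<ominus>\<^bsub>Hom C ?A' ?A'\<^esub> ?d \<cdot> ?h"
 note q = mor_diff[OF Id hd] and q' = mor_diff[OF Id' dh]
 have minus_zero: "f \<ominus>\<^bsub>Hom C A B\<^esub> zero_arr C A B = f" if f: "f \<in> mor C A B" for f A B
 proof -
  interpret G: abelian_group "Hom C A B" by (rule mor_group[OF f])
  show ?thesis using morD(1)[OF f] by (simp add: a_minus_def)
 qed
 have qu: "?q \<cdot> ?u = zero_arr C ?K ?A"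
  unfolding comp_diff_left[OF u Id hd] hdu id_left[OF u] using diff_zero_arr[OF u u] by simp
 have vq: "?v \<cdot> ?q' = zero_arr C ?A' ?K'"
  unfolding comp_diff_right[OF Id' dh v] vdh id_right[OF v] using diff_zero_arr[OF v v] by simp
 have pq: "pY \<cdot> ?q = pY"
 proof -
  have "pY \<cdot> (?h \<cdot> ?d) = (pY \<cdot> ?u) \<cdot> ((e' \<cdot> ?v) \<cdot> ?d)"
   unfolding comp_assoc[OF d ev u] comp_assoc[OF mor_comp[OF d ev] u D(3)] ..
  also have "\<dots> = zero_arr C ?A Y" unfolding D(8) by (rule comp_zero_left[OF mor_comp[OF d ev] morD(3)[OF D(3)]])
  finally show ?thesis unfolding comp_diff_right[OF Id hd D(3)] id_right[OF D(3)] using minus_zero[OF D(3)] by simp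
 qed
 have qi: "?q' \<cdot> iY' = iY'"
 proof -
  have "(?d \<cdot> ?h) \<cdot> iY' = ?d \<cdot> (?u \<cdot> (e' \<cdot> (?v \<cdot> iY')))"
   unfolding comp_assoc[OF D'(1) h d] comp_assoc[OF D'(1) ev u] comp_assoc[OF D'(1) v e'(1)] ..
  also have "\<dots> = zero_arr C Y' ?A'"
   unfolding D'(7) comp_zero_right[OF morD(2)[OF D'(1)] e'(1)] comp_zero_right[OF morD(2)[OF D'(1)] u]
   by (rule comp_zero_right[OF morD(2)[OF D'(1)] d])
  finally show ?thesis unfolding comp_diff_left[OF D'(1) Id' dh] id_left[OF D'(1)] using minus_zero[OF D'(1)] by simp
 qed
 (* the idempotents 1 - hd and 1 - dh split through the complements Y and Y' *)
 have "\<exists>X'. X' \<in> homotopy_class C n X \<and> ob X' i = Y \<and> ob X' (i + 1) = Y' \<and>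
  (\<forall>j\<le>n + 1. j \<noteq> i \<longrightarrow> j \<noteq> i + 1 \<longrightarrow> ob X' j = ob X j)"
 proof (rule homotopy_class_cancel[OF X i h])
  show "?q \<cdot> iY \<in> mor C Y ?A" by (rule mor_comp[OF D(1) q])
  show "pY \<in> mor C ?A Y" by (rule D(3))
  show "pY \<cdot> (?q \<cdot> iY) = Id C Y" unfolding comp_assoc[OF D(1) q D(3), symmetric] pq by (rule D(5))
  have "?q = ?q \<cdot> (iY \<cdot> pY \<oplus>\<^bsub>Hom C ?A ?A\<^esub> ?u \<cdot> \<pi> x)" unfolding D(9) id_right[OF q] ..
  also have "\<dots> = (?q \<cdot> iY) \<cdot> pY \<oplus>\<^bsub>Hom C ?A ?A\<^esub> (?q \<cdot> ?u) \<cdot> \<pi> x"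
   unfolding comp_add_right[OF mor_comp[OF D(3) D(1)] mor_comp[OF D(4) u] q] comp_assoc[OF D(3) D(1) q] comp_assoc[OF D(4) u q] ..
  also have "\<dots> = (?q \<cdot> iY) \<cdot> pY"
   unfolding qu comp_zero_left[OF D(4) SD(1)] by (rule H.r_zero[OF morD(1)[OF mor_comp[OF D(3) mor_comp[OF D(1) q]]]])
  finally show "(?q \<cdot> iY) \<cdot> pY = ?q" by (rule sym)
  show "iY' \<in> mor C Y' ?A'" by (rule D'(1))
  show "pY' \<cdot> ?q' \<in> mor C ?A' Y'" by (rule mor_comp[OF q' D'(3)])
  show "(pY' \<cdot> ?q') \<cdot> iY' = Id C Y'" unfolding comp_assoc[OF D'(1) q' D'(3)] qi by (rule D'(5))
  have "?q' = (iY' \<cdot> pY' \<oplus>\<^bsub>Hom C ?A' ?A'\<^esub> \<iota>' y \<cdot> ?v) \<cdot> ?q'" unfolding D'(9) id_left[OF q'] ..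
  also have "\<dots> = iY' \<cdot> (pY' \<cdot> ?q') \<oplus>\<^bsub>Hom C ?A' ?A'\<^esub> \<iota>' y \<cdot> (?v \<cdot> ?q')"
   unfolding comp_add_left[OF q' mor_comp[OF D'(3) D'(1)] mor_comp[OF v D'(2)]] comp_assoc[OF q' D'(3) D'(1)] comp_assoc[OF q' v D'(2)] ..
  also have "\<dots> = iY' \<cdot> (pY' \<cdot> ?q')"
   unfolding vq comp_zero_right[OF SD'(1) D'(2)] by (rule H'.r_zero[OF morD(1)[OF mor_comp[OF mor_comp[OF q' D'(3)] D'(1)]]])
  finally show "iY' \<cdot> (pY' \<cdot> ?q') = ?q'" by (rule sym)
 qed
 then obtain X' where X': "X' \<in> homotopy_class C n X" "ob X' i = Y" "ob X' (i + 1) = Y'"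
  "\<forall>j\<le>n + 1. j \<noteq> i \<longrightarrow> j \<noteq> i + 1 \<longrightarrow> ob X' j = ob X j" by (elim exE conjE)
 show ?thesis
  by (intro exI[of _ X'] exI[of _ r] exI[of _ r'] conjI X'(1,4) r(1) r'(1)) (simp_all only: X'(2,3) r(2) r'(2))
qed

text \<open>Cancellation ends because it lowers the total number of summands.\<close>

lemma radical_representative:
 assumes KS: "Krull_Schmidt C" and X: "is_complex C n X"
 shows "\<exists>Y. Y \<in> homotopy_class C n X \<and> (\<forall>i\<in>{1..<n}. df Y i \<in> rad C (ob Y i) (ob Y (i + 1)))"
proof -
 have main: "\<exists>Y. Y \<in> homotopy_class C n Z \<and> (\<forall>i\<in>{1..<n}. df Y i \<in> rad C (ob Y i) (ob Y (i + 1)))"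
  if "is_complex C n Z" "\<forall>i\<in>{1..n}. local_sum C (ob Z i) (s i)" for Z s
  using that
 proof (induction "\<Sum>i\<in>{1..n}. s i" arbitrary: Z s rule: less_induct)
  case less
  note Z = less.prems(1) and sZ = less.prems(2)
  show ?case
  proof (cases "\<forall>i\<in>{1..<n}. df Z i \<in> rad C (ob Z i) (ob Z (i + 1))")
   case True
   then show ?thesis using homotopy_class_refl[OF Z] by blast
  next
   case False
   then obtain i where i: "1 \<le> i" "i < n" and nr: "df Z i \<notin> rad C (ob Z i) (ob Z (i + 1))" by auto
   have i2: "i \<in> {1..n}" "i + 1 \<in> {1..n}" using i by simp_all
   obtain W r r' where W: "W \<in> homotopy_class C n Z" and r: "s i = Suc r" "s (i + 1) = Suc r'"
    and sW: "local_sum C (ob W i) r" "local_sum C (ob W (i + 1)) r'"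
    and oW: "\<forall>j\<le>n + 1. j \<noteq> i \<longrightarrow> j \<noteq> i + 1 \<longrightarrow> ob W j = ob Z j"
    using cancel_nonradical[OF Z i bspec[OF sZ i2(1)] bspec[OF sZ i2(2)] nr] by (elim exE conjE)
   define s' where "s' = s(i := r, i + 1 := r')"
   have cW: "is_complex C n W" using W by (simp add: homotopy_class_def)
   have small: "(\<Sum>i\<in>{1..n}. s' i) < (\<Sum>i\<in>{1..n}. s i)"
   proof (rule sum_strict_mono_ex1)
    show "\<forall>j\<in>{1..n}. s' j \<le> s j" using r by (auto simp: s'_def)
    show "\<exists>j\<in>{1..n}. s' j < s j" using i2(1) r by (intro bexI[of _ i]) (simp_all add: s'_def)
   qed simp
   have sW': "\<forall>j\<in>{1..n}. local_sum C (ob W j) (s' j)"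
   proof
    fix j assume j: "j \<in> {1..n}"
    consider "j = i" | "j = i + 1" | "j \<noteq> i" "j \<noteq> i + 1" by blast
    then show "local_sum C (ob W j) (s' j)"
    proof cases
     case 3
     then have "ob W j = ob Z j" "s' j = s j" using oW j by (simp_all add: s'_def)
     then show ?thesis using bspec[OF sZ j] by simp
    qed (use sW in \<open>simp_all add: s'_def\<close>)
   qed
   obtain Y where Y: "Y \<in> homotopy_class C n W" "\<forall>i\<in>{1..<n}. df Y i \<in> rad C (ob Y i) (ob Y (i + 1))"
    using less.hyps[OF small cW sW'] by (elim exE conjE)
   show ?thesis using homotopy_class_trans[OF Z W Y(1)] Y(2) by blast
  qed
 qed
 have "\<forall>i\<in>{1..n}. \<exists>m. local_sum C (ob X i) m"
  using is_complexD(3)[OF X] by (intro ballI Krull_Schmidt_local_sum[OF KS]) simp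
 from bchoice[OF this] obtain s where "\<forall>i\<in>{1..n}. local_sum C (ob X i) (s i)" ..
 then show ?thesis by (rule main[OF X])
qed

end

section \<open>Auslander-Reiten exangles from almost split extensions\<close>

context n_exangulated_category
begin

lemma distinguished_homotopy_class:
 assumes d: "distinguished C n X \<delta>" and Y: "Y \<in> homotopy_class C n X"
 shows "distinguished C n Y \<delta>"
proof -
 have X: "is_complex C n X" "\<delta> \<in> ext C (ob X (n+1)) (ob X 0)" "X \<in> Real C (ob X (n+1)) (ob X 0) \<delta>"
  using d by (simp_all add: distinguished_def)
 have cY: "is_complex C n Y" and e: "ob Y 0 = ob X 0" "ob Y (n+1) = ob X (n+1)" using Y by (simp_all add: homotopy_class_def)
 have O: "ob X 0 \<in> Obj C" "ob X (n+1) \<in> Obj C" using is_complexD(3)[OF X(1)] by simp_all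
 obtain B where B: "is_complex C n B" "Real C (ob X (n+1)) (ob X 0) \<delta> = homotopy_class C n B"
  using Real_class[OF O X(2)] by (elim exE conjE)
 have "Y \<in> homotopy_class C n B" by (rule homotopy_class_trans[OF B(1) X(3)[unfolded B(2)] Y])
 then show ?thesis unfolding distinguished_def e B(2) using cY X(2) by simp
qed

lemma n_exangulated_realized_bifunctor:
 assumes n: "n \<ge> 1"
 shows "realized_bifunctor C n"
proof (unfold_locales)
 show "n \<ge> 1" by (rule n)
 show "EA2 C n" "EA2 (opposite C) n" by (rule EA2 EA2_op)+
 show "is_exangle C n X \<delta>" if "distinguished C n X \<delta>" for X \<delta> by (rule R1[OF that])
 fix D A \<delta> assume \<delta>: "\<delta> \<in> xt C D A"
 obtain X where X: "is_complex C n X" "ob X 0 = A" "ob X (n+1) = D" "Real C D A \<delta> = homotopy_class C n X"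
  using Real_class[OF xtD(3)[OF \<delta>] xtD(2)[OF \<delta>] xtD(1)[OF \<delta>]] by (elim exE conjE)
 have "distinguished C n X \<delta>" unfolding distinguished_def X(2-4) using X(1) xtD(1)[OF \<delta>] homotopy_class_refl[OF X(1)] by simp
 then show "\<exists>X. distinguished C n X \<delta> \<and> ob X 0 = A \<and> ob X (n + 1) = D" using X(2,3) by blast
qed

lemma almost_split_AR_exangle:
 assumes n: "n \<ge> 1" and KS: "Krull_Schmidt C" and a: "almost_split C U A \<delta>"
 shows "\<exists>X. AR_exangle C n X \<delta> \<and> ob X 0 = A \<and> ob X (n + 1) = U"
proof -
 interpret R: realized_bifunctor C n by (rule n_exangulated_realized_bifunctor[OF n])
 obtain X where X: "distinguished C n X \<delta>" "ob X 0 = A" "ob X (n + 1) = U"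
  using R.realization[OF almost_splitD(1)[OF a]] by (elim exE conjE)
 have cX: "is_complex C n X" using X(1) by (simp add: distinguished_def)
 obtain Y where Y: "Y \<in> homotopy_class C n X" "\<forall>i\<in>{1..<n}. df Y i \<in> rad C (ob Y i) (ob Y (i + 1))"
  using radical_representative[OF KS cX] by (elim exE conjE)
 have e: "ob Y 0 = A" "ob Y (n + 1) = U" using Y(1) X(2,3) by (simp_all add: homotopy_class_def)
 note dY = distinguished_homotopy_class[OF X(1) Y(1)]
 have "left_almost_split C (ob Y 0) (ob Y 1) (df Y 0) \<and> right_almost_split C (ob Y n) (ob Y (n + 1)) (df Y n)"
  using almost_split_iff[OF R1[OF dY]] a unfolding e by simp
 then have "AR_exangle C n Y \<delta>" unfolding AR_exangle_def using dY Y(2) by auto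
 then show ?thesis using e by blast
qed

lemma AR_exangle_almost_split:
 assumes "AR_exangle C n X \<delta>"
 shows "almost_split C (ob X (n + 1)) (ob X 0) \<delta>"
 using assms almost_split_iff[OF R1] unfolding AR_exangle_def by blast

end

section \<open>The equivalence\<close>

theorem theorem1p1:
 fixes k :: "('k, 'r) ring_scheme"
  and J :: "('k, 'j, 'x) module_scheme"
  and C :: "('o, 'm, 'k, 'e) ecat"
  and n :: nat
 assumes "artinian_cring k"
  and "minimal_injective_cogenerator k J"
  and "n \<ge> 1"
  and "n_exangulated_category C n"
  and "linear_ecat k C"
  and "Ext_finite k C"
  and "Krull_Schmidt C"
 shows "has_AR_exangles C n \<longleftrightarrow> has_AR_Serre_duality k J C"
proof -
 interpret n_exangulated_category C n by fact
 interpret S: artinian_ecat C k J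
  by (intro artinian_ecat.intro artinian_ecat_axioms.intro additive_bifunctor_axioms) fact+
 note KS = \<open>Krull_Schmidt C\<close> and n = \<open>n \<ge> 1\<close>
 note R = n_exangulated_realized_bifunctor[OF n]
 show ?thesis
 proof
  assume AR: "has_AR_exangles C n"
  have right: "\<exists>A \<eta>. serre k J C U A \<eta>" if U: "local_object C U" "\<not> projective C U" for U
  proof -
   obtain X \<delta> where X: "AR_exangle C n X \<delta>" "ob X (n + 1) = U"
    using AR local_object_indecomposable[OF U(1)] U(2) unfolding has_AR_exangles_def by blast
   show ?thesis using S.almost_split_serre[OF R AR_exangle_almost_split[OF X(1)]] unfolding X(2) by blast
  qed
  have left: "\<exists>U \<eta>. serre k J C U A \<eta>" if A: "local_object C A" "\<not> injective C A" for A
  proof -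
   obtain X \<delta> where X: "AR_exangle C n X \<delta>" "ob X 0 = A"
    using AR local_object_indecomposable[OF A(1)] A(2) unfolding has_AR_exangles_def by blast
   show ?thesis using S.almost_split_serre[OF R AR_exangle_almost_split[OF X(1)]] unfolding X(2) by blast
  qed
  show "has_AR_Serre_duality k J C"
   using S.serre_imp_duality S.serre_right_exists[OF KS] S.serre_left_exists[OF KS] right left by blast
 next
  assume D: "has_AR_Serre_duality k J C"
  show "has_AR_exangles C n" unfolding has_AR_exangles_def
  proof (intro conjI allI impI; elim conjE)
   fix U assume U: "indecomposable C U" "\<not> projective C U"
   note L = indecomposable_local_object[OF KS U(1)]
   obtain A \<delta> where "almost_split C U A \<delta>"
    using S.almost_split_of_serre_right[OF KS] S.duality_imp_serre(1)[OF D] local_objectD(1)[OF L] L U(2) by blast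
   then show "\<exists>X \<delta>. AR_exangle C n X \<delta> \<and> ob X (n + 1) = U" using almost_split_AR_exangle[OF n KS] by blast
  next
   fix A assume A: "indecomposable C A" "\<not> injective C A"
   note L = indecomposable_local_object[OF KS A(1)]
   obtain U \<delta> where "almost_split C U A \<delta>"
    using S.almost_split_of_serre_left[OF KS] S.duality_imp_serre(2)[OF D] local_objectD(1)[OF L] L A(2) by blast
   then show "\<exists>X \<delta>. AR_exangle C n X \<delta> \<and> ob X 0 = A" using almost_split_AR_exangle[OF n KS] by blast
  qed
 qed
qed

end
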